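(* Let $n\ge 2$ and $m,m'\ge 0$. (a) The subspace of zonal polynomials in $\mathcal H_{m,m'}$ is one-dimensional. (b) Up to a constant, a zonal polynomial of $\mathcal H_{m,m'}$ is given by $$\varphi'_{m,m'}=z_n^{m-m'}\sum_{s=0}^{m'}\frac{(q^{-2m'};q^2)_s\,(q^{2(m+n-1)};q^2)_s}{(q^{2(n-1)};q^2)_s\,(q^2;q^2)_s}\,q^{2s}\,Q^{m'-s}Q_{n-1}^s\qquad\text{if } m\ge m',$$ and by $$\varphi'_{m,m'}=\left(\sum_{s=0}^{m}\frac{(q^{-2m};q^2)_s\,(q^{2(m'+n-1)};q^2)_s}{(q^{2(n-1)};q^2)_s\,(q^2;q^2)_s}\,q^{2s}\,Q^{m-s}Q_{n-1}^s\right)w_n^{m'-m}\qquad\text{if } m\le m'.$$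
   Context: Let $q$ be a nonzero complex number that is not a root of unity (with a fixed square root $q^{1/2}$). Put $[a]=(q^a-q^{-a})/(q-q^{-1})$ and $(a;t)_s=(1-a)(1-at)\cdots(1-at^{s-1})$. $\mathcal A$ is the unital associative $\mathbb C$-algebra generated by $z_1,\dots,z_n,w_1,\dots,w_n$ with relations $z_iz_j=qz_jz_i$ and $w_iw_j=q^{-1}w_jw_i$ for $i<j$; $w_jz_i=qz_iw_j$ for $i\ne j$; $w_kz_k=z_kw_k+(1-q^2)\sum_{s<k}z_sw_s$. Both the monomials $z_1^{r_1}\cdots z_n^{r_n}w_1^{s_1}\cdots w_n^{s_n}$ and the monomials $w_1^{r_1}\cdots w_n^{r_n}z_1^{s_1}\cdots z_n^{s_n}$ form bases of $\mathcal A$. $\mathcal A_{m,m'}$ is the subspace of polynomials homogeneous of degree $m$ in the $z_i$ and of degree $m'$ in the $w_i$. Linear operators $\partial_i,\bar\partial_i$ on $\mathcal A$ are defined on these bases by $\partial_i(z_1^{r_1}\cdots z_n^{r_n}w_1^{s_1}\cdots w_n^{s_n})=q^{r_{i+1}+\cdots+r_n}[r_i]\,z_1^{r_1}\cdots z_i^{r_i-1}\cdots z_n^{r_n}w_1^{s_1}\cdots w_n^{s_n}$ and $\bar\partial_i(w_1^{r_1}\cdots w_n^{r_n}z_1^{s_1}\cdots z_n^{s_n})=q^{-(r_{i+1}+\cdots+r_n)}[r_i]\,w_1^{r_1}\cdots w_i^{r_i-1}\cdots w_n^{r_n}z_1^{s_1}\cdots z_n^{s_n}$ (both are $0$ if $r_i=0$).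 $\Delta_q=\sum_{i=1}^n\partial_i\bar\partial_i$ $(=\sum_{i=1}^n q^{2(i-1)}\bar\partial_i\partial_i)$, and $\mathcal H_{m,m'}=\{p\in\mathcal A_{m,m'}:\Delta_qp=0\}$. $Q=\sum_{i=1}^n z_iw_i$ (central in $\mathcal A$) and $Q_{n-1}=\sum_{i=1}^{n-1}z_iw_i$. $U_q(\mathrm{gl}_n)$ is the algebra generated by pairwise commuting invertible $k_i^{\pm1/2}$ ($1\le i\le n$) and $e_j,f_j$ ($1\le j\le n-1$) with $k_i^{1/2}e_jk_i^{-1/2}=q^{a_{ij}/2}e_j$, $k_i^{1/2}f_jk_i^{-1/2}=q^{-a_{ij}/2}f_j$, where $a_{jj}=1$, $a_{j+1,j}=-1$, $a_{ij}=0$ otherwise; $[e_i,f_j]=\delta_{ij}(k_ik_{i+1}^{-1}-k_i^{-1}k_{i+1})/(q-q^{-1})$; $e_i^2e_{i\pm1}-(q+q^{-1})e_ie_{i\pm1}e_i+e_{i\pm1}e_i^2=0$ and the same for the $f$'s; $[e_i,e_j]=[f_i,f_j]=0$ for $|i-j|>1$. Its comultiplication is $k_i^{\pm 1/2}\mapsto k_i^{\pm 1/2}\otimes k_i^{\pm 1/2}$, $e_i\mapsto e_i\otimes k_i^{-1/2}k_{i+1}^{1/2}+k_i^{1/2}k_{i+1}^{-1/2}\otimes e_i$, $f_i\mapsto f_i\otimes k_i^{-1/2}k_{i+1}^{1/2}+k_i^{1/2}k_{i+1}^{-1/2}\otimes f_i$; the counit is $\varepsilon(k_i)=1$, $\varepsilon(e_i)=\varepsilon(f_i)=0$.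 It acts on $\mathcal A$ by $X\triangleright 1=\varepsilon(X)1$, $k_i^{1/2}\triangleright z_j=q^{\delta_{ij}/2}z_j$, $e_i\triangleright z_j=\delta_{j,i+1}z_{j-1}$, $f_i\triangleright z_j=\delta_{j,i}z_{j+1}$, $k_i^{1/2}\triangleright w_j=q^{-\delta_{ij}/2}w_j$, $e_i\triangleright w_j=-\delta_{j,i}q^{-1}w_{j+1}$, $f_i\triangleright w_j=-\delta_{j,i+1}q\,w_{j-1}$, and $X\triangleright(p_1p_2)=\sum(X_{(1)}\triangleright p_1)(X_{(2)}\triangleright p_2)$; the subspaces $\mathcal H_{m,m'}$ are invariant. $U_q(\mathrm{gl}_{n-1})$ is the subalgebra generated by $k_i^{\pm1/2}$ ($i\le n-1$) and $e_j,f_j$ ($j\le n-2$). A polynomial $\varphi\in\mathcal H_{m,m'}$ is called zonal if $X\triangleright\varphi=\varepsilon(X)\varphi$ for all $X\in U_q(\mathrm{gl}_{n-1})$. *)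

theory Defs
  imports
    Complex_Main
    "HOL-Library.Poly_Mapping"
    "HOL-Algebra.QuotRing"
    "HOL-Algebra.Module"
    "HOL-Algebra.Embedded_Algebras"
begin

text \<open>
  Words form a monoid under concatenation, so the type \<open>'g list \<Rightarrow>\<^sub>0 complex\<close> of finitely
  supported functions on words is, with the convolution product of the library, the free
  associative unital complex algebra on the type \<open>'g\<close>.
\<close>

instantiation list :: (type) monoid_add
begin

definition zero_list :: "'a list" where "zero_list = []"

definition plus_list :: "'a list \<Rightarrow> 'a list \<Rightarrow> 'a list" where "plus_list = (@)"

instance by standard (simp_all add: zero_list_def plus_list_def)

end

type_synonym 'g ncpoly = "'g list \<Rightarrow>\<^sub>0 complex"

abbreviation var :: "'g \<Rightarrow> 'g ncpoly" where
  "var g \<equiv> Poly_Mapping.single [g] 1"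

abbreviation scal :: "complex \<Rightarrow> 'g ncpoly" where
  "scal c \<equiv> Poly_Mapping.single [] c"

definition free_algebra :: "'g set \<Rightarrow> (complex, 'g ncpoly) module" where
  "free_algebra S =
     \<lparr>carrier = {p. Poly_Mapping.keys p \<subseteq> lists S}, mult = (*), one = 1, zero = 0, add = (+),
      smult = (\<lambda>c p. scal c * p)\<rparr>"

text \<open>
  The algebra with generators \<open>S\<close> and relations \<open>r = 0\<close> for \<open>r \<in> R\<close>: the quotient of the free
  algebra by the two-sided ideal generated by \<open>R\<close>.  The factor ring of the library carries
  no scalar multiplication, which is therefore added here.
\<close>

definition relation_ideal :: "'g set \<Rightarrow> 'g ncpoly set \<Rightarrow> 'g ncpoly set" where
  "relation_ideal S R = genideal (free_algebra S) R"

definition presented_class :: "'g set \<Rightarrow> 'g ncpoly set \<Rightarrow> 'g ncpoly \<Rightarrow> 'g ncpoly set" where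
  "presented_class S R p = relation_ideal S R +>\<^bsub>free_algebra S\<^esub> p"

definition presented_algebra ::
  "'g set \<Rightarrow> 'g ncpoly set \<Rightarrow> (complex, 'g ncpoly set) module" where
  "presented_algebra S R =
     ring.extend (free_algebra S Quot relation_ideal S R)
       (module.fields (\<lambda>c X. \<Union>p\<in>X. presented_class S R (scal c * p)))"

definition linear_operator :: "(complex, 'b) module \<Rightarrow> ('b \<Rightarrow> 'b) \<Rightarrow> bool" where
  "linear_operator M D \<longleftrightarrow>
     D \<in> carrier M \<rightarrow>\<^sub>E carrier M \<and>
     (\<forall>x\<in>carrier M. \<forall>y\<in>carrier M. D (x \<oplus>\<^bsub>M\<^esub> y) = D x \<oplus>\<^bsub>M\<^esub> D y) \<and>
     (\<forall>c. \<forall>x\<in>carrier M. D (c \<odot>\<^bsub>M\<^esub> x) = c \<odot>\<^bsub>M\<^esub> D x)"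

text \<open>The copy of the complex numbers in an algebra, over which dimensions are taken.\<close>

definition scalars :: "(complex, 'b) module \<Rightarrow> 'b set" where
  "scalars M = range (\<lambda>c. c \<odot>\<^bsub>M\<^esub> \<one>\<^bsub>M\<^esub>)"

definition qint :: "complex \<Rightarrow> nat \<Rightarrow> complex" where
  "qint q a = (q powi (int a) - q powi (- int a)) / (q - inverse q)"

definition qpoch :: "complex \<Rightarrow> complex \<Rightarrow> nat \<Rightarrow> complex" where
  "qpoch a t s = (\<Prod>k<s. 1 - a * t ^ k)"

datatype zw = Z nat | W nat

definition zw_gens :: "nat \<Rightarrow> zw set" where
  "zw_gens n = Z ` {1..n} \<union> W ` {1..n}"

definition zw_rels :: "nat \<Rightarrow> complex \<Rightarrow> zw ncpoly set" where
  "zw_rels n q =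
     {var (Z i) * var (Z j) - scal q * var (Z j) * var (Z i) | i j. 1 \<le> i \<and> i < j \<and> j \<le> n} \<union>
     {var (W i) * var (W j) - scal (inverse q) * var (W j) * var (W i) | i j.
        1 \<le> i \<and> i < j \<and> j \<le> n} \<union>
     {var (W j) * var (Z i) - scal q * var (Z i) * var (W j) | i j.
        i \<in> {1..n} \<and> j \<in> {1..n} \<and> i \<noteq> j} \<union>
     {var (W k) * var (Z k) -
        (var (Z k) * var (W k) + scal (1 - q\<^sup>2) * (\<Sum>s\<in>{1..<k}. var (Z s) * var (W s))) | k.
        k \<in> {1..n}}"

definition zw_algebra :: "nat \<Rightarrow> complex \<Rightarrow> (complex, zw ncpoly set) module" where
  "zw_algebra n q = presented_algebra (zw_gens n) (zw_rels n q)"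

definition zw_class :: "nat \<Rightarrow> complex \<Rightarrow> zw ncpoly \<Rightarrow> zw ncpoly set" where
  "zw_class n q p = presented_class (zw_gens n) (zw_rels n q) p"

text \<open>
  The relations are homogeneous in the \<open>z\<^sub>i\<close> and in the \<open>w\<^sub>i\<close> separately, so the bidegree can be
  read off from the words of a representative.
\<close>

definition zw_homogeneous :: "nat \<Rightarrow> complex \<Rightarrow> nat \<Rightarrow> nat \<Rightarrow> zw ncpoly set set" where
  "zw_homogeneous n q m m' = zw_class n q `
     {p \<in> carrier (free_algebra (zw_gens n)). \<forall>u\<in>Poly_Mapping.keys p.
        length (filter (\<lambda>g. g \<in> range Z) u) = m \<and> length (filter (\<lambda>g. g \<in> range W) u) = m'}"

definition z_monomial :: "nat \<Rightarrow> (nat \<Rightarrow> nat) \<Rightarrow> zw ncpoly" where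
  "z_monomial n r = prod_list (map (\<lambda>i. var (Z i) ^ r i) [1..<Suc n])"

definition w_monomial :: "nat \<Rightarrow> (nat \<Rightarrow> nat) \<Rightarrow> zw ncpoly" where
  "w_monomial n r = prod_list (map (\<lambda>i. var (W i) ^ r i) [1..<Suc n])"

text \<open>
  The \<open>q\<close>-derivatives with respect to \<open>z\<^sub>i\<close> and \<open>w\<^sub>i\<close> are linear operators, each determined by
  its values on one of the two monomial bases.  For \<open>r i = 0\<close> the factor \<open>qint q (r i)\<close>
  vanishes, so the truncated exponent \<open>r i - 1\<close> is harmless.
\<close>

definition z_deriv :: "nat \<Rightarrow> complex \<Rightarrow> nat \<Rightarrow> zw ncpoly set \<Rightarrow> zw ncpoly set" where
  "z_deriv n q i = (THE D. linear_operator (zw_algebra n q) D \<and>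
     (\<forall>r s. D (zw_class n q (z_monomial n r * w_monomial n s)) =
        zw_class n q (scal (q ^ (\<Sum>j\<in>{i<..n}. r j) * qint q (r i)) *
          z_monomial n (r(i := r i - 1)) * w_monomial n s)))"

definition w_deriv :: "nat \<Rightarrow> complex \<Rightarrow> nat \<Rightarrow> zw ncpoly set \<Rightarrow> zw ncpoly set" where
  "w_deriv n q i = (THE D. linear_operator (zw_algebra n q) D \<and>
     (\<forall>r s. D (zw_class n q (w_monomial n r * z_monomial n s)) =
        zw_class n q (scal (q powi (- int (\<Sum>j\<in>{i<..n}. r j)) * qint q (r i)) *
          w_monomial n (r(i := r i - 1)) * z_monomial n s)))"

definition q_laplace :: "nat \<Rightarrow> complex \<Rightarrow> zw ncpoly set \<Rightarrow> zw ncpoly set" where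
  "q_laplace n q p = (\<Oplus>\<^bsub>zw_algebra n q\<^esub>i\<in>{1..n}. z_deriv n q i (w_deriv n q i p))"

definition harmonic :: "nat \<Rightarrow> complex \<Rightarrow> nat \<Rightarrow> nat \<Rightarrow> zw ncpoly set set" where
  "harmonic n q m m' = {p \<in> zw_homogeneous n q m m'. q_laplace n q p = \<zero>\<^bsub>zw_algebra n q\<^esub>}"

text \<open>\<open>Q_poly n\<close> represents \<open>Q\<close> and \<open>Q_poly (n - 1)\<close> represents \<open>Q\<^sub>n\<^sub>-\<^sub>1\<close>.\<close>

definition Q_poly :: "nat \<Rightarrow> zw ncpoly" where
  "Q_poly k = (\<Sum>i\<in>{1..k}. var (Z i) * var (W i))"

text \<open>
  \<open>KH i\<close> and \<open>KHI i\<close> stand for the square root of \<open>k\<^sub>i\<close> and its inverse.  The parameter \<open>h\<close> is the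
  fixed square root of \<open>q\<close>.
\<close>

datatype uq_gen = KH nat | KHI nat | E nat | F nat

definition uq_gens :: "nat \<Rightarrow> uq_gen set" where
  "uq_gens n = KH ` {1..n} \<union> KHI ` {1..n} \<union> E ` {1..<n} \<union> F ` {1..<n}"

definition uq_weight :: "nat \<Rightarrow> nat \<Rightarrow> int" where
  "uq_weight i j = (if i = j then 1 else if i = Suc j then -1 else 0)"

definition uq_rels :: "nat \<Rightarrow> complex \<Rightarrow> complex \<Rightarrow> uq_gen ncpoly set" where
  "uq_rels n q h =
     {var (KH i) * var (KHI i) - 1 | i. i \<in> {1..n}} \<union>
     {var (KHI i) * var (KH i) - 1 | i. i \<in> {1..n}} \<union>
     {var (KH i) * var (KH j) - var (KH j) * var (KH i) | i j. i \<in> {1..n} \<and> j \<in> {1..n}} \<union>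
     {var (KH i) * var (E j) * var (KHI i) - scal (h powi uq_weight i j) * var (E j) | i j.
        i \<in> {1..n} \<and> j \<in> {1..<n}} \<union>
     {var (KH i) * var (F j) * var (KHI i) - scal (h powi (- uq_weight i j)) * var (F j) | i j.
        i \<in> {1..n} \<and> j \<in> {1..<n}} \<union>
     {var (E i) * var (F j) - var (F j) * var (E i) -
        (if i = j then scal (1 / (q - inverse q)) *
           (var (KH i) ^ 2 * var (KHI (Suc i)) ^ 2 - var (KHI i) ^ 2 * var (KH (Suc i)) ^ 2)
         else 0) | i j. i \<in> {1..<n} \<and> j \<in> {1..<n}} \<union>
     (\<Union>X\<in>{E, F}.
       {var (X i) ^ 2 * var (X j) - scal (q + inverse q) * var (X i) * var (X j) * var (X i) +
          var (X j) * var (X i) ^ 2 | i j.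
          i \<in> {1..<n} \<and> j \<in> {1..<n} \<and> (j = Suc i \<or> i = Suc j)} \<union>
       {var (X i) * var (X j) - var (X j) * var (X i) | i j.
          i \<in> {1..<n} \<and> j \<in> {1..<n} \<and> \<bar>int i - int j\<bar> > 1})"

definition uq_algebra ::
  "nat \<Rightarrow> complex \<Rightarrow> complex \<Rightarrow> (complex, uq_gen ncpoly set) module" where
  "uq_algebra n q h = presented_algebra (uq_gens n) (uq_rels n q h)"

definition uq_class :: "nat \<Rightarrow> complex \<Rightarrow> complex \<Rightarrow> uq_gen ncpoly \<Rightarrow> uq_gen ncpoly set" where
  "uq_class n q h p = presented_class (uq_gens n) (uq_rels n q h) p"

text \<open>
  The subalgebra \<open>U\<^sub>q(gl\<^sub>n\<^sub>-\<^sub>1)\<close> consists of the classes of the noncommutative polynomials in its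
  generators.
\<close>

definition uq_subalgebra :: "nat \<Rightarrow> complex \<Rightarrow> complex \<Rightarrow> uq_gen ncpoly set set" where
  "uq_subalgebra n q h = uq_class n q h ` carrier (free_algebra (uq_gens (n - 1)))"

text \<open>
  The counit is the algebra homomorphism induced on classes by its values on the generators;
  all representatives of a class have the same value.
\<close>

fun counit_gen :: "uq_gen \<Rightarrow> complex" where
  "counit_gen (KH i) = 1"
| "counit_gen (KHI i) = 1"
| "counit_gen (E i) = 0"
| "counit_gen (F i) = 0"

definition nc_eval :: "('g \<Rightarrow> complex) \<Rightarrow> 'g ncpoly \<Rightarrow> complex" where
  "nc_eval v p = (\<Sum>u\<in>Poly_Mapping.keys p. Poly_Mapping.lookup p u * prod_list (map v u))"

definition counit :: "uq_gen ncpoly set \<Rightarrow> complex" where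
  "counit X = the_elem (nc_eval counit_gen ` X)"

text \<open>
  \<open>comult n q h X L\<close> says that the comultiplication, extended from the generators as an algebra
  homomorphism, yields the expression of the coproduct of \<open>X\<close> as the sum of the tensors
  \<open>a \<otimes> b\<close> over the pairs \<open>(a, b)\<close> in the list \<open>L\<close>.  One \<open>X\<close> is related to many such lists.
\<close>

inductive comult ::
  "nat \<Rightarrow> complex \<Rightarrow> complex \<Rightarrow> uq_gen ncpoly set \<Rightarrow>
    (uq_gen ncpoly set \<times> uq_gen ncpoly set) list \<Rightarrow> bool"
  for n :: nat and q h :: complex where
  comult_KH: "i \<in> {1..n} \<Longrightarrow>
    comult n q h (uq_class n q h (var (KH i)))
      [(uq_class n q h (var (KH i)), uq_class n q h (var (KH i)))]"
| comult_KHI: "i \<in> {1..n} \<Longrightarrow>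
    comult n q h (uq_class n q h (var (KHI i)))
      [(uq_class n q h (var (KHI i)), uq_class n q h (var (KHI i)))]"
| comult_E: "i \<in> {1..<n} \<Longrightarrow>
    comult n q h (uq_class n q h (var (E i)))
      [(uq_class n q h (var (E i)), uq_class n q h (var (KHI i) * var (KH (Suc i)))),
       (uq_class n q h (var (KH i) * var (KHI (Suc i))), uq_class n q h (var (E i)))]"
| comult_F: "i \<in> {1..<n} \<Longrightarrow>
    comult n q h (uq_class n q h (var (F i)))
      [(uq_class n q h (var (F i)), uq_class n q h (var (KHI i) * var (KH (Suc i)))),
       (uq_class n q h (var (KH i) * var (KHI (Suc i))), uq_class n q h (var (F i)))]"
| comult_one: "comult n q h \<one>\<^bsub>uq_algebra n q h\<^esub>
    [(\<one>\<^bsub>uq_algebra n q h\<^esub>, \<one>\<^bsub>uq_algebra n q h\<^esub>)]"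
| comult_add: "comult n q h X L \<Longrightarrow> comult n q h Y M \<Longrightarrow>
    comult n q h (X \<oplus>\<^bsub>uq_algebra n q h\<^esub> Y) (L @ M)"
| comult_smult: "comult n q h X L \<Longrightarrow>
    comult n q h (c \<odot>\<^bsub>uq_algebra n q h\<^esub> X)
      (map (\<lambda>(a, b). (c \<odot>\<^bsub>uq_algebra n q h\<^esub> a, b)) L)"
| comult_mult: "comult n q h X L \<Longrightarrow> comult n q h Y M \<Longrightarrow>
    comult n q h (X \<otimes>\<^bsub>uq_algebra n q h\<^esub> Y)
      [(a \<otimes>\<^bsub>uq_algebra n q h\<^esub> a', b \<otimes>\<^bsub>uq_algebra n q h\<^esub> b'). (a, b) \<leftarrow> L, (a', b') \<leftarrow> M]"

text \<open>
  \<open>uq_action n q h act\<close>: \<open>act\<close> makes the algebra of the \<open>z\<^sub>i\<close> and \<open>w\<^sub>i\<close> a module algebra over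
  \<open>U\<^sub>q(gl\<^sub>n)\<close> with the prescribed values on generators.  This determines \<open>act\<close> on the two carriers.
\<close>

definition uq_action ::
  "nat \<Rightarrow> complex \<Rightarrow> complex \<Rightarrow>
    (uq_gen ncpoly set \<Rightarrow> zw ncpoly set \<Rightarrow> zw ncpoly set) \<Rightarrow> bool" where
  "uq_action n q h act \<longleftrightarrow>
     (let U = uq_algebra n q h; A = zw_algebra n q; u = uq_class n q h; a = zw_class n q in
       (\<forall>X\<in>carrier U. \<forall>p\<in>carrier A. act X p \<in> carrier A) \<and>
       (\<forall>X\<in>carrier U. \<forall>p\<in>carrier A. \<forall>p'\<in>carrier A.
          act X (p \<oplus>\<^bsub>A\<^esub> p') = act X p \<oplus>\<^bsub>A\<^esub> act X p') \<and>
       (\<forall>X\<in>carrier U. \<forall>c. \<forall>p\<in>carrier A. act X (c \<odot>\<^bsub>A\<^esub> p) = c \<odot>\<^bsub>A\<^esub> act X p) \<and>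
       (\<forall>X\<in>carrier U. \<forall>Y\<in>carrier U. \<forall>p\<in>carrier A.
          act (X \<oplus>\<^bsub>U\<^esub> Y) p = act X p \<oplus>\<^bsub>A\<^esub> act Y p) \<and>
       (\<forall>X\<in>carrier U. \<forall>c. \<forall>p\<in>carrier A. act (c \<odot>\<^bsub>U\<^esub> X) p = c \<odot>\<^bsub>A\<^esub> act X p) \<and>
       (\<forall>p\<in>carrier A. act \<one>\<^bsub>U\<^esub> p = p) \<and>
       (\<forall>X\<in>carrier U. \<forall>Y\<in>carrier U. \<forall>p\<in>carrier A. act (X \<otimes>\<^bsub>U\<^esub> Y) p = act X (act Y p)) \<and>
       (\<forall>X\<in>carrier U. act X \<one>\<^bsub>A\<^esub> = counit X \<odot>\<^bsub>A\<^esub> \<one>\<^bsub>A\<^esub>) \<and>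
       (\<forall>i\<in>{1..n}. \<forall>j\<in>{1..n}.
          act (u (var (KH i))) (a (var (Z j))) = a (scal (if i = j then h else 1) * var (Z j)) \<and>
          act (u (var (KH i))) (a (var (W j))) =
            a (scal (if i = j then inverse h else 1) * var (W j))) \<and>
       (\<forall>i\<in>{1..<n}. \<forall>j\<in>{1..n}.
          act (u (var (E i))) (a (var (Z j))) = a (if j = Suc i then var (Z (j - 1)) else 0) \<and>
          act (u (var (F i))) (a (var (Z j))) = a (if j = i then var (Z (Suc j)) else 0) \<and>
          act (u (var (E i))) (a (var (W j))) =
            a (if j = i then - scal (inverse q) * var (W (Suc j)) else 0) \<and>
          act (u (var (F i))) (a (var (W j))) =
            a (if j = Suc i then - scal q * var (W (j - 1)) else 0)) \<and>
       (\<forall>X L. comult n q h X L \<longrightarrow> (\<forall>p\<in>carrier A. \<forall>p'\<in>carrier A.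
          act X (p \<otimes>\<^bsub>A\<^esub> p') =
            foldr (\<lambda>(b, c) t. (act b p \<otimes>\<^bsub>A\<^esub> act c p') \<oplus>\<^bsub>A\<^esub> t) L \<zero>\<^bsub>A\<^esub>)))"

definition zonal ::
  "nat \<Rightarrow> complex \<Rightarrow> complex \<Rightarrow> (uq_gen ncpoly set \<Rightarrow> zw ncpoly set \<Rightarrow> zw ncpoly set) \<Rightarrow>
    nat \<Rightarrow> nat \<Rightarrow> zw ncpoly set set" where
  "zonal n q h act m m' = {p \<in> harmonic n q m m'.
     \<forall>X\<in>uq_subalgebra n q h. act X p = counit X \<odot>\<^bsub>zw_algebra n q\<^esub> p}"

end

theory Submission
  imports Defs "HOL-Computational_Algebra.Polynomial"
begin

text \<open>
  The algebra is represented faithfully by operators on functions of an exponent vector \<open>a\<close> and a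
  parameter vector \<open>l\<close>: up to powers of \<open>q\<close>, \<open>z\<^sub>i\<close> and \<open>w\<^sub>i\<close> raise and lower \<open>a\<^sub>i\<close>, and each partial sum
  \<open>z\<^sub>1w\<^sub>1 + \<dots> + z\<^sub>kw\<^sub>k\<close> acts diagonally, as \<open>l\<^sub>k\<close> times a power of \<open>q\<close>.  Ordered monomials act linearly
  independently, so they form bases and the \<open>q\<close>-derivatives are well defined.

  An element of bidegree \<open>(m, m')\<close> that is invariant under \<open>U\<^sub>q(gl\<^sub>n\<^sub>-\<^sub>1)\<close> is determined by its coefficients
  at the monomials in \<open>z\<^sub>1, z\<^sub>n, w\<^sub>1, w\<^sub>n\<close> with equal exponents of \<open>z\<^sub>1\<close> and \<open>w\<^sub>1\<close>: the weight condition kills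
  most coefficients, and the raising operators express the others by these.  There are \<open>K + 1\<close> such
  monomials, \<open>K = min m m'\<close>, and the \<open>K + 1\<close> invariants \<open>z\<^sub>n\<^sup>m\<^sup>-\<^sup>t Q\<^sub>n\<^sub>-\<^sub>1\<^sup>t w\<^sub>n\<^sup>m\<^sup>'\<^sup>-\<^sup>t\<close> separate them, hence span all
  invariants.  Since \<open>z\<^sub>n\<^sup>kw\<^sub>n\<^sup>k\<close> is a polynomial in \<open>Q\<close> and \<open>Q\<^sub>n\<^sub>-\<^sub>1\<close>, the products of \<open>Q\<^sup>K\<^sup>-\<^sup>s Q\<^sub>n\<^sub>-\<^sub>1\<^sup>s\<close> with the
  missing power of \<open>z\<^sub>n\<close> or \<open>w\<^sub>n\<close> span them as well.  The Laplacian sends each such product to a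
  combination of two products of lower degree.  Harmonicity is therefore a two-term recurrence for the
  coefficients, which has a one-dimensional space of solutions, spanned by the stated \<open>q\<close>-hypergeometric
  coefficients.
\<close>

section \<open>Evaluation of noncommutative polynomials\<close>

text \<open>The derivatives are given by \<open>THE\<close> on a quotient by an ideal, so nothing
  can be computed before ordered monomials are known to be independent. Shifts of \<open>a\<close>
  alone do not separate them, since z_i w_i shifts nothing; the free parameters \<open>l\<close> do.
  Once the kernel of the representation is known to be the relation ideal, all computations are with
  operators. The main obstacle is that the two kinds of derivatives are explicit in opposite
  orderings. Each passes over right factors of the other kind, and over left factors of its own kind
  with a different index. Partial sums of the z_i w_i commute with generators of lower index, so a
  product of Q and Q_{n-1} is both a sum of sandwiches z_i X w_i and a weighted sum of sandwiches
  w_i X z_i, and both kinds of rules apply. The sum of z-derivatives over i < n left in the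
  Laplacian is obtained at once: a q-Euler identity gives the sum over all i, and the term i = n is
  subtracted. A third product, with one more Q_{n-1} and two fewer Q, cancels. The two surviving
  coefficients are products of q-integers whose quotient is the ratio of successive hypergeometric
  terms.\<close>

lemma single_mult_append:
  "Poly_Mapping.single u a * Poly_Mapping.single v b = Poly_Mapping.single (u @ v) (a * b)"
  for a b :: complex
  by (simp add: mult_single plus_list_def)

lemma ncpoly_one: "(1 :: 'g ncpoly) = Poly_Mapping.single [] 1"
  by (metis single_one zero_list_def)

lemma scal_one: "(scal 1 :: 'g ncpoly) = 1"
  by (simp add: ncpoly_one)

lemma scal_uminus: "scal (- a) = (- scal a :: 'g ncpoly)"
  by (rule single_uminus)

lemma ncpoly_decomp:
  fixes p :: "'g ncpoly"
  assumes "finite S" "Poly_Mapping.keys p \<subseteq> S"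
  shows "p = (\<Sum>u\<in>S. Poly_Mapping.single u (Poly_Mapping.lookup p u))"
proof (rule poly_mapping_eqI)
  fix k
  have "Poly_Mapping.lookup (\<Sum>u\<in>S. Poly_Mapping.single u (Poly_Mapping.lookup p u)) k
      = (\<Sum>u\<in>S. if u = k then Poly_Mapping.lookup p k else 0)"
    by (simp add: lookup_sum lookup_single when_def cong: if_cong)
  also have "\<dots> = Poly_Mapping.lookup p k"
    using assms by (auto simp: in_keys_iff)
  finally show "Poly_Mapping.lookup p k
      = Poly_Mapping.lookup (\<Sum>u\<in>S. Poly_Mapping.single u (Poly_Mapping.lookup p u)) k" by simp
qed

lemma ncpoly_induct [case_names single add]:
  fixes p :: "'g ncpoly"
  assumes "\<And>u c. u \<in> Poly_Mapping.keys p \<union> {[]} \<Longrightarrow> P (Poly_Mapping.single u c)"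
    and "\<And>x y. P x \<Longrightarrow> P y \<Longrightarrow> P (x + y)"
  shows "P p"
proof -
  have "P (\<Sum>u\<in>S. Poly_Mapping.single u (Poly_Mapping.lookup p u))"
    if "finite S" "S \<subseteq> Poly_Mapping.keys p" for S
    using that
  proof (induction rule: finite_induct)
    case empty
    show ?case using assms(1)[of "[]" 0] by simp
  qed (auto intro: assms)
  from this[of "Poly_Mapping.keys p"] show ?thesis
    using ncpoly_decomp[of "Poly_Mapping.keys p" p] by simp
qed

text \<open>Evaluation in a ring with a central image of the complex numbers; the instances are the
  complex numbers for the counit and operators for the representation. Centrality lets the scalars
  of two words be collected in front, which makes \<open>ev\<close> multiplicative.\<close>

locale scalar_hom =
  fixes \<sigma> :: "complex \<Rightarrow> 'r::ring_1"
  assumes hom_add: "\<sigma> (a + b) = \<sigma> a + \<sigma> b"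
    and hom_mult: "\<sigma> (a * b) = \<sigma> a * \<sigma> b"
    and hom_one: "\<sigma> 1 = 1"
    and central: "\<sigma> a * x = x * \<sigma> a"
begin

lemma hom_zero: "\<sigma> 0 = 0"
  using hom_add[of 0 0] by simp

definition ev :: "('g \<Rightarrow> 'r) \<Rightarrow> 'g ncpoly \<Rightarrow> 'r" where
  "ev v p = (\<Sum>u\<in>Poly_Mapping.keys p. \<sigma> (Poly_Mapping.lookup p u) * prod_list (map v u))"

lemma ev_superset:
  assumes "finite S" "Poly_Mapping.keys p \<subseteq> S"
  shows "ev v p = (\<Sum>u\<in>S. \<sigma> (Poly_Mapping.lookup p u) * prod_list (map v u))"
  unfolding ev_def using assms
  by (intro sum.mono_neutral_left) (auto simp: in_keys_iff hom_zero)

lemma ev_single: "ev v (Poly_Mapping.single u c) = \<sigma> c * prod_list (map v u)"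
  by (subst ev_superset[of "{u}"]) auto

lemma ev_add: "ev v (p + p') = ev v p + ev v p'"
proof -
  let ?S = "Poly_Mapping.keys p \<union> Poly_Mapping.keys p'"
  have "Poly_Mapping.keys (p + p') \<subseteq> ?S"
    by (rule Poly_Mapping.keys_add)
  then show ?thesis
    by (simp add: ev_superset[of ?S] lookup_add hom_add distrib_right sum.distrib)
qed

lemma ev_zero: "ev v 0 = 0"
  by (simp add: ev_def)

lemma ev_uminus: "ev v (- p) = - ev v p"
  using ev_add[of v p "- p"] by (simp add: ev_zero eq_neg_iff_add_eq_0 add.commute)

lemma ev_diff: "ev v (p - p') = ev v p - ev v p'"
  using ev_add[of v p "- p'"] by (simp add: ev_uminus)

lemma ev_mult: "ev v (p * p') = ev v p * ev v p'"
proof (induction p rule: ncpoly_induct)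
  case (single u c)
  show ?case
  proof (induction p' rule: ncpoly_induct)
    case (single u' c')
    have "\<sigma> c * \<sigma> c' * (prod_list (map v u) * prod_list (map v u'))
        = \<sigma> c * (\<sigma> c' * prod_list (map v u)) * prod_list (map v u')"
      by (simp add: mult.assoc)
    also have "\<dots> = \<sigma> c * (prod_list (map v u) * \<sigma> c') * prod_list (map v u')"
      by (simp only: central)
    finally show ?case
      by (simp add: single_mult_append ev_single hom_mult mult.assoc)
  next
    case (add x y)
    then show ?case by (simp add: distrib_left ev_add)
  qed
next
  case (add x y)
  then show ?case by (simp add: distrib_right ev_add)
qed

lemma ev_one: "ev v 1 = 1"
  by (simp add: ncpoly_one ev_single hom_one)

lemma ev_var: "ev v (var g) = v g"
  by (simp add: ev_single hom_one)

lemma ev_scal: "ev v (scal c) = \<sigma> c"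
  by (simp add: ev_single)

lemma ev_power: "ev v (p ^ k) = ev v p ^ k"
  by (induction k) (simp_all add: ev_one ev_mult)

lemma ev_sum: "ev v (sum f S) = (\<Sum>x\<in>S. ev v (f x))"
  by (induction S rule: infinite_finite_induct) (simp_all add: ev_zero ev_add)

lemma ev_prod_list: "ev v (prod_list ps) = prod_list (map (ev v) ps)"
  by (induction ps) (simp_all add: ev_one ev_mult)

lemmas ev_simps = ev_add ev_zero ev_uminus ev_diff ev_mult ev_one ev_var ev_scal ev_power ev_sum
  ev_prod_list

end

interpretation cnum: scalar_hom "\<lambda>c::complex. c"
  by standard (simp_all add: mult.commute)

lemma nc_eval_eq: "nc_eval v p = cnum.ev v p"
  by (simp add: nc_eval_def cnum.ev_def)

section \<open>Linear operators on functions of integer and complex parameters\<close>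

type_synonym idx = "(nat \<Rightarrow> int) \<times> (nat \<Rightarrow> complex)"

text \<open>Linear operators form a type of their own so that composition is the product of a
  \<open>ring_1\<close>, and powers, finite sums and vector space theory apply to them
  directly.\<close>

typedef lop = "{T :: (idx \<Rightarrow> complex) \<Rightarrow> idx \<Rightarrow> complex.
    (\<forall>f g. T (\<lambda>x. f x + g x) = (\<lambda>x. T f x + T g x)) \<and> (\<forall>c f. T (\<lambda>x. c * f x) = (\<lambda>x. c * T f x))}"
  morphisms app Abs_lop
  by (rule exI[of _ "\<lambda>f x. 0"]) simp

setup_lifting type_definition_lop

lemma app_add: "app T (\<lambda>x. f x + g x) = (\<lambda>x. app T f x + app T g x)"
  by transfer simp

lemma app_smult: "app T (\<lambda>x. c * f x) = (\<lambda>x. c * app T f x)"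
  by transfer simp

lemma lop_eqI: "(\<And>f x. app S f x = app T f x) \<Longrightarrow> S = T"
  by transfer (simp add: fun_eq_iff)

instantiation lop :: ring_1
begin

lift_definition zero_lop :: lop is "\<lambda>f x. 0" by simp
lift_definition one_lop :: lop is "\<lambda>f. f" by simp
lift_definition plus_lop :: "lop \<Rightarrow> lop \<Rightarrow> lop" is "\<lambda>S T f x. S f x + T f x"
  by (simp add: algebra_simps)
lift_definition uminus_lop :: "lop \<Rightarrow> lop" is "\<lambda>S f x. - S f x" by simp
lift_definition minus_lop :: "lop \<Rightarrow> lop \<Rightarrow> lop" is "\<lambda>S T f x. S f x - T f x"
  by (simp add: algebra_simps)
lift_definition times_lop :: "lop \<Rightarrow> lop \<Rightarrow> lop" is "\<lambda>S T f. S (T f)" by simp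

lemma app_lop_simps:
  "app 0 f x = 0" "app 1 f = f" "app (S + T) f x = app S f x + app T f x"
  "app (- S) f x = - app S f x" "app (S - T) f x = app S f x - app T f x"
  "app (S * T) f = app S (app T f)"
  by (transfer, simp)+

instance
proof
  show "(0::lop) \<noteq> 1"
  proof
    assume "(0::lop) = 1"
    then have "app 0 (\<lambda>_. 1) undefined = app 1 (\<lambda>_. 1) undefined" by simp
    then show False by (simp add: app_lop_simps)
  qed
  fix a b c :: lop
  \<comment> \<open>The only ring identity that rests on linearity of the operators.\<close>
  show "a * (b + c) = a * b + a * c"
  proof (rule lop_eqI)
    fix f x
    have "app (b + c) f = (\<lambda>x. app b f x + app c f x)"
      by (rule ext) (simp add: app_lop_simps)
    then show "app (a * (b + c)) f x = app (a * b + a * c) f x"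
      by (simp add: app_lop_simps app_add)
  qed
qed (rule lop_eqI, simp add: app_lop_simps; fail)+

end

lift_definition scale :: "complex \<Rightarrow> lop \<Rightarrow> lop" is "\<lambda>c T f x. c * T f x"
  by (simp add: algebra_simps)

lemma app_scale: "app (scale c T) f x = c * app T f x"
  by transfer simp

lemma app_sum: "app (sum T S) f x = (\<Sum>i\<in>S. app (T i) f x)"
  by (induction S rule: infinite_finite_induct) (simp_all add: app_lop_simps)

interpretation lop: vector_space scale
  by standard (rule lop_eqI, simp add: app_lop_simps app_scale algebra_simps; fail)+

interpretation lopp: vector_space_pair scale scale ..

lemma scale_mult_left: "scale c S * T = scale c (S * T)"
  by (rule lop_eqI) (simp add: app_lop_simps app_scale)

lemma scale_mult_right: "S * scale c T = scale c (S * T)"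
proof (rule lop_eqI)
  fix f x
  have "app (scale c T) f = (\<lambda>x. c * app T f x)"
    by (rule ext) (simp add: app_scale)
  then show "app (S * scale c T) f x = app (scale c (S * T)) f x"
    by (simp add: app_lop_simps app_scale app_smult)
qed

lemmas scale_simps = scale_mult_left scale_mult_right lop.scale_scale

interpretation lops: scalar_hom "\<lambda>c. scale c 1"
  by standard (simp_all add: lop.scale_left_distrib scale_simps)

lemma scale_one_mult: "scale c 1 * T = scale c T"
  by (simp add: scale_mult_left)

definition linop :: "(lop \<Rightarrow> lop) \<Rightarrow> bool" where
  "linop D \<longleftrightarrow> (\<forall>x y. D (x + y) = D x + D y) \<and> (\<forall>c x. D (scale c x) = scale c (D x))"

lemma linopI [intro?]:
  assumes "\<And>x y. D (x + y) = D x + D y" "\<And>c x. D (scale c x) = scale c (D x)"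
  shows "linop D"
  using assms by (simp add: linop_def)

lemma linop_add: "linop D \<Longrightarrow> D (x + y) = D x + D y"
  by (simp add: linop_def)

lemma linop_scale: "linop D \<Longrightarrow> D (scale c x) = scale c (D x)"
  by (simp add: linop_def)

lemma linop_zero: "linop D \<Longrightarrow> D 0 = 0"
  using linop_scale[of D 0 0] by simp

lemma linop_uminus: "linop D \<Longrightarrow> D (- x) = - D x"
  using linop_scale[of D "-1" x] by simp

lemma linop_diff: "linop D \<Longrightarrow> D (x - y) = D x - D y"
  using linop_add[of D x "- y"] by (simp add: linop_uminus)

lemma linop_sum: "linop D \<Longrightarrow> D (sum f S) = (\<Sum>x\<in>S. D (f x))"
  by (induction S rule: infinite_finite_induct) (simp_all add: linop_zero linop_add)

lemmas linop_simps = linop_add linop_scale linop_zero linop_uminus linop_diff linop_sum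

lemma linop_extension:
  assumes "lop.independent (f ` I)" "inj_on f I"
  obtains D where "linop D" "\<And>i. i \<in> I \<Longrightarrow> D (f i) = g i"
proof -
  obtain D where D: "Vector_Spaces.linear scale scale D" "\<forall>x\<in>f ` I. D x = g (the_inv_into I f x)"
    using lopp.linear_independent_extend[OF assms(1), of "\<lambda>x. g (the_inv_into I f x)"] by blast
  interpret Vector_Spaces.linear scale scale D by fact
  show thesis
  proof (rule that)
    show "linop D" by (rule linopI) (simp_all add: add scale)
    show "D (f i) = g i" if "i \<in> I" for i
      using D(2) that assms(2) by (simp add: the_inv_into_f_f)
  qed
qed

text \<open>Coordinates with respect to an independent family. Outside the span of the family the
  functionals are arbitrary linear extensions, so their values have a meaning only on the
  span.\<close>

lemma coeff_functional:
  assumes "lop.independent (f ` I)" "inj_on f I"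
  obtains \<kappa> :: "'i \<Rightarrow> lop \<Rightarrow> complex" where
    "\<And>i x y. \<kappa> i (x + y) = \<kappa> i x + \<kappa> i y" "\<And>i c x. \<kappa> i (scale c x) = c * \<kappa> i x"
    "\<And>i j. i \<in> I \<Longrightarrow> j \<in> I \<Longrightarrow> \<kappa> i (f j) = (if i = j then 1 else 0)"
proof -
  have "\<exists>k. (\<forall>x y. k (x + y) = k x + k y) \<and> (\<forall>c x. k (scale c x) = c * k x) \<and>
      (\<forall>j\<in>I. i \<in> I \<longrightarrow> k (f j) = (if i = j then 1 else 0))" for i
  proof -
    interpret lopc: vector_space_pair scale "(*) :: complex \<Rightarrow> _"
      by standard (simp_all add: algebra_simps)
    let ?g = "\<lambda>x. if the_inv_into I f x = i then 1 else 0 :: complex"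
    obtain D where D: "Vector_Spaces.linear scale (*) D" "\<forall>x\<in>f ` I. D x = ?g x"
      using lopc.linear_independent_extend[OF assms(1), of ?g] by blast
    interpret Vector_Spaces.linear scale "(*)" D by fact
    have "D (f j) = (if i = j then 1 else 0)" if "j \<in> I" for j
      using D(2) that assms(2) by (auto simp: the_inv_into_f_f)
    then show ?thesis by (intro exI[of _ D]) (simp add: add scale)
  qed
  then obtain \<kappa> where "\<And>i. (\<forall>x y. \<kappa> i (x + y) = \<kappa> i x + \<kappa> i y) \<and>
      (\<forall>c x. \<kappa> i (scale c x) = c * \<kappa> i x) \<and> (\<forall>j\<in>I. i \<in> I \<longrightarrow> \<kappa> i (f j) = (if i = j then 1 else 0))"
    by metis
  then show thesis by (intro that[of \<kappa>]) auto
qed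

section \<open>Presented algebras\<close>

definition fpoly :: "'g set \<Rightarrow> 'g ncpoly set" where
  "fpoly S = {p. Poly_Mapping.keys p \<subseteq> lists S}"

lemma free_algebra_simps [simp]:
  "carrier (free_algebra S) = fpoly S"
  "x \<otimes>\<^bsub>free_algebra S\<^esub> y = x * y" "x \<oplus>\<^bsub>free_algebra S\<^esub> y = x + y"
  "\<one>\<^bsub>free_algebra S\<^esub> = 1" "\<zero>\<^bsub>free_algebra S\<^esub> = 0"
  by (simp_all add: free_algebra_def fpoly_def)

lemma fpoly_zero [simp, intro]: "0 \<in> fpoly S"
  by (simp add: fpoly_def)

lemma fpoly_single: "u \<in> lists S \<Longrightarrow> Poly_Mapping.single u c \<in> fpoly S"
  by (auto simp: fpoly_def keys_single)

lemma fpoly_scal [simp, intro]: "scal c \<in> fpoly S"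
  by (rule fpoly_single) simp

lemma fpoly_one [simp, intro]: "1 \<in> fpoly S"
  unfolding ncpoly_one by (rule fpoly_scal)

lemma fpoly_var [intro]: "g \<in> S \<Longrightarrow> var g \<in> fpoly S"
  by (rule fpoly_single) simp

lemma fpoly_add [intro]: "p \<in> fpoly S \<Longrightarrow> p' \<in> fpoly S \<Longrightarrow> p + p' \<in> fpoly S"
  using Poly_Mapping.keys_add[of p p'] by (auto simp: fpoly_def)

lemma fpoly_uminus [intro]: "p \<in> fpoly S \<Longrightarrow> - p \<in> fpoly S"
  by (simp add: fpoly_def keys_minus)

lemma fpoly_diff [intro]: "p \<in> fpoly S \<Longrightarrow> p' \<in> fpoly S \<Longrightarrow> p - p' \<in> fpoly S"
  using fpoly_add[of p S "- p'"] by auto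

lemma fpoly_mult [intro]: "p \<in> fpoly S \<Longrightarrow> p' \<in> fpoly S \<Longrightarrow> p * p' \<in> fpoly S"
  using keys_mult[of p p'] by (fastforce simp: fpoly_def plus_list_def)

lemma fpoly_sum [intro]: "(\<And>x. x \<in> I \<Longrightarrow> f x \<in> fpoly S) \<Longrightarrow> sum f I \<in> fpoly S"
  by (induction I rule: infinite_finite_induct) auto

lemma fpoly_power [intro]: "p \<in> fpoly S \<Longrightarrow> p ^ k \<in> fpoly S"
  by (induction k) auto

lemma fpoly_prod_list [intro]: "(\<And>p. p \<in> set ps \<Longrightarrow> p \<in> fpoly S) \<Longrightarrow> prod_list ps \<in> fpoly S"
  by (induction ps) auto

lemma fpoly_mono: "S \<subseteq> T \<Longrightarrow> fpoly S \<subseteq> fpoly T"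
  by (fastforce simp: fpoly_def)

lemma fpoly_induct [consumes 1, case_names zero add mult]:
  assumes "p \<in> fpoly S" "P 0" "\<And>x y. P x \<Longrightarrow> P y \<Longrightarrow> P (x + y)"
    "\<And>u c. u \<in> lists S \<Longrightarrow> P (Poly_Mapping.single u c)"
  shows "P p"
proof (induction p rule: ncpoly_induct)
  case (single u c)
  then have "u \<in> lists S" using assms(1) by (auto simp: fpoly_def)
  then show ?case by (rule assms(4))
qed (rule assms)

lemma single_Cons: "Poly_Mapping.single (g # u) c = var g * Poly_Mapping.single u c"
  by (simp add: single_mult_append)

lemma ring_free_algebra: "ring (free_algebra S)"
proof (rule ringI)
  show "abelian_group (free_algebra S)"
    by (rule abelian_groupI)
      (use fpoly_add fpoly_uminus in \<open>auto simp: add.commute add.left_commute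
          intro: bexI[of _ "- x" for x]\<close>)
  show "Group.monoid (free_algebra S)"
    by (rule Group.monoidI) (use fpoly_mult in \<open>auto simp: mult.assoc\<close>)
qed (simp_all add: distrib_left distrib_right)

locale presented =
  fixes S :: "'g set" and R :: "'g ncpoly set"
  assumes rels: "R \<subseteq> fpoly S"
begin

definition J where "J = relation_ideal S R"

sublocale free: ring "free_algebra S"
  by (rule ring_free_algebra)

lemma ideal_J: "ideal J (free_algebra S)"
  unfolding J_def relation_ideal_def by (rule free.genideal_ideal) (simp add: rels)

sublocale ideal J "free_algebra S"
  by (rule ideal_J)

lemma J_rel: "r \<in> R \<Longrightarrow> r \<in> J"
  using free.genideal_self[of R] rels unfolding J_def relation_ideal_def by auto

lemma J_sub: "J \<subseteq> fpoly S"
  using a_subset by simp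

lemma J_zero: "0 \<in> J"
  using additive_subgroup.zero_closed[OF is_additive_subgroup] by simp

lemma J_add: "x \<in> J \<Longrightarrow> y \<in> J \<Longrightarrow> x + y \<in> J"
  using additive_subgroup.a_closed[OF is_additive_subgroup] by simp

lemma J_lmult: "x \<in> J \<Longrightarrow> p \<in> fpoly S \<Longrightarrow> p * x \<in> J"
  using I_l_closed[of x p] by simp

lemma J_rmult: "x \<in> J \<Longrightarrow> p \<in> fpoly S \<Longrightarrow> x * p \<in> J"
  using I_r_closed[of x p] by simp

lemma J_uminus: "x \<in> J \<Longrightarrow> - x \<in> J"
  using J_lmult[OF _ fpoly_scal[of "-1"]] by (simp only: scal_uminus scal_one mult_minus1)

lemma J_diff: "x \<in> J \<Longrightarrow> y \<in> J \<Longrightarrow> x - y \<in> J"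
  using J_add[of x "- y"] J_uminus[of y] by simp

lemma J_minimal:
  assumes "R \<subseteq> K" "K \<subseteq> fpoly S" "0 \<in> K" "\<And>x y. x \<in> K \<Longrightarrow> y \<in> K \<Longrightarrow> x + y \<in> K"
    and "\<And>x p. x \<in> K \<Longrightarrow> p \<in> fpoly S \<Longrightarrow> p * x \<in> K" "\<And>x p. x \<in> K \<Longrightarrow> p \<in> fpoly S \<Longrightarrow> x * p \<in> K"
  shows "J \<subseteq> K"
proof -
  have neg: "- x \<in> K" if "x \<in> K" for x
    using assms(5)[OF that fpoly_scal[of "-1"]] by (simp only: scal_uminus scal_one mult_minus1)
  have inv: "\<ominus>\<^bsub>free_algebra S\<^esub> x = - x" if "x \<in> fpoly S" for x
    by (rule free.minus_equality) (use that fpoly_uminus[OF that] in auto)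
  have "ideal K (free_algebra S)"
  proof (rule idealI[OF ring_free_algebra])
    show "subgroup K (add_monoid (free_algebra S))"
      by (rule free.add.subgroupI)
        (use assms neg inv in \<open>auto simp flip: a_inv_def\<close>)
  qed (use assms in auto)
  then show ?thesis
    unfolding J_def relation_ideal_def using assms(1) by (rule free.genideal_minimal)
qed

abbreviation cls where "cls \<equiv> presented_class S R"

abbreviation alg where "alg \<equiv> presented_algebra S R"

lemma cls_eq_coset: "cls p = J +>\<^bsub>free_algebra S\<^esub> p"
  by (simp add: presented_class_def J_def)

lemma cls_eq_image: "cls p = (\<lambda>x. x + p) ` J"
  unfolding cls_eq_coset a_r_coset_def r_coset_def by auto

lemma cls_eq_iff: "cls p = cls p' \<longleftrightarrow> p - p' \<in> J"
proof
  assume "cls p = cls p'"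
  then have "p \<in> cls p'"
    using J_zero unfolding cls_eq_image by force
  then show "p - p' \<in> J" unfolding cls_eq_image by auto
next
  assume *: "p - p' \<in> J"
  show "cls p = cls p'"
    unfolding cls_eq_image
  proof safe
    fix x assume "x \<in> J"
    then show "x + p \<in> (\<lambda>x. x + p') ` J"
      using J_add[OF _ *] by (intro image_eqI[of _ _ "x + (p - p')"]) auto
  next
    fix x assume "x \<in> J"
    then show "x + p' \<in> (\<lambda>x. x + p) ` J"
      using J_diff[OF _ *] by (intro image_eqI[of _ _ "x - (p - p')"]) auto
  qed
qed

lemma cls_self: "p \<in> cls p"
  using J_zero unfolding cls_eq_image by force

lemma carrier_alg: "carrier alg = cls ` fpoly S"
  unfolding presented_algebra_def
  by (auto simp: ring.defs module.defs FactRing_def A_RCOSETS_def' cls_eq_coset J_def[symmetric])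

lemma alg_mult: "p \<in> fpoly S \<Longrightarrow> p' \<in> fpoly S \<Longrightarrow> cls p \<otimes>\<^bsub>alg\<^esub> cls p' = cls (p * p')"
  using rcoset_mult_add[of p p'] unfolding presented_algebra_def
  by (simp add: ring.defs module.defs FactRing_def cls_eq_coset J_def[symmetric])

lemma alg_add: "p \<in> fpoly S \<Longrightarrow> p' \<in> fpoly S \<Longrightarrow> cls p \<oplus>\<^bsub>alg\<^esub> cls p' = cls (p + p')"
  using a_rcos_sum[of p p'] unfolding presented_algebra_def
  by (simp add: ring.defs module.defs FactRing_def cls_eq_coset J_def[symmetric])

lemma alg_one: "\<one>\<^bsub>alg\<^esub> = cls 1"
  unfolding presented_algebra_def
  by (simp add: ring.defs module.defs FactRing_def cls_eq_coset J_def[symmetric])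

lemma alg_zero: "\<zero>\<^bsub>alg\<^esub> = cls 0"
  unfolding presented_algebra_def
  by (simp add: ring.defs module.defs FactRing_def cls_eq_image J_def[symmetric])

text \<open>Two representatives differ by an element of \<open>J\<close>, and \<open>J\<close> is
  closed under multiplication by \<open>scal c\<close>; hence all sets in the union that defines
  scalar multiplication coincide.\<close>

lemma alg_smult: "c \<odot>\<^bsub>alg\<^esub> cls p = cls (scal c * p)"
proof -
  have "cls (scal c * x) = cls (scal c * p)" if "x \<in> cls p" for x
  proof -
    from that have "x \<in> (\<lambda>x. x + p) ` J" by (simp only: cls_eq_image)
    then obtain j where "j \<in> J" "x = j + p" by blast
    then show ?thesis using J_lmult[of j "scal c"] by (simp add: cls_eq_iff distrib_left)
  qed
  then have "(\<Union>x\<in>cls p. cls (scal c * x)) = cls (scal c * p)"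
    using cls_self[of p] by blast
  then show ?thesis
    unfolding presented_algebra_def by (simp add: ring.defs module.defs)
qed

lemma ring_alg: "ring alg"
proof -
  have q: "ring (free_algebra S Quot J)" by (rule quotient_is_ring)
  interpret q: ring "free_algebra S Quot J" by (rule q)
  have e: "carrier alg = carrier (free_algebra S Quot J)" "x \<otimes>\<^bsub>alg\<^esub> y = x \<otimes>\<^bsub>free_algebra S Quot J\<^esub> y"
    "x \<oplus>\<^bsub>alg\<^esub> y = x \<oplus>\<^bsub>free_algebra S Quot J\<^esub> y" "\<one>\<^bsub>alg\<^esub> = \<one>\<^bsub>free_algebra S Quot J\<^esub>"
    "\<zero>\<^bsub>alg\<^esub> = \<zero>\<^bsub>free_algebra S Quot J\<^esub>" for x y
    unfolding presented_algebra_def by (simp_all add: ring.defs module.defs J_def)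
  show ?thesis
  proof (rule ringI)
    show "abelian_group alg"
    proof (rule abelian_groupI)
      show "\<exists>y\<in>carrier alg. y \<oplus>\<^bsub>alg\<^esub> x = \<zero>\<^bsub>alg\<^esub>" if "x \<in> carrier alg" for x
        using that unfolding e
        by (intro bexI[of _ "\<ominus>\<^bsub>free_algebra S Quot J\<^esub> x"]) (auto simp: q.l_neg)
    qed (auto simp: e q.a_ac)
    show "Group.monoid alg"
      by (rule Group.monoidI) (auto simp: e q.m_assoc)
  qed (auto simp: e q.l_distr q.r_distr)
qed

lemma alg_finsum:
  assumes "finite I" "\<And>i. i \<in> I \<Longrightarrow> f i \<in> fpoly S"
  shows "(\<Oplus>\<^bsub>alg\<^esub>i\<in>I. cls (f i)) = cls (\<Sum>i\<in>I. f i)"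
proof -
  interpret A: ring alg by (rule ring_alg)
  show ?thesis using assms
  proof (induction rule: finite_induct)
    case empty
    show ?case by (simp add: alg_zero)
  next
    case (insert x F)
    have "(\<Oplus>\<^bsub>alg\<^esub>i\<in>insert x F. cls (f i)) = cls (f x) \<oplus>\<^bsub>alg\<^esub> (\<Oplus>\<^bsub>alg\<^esub>i\<in>F. cls (f i))"
      by (rule A.finsum_insert) (use insert in \<open>auto simp: carrier_alg\<close>)
    also have "\<dots> = cls (f x) \<oplus>\<^bsub>alg\<^esub> cls (\<Sum>i\<in>F. f i)"
      using insert by simp
    also have "\<dots> = cls (\<Sum>i\<in>insert x F. f i)"
      using insert by (subst alg_add) auto
    finally show ?case .
  qed
qed

end

text \<open>The kernel of an evaluation is a two-sided ideal, so it is enough to check the defining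
  relations. This serves the representation on operators as well as the counit.\<close>

lemma (in scalar_hom) ideal_in_kernel:
  assumes "presented S R" "\<And>r. r \<in> R \<Longrightarrow> ev v r = 0"
  shows "presented.J S R \<subseteq> {p \<in> fpoly S. ev v p = 0}"
proof -
  interpret presented S R by fact
  show ?thesis
    by (rule J_minimal) (use rels assms in \<open>auto simp: ev_simps\<close>)
qed

section \<open>A faithful representation on a quantum torus\<close>

lemma sum_upd:
  fixes a :: "nat \<Rightarrow> 'b::ab_group_add"
  assumes "finite S"
  shows "sum (a(k := v)) S = sum a S + (if k \<in> S then v - a k else 0)"
proof -
  have "sum (a(k := v)) S = (\<Sum>j\<in>S. a j + (if j = k then v - a k else 0))"
    by (rule sum.cong) auto
  then show ?thesis using assms by (simp add: sum.distrib)
qed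

text \<open>The two terms of \<open>Lfac\<close> make the operators of \<open>z\<^sub>1w\<^sub>1 + \<dots> + z\<^sub>kw\<^sub>k\<close> telescope to \<open>Qop n q k\<close>.\<close>

definition Lfac :: "nat \<Rightarrow> complex \<Rightarrow> nat \<Rightarrow> (nat \<Rightarrow> int) \<Rightarrow> (nat \<Rightarrow> complex) \<Rightarrow> complex" where
  "Lfac n q k a l = l k * q powi (- 2 * sum a {k<..n})
     - (if k = 1 then 0 else l (k - 1)) * q powi (2 - 2 * sum a {k..n})"

text \<open>The twist by the sum of the exponents below \<open>k\<close> produces z_i z_j = q z_j
  z_i for i < j. \<open>wop\<close> carries the inverse twist, so that the twists cancel in z_k w_k
  and w_k z_k, which act by multiplication.\<close>

lift_definition zop :: "complex \<Rightarrow> nat \<Rightarrow> lop" is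
  "\<lambda>q k f (a, l). q powi (sum a {1..<k}) * f (a(k := a k + 1), l)"
  by (intro conjI allI ext) (simp_all add: case_prod_unfold distrib_left mult.left_commute)

lift_definition wop :: "nat \<Rightarrow> complex \<Rightarrow> nat \<Rightarrow> lop" is
  "\<lambda>n q k f (a, l). q powi (- sum a {1..<k}) * Lfac n q k a l * f (a(k := a k - 1), l)"
  by (intro conjI allI ext) (simp_all add: case_prod_unfold distrib_left mult.left_commute)

lemma app_zop: "app (zop q k) f (a, l) = q powi (sum a {1..<k}) * f (a(k := a k + 1), l)"
  by transfer simp

lemma app_wop:
  "app (wop n q k) f (a, l) = q powi (- sum a {1..<k}) * Lfac n q k a l * f (a(k := a k - 1), l)"
  by transfer simp

lift_definition Qop :: "nat \<Rightarrow> complex \<Rightarrow> nat \<Rightarrow> lop" is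
  "\<lambda>n q k f (a, l). (if k = 0 then 0 else l k * q powi (- 2 * sum a {k<..n})) * f (a, l)"
  by (intro conjI allI ext) (simp_all add: case_prod_unfold distrib_left mult.left_commute)

lemma app_Qop: "app (Qop n q k) f (a, l)
    = (if k = 0 then 0 else l k * q powi (- 2 * sum a {k<..n})) * f (a, l)"
  by transfer simp

locale zw_setup =
  fixes n :: nat and q :: complex
  assumes q0: "q \<noteq> 0" and qroot: "\<And>k. k > 0 \<Longrightarrow> q ^ k \<noteq> 1"
begin

lemma powi_add: "q powi (x + y) = q powi x * q powi y"
  using q0 by (simp add: power_int_add)

text \<open>Both exponents in \<open>Lfac\<close> are sums over indices from \<open>k\<close>
  upwards. A shift at i < k is not seen, and a shift at i > k rescales both terms equally; this
  gives the commutation rules for different indices.\<close>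

lemma Lfac_upd:
  assumes "i \<noteq> k" "1 \<le> k" "k \<le> n" "1 \<le> i" "i \<le> n"
  shows "Lfac n q k (a(i := a i + c)) l = (if k < i then q powi (- 2 * c) else 1) * Lfac n q k a l"
proof -
  have e: "q powi (- 2 * (A + c)) = q powi (- 2 * c) * q powi (- 2 * A)"
    "q powi (2 - 2 * (A + c)) = q powi (- 2 * c) * q powi (2 - 2 * A)" for A
    unfolding powi_add[symmetric] by (rule arg_cong[of _ _ "\<lambda>x. q powi x"], simp)+
  show ?thesis
  proof (cases "k < i")
    case True
    then have "sum (a(i := a i + c)) {k<..n} = sum a {k<..n} + c"
      "sum (a(i := a i + c)) {k..n} = sum a {k..n} + c"
      unfolding sum_upd[OF finite_greaterThanAtMost] sum_upd[OF finite_atLeastAtMost]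
      using assms by simp_all
    then show ?thesis
      unfolding Lfac_def using True by (simp only: e if_True right_diff_distrib mult.left_commute)
  next
    case False
    then have "sum (a(i := a i + c)) {k<..n} = sum a {k<..n}"
      "sum (a(i := a i + c)) {k..n} = sum a {k..n}"
      unfolding sum_upd[OF finite_greaterThanAtMost] sum_upd[OF finite_atLeastAtMost]
      using assms by simp_all
    then show ?thesis unfolding Lfac_def using False by (simp only: if_False mult_1)
  qed
qed

abbreviation z where "z \<equiv> zop q"

abbreviation w where "w \<equiv> wop n q"

lemma z_z: assumes "1 \<le> i" "i < j" "j \<le> n" shows "z i * z j = scale q (z j * z i)"
proof (rule lop_eqI)
  fix f and x :: idx
  obtain a l where x: "x = (a, l)" by (cases x)
  have tw: "a(i := u, j := v) = a(j := v, i := u)" for u v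
    using assms by (intro fun_upd_twist) auto
  show "app (z i * z j) f x = app (scale q (z j * z i)) f x"
    unfolding x app_lop_simps app_scale app_zop sum_upd[OF finite_atLeastLessThan]
    using assms by (auto simp: powi_add tw)
qed

lemma w_w: assumes "1 \<le> i" "i < j" "j \<le> n" shows "w i * w j = scale (inverse q) (w j * w i)"
proof (rule lop_eqI)
  fix f and x :: idx
  obtain a l where x: "x = (a, l)" by (cases x)
  have tw: "a(i := u, j := v) = a(j := v, i := u)" for u v
    using assms by (intro fun_upd_twist) auto
  have "Lfac n q j (a(i := a i - 1)) l = Lfac n q j a l"
    "Lfac n q i (a(j := a j - 1)) l = q^2 * Lfac n q i a l"
    using Lfac_upd[of i j a "-1" l] Lfac_upd[of j i a "-1" l] assms by auto
  moreover have "sum (a(i := a i - 1)) {1..<j} = sum a {1..<j} - 1"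
    "sum (a(j := a j - 1)) {1..<i} = sum a {1..<i}"
    unfolding sum_upd[OF finite_atLeastLessThan] using assms by simp_all
  moreover have "q powi (- (A - 1)) = q * q powi (- A)" for A
    using powi_add[of 1 "- A"] by simp
  moreover have "(a(i := a i - 1)) j = a j" "(a(j := a j - 1)) i = a i"
    using assms by simp_all
  ultimately show "app (w i * w j) f x = app (scale (inverse q) (w j * w i)) f x"
    unfolding x app_lop_simps app_scale app_wop tw using q0 by (simp add: power2_eq_square)
qed

lemma w_z: assumes "i \<noteq> j" "i \<in> {1..n}" "j \<in> {1..n}" shows "w j * z i = scale q (z i * w j)"
proof (rule lop_eqI)
  fix f and x :: idx
  obtain a l where x: "x = (a, l)" by (cases x)
  have tw: "a(i := u, j := v) = a(j := v, i := u)" for u v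
    using assms by (intro fun_upd_twist) auto
  have "Lfac n q j (a(i := a i + 1)) l = (if j < i then q powi (-2) else 1) * Lfac n q j a l"
    using Lfac_upd[of i j a "1" l] assms by auto
  moreover have "sum (a(i := a i + 1)) {1..<j} = sum a {1..<j} + (if i < j then 1 else 0)"
    "sum (a(j := a j - 1)) {1..<i} = sum a {1..<i} - (if j < i then 1 else 0)"
    unfolding sum_upd[OF finite_atLeastLessThan] using assms by simp_all
  moreover have "q powi (- (A + 1)) = inverse q * q powi (- A)" "q powi (A - 1) = inverse q * q powi A" for A
    using powi_add[of "- A" "-1"] powi_add[of A "-1"] by (simp_all add: power_int_minus mult.commute)
  moreover have "(a(i := a i + 1)) j = a j" "(a(j := a j - 1)) i = a i"
    using assms by simp_all
  moreover have "q powi (-2) = inverse q * inverse q"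
    using powi_add[of "-1" "-1"] by (simp add: power_int_minus)
  ultimately show "app (w j * z i) f x = app (scale q (z i * w j)) f x"
    unfolding x app_lop_simps app_scale app_wop app_zop tw using q0 assms
    by (cases "i < j") simp_all
qed

lemma z_w_same: assumes "k \<in> {1..n}" shows "z k * w k = Qop n q k - Qop n q (k - 1)"
proof (rule lop_eqI)
  fix f and x :: idx
  obtain a l where x: "x = (a, l)" by (cases x)
  have e: "{k - 1<..n} = {k..n}" using assms by auto
  define A B C where "A = sum a {1..<k}" "B = q powi (- 2 * sum a {k<..n})"
    "C = q powi (- 2 * sum a {k..n})"
  have "sum (a(k := a k + 1)) {k<..n} = sum a {k<..n}"
    "2 - 2 * sum (a(k := a k + 1)) {k..n} = - 2 * sum a {k..n}"
    unfolding sum_upd[OF finite_greaterThanAtMost] sum_upd[OF finite_atLeastAtMost]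
    using assms by simp_all
  then have L: "Lfac n q k (a(k := a k + 1)) l = l k * B - (if k = 1 then 0 else l (k - 1)) * C"
    by (simp only: Lfac_def A_B_C_def)
  have s: "sum (a(k := a k + 1)) {1..<k} = A"
    unfolding sum_upd[OF finite_atLeastLessThan] A_B_C_def by simp
  have c: "q powi A * (q powi (- A) * X * Y) = X * Y" for X Y
    using q0 by (simp add: power_int_minus)
  have u: "a(k := a k + 1, k := (a(k := a k + 1)) k - 1) = a" by simp
  show "app (z k * w k) f x = app (Qop n q k - Qop n q (k - 1)) f x"
    unfolding x app_lop_simps app_scale app_wop app_zop app_Qop s u L e A_B_C_def(1)[symmetric] c
      A_B_C_def(2,3)[symmetric]
    using assms by (cases "k = 1") (simp_all only: left_diff_distrib, simp_all)
qed

lemma w_z_same: assumes "k \<in> {1..n}" shows "w k * z k = Qop n q k - scale (q\<^sup>2) (Qop n q (k - 1))"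
proof (rule lop_eqI)
  fix f and x :: idx
  obtain a l where x: "x = (a, l)" by (cases x)
  have e: "{k - 1<..n} = {k..n}" using assms by auto
  define A B C where "A = sum a {1..<k}" "B = q powi (- 2 * sum a {k<..n})"
    "C = q powi (- 2 * sum a {k..n})"
  have "q powi (2 - 2 * sum a {k..n}) = q\<^sup>2 * C"
  proof -
    have "2 - 2 * sum a {k..n} = 2 + (- 2 * sum a {k..n})" by simp
    then show ?thesis by (simp only: powi_add A_B_C_def power_int_numeral)
  qed
  then have L: "Lfac n q k a l = l k * B - (if k = 1 then 0 else l (k - 1)) * (q\<^sup>2 * C)"
    by (simp only: Lfac_def A_B_C_def)
  have s: "sum (a(k := a k - 1)) {1..<k} = A"
    unfolding sum_upd[OF finite_atLeastLessThan] A_B_C_def by simp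
  have c: "q powi (- A) * X * (q powi A * Y) = X * Y" for X Y
    using q0 by (simp add: power_int_minus)
  have u: "a(k := a k - 1, k := (a(k := a k - 1)) k + 1) = a" by simp
  show "app (w k * z k) f x = app (Qop n q k - scale (q\<^sup>2) (Qop n q (k - 1))) f x"
    unfolding x app_lop_simps app_scale app_wop app_zop app_Qop s u L e A_B_C_def(1)[symmetric] c
      A_B_C_def(2,3)[symmetric]
    using assms by (cases "k = 1") (simp_all only: left_diff_distrib, simp_all)
qed

definition Qu where "Qu k = (\<Sum>i\<in>{1..k}. z i * w i)"

lemma Qu_eq: "k \<le> n \<Longrightarrow> Qu k = Qop n q k"
proof (induction k)
  case 0
  show ?case by (rule lop_eqI) (auto simp: Qu_def app_lop_simps app_Qop split: prod.splits)
next
  case (Suc k)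
  then show ?case using z_w_same[of "Suc k"] by (simp add: Qu_def)
qed

text \<open>The difference of \<open>w_z_same\<close> and \<open>z_w_same\<close>: the two products
  of index \<open>k\<close> involve the operator of the preceding partial sum with the coefficients
  \<open>q\<^sup>2\<close> and 1.\<close>

lemma w_z_k: "k \<in> {1..n} \<Longrightarrow> w k * z k = z k * w k + scale (1 - q\<^sup>2) (Qu (k - 1))"
proof -
  assume k: "k \<in> {1..n}"
  then have "k - 1 \<le> n" by auto
  then show ?thesis using k by (simp add: z_w_same w_z_same Qu_eq lop.scale_left_diff_distrib)
qed

text \<open>
  The parameters are specialised to the powers \<open>t ^ M ^ k\<close>, so that monomials with the same shift in \<open>a\<close> are
  told apart by the degree in \<open>t\<close> of their multipliers.
\<close>

definition shiftdeg :: "nat \<Rightarrow> lop \<Rightarrow> (nat \<Rightarrow> int) \<Rightarrow> nat \<Rightarrow> bool" where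
  "shiftdeg M T d D \<longleftrightarrow> (\<forall>a. \<exists>P. P \<noteq> 0 \<and> degree P = D \<and>
     (\<forall>f t. app T f (a, \<lambda>k. t ^ M ^ k) = poly P t * f (\<lambda>i. a i + d i, \<lambda>k. t ^ M ^ k)))"

lemma shiftdeg_mult:
  assumes "shiftdeg M T d D" "shiftdeg M T' d' D'"
  shows "shiftdeg M (T * T') (\<lambda>i. d i + d' i) (D + D')"
  unfolding shiftdeg_def
proof
  fix a :: "nat \<Rightarrow> int"
  obtain P where P: "P \<noteq> 0" "degree P = D"
    "\<And>f t. app T f (a, \<lambda>k. t ^ M ^ k) = poly P t * f (\<lambda>i. a i + d i, \<lambda>k. t ^ M ^ k)"
    using assms(1) unfolding shiftdeg_def by blast
  obtain P' where P': "P' \<noteq> 0" "degree P' = D'"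
    "\<And>f t. app T' f (\<lambda>i. a i + d i, \<lambda>k. t ^ M ^ k)
      = poly P' t * f (\<lambda>i. a i + d i + d' i, \<lambda>k. t ^ M ^ k)"
    using assms(2) unfolding shiftdeg_def by blast
  show "\<exists>P. P \<noteq> 0 \<and> degree P = D + D' \<and> (\<forall>f t. app (T * T') f (a, \<lambda>k. t ^ M ^ k)
      = poly P t * f (\<lambda>i. a i + (d i + d' i), \<lambda>k. t ^ M ^ k))"
    by (rule exI[of _ "P * P'"])
      (use P(1,2) P'(1,2) in \<open>auto simp: degree_mult_eq app_lop_simps P(3) P'(3) add.assoc\<close>)
qed

lemma shiftdeg_one: "shiftdeg M 1 (\<lambda>i. 0) 0"
  unfolding shiftdeg_def by (intro allI exI[of _ 1]) (simp add: app_lop_simps)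

lemma shiftdeg_power: "shiftdeg M T d D \<Longrightarrow> shiftdeg M (T ^ k) (\<lambda>i. int k * d i) (k * D)"
proof (induction k)
  case 0
  show ?case using shiftdeg_one by simp
next
  case (Suc k)
  show ?case using shiftdeg_mult[OF Suc.prems Suc.IH[OF Suc.prems]] by (simp add: algebra_simps)
qed

lemma shiftdeg_prod_list:
  assumes "\<And>j. j \<in> set js \<Longrightarrow> shiftdeg M (T j) (d j) (D j)"
  shows "shiftdeg M (prod_list (map T js)) (\<lambda>i. \<Sum>j\<leftarrow>js. d j i) (\<Sum>j\<leftarrow>js. D j)"
  using assms
proof (induction js)
  case Nil
  show ?case using shiftdeg_one by simp
next
  case (Cons j js)
  show ?case using shiftdeg_mult[OF Cons.prems[of j] Cons.IH] Cons.prems by simp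
qed

lemma shiftdeg_z: "shiftdeg M (z k) (\<lambda>i. if i = k then 1 else 0) 0"
  unfolding shiftdeg_def
proof
  fix a :: "nat \<Rightarrow> int"
  have "(\<lambda>i. a i + (if i = k then 1 else 0)) = a(k := a k + 1)" by auto
  then show "\<exists>P. P \<noteq> 0 \<and> degree P = 0 \<and> (\<forall>f t. app (z k) f (a, \<lambda>k. t ^ M ^ k)
      = poly P t * f (\<lambda>i. a i + (if i = k then 1 else 0), \<lambda>k. t ^ M ^ k))"
    using q0 by (intro exI[of _ "[: q powi (sum a {1..<k}) :]"]) (auto simp: app_zop)
qed

text \<open>\<open>Lfac\<close> becomes a binomial in t with exponents M^k and M^(k-1). Since M is
  at least 2, the first dominates, and its coefficient is a product of powers of \<open>q\<close>.
  For k = 1 the second term is absent.\<close>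

lemma shiftdeg_w:
  assumes "M \<ge> 2" "k \<in> {1..n}"
  shows "shiftdeg M (w k) (\<lambda>i. if i = k then -1 else 0) (M ^ k)"
  unfolding shiftdeg_def
proof
  fix a :: "nat \<Rightarrow> int"
  define \<alpha> \<beta> where "\<alpha> = q powi (- sum a {1..<k}) * q powi (- 2 * sum a {k<..n})"
    and "\<beta> = q powi (- sum a {1..<k}) * (if k = 1 then 0 else q powi (2 - 2 * sum a {k..n}))"
  define P where "P = monom \<alpha> (M ^ k) - monom \<beta> (M ^ (k - 1))"
  have "\<alpha> \<noteq> 0" using q0 by (simp add: \<alpha>_def)
  moreover have lt: "M ^ (k - 1) < M ^ k"
    using assms by (intro power_strict_increasing) auto
  ultimately have c: "coeff P (M ^ k) \<noteq> 0" by (simp add: P_def)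
  have "degree P = M ^ k"
  proof (rule antisym)
    have "degree (monom \<alpha> (M ^ k)) \<le> M ^ k" "degree (monom \<beta> (M ^ (k - 1))) \<le> M ^ k"
      using lt degree_monom_le[of \<beta> "M ^ (k - 1)"] degree_monom_le[of \<alpha> "M ^ k"] by linarith+
    then show "degree P \<le> M ^ k" unfolding P_def by (rule degree_diff_le)
    show "M ^ k \<le> degree P" using c by (rule le_degree)
  qed
  moreover have "P \<noteq> 0" using c by auto
  moreover have u: "(\<lambda>i. a i + (if i = k then -1 else 0)) = a(k := a k - 1)" by auto
  have v: "q powi (- sum a {1..<k}) * Lfac n q k a (\<lambda>k. t ^ M ^ k) = poly P t" for t
  proof -
    have "c * (x * B - (if k = 1 then 0 else y) * C) = c * B * x - c * (if k = 1 then 0 else C) * y"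
      for c x y B C :: complex
      by (cases "k = 1") (simp_all add: algebra_simps)
    then show ?thesis unfolding Lfac_def P_def poly_diff poly_monom \<alpha>_def \<beta>_def .
  qed
  have "app (w k) f (a, \<lambda>k. t ^ M ^ k)
      = poly P t * f (\<lambda>i. a i + (if i = k then -1 else 0), \<lambda>k. t ^ M ^ k)" for f t
    unfolding app_wop u v ..
  ultimately show "\<exists>P. P \<noteq> 0 \<and> degree P = M ^ k \<and> (\<forall>f t. app (w k) f (a, \<lambda>k. t ^ M ^ k)
      = poly P t * f (\<lambda>i. a i + (if i = k then -1 else 0), \<lambda>k. t ^ M ^ k))"
    by (intro exI[of _ P] conjI allI)
qed

text \<open>Testing on the indicator function of one shift \<open>d i\<close>, at a = 0, keeps only
  the operators with that shift. They turn into polynomials in t of pairwise different degrees, and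
  the one of largest degree with nonzero coefficient cannot cancel.\<close>

lemma shiftdeg_independent:
  assumes fin: "finite I" and sd: "\<And>i. i \<in> I \<Longrightarrow> shiftdeg M (T i) (d i) (D i)"
    and inj: "inj_on (\<lambda>i. (d i, D i)) I"
    and zero: "(\<Sum>i\<in>I. scale (c i) (T i)) = 0" and "i \<in> I"
  shows "c i = 0"
proof (rule ccontr)
  assume "c i \<noteq> 0"
  define I0 where "I0 = {j \<in> I. c j \<noteq> 0 \<and> d j = d i}"
  have I0: "finite I0" "i \<in> I0" using fin \<open>i \<in> I\<close> \<open>c i \<noteq> 0\<close> by (auto simp: I0_def)
  have "Max (D ` I0) \<in> D ` I0"
    using I0 by (intro Max_in) auto
  then obtain m where m: "m \<in> I0" "D m = Max (D ` I0)"
    by auto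
  have max: "D j \<le> D m" if "j \<in> I0" for j
    unfolding m(2) using I0 that by (intro Max_ge) auto
  have "\<exists>P. P \<noteq> 0 \<and> degree P = D j \<and> (\<forall>f t. app (T j) f (\<lambda>_. 0, \<lambda>k. t ^ M ^ k)
      = poly P t * f (d j, \<lambda>k. t ^ M ^ k))" if "j \<in> I" for j
    using sd[OF that, unfolded shiftdeg_def, THEN spec[of _ "\<lambda>_. 0"]] by simp
  then obtain P where P: "\<And>j. j \<in> I \<Longrightarrow> P j \<noteq> 0 \<and> degree (P j) = D j \<and>
      (\<forall>f t. app (T j) f (\<lambda>_. 0, \<lambda>k. t ^ M ^ k) = poly (P j) t * f (d j, \<lambda>k. t ^ M ^ k))"
    by metis
  let ?f = "\<lambda>(a, l :: nat \<Rightarrow> complex). if a = d i then 1 else 0 :: complex"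
  have "poly (\<Sum>j\<in>I0. smult (c j) (P j)) t = 0" for t
  proof -
    have "0 = app (\<Sum>j\<in>I. scale (c j) (T j)) ?f (\<lambda>_. 0, \<lambda>k. t ^ M ^ k)"
      by (simp add: zero app_lop_simps)
    also have "\<dots> = (\<Sum>j\<in>I. c j * (poly (P j) t * (if d j = d i then 1 else 0)))"
      unfolding app_sum app_scale by (rule sum.cong) (use P in auto)
    also have "\<dots> = (\<Sum>j\<in>I0. c j * poly (P j) t)"
      by (rule sum.mono_neutral_cong_right) (use fin in \<open>auto simp: I0_def\<close>)
    finally show ?thesis by (simp add: poly_sum)
  qed
  then have "(\<Sum>j\<in>I0. smult (c j) (P j)) = 0"
    using poly_all_0_iff_0 by blast
  then have "0 = coeff (\<Sum>j\<in>I0. smult (c j) (P j)) (D m)" by simp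
  also have "\<dots> = (\<Sum>j\<in>I0. c j * coeff (P j) (D m))" by (simp add: coeff_sum)
  also have "\<dots> = (\<Sum>j\<in>I0. if j = m then c m * coeff (P m) (D m) else 0)"
  proof (rule sum.cong)
    fix j assume j: "j \<in> I0"
    show "c j * coeff (P j) (D m) = (if j = m then c m * coeff (P m) (D m) else 0)"
    proof (cases "j = m")
      case False
      then have "D j \<noteq> D m" using inj j m(1) unfolding inj_on_def I0_def by auto
      then have "D j < D m" using max[OF j] by simp
      then have "coeff (P j) (D m) = 0" using P[of j] j by (auto simp: I0_def intro: coeff_eq_0)
      then show ?thesis using False by simp
    qed simp
  qed simp
  also have "\<dots> = c m * coeff (P m) (D m)" using I0 m by simp
  finally have "coeff (P m) (degree (P m)) = 0" using P[of m] m(1) by (auto simp: I0_def)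
  then show False using P[of m] m(1) by (auto simp: I0_def leading_coeff_0_iff)
qed

end

lemma base_bound:
  fixes s :: "nat \<Rightarrow> nat"
  assumes "\<And>k. s k < M"
  shows "(\<Sum>k\<in>{1..n}. s k * M ^ k) < M ^ Suc n"
proof (induction n)
  case 0
  show ?case using assms[of 0] by simp
next
  case (Suc n)
  have "s (Suc n) * M ^ Suc n + M ^ Suc n = (s (Suc n) + 1) * M ^ Suc n" by (simp add: algebra_simps)
  also have "\<dots> \<le> M * M ^ Suc n" by (rule mult_right_mono) (use assms[of "Suc n"] in auto)
  finally show ?case using Suc by simp
qed

text \<open>Uniqueness of digits in base \<open>M\<close>: the lower digits sum to less than the
  highest power, so division by it isolates the last digit. This is how the degree of the multiplier
  recovers the exponents of the w_k.\<close>

lemma base_unique: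
  fixes s s' :: "nat \<Rightarrow> nat"
  assumes "\<And>k. s k < M" "\<And>k. s' k < M"
    and "(\<Sum>k\<in>{1..n}. s k * M ^ k) = (\<Sum>k\<in>{1..n}. s' k * M ^ k)"
  shows "\<forall>k\<in>{1..n}. s k = s' k"
  using assms(3)
proof (induction n)
  case (Suc n)
  let ?A = "\<Sum>k\<in>{1..n}. s k * M ^ k" and ?B = "\<Sum>k\<in>{1..n}. s' k * M ^ k"
  have e: "?A + s (Suc n) * M ^ Suc n = ?B + s' (Suc n) * M ^ Suc n"
    using Suc.prems by simp
  have "M \<noteq> 0" using assms(1)[of 0] by simp
  then have "(?A + s (Suc n) * M ^ Suc n) div M ^ Suc n = s (Suc n)"
    "(?B + s' (Suc n) * M ^ Suc n) div M ^ Suc n = s' (Suc n)"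
    using base_bound[of s M n] base_bound[of s' M n] assms by simp_all
  then have "s (Suc n) = s' (Suc n)" using e by metis
  with Suc.IH e show ?case by (auto simp: le_Suc_eq)
qed simp

section \<open>Spanning sets of ordered monomials\<close>

lemma scal_commute: "scal c * p = p * scal c"
  by (induction p rule: ncpoly_induct) (simp_all add: single_mult_append mult.commute distrib_left distrib_right)

lemma scal_left_commute: "p * (scal c * p') = scal c * (p * p')"
  by (metis mult.assoc scal_commute)

lemma scal_scal: "scal a * (scal b * p) = scal (a * b) * p"
  by (simp add: single_mult_append mult.assoc[symmetric])

lemma scal_add: "scal (a + b) * p = scal a * p + scal b * p"
  by (simp add: single_add distrib_right)

lemma prod_list_split:
  fixes f :: "nat \<Rightarrow> 'b::monoid_mult"
  assumes "i \<in> {1..n}"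
  shows "prod_list (map f [1..<Suc n]) = prod_list (map f [1..<i]) * f i * prod_list (map f [Suc i..<Suc n])"
proof -
  have "[1..<Suc n] = [1..<i] @ i # [Suc i..<Suc n]"
    using assms upt_add_eq_append[of 1 i "Suc n - i"] upt_conv_Cons[of i "Suc n"] by auto
  then show ?thesis by (simp add: mult.assoc)
qed

context presented
begin

definition cong :: "'g ncpoly \<Rightarrow> 'g ncpoly \<Rightarrow> bool" where
  "cong p p' \<longleftrightarrow> p - p' \<in> J"

lemma cong_refl [simp]: "cong p p"
  by (simp add: cong_def J_zero)

lemma cong_sym: "cong p p' \<Longrightarrow> cong p' p"
  using J_uminus[of "p - p'"] by (simp add: cong_def)

lemma cong_trans [trans]: "cong p p' \<Longrightarrow> cong p' p'' \<Longrightarrow> cong p p''"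
  using J_add[of "p - p'" "p' - p''"] by (simp add: cong_def)

lemma cong_add: "cong a b \<Longrightarrow> cong c d \<Longrightarrow> cong (a + c) (b + d)"
  using J_add[of "a - b" "c - d"] by (simp add: cong_def algebra_simps)

lemma cong_lmult: "cong a b \<Longrightarrow> c \<in> fpoly S \<Longrightarrow> cong (c * a) (c * b)"
  using J_lmult[of "a - b" c] by (simp add: cong_def algebra_simps)

lemma cong_rmult: "cong a b \<Longrightarrow> c \<in> fpoly S \<Longrightarrow> cong (a * c) (b * c)"
  using J_rmult[of "a - b" c] by (simp add: cong_def algebra_simps)

lemma cong_scal: "cong a b \<Longrightarrow> cong (scal c * a) (scal c * b)"
  by (rule cong_lmult) auto

definition qcom :: "complex \<Rightarrow> 'g ncpoly \<Rightarrow> 'g ncpoly \<Rightarrow> bool" where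
  "qcom c a b \<longleftrightarrow> cong (a * b) (scal c * (b * a))"

lemma qcom_one: "qcom 1 a 1"
  by (simp add: qcom_def scal_one)

lemma qcom_mult:
  assumes "qcom c a b" "qcom d a b'" "b \<in> fpoly S" "b' \<in> fpoly S"
  shows "qcom (c * d) a (b * b')"
proof -
  have "cong (a * (b * b')) (scal c * (b * (a * b')))"
    using cong_rmult[OF assms(1)[unfolded qcom_def] assms(4)] by (simp add: mult.assoc)
  also have "cong \<dots> (scal c * (b * (scal d * (b' * a))))"
    using assms(2,3) unfolding qcom_def by (intro cong_scal cong_lmult)
  finally show ?thesis
    unfolding qcom_def by (simp add: scal_left_commute[of b] scal_scal mult.assoc)
qed

lemma qcom_power: "qcom c a b \<Longrightarrow> b \<in> fpoly S \<Longrightarrow> qcom (c ^ k) a (b ^ k)"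
  by (induction k) (auto intro: qcom_one qcom_mult)

lemma qcom_prod_list:
  assumes "\<And>j. j \<in> set js \<Longrightarrow> qcom (c ^ k j) a (f j)" "\<And>j. j \<in> set js \<Longrightarrow> f j \<in> fpoly S"
  shows "qcom (c ^ (\<Sum>j\<leftarrow>js. k j)) a (prod_list (map f js))"
  using assms
proof (induction js)
  case (Cons j js)
  then show ?case
    by (simp add: power_add) (rule qcom_mult, auto intro!: fpoly_prod_list)
qed (simp add: qcom_one)

lemma qcom_swap: "qcom c a b \<Longrightarrow> c \<noteq> 0 \<Longrightarrow> qcom (inverse c) b a"
  unfolding qcom_def using cong_scal[of "a * b" "scal c * (b * a)" "inverse c"]
  by (simp add: scal_scal scal_one cong_sym)

end

text \<open>Instantiated with (Z, W, q, 1/q) and with (W, Z, 1/q, q), so that both orderings of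
  monomials share one normal form argument.\<close>

locale ord_base = presented S R for S :: "'g set" and R +
  fixes n :: nat and x y :: "nat \<Rightarrow> 'g" and \<gamma> \<delta> :: complex
  assumes S_eq: "S = x ` {1..n} \<union> y ` {1..n}"
    and xy_disjoint: "range x \<inter> range y = {}"
    and nonzero: "\<gamma> \<noteq> 0" "\<delta> \<noteq> 0"
    and x_x: "1 \<le> i \<Longrightarrow> i < j \<Longrightarrow> j \<le> n \<Longrightarrow> qcom \<gamma> (var (x i)) (var (x j))"
    and y_y: "1 \<le> i \<Longrightarrow> i < j \<Longrightarrow> j \<le> n \<Longrightarrow> qcom \<delta> (var (y i)) (var (y j))"
begin

lemma var_x [intro]: "i \<in> {1..n} \<Longrightarrow> var (x i) \<in> fpoly S"
  by (rule fpoly_var) (simp add: S_eq)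

lemma var_y [intro]: "i \<in> {1..n} \<Longrightarrow> var (y i) \<in> fpoly S"
  by (rule fpoly_var) (simp add: S_eq)

definition xm where "xm r = prod_list (map (\<lambda>i. var (x i) ^ r i) [1..<Suc n])"

definition ym where "ym r = prod_list (map (\<lambda>i. var (y i) ^ r i) [1..<Suc n])"

lemma xm_fpoly [intro]: "xm r \<in> fpoly S"
  unfolding xm_def by (rule fpoly_prod_list) (auto intro!: fpoly_power simp del: upt_Suc)

lemma ym_fpoly [intro]: "ym r \<in> fpoly S"
  unfolding ym_def by (rule fpoly_prod_list) (auto intro!: fpoly_power simp del: upt_Suc)

text \<open>A factor entering from the left passes the generators of smaller index, one entering
  from the right those of larger index. Each passage costs \<open>inverse c\<close>.\<close>

lemma ordered_product_mult:
  fixes v :: "nat \<Rightarrow> 'g" and c :: complex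
  assumes vS: "\<And>i. i \<in> {1..n} \<Longrightarrow> var (v i) \<in> fpoly S" and "c \<noteq> 0"
    and v_v: "\<And>i j. 1 \<le> i \<Longrightarrow> i < j \<Longrightarrow> j \<le> n \<Longrightarrow> qcom c (var (v i)) (var (v j))"
    and i: "i \<in> {1..n}"
  defines "vm \<equiv> \<lambda>r. prod_list (map (\<lambda>i. var (v i) ^ r i) [1..<Suc n])"
  shows "cong (var (v i) * vm r) (scal (inverse c ^ sum r {1..<i}) * vm (r(i := Suc (r i))))"
    and "cong (vm r * var (v i)) (scal (inverse c ^ sum r {i<..n}) * vm (r(i := Suc (r i))))"
proof -
  define P where "P = prod_list (map (\<lambda>i. var (v i) ^ r i) [1..<i])"
  define T where "T = prod_list (map (\<lambda>i. var (v i) ^ r i) [Suc i..<Suc n])"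
  let ?v = "var (v i)"
  have vm: "vm r = P * ?v ^ r i * T"
    unfolding vm_def P_def T_def using i by (rule prod_list_split)
  have vm': "vm (r(i := Suc (r i))) = P * ?v ^ Suc (r i) * T"
  proof -
    have m: "map (\<lambda>j. var (v j) ^ (r(i := Suc (r i))) j) [1..<i] = map (\<lambda>i. var (v i) ^ r i) [1..<i]"
      "map (\<lambda>j. var (v j) ^ (r(i := Suc (r i))) j) [Suc i..<Suc n] = map (\<lambda>i. var (v i) ^ r i) [Suc i..<Suc n]"
      by auto
    show ?thesis
      unfolding vm_def P_def T_def prod_list_split[OF i, of "\<lambda>j. var (v j) ^ (r(i := Suc (r i))) j"] m
      by (simp only: fun_upd_same)
  qed
  have PT: "P \<in> fpoly S" "T \<in> fpoly S"
    unfolding P_def T_def using i by (auto intro!: fpoly_prod_list fpoly_power vS simp del: upt_Suc)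
  have "qcom (inverse c ^ (\<Sum>j\<leftarrow>[1..<i]. r j)) ?v P"
    unfolding P_def
    by (rule qcom_prod_list) (use i \<open>c \<noteq> 0\<close> in \<open>auto intro!: qcom_power qcom_swap v_v fpoly_power vS\<close>)
  moreover have "(\<Sum>j\<leftarrow>[1..<i]. r j) = sum r {1..<i}"
    by (simp add: sum_list_distinct_conv_sum_set)
  ultimately have P: "qcom (inverse c ^ sum r {1..<i}) ?v P" by simp
  have "cong (?v * vm r) ((scal (inverse c ^ sum r {1..<i}) * (P * ?v)) * (?v ^ r i * T))"
    using cong_rmult[OF P[unfolded qcom_def], of "?v ^ r i * T"] PT vS[OF i]
    unfolding vm by (auto simp: mult.assoc)
  then show "cong (var (v i) * vm r) (scal (inverse c ^ sum r {1..<i}) * vm (r(i := Suc (r i))))"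
    unfolding vm' by (simp add: mult.assoc)
  have "qcom (c ^ (\<Sum>j\<leftarrow>[Suc i..<Suc n]. r j)) ?v T"
    unfolding T_def
    by (rule qcom_prod_list) (use i in \<open>auto intro!: qcom_power v_v fpoly_power vS simp del: upt_Suc\<close>)
  moreover have "(\<Sum>j\<leftarrow>[Suc i..<Suc n]. r j) = sum r {i<..n}"
    by (simp add: sum_list_distinct_conv_sum_set atLeastSucLessThan_greaterThanLessThan
        atLeastLessThanSuc_atLeastAtMost atLeastSucAtMost_greaterThanAtMost del: upt_Suc)
  ultimately have "qcom (inverse c ^ sum r {i<..n}) T ?v"
    using qcom_swap[of _ ?v T] \<open>c \<noteq> 0\<close> by (simp add: power_inverse)
  then have "cong (vm r * ?v) ((P * ?v ^ r i) * (scal (inverse c ^ sum r {i<..n}) * (?v * T)))"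
    unfolding vm mult.assoc[of _ T] using PT vS[OF i] unfolding qcom_def by (intro cong_lmult) auto
  then show "cong (vm r * var (v i)) (scal (inverse c ^ sum r {i<..n}) * vm (r(i := Suc (r i))))"
    unfolding vm' scal_left_commute[of "P * ?v ^ r i"]
    by (simp only: mult.assoc power_Suc power_commutes[symmetric])
qed

lemma x_xm: "i \<in> {1..n} \<Longrightarrow>
    cong (var (x i) * xm r) (scal (inverse \<gamma> ^ sum r {1..<i}) * xm (r(i := Suc (r i))))"
  unfolding xm_def by (rule ordered_product_mult(1)) (use x_x nonzero in auto)

lemma xm_x: "i \<in> {1..n} \<Longrightarrow>
    cong (xm r * var (x i)) (scal (inverse \<gamma> ^ sum r {i<..n}) * xm (r(i := Suc (r i))))"
  unfolding xm_def by (rule ordered_product_mult(2)) (use x_x nonzero in auto)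

lemma y_ym: "i \<in> {1..n} \<Longrightarrow>
    cong (var (y i) * ym r) (scal (inverse \<delta> ^ sum r {1..<i}) * ym (r(i := Suc (r i))))"
  unfolding ym_def by (rule ordered_product_mult(1)) (use y_y nonzero in auto)

lemma ym_y: "i \<in> {1..n} \<Longrightarrow>
    cong (ym r * var (y i)) (scal (inverse \<delta> ^ sum r {i<..n}) * ym (r(i := Suc (r i))))"
  unfolding ym_def by (rule ordered_product_mult(2)) (use y_y nonzero in auto)

text \<open>The span, modulo \<open>J\<close>, of the ordered words of length two. That each product
  of y_j and x_i lies in it is the only information on mixed relations that reordering of longer
  words uses.\<close>

inductive_set XY where
  XY_mon: "s \<in> {1..n} \<Longrightarrow> t \<in> {1..n} \<Longrightarrow> var (x s) * var (y t) \<in> XY"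
| XY_J: "p \<in> J \<Longrightarrow> p \<in> XY"
| XY_add: "p \<in> XY \<Longrightarrow> p' \<in> XY \<Longrightarrow> p + p' \<in> XY"
| XY_scal: "p \<in> XY \<Longrightarrow> scal c * p \<in> XY"

lemma XY_cong: "p' \<in> XY \<Longrightarrow> cong p p' \<Longrightarrow> p \<in> XY"
  using XY_add[of p' "p - p'"] XY_J[of "p - p'"] by (simp add: cong_def)

lemma XY_sum: "finite I \<Longrightarrow> (\<And>i. i \<in> I \<Longrightarrow> f i \<in> XY) \<Longrightarrow> sum f I \<in> XY"
  by (induction I rule: finite_induct) (auto intro: XY_add XY_J J_zero)

text \<open>The span, modulo \<open>J\<close>, of ordered monomials with exponents in
  \<open>A\<close>. Membership spares explicit coefficients during reordering;
  \<open>V_explicit\<close> recovers them.\<close>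

inductive_set V for A where
  V_mon: "(r, s) \<in> A \<Longrightarrow> xm r * ym s \<in> V A"
| V_J: "p \<in> J \<Longrightarrow> p \<in> V A"
| V_add: "p \<in> V A \<Longrightarrow> p' \<in> V A \<Longrightarrow> p + p' \<in> V A"
| V_scal: "p \<in> V A \<Longrightarrow> scal c * p \<in> V A"

lemma V_cong: "p' \<in> V A \<Longrightarrow> cong p p' \<Longrightarrow> p \<in> V A"
  using V_add[of p' A "p - p'"] V_J[of "p - p'"] by (simp add: cong_def)

lemma V_mono: assumes "A \<subseteq> B" shows "p \<in> V A \<Longrightarrow> p \<in> V B"
  by (induction rule: V.induct) (use assms in \<open>auto intro: V.intros\<close>)

lemma V_fpoly: "p \<in> V A \<Longrightarrow> p \<in> fpoly S"
  by (induction rule: V.induct) (use J_sub in auto)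

lemma V_lmult:
  assumes "a \<in> fpoly S" "\<And>r s. (r, s) \<in> A \<Longrightarrow> a * (xm r * ym s) \<in> V B"
  shows "p \<in> V A \<Longrightarrow> a * p \<in> V B"
proof (induction rule: V.induct)
  case (V_scal p c)
  then show ?case by (simp add: scal_left_commute[of a] V.V_scal)
qed (use assms in \<open>auto simp: distrib_left intro: V.intros J_lmult\<close>)

definition supp :: "((nat \<Rightarrow> nat) \<times> (nat \<Rightarrow> nat)) set" where
  "supp = {(r, s). \<forall>i. i \<notin> {1..n} \<longrightarrow> r i = 0 \<and> s i = 0}"

definition Dg :: "nat \<Rightarrow> nat \<Rightarrow> ((nat \<Rightarrow> nat) \<times> (nat \<Rightarrow> nat)) set" where
  "Dg a b = {(r, s) \<in> supp. sum r {1..n} = a \<and> sum s {1..n} = b}"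

lemma sum_Suc_upd:
  fixes r :: "nat \<Rightarrow> nat"
  assumes "i \<in> {1..n}" shows "sum (r(i := Suc (r i))) {1..n} = Suc (sum r {1..n})"
proof -
  have "sum (r(i := Suc (r i))) {1..n} = (\<Sum>j\<in>{1..n}. r j + (if j = i then 1 else 0))"
    by (rule sum.cong) auto
  then show ?thesis using assms by (simp add: sum.distrib)
qed

lemma x_V: "i \<in> {1..n} \<Longrightarrow> p \<in> V (Dg a b) \<Longrightarrow> var (x i) * p \<in> V (Dg (Suc a) b)"
proof (rule V_lmult)
  fix r s assume i: "i \<in> {1..n}" and "(r, s) \<in> Dg a b"
  then have "(r(i := Suc (r i)), s) \<in> Dg (Suc a) b"
    using sum_Suc_upd[OF i, of r] by (auto simp: Dg_def supp_def)
  from V_scal[OF V_mon[OF this]] cong_rmult[OF x_xm[OF i] ym_fpoly, of r s]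
  show "var (x i) * (xm r * ym s) \<in> V (Dg (Suc a) b)"
    by (auto simp: mult.assoc intro: V_cong)
qed auto

end

locale ord = ord_base +
  assumes y_x: "i \<in> {1..n} \<Longrightarrow> j \<in> {1..n} \<Longrightarrow> var (y j) * var (x i) \<in> XY"
begin

lemma XY_V:
  assumes "p \<in> XY" "v \<in> fpoly S" "\<And>t. t \<in> {1..n} \<Longrightarrow> var (y t) * v \<in> V (Dg a b)"
  shows "p * v \<in> V (Dg (Suc a) b)"
  using assms(1)
proof (induction rule: XY.induct)
  case (XY_mon s t)
  then show ?case using x_V[OF _ assms(3)] by (simp add: mult.assoc)
next
  case (XY_J p)
  then show ?case using assms(2) by (auto intro: V_J J_rmult)
qed (auto simp: distrib_right mult.assoc intro: V_add V_scal)

text \<open>Induction on the degree in x. One x_i is split off in front of the monomial, y_j x_i is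
  replaced by a combination of words x_s y_t, and the induction hypothesis moves y_t into the
  remaining monomial, whose degree in x is smaller by one.\<close>

lemma y_V: "j \<in> {1..n} \<Longrightarrow> p \<in> V (Dg a b) \<Longrightarrow> var (y j) * p \<in> V (Dg a (Suc b))"
proof (induction a arbitrary: j p)
  case 0
  show ?case
  proof (rule V_lmult[OF _ _ 0(2)])
    fix r s assume rs: "(r, s) \<in> Dg 0 b"
    then have "r = (\<lambda>_. 0)" by (fastforce simp: Dg_def supp_def)
    then have xm: "xm r = 1" by (simp add: xm_def map_replicate_const del: upt_Suc)
    have "(r, s(j := Suc (s j))) \<in> Dg 0 (Suc b)"
      using rs 0 sum_Suc_upd[of j s] by (auto simp: Dg_def supp_def)
    from V_scal[OF V_mon[OF this]] y_ym[OF 0(1), of s]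
    show "var (y j) * (xm r * ym s) \<in> V (Dg 0 (Suc b))"
      unfolding xm mult_1_left by (rule V_cong)
  qed (use 0 in auto)
next
  case (Suc a)
  show ?case
  proof (rule V_lmult[OF _ _ Suc(3)])
    fix r s assume rs: "(r, s) \<in> Dg (Suc a) b"
    then have "sum r {1..n} \<noteq> 0" by (simp add: Dg_def)
    then obtain i where i: "i \<in> {1..n}" "r i \<noteq> 0" by (meson sum.neutral)
    define r' where "r' = r(i := r i - 1)"
    have r: "r = r'(i := Suc (r' i))" using i by (auto simp: r'_def)
    have r's: "(r', s) \<in> Dg a b"
      using rs i sum_Suc_upd[OF i(1), of r'] unfolding r[symmetric] by (auto simp: Dg_def supp_def r'_def)
    let ?c = "inverse \<gamma> ^ sum r' {1..<i}"
    let ?v = "xm r' * ym s"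
    have "?c \<noteq> 0" using nonzero by simp
    then have "cong (xm r) (scal (inverse ?c) * (var (x i) * xm r'))"
      using cong_scal[OF x_xm[OF i(1), of r'], of "inverse ?c"] unfolding r[symmetric]
      by (simp add: scal_scal scal_one cong_sym)
    from cong_rmult[OF this ym_fpoly, of s] have "cong (xm r * ym s) (scal (inverse ?c) * (var (x i) * ?v))"
      by (simp add: mult.assoc)
    from cong_lmult[OF this var_y[OF Suc(2)]]
    have "cong (var (y j) * (xm r * ym s)) (scal (inverse ?c) * ((var (y j) * var (x i)) * ?v))"
      by (auto simp: scal_left_commute[of "var (y j)"] mult.assoc)
    moreover have "(var (y j) * var (x i)) * ?v \<in> V (Dg (Suc a) (Suc b))"
      by (rule XY_V) (use Suc i V_mon[OF r's] y_x in \<open>auto intro: V_fpoly\<close>)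
    ultimately show "var (y j) * (xm r * ym s) \<in> V (Dg (Suc a) (Suc b))"
      by (auto intro: V_cong V_scal)
  qed (use Suc in auto)
qed

lemma word_V:
  "u \<in> lists S \<Longrightarrow> Poly_Mapping.single u c \<in>
     V (Dg (length (filter (\<lambda>g. g \<in> range x) u)) (length (filter (\<lambda>g. g \<in> range y) u)))"
proof (induction u)
  case Nil
  have "((\<lambda>_. 0, \<lambda>_. 0) :: (nat \<Rightarrow> nat) \<times> (nat \<Rightarrow> nat)) \<in> Dg 0 0"
    by (simp add: Dg_def supp_def)
  from V_scal[OF V_mon[OF this], of c] show ?case
    by (simp add: xm_def ym_def map_replicate_const del: upt_Suc)
next
  case (Cons g u)
  then consider i where "i \<in> {1..n}" "g = x i" | i where "i \<in> {1..n}" "g = y i"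
    by (auto simp: S_eq)
  then show ?case
  proof cases
    case 1
    moreover have "g \<notin> range y" using 1 xy_disjoint by auto
    ultimately show ?thesis unfolding single_Cons[of g u c] using Cons x_V by auto
  next
    case 2
    moreover have "g \<notin> range x" using 2 xy_disjoint by auto
    ultimately show ?thesis unfolding single_Cons[of g u c] using Cons y_V by auto
  qed
qed

lemma homogeneous_V:
  assumes "p \<in> fpoly S" "\<And>u. u \<in> Poly_Mapping.keys p \<Longrightarrow>
    length (filter (\<lambda>g. g \<in> range x) u) = a \<and> length (filter (\<lambda>g. g \<in> range y) u) = b"
  shows "p \<in> V (Dg a b)"
proof -
  have "(\<Sum>u\<in>Poly_Mapping.keys p. Poly_Mapping.single u (Poly_Mapping.lookup p u)) \<in> V (Dg a b)"
  proof -
    have sum: "sum f U \<in> V (Dg a b)" if "finite U" "\<And>u. u \<in> U \<Longrightarrow> f u \<in> V (Dg a b)" for f and U :: "'a list set"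
      using that by (induction U rule: finite_induct) (auto intro: V_add V_J J_zero)
    have "Poly_Mapping.single u c \<in> V (Dg a b)" if "u \<in> Poly_Mapping.keys p" for u c
      using assms word_V[of u c] that by (auto simp: fpoly_def)
    then show ?thesis by (intro sum) auto
  qed
  then show ?thesis using ncpoly_decomp[of "Poly_Mapping.keys p" p] by simp
qed

lemma fpoly_V: "p \<in> fpoly S \<Longrightarrow> p \<in> V supp"
proof (induction p rule: fpoly_induct)
  case (mult u c)
  show ?case by (rule V_mono[OF _ word_V[OF mult]]) (auto simp: Dg_def)
qed (auto intro: V_add V_J J_zero)

end

context ord_base
begin

lemma V_explicit:
  "p \<in> V A \<Longrightarrow> \<exists>I c. finite I \<and> I \<subseteq> A \<and> cong p (\<Sum>(r, s)\<in>I. scal (c (r, s)) * (xm r * ym s))"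
proof (induction rule: V.induct)
  case (V_mon r s)
  then show ?case
    by (intro exI[of _ "{(r, s)}"] exI[of _ "\<lambda>_. 1"]) (simp add: scal_one)
next
  case (V_J p)
  then show ?case by (intro exI[of _ "{}"] exI[of _ "\<lambda>_. 1"]) (simp add: cong_def)
next
  case (V_add p p')
  then obtain I c I' c' where *: "finite I" "I \<subseteq> A" "finite I'" "I' \<subseteq> A"
    "cong p (\<Sum>(r, s)\<in>I. scal (c (r, s)) * (xm r * ym s))"
    "cong p' (\<Sum>(r, s)\<in>I'. scal (c' (r, s)) * (xm r * ym s))" by blast
  have ext: "(\<Sum>(r, s)\<in>J'. scal (d (r, s)) * (xm r * ym s))
      = (\<Sum>(r, s)\<in>I \<union> I'. scal (if (r, s) \<in> J' then d (r, s) else 0) * (xm r * ym s))"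
    if "J' \<subseteq> I \<union> I'" for J' d
    by (rule sum.mono_neutral_cong_left) (use that * in auto)
  let ?d = "\<lambda>i. (if i \<in> I then c i else 0) + (if i \<in> I' then c' i else 0)"
  have "cong (p + p') (\<Sum>(r, s)\<in>I \<union> I'. scal (?d (r, s)) * (xm r * ym s))"
    using cong_add[OF *(5,6)] unfolding ext[of I c, OF Un_upper1] ext[of I' c', OF Un_upper2]
    by (simp only: sum.distrib[symmetric] case_prod_unfold scal_add)
  then show ?case using * by (intro exI[of _ "I \<union> I'"] exI[of _ ?d]) auto
next
  case (V_scal p d)
  then obtain I c where "finite I" "I \<subseteq> A" "cong p (\<Sum>(r, s)\<in>I. scal (c (r, s)) * (xm r * ym s))"
    by blast
  moreover from cong_scal[OF this(3), of d]
  have "cong (scal d * p) (\<Sum>(r, s)\<in>I. scal (d * c (r, s)) * (xm r * ym s))"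
    by (simp add: sum_distrib_left case_prod_unfold scal_scal)
  ultimately show ?case by (intro exI[of _ I] exI[of _ "\<lambda>i. d * c i"]) auto
qed

end

section \<open>The two monomial bases\<close>

sublocale zw_setup \<subseteq> presented "zw_gens n" "zw_rels n q"
proof
  have g: "var (Z i) \<in> fpoly (zw_gens n)" "var (W i) \<in> fpoly (zw_gens n)" if "i \<in> {1..n}" for i
    using that by (auto intro!: fpoly_var simp: zw_gens_def)
  show "zw_rels n q \<subseteq> fpoly (zw_gens n)"
    unfolding zw_rels_def by (auto intro!: fpoly_diff fpoly_add fpoly_mult fpoly_sum g)
qed

context zw_setup
begin

lemma rel_zz: assumes "1 \<le> i" "i < j" "j \<le> n" shows "qcom q (var (Z i)) (var (Z j))"
proof -
  have "var (Z i) * var (Z j) - scal q * var (Z j) * var (Z i) \<in> zw_rels n q"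
    unfolding zw_rels_def using assms by blast
  from J_rel[OF this] show ?thesis by (simp add: qcom_def cong_def mult.assoc)
qed

lemma rel_ww: assumes "1 \<le> i" "i < j" "j \<le> n" shows "qcom (inverse q) (var (W i)) (var (W j))"
proof -
  have "var (W i) * var (W j) - scal (inverse q) * var (W j) * var (W i) \<in> zw_rels n q"
    unfolding zw_rels_def using assms by blast
  from J_rel[OF this] show ?thesis by (simp add: qcom_def cong_def mult.assoc)
qed

lemma rel_wz: assumes "i \<noteq> j" "i \<in> {1..n}" "j \<in> {1..n}" shows "qcom q (var (W j)) (var (Z i))"
proof -
  have "var (W j) * var (Z i) - scal q * var (Z i) * var (W j) \<in> zw_rels n q"
    unfolding zw_rels_def using assms by blast
  from J_rel[OF this] show ?thesis by (simp add: qcom_def cong_def mult.assoc)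
qed

lemma rel_wz_same: assumes "k \<in> {1..n}"
  shows "cong (var (W k) * var (Z k))
    (var (Z k) * var (W k) + scal (1 - q\<^sup>2) * (\<Sum>s\<in>{1..<k}. var (Z s) * var (W s)))"
  unfolding cong_def
  by (rule J_rel) (use assms in \<open>unfold zw_rels_def, blast\<close>)

sublocale zw: ord_base "zw_gens n" "zw_rels n q" n Z W q "inverse q"
  by standard (use q0 rel_zz rel_ww in \<open>auto simp: zw_gens_def\<close>)

sublocale wz: ord_base "zw_gens n" "zw_rels n q" n W Z "inverse q" q
  by standard (use q0 rel_zz rel_ww in \<open>auto simp: zw_gens_def\<close>)

sublocale zw: ord "zw_gens n" "zw_rels n q" n Z W q "inverse q"
proof
  fix i j assume ij: "i \<in> {1..n}" "j \<in> {1..n}"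
  show "var (W j) * var (Z i) \<in> zw.XY"
  proof (cases "i = j")
    case False
    show ?thesis
      by (rule zw.XY_cong[OF zw.XY_scal[OF zw.XY_mon[OF ij]] rel_wz[OF False ij, unfolded qcom_def]])
  next
    case True
    have "var (W i) * var (Z i) \<in> zw.XY"
      by (rule zw.XY_cong[OF _ rel_wz_same[OF ij(1)]])
        (use ij in \<open>auto intro!: zw.XY_add zw.XY_scal zw.XY_sum zw.XY_mon\<close>)
    then show ?thesis using True by simp
  qed
qed

text \<open>The relation for w_k z_k, added to the partial sum below \<open>k\<close>, gives Q_k =
  q^2 Q_{k-1} + w_k z_k; iteration produces the even powers of \<open>q\<close>.\<close>

lemma Q_poly_reversed:
  "k \<le> n \<Longrightarrow> cong (\<Sum>s\<in>{1..k}. var (Z s) * var (W s)) (\<Sum>s\<in>{1..k}. scal (q ^ (2 * (k - s))) * (var (W s) * var (Z s)))"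
proof (induction k)
  case (Suc k)
  let ?Q = "\<Sum>s\<in>{1..k}. var (Z s) * var (W s)"
  let ?R = "\<lambda>k. \<Sum>s\<in>{1..k}. scal (q ^ (2 * (k - s))) * (var (W s) * var (Z s))"
  let ?wz = "var (W (Suc k)) * var (Z (Suc k))"
  have "cong (?Q + (?wz - scal (1 - q\<^sup>2) * ?Q)) (?Q + var (Z (Suc k)) * var (W (Suc k)))"
    using rel_wz_same[of "Suc k"] Suc.prems
    by (intro cong_add cong_refl) (simp add: cong_def atLeastLessThanSuc_atLeastAtMost algebra_simps)
  moreover have "scal (1 - q\<^sup>2) * ?Q = ?Q - scal (q\<^sup>2) * ?Q"
    by (simp add: single_diff scal_one left_diff_distrib)
  ultimately have "cong (scal (q\<^sup>2) * ?Q + ?wz) (?Q + var (Z (Suc k)) * var (W (Suc k)))"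
    by (simp add: add.commute)
  then have "cong (?Q + var (Z (Suc k)) * var (W (Suc k))) (scal (q\<^sup>2) * ?Q + ?wz)"
    by (rule cong_sym)
  also have "cong \<dots> (scal (q\<^sup>2) * ?R k + ?wz)"
    using Suc by (intro cong_add cong_refl cong_scal) auto
  also have "scal (q\<^sup>2) * ?R k = (\<Sum>s\<in>{1..k}. scal (q ^ (2 * (Suc k - s))) * (var (W s) * var (Z s)))"
    unfolding sum_distrib_left scal_scal
    by (rule sum.cong) (auto simp: Suc_diff_le power2_eq_square mult.assoc)
  finally show ?case by (simp add: scal_one)
qed simp

sublocale wz: ord "zw_gens n" "zw_rels n q" n W Z "inverse q" q
proof
  fix i j assume ij: "i \<in> {1..n}" "j \<in> {1..n}"
  show "var (Z j) * var (W i) \<in> wz.XY"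
  proof (cases "i = j")
    case False
    then have "qcom (inverse q) (var (Z j)) (var (W i))"
      using ij q0 by (intro qcom_swap rel_wz) auto
    then show ?thesis
      by (intro wz.XY_cong[OF wz.XY_scal[OF wz.XY_mon[OF ij]]]) (simp add: qcom_def)
  next
    case True
    let ?Q = "\<Sum>s\<in>{1..i - 1}. var (Z s) * var (W s)"
    \<comment> \<open>The relation for equal indices leaves words z_s w_s with s < i, which are in
      the wrong order here; \<open>Q_poly_reversed\<close> turns their sum round.\<close>
    have "?Q \<in> wz.XY"
      by (rule wz.XY_cong[OF _ Q_poly_reversed]) (use ij in \<open>auto intro!: wz.XY_sum wz.XY_scal wz.XY_mon\<close>)
    then have "var (W i) * var (Z i) + scal (- (1 - q\<^sup>2)) * ?Q \<in> wz.XY"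
      using ij by (intro wz.XY_add wz.XY_scal wz.XY_mon)
    moreover have "{1..<i} = {1..i - 1}" using ij by auto
    then have "cong (var (Z i) * var (W i)) (var (W i) * var (Z i) + scal (- (1 - q\<^sup>2)) * ?Q)"
      using cong_sym[OF rel_wz_same[OF ij(1)]]
      unfolding cong_def scal_uminus mult_minus_left by (simp add: algebra_simps)
    ultimately show ?thesis unfolding True[symmetric] by (rule wz.XY_cong)
  qed
qed

definition gen :: "zw \<Rightarrow> lop" where
  "gen g = (case g of Z i \<Rightarrow> z i | W i \<Rightarrow> w i)"

lemma gen_simps [simp]: "gen (Z i) = z i" "gen (W i) = w i"
  by (simp_all add: gen_def)

definition evl :: "zw ncpoly \<Rightarrow> lop" where "evl p = lops.ev gen p"

lemma evl_simps:
  "evl (p + p') = evl p + evl p'" "evl 0 = 0" "evl (- p) = - evl p" "evl (p - p') = evl p - evl p'"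
  "evl (p * p') = evl p * evl p'" "evl 1 = 1" "evl (var g) = gen g" "evl (scal c) = scale c 1"
  "evl (p ^ k) = evl p ^ k" "evl (sum f I) = (\<Sum>x\<in>I. evl (f x))"
  "evl (prod_list ps) = prod_list (map evl ps)"
  using lops.ev_prod_list[of gen ps] by (simp_all add: evl_def[abs_def] lops.ev_simps)

lemma evl_scal: "evl (scal c * p) = scale c (evl p)"
  by (simp add: evl_simps scale_one_mult)

definition zmon where "zmon r = prod_list (map (\<lambda>i. z i ^ r i) [1..<Suc n])"

definition wmon where "wmon r = prod_list (map (\<lambda>i. w i ^ r i) [1..<Suc n])"

lemma evl_mon: "evl (zw.xm r) = zmon r" "evl (zw.ym r) = wmon r" "evl (wz.xm r) = wmon r" "evl (wz.ym r) = zmon r"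
  by (simp_all add: zw.xm_def zw.ym_def wz.xm_def wz.ym_def zmon_def wmon_def evl_simps o_def del: upt_Suc)

lemma J_kernel: "p \<in> J \<Longrightarrow> evl p = 0"
proof -
  have "evl r = 0" if r: "r \<in> zw_rels n q" for r
  proof -
    consider (zz) i j where "1 \<le> i" "i < j" "j \<le> n"
        "r = var (Z i) * var (Z j) - scal q * var (Z j) * var (Z i)"
      | (ww) i j where "1 \<le> i" "i < j" "j \<le> n"
        "r = var (W i) * var (W j) - scal (inverse q) * var (W j) * var (W i)"
      | (wz) i j where "i \<in> {1..n}" "j \<in> {1..n}" "i \<noteq> j"
        "r = var (W j) * var (Z i) - scal q * var (Z i) * var (W j)"
      | (wzk) k where "k \<in> {1..n}"
        "r = var (W k) * var (Z k) -
          (var (Z k) * var (W k) + scal (1 - q\<^sup>2) * (\<Sum>s\<in>{1..<k}. var (Z s) * var (W s)))"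
      using r unfolding zw_rels_def by blast
    then show ?thesis
    proof cases
      case zz
      then show ?thesis by (simp add: evl_simps scale_one_mult mult.assoc z_z)
    next
      case ww
      then show ?thesis by (simp add: evl_simps scale_one_mult mult.assoc w_w)
    next
      case wz
      then show ?thesis by (simp add: evl_simps scale_one_mult mult.assoc w_z)
    next
      case wzk
      moreover have "{1..<k} = {1..k - 1}" using wzk by auto
      ultimately show ?thesis by (simp add: evl_simps scale_one_mult mult.assoc w_z_k Qu_def)
    qed
  qed
  then have "J \<subseteq> {p \<in> fpoly (zw_gens n). lops.ev gen p = 0}"
    by (intro lops.ideal_in_kernel presented_axioms) (simp add: evl_def)
  then show "p \<in> J \<Longrightarrow> evl p = 0" by (auto simp: evl_def)
qed

lemma cong_evl: "cong p p' \<Longrightarrow> evl p = evl p'"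
  using J_kernel[of "p - p'"] by (simp add: cong_def evl_simps)

abbreviation supp where "supp \<equiv> zw.supp"

abbreviation Dg where "Dg \<equiv> zw.Dg"

lemma supp_iff: "(r, s) \<in> supp \<longleftrightarrow> (\<forall>i. i \<notin> {1..n} \<longrightarrow> r i = 0 \<and> s i = 0)"
  by (simp add: zw.supp_def)

text \<open>The degree of the multiplier encodes the exponents of the w_k, and the shift then yields
  those of the z_k as r_k = (r_k - s_k) + s_k. Only these data of the operators enter, so both
  orderings of monomials are covered.\<close>

lemma independent_family:
  fixes m :: "(nat \<Rightarrow> nat) \<times> (nat \<Rightarrow> nat) \<Rightarrow> lop"
  assumes sd: "\<And>M r s. M \<ge> 2 \<Longrightarrow> shiftdeg M (m (r, s))
      (\<lambda>i. if i \<in> {1..n} then int (r i) - int (s i) else 0) (\<Sum>k\<in>{1..n}. s k * M ^ k)"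
    and I: "finite I" "I \<subseteq> supp" and zero: "(\<Sum>i\<in>I. scale (c i) (m i)) = 0" and "i \<in> I"
  shows "c i = 0"
proof -
  have out: "fst i k = 0 \<and> snd i k = 0" if "i \<in> I" "k \<notin> {1..n}" for i k
    using subsetD[OF I(2) that(1)] that(2) by (cases i) (simp add: zw.supp_def)
  \<comment> \<open>The base exceeds every exponent of a w_k that occurs in the finite set
    \<open>I\<close>, so these exponents are digits; the summand 2 secures the bound required by
    \<open>sd\<close>.\<close>
  define M where "M = 2 + (\<Sum>i\<in>I. \<Sum>k\<in>{1..n}. snd i k)"
  have M: "snd i k < M" if "i \<in> I" for i k
  proof (cases "k \<in> {1..n}")
    case True
    then have "snd i k \<le> (\<Sum>k\<in>{1..n}. snd i k)" by (intro member_le_sum) auto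
    also have "\<dots> \<le> (\<Sum>i\<in>I. \<Sum>k\<in>{1..n}. snd i k)"
      using I that by (intro member_le_sum[of i I "\<lambda>i. \<Sum>k\<in>{1..n}. snd i k"]) auto
    finally show ?thesis by (simp add: M_def)
  next
    case False
    then have "snd i k = 0" using out[OF that] by simp
    then show ?thesis by (simp add: M_def)
  qed
  let ?d = "\<lambda>i k. if k \<in> {1..n} then int (fst i k) - int (snd i k) else 0"
  let ?D = "\<lambda>i. \<Sum>k\<in>{1..n}. snd i k * M ^ k"
  show ?thesis
  proof (rule shiftdeg_independent[of I M m ?d ?D c])
    show "shiftdeg M (m i) (?d i) (?D i)" for i
      using sd[of M "fst i" "snd i"] by (simp add: M_def)
    show "inj_on (\<lambda>i. (?d i, ?D i)) I"
    proof (rule inj_onI)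
      fix i j assume ij: "i \<in> I" "j \<in> I" and e: "(?d i, ?D i) = (?d j, ?D j)"
      have s: "\<forall>k\<in>{1..n}. snd i k = snd j k"
        by (rule base_unique[of _ M]) (use M ij e in auto)
      have r: "\<forall>k\<in>{1..n}. fst i k = fst j k"
      proof
        fix k assume k: "k \<in> {1..n}"
        from e have "?d i = ?d j" by simp
        from fun_cong[OF this, of k] have "?d i k = ?d j k" .
        then show "fst i k = fst j k" using s k by auto
      qed
      have "fst i k = fst j k \<and> snd i k = snd j k" for k
        using r s out[OF ij(1), of k] out[OF ij(2), of k] by (cases "k \<in> {1..n}") auto
      then show "i = j" by (intro prod_eqI ext) auto
    qed
  qed (use I zero \<open>i \<in> I\<close> in auto)
qed

lemma independent_family_basis:
  fixes m :: "(nat \<Rightarrow> nat) \<times> (nat \<Rightarrow> nat) \<Rightarrow> lop"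
  assumes sd: "\<And>M r s. M \<ge> 2 \<Longrightarrow> shiftdeg M (m (r, s))
      (\<lambda>i. if i \<in> {1..n} then int (r i) - int (s i) else 0) (\<Sum>k\<in>{1..n}. s k * M ^ k)"
  shows "inj_on m supp" "lop.independent (m ` supp)"
proof -
  show inj: "inj_on m supp"
  proof (rule inj_onI, rule ccontr)
    fix i j assume ij: "i \<in> supp" "j \<in> supp" "m i = m j" "i \<noteq> j"
    have "(if i = i then 1 else - 1 :: complex) = 0"
      by (rule independent_family[OF sd, of "{i, j}" "\<lambda>k. if k = i then 1 else - 1"]) (use ij in auto)
    then show False by simp
  qed
  show "lop.independent (m ` supp)"
    unfolding lop.dependent_explicit
  proof clarify
    fix t u x assume t: "finite t" "t \<subseteq> m ` supp" "(\<Sum>v\<in>t. scale (u v) v) = 0" and x: "x \<in> t" "u x \<noteq> 0"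
    obtain I where I: "I \<subseteq> supp" "t = m ` I" using t(2) by (auto simp: subset_image_iff)
    have inj': "inj_on m I" using inj I(1) by (rule inj_on_subset)
    then have "finite I" using t(1) I(2) finite_imageD by blast
    obtain i where i: "i \<in> I" "x = m i" using x I(2) by auto
    have "u (m i) = 0"
      by (rule independent_family[OF sd, of I "\<lambda>i. u (m i)"])
        (use \<open>finite I\<close> I i t(3) inj' in \<open>auto simp: sum.reindex\<close>)
    then show False using x i by simp
  qed
qed

lemma shiftdeg_zmon: "shiftdeg M (zmon r) (\<lambda>i. if i \<in> {1..n} then int (r i) else 0) 0"
proof -
  have "shiftdeg M (zmon r) (\<lambda>i. \<Sum>j\<leftarrow>[1..<Suc n]. int (r j) * (if i = j then 1 else 0)) (\<Sum>j\<leftarrow>[1..<Suc n]. r j * 0)"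
    unfolding zmon_def by (rule shiftdeg_prod_list, rule shiftdeg_power, rule shiftdeg_z)
  moreover have "(\<Sum>j\<leftarrow>[1..<Suc n]. int (r j) * (if i = j then 1 else 0)) = (if i \<in> {1..n} then int (r i) else 0)" for i
    by (subst sum_list_distinct_conv_sum_set)
      (simp_all add: atLeastLessThanSuc_atLeastAtMost if_distrib cong: if_cong del: upt_Suc)
  ultimately show ?thesis by (simp del: upt_Suc add: sum_list_0)
qed

lemma shiftdeg_wmon: "M \<ge> 2 \<Longrightarrow>
  shiftdeg M (wmon r) (\<lambda>i. if i \<in> {1..n} then - int (r i) else 0) (\<Sum>k\<in>{1..n}. r k * M ^ k)"
proof -
  assume M: "M \<ge> 2"
  have "shiftdeg M (wmon r) (\<lambda>i. \<Sum>j\<leftarrow>[1..<Suc n]. int (r j) * (if i = j then - 1 else 0)) (\<Sum>j\<leftarrow>[1..<Suc n]. r j * M ^ j)"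
    unfolding wmon_def by (rule shiftdeg_prod_list, rule shiftdeg_power, rule shiftdeg_w) (use M in auto)
  moreover have "(\<Sum>j\<leftarrow>[1..<Suc n]. int (r j) * (if i = j then - 1 else 0)) = (if i \<in> {1..n} then - int (r i) else 0)" for i
    by (subst sum_list_distinct_conv_sum_set)
      (simp_all add: atLeastLessThanSuc_atLeastAtMost if_distrib cong: if_cong del: upt_Suc)
  moreover have "(\<Sum>j\<leftarrow>[1..<Suc n]. r j * M ^ j) = (\<Sum>k\<in>{1..n}. r k * M ^ k)"
    by (subst sum_list_distinct_conv_sum_set)
      (simp_all add: atLeastLessThanSuc_atLeastAtMost del: upt_Suc)
  ultimately show ?thesis by (simp del: upt_Suc)
qed

definition mzw :: "(nat \<Rightarrow> nat) \<times> (nat \<Rightarrow> nat) \<Rightarrow> lop" where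
  "mzw = (\<lambda>(r, s). zmon r * wmon s)"

text \<open>The exponents of the z_i stay in the first component although the w_i come first in the
  product, so that both bases share the index set \<open>supp\<close>.\<close>

definition mwz :: "(nat \<Rightarrow> nat) \<times> (nat \<Rightarrow> nat) \<Rightarrow> lop" where
  "mwz = (\<lambda>(r, s). wmon s * zmon r)"

lemma mzw_shiftdeg: "M \<ge> 2 \<Longrightarrow> shiftdeg M (mzw (r, s))
  (\<lambda>i. if i \<in> {1..n} then int (r i) - int (s i) else 0) (\<Sum>k\<in>{1..n}. s k * M ^ k)"
proof -
  assume "M \<ge> 2"
  have "(\<lambda>i. (if i \<in> {1..n} then int (r i) else 0) + (if i \<in> {1..n} then - int (s i) else 0))
    = (\<lambda>i. if i \<in> {1..n} then int (r i) - int (s i) else 0)" by auto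
  then show ?thesis
    using shiftdeg_mult[OF shiftdeg_zmon[of M r] shiftdeg_wmon[of M s, OF \<open>M \<ge> 2\<close>]] by (simp add: mzw_def)
qed

lemma mwz_shiftdeg: "M \<ge> 2 \<Longrightarrow> shiftdeg M (mwz (r, s))
  (\<lambda>i. if i \<in> {1..n} then int (r i) - int (s i) else 0) (\<Sum>k\<in>{1..n}. s k * M ^ k)"
proof -
  assume "M \<ge> 2"
  have "(\<lambda>i. (if i \<in> {1..n} then - int (s i) else 0) + (if i \<in> {1..n} then int (r i) else 0))
    = (\<lambda>i. if i \<in> {1..n} then int (r i) - int (s i) else 0)" by auto
  then show ?thesis
    using shiftdeg_mult[OF shiftdeg_wmon[of M s, OF \<open>M \<ge> 2\<close>] shiftdeg_zmon[of M r]] by (simp add: mwz_def)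
qed

lemma mzw_basis: "inj_on mzw supp" "lop.independent (mzw ` supp)"
  by (rule independent_family_basis, erule mzw_shiftdeg)+

lemma mwz_basis: "inj_on mwz supp" "lop.independent (mwz ` supp)"
  by (rule independent_family_basis, erule mwz_shiftdeg)+

abbreviation fp where "fp \<equiv> fpoly (zw_gens n)"

text \<open>Faithfulness. Modulo \<open>J\<close> an element is a combination of ordered monomials,
  and independence of their operators forces all coefficients to vanish.\<close>

lemma kernel_J: "p \<in> fp \<Longrightarrow> evl p = 0 \<Longrightarrow> p \<in> J"
proof -
  assume p: "p \<in> fp" "evl p = 0"
  obtain I c where I: "finite I" "I \<subseteq> supp" and c: "cong p (\<Sum>(r, s)\<in>I. scal (c (r, s)) * (zw.xm r * zw.ym s))"
    using zw.V_explicit[OF zw.fpoly_V[OF p(1)]] by blast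
  have "(\<Sum>i\<in>I. scale (c i) (mzw i)) = evl (\<Sum>(r, s)\<in>I. scal (c (r, s)) * (zw.xm r * zw.ym s))"
    by (simp add: evl_simps evl_mon evl_scal mzw_def case_prod_unfold scale_one_mult)
  also have "\<dots> = 0" using cong_evl[OF c] p(2) by simp
  finally have "c i = 0" if "i \<in> I" for i
    using independent_family[OF mzw_shiftdeg I _ that] by blast
  then have "(\<Sum>(r, s)\<in>I. scal (c (r, s)) * (zw.xm r * zw.ym s)) = 0"
    by (intro sum.neutral) auto
  then show "p \<in> J" using c by (simp add: cong_def)
qed

lemma cls_eq_evl: "p \<in> fp \<Longrightarrow> p' \<in> fp \<Longrightarrow> cls p = cls p' \<longleftrightarrow> evl p = evl p'"
  using kernel_J[of "p - p'"] J_kernel[of "p - p'"] by (auto simp: cls_eq_iff evl_simps)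

end

section \<open>The q-derivatives as linear operators\<close>

context ord
begin

text \<open>The uniqueness required by \<open>THE\<close>: ordered monomials span modulo
  \<open>J\<close>. Outside the carrier both operators are \<open>undefined\<close>, since
  \<open>linear_operator\<close> asks for an extensional function.\<close>

lemma linear_operator_unique:
  assumes D: "linear_operator alg D" "linear_operator alg D'"
    and eq: "\<And>r s. (r, s) \<in> supp \<Longrightarrow> D (cls (xm r * ym s)) = D' (cls (xm r * ym s))"
  shows "D = D'"
proof -
  interpret A: ring alg by (rule ring_alg)
  have add: "T (cls (p + p')) = T (cls p) \<oplus>\<^bsub>alg\<^esub> T (cls p')"
    and smult: "T (cls (scal c * p)) = c \<odot>\<^bsub>alg\<^esub> T (cls p)"
    if "linear_operator alg T" "p \<in> fpoly S" "p' \<in> fpoly S" for T p p' c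
    using that unfolding linear_operator_def
    by (auto simp: carrier_alg alg_add[symmetric] alg_smult[symmetric])
  have zero: "T (cls 0) = cls 0" if "linear_operator alg T" for T
  proof -
    have "T (cls 0) \<in> carrier alg" using that by (auto simp: linear_operator_def carrier_alg)
    then obtain p where "p \<in> fpoly S" "T (cls 0) = cls p" by (auto simp: carrier_alg)
    then show ?thesis using smult[OF that, of 0 0 0] by (simp add: alg_smult)
  qed
  have "D (cls p) = D' (cls p)" if "p \<in> V supp" for p
    using that
  proof (induction rule: V.induct)
    case (V_mon r s)
    then show ?case by (rule eq)
  next
    case (V_J p)
    then have "cls p = cls 0" by (simp add: cls_eq_iff)
    then show ?case by (simp add: zero[OF D(1)] zero[OF D(2)])
  next
    case (V_add p p')
    have "p \<in> fpoly S" "p' \<in> fpoly S" using V_add(1,2) by (simp_all add: V_fpoly)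
    then show ?case using V_add(3,4) by (simp add: add[OF D(1)] add[OF D(2)])
  next
    case (V_scal p c)
    have "p \<in> fpoly S" using V_scal(1) by (simp add: V_fpoly)
    then show ?case using V_scal(2) by (simp add: smult[OF D(1) _ fpoly_zero] smult[OF D(2) _ fpoly_zero])
  qed
  then have "D X = D' X" if "X \<in> carrier alg" for X
    using that fpoly_V by (auto simp: carrier_alg)
  moreover have "D \<in> extensional (carrier alg)" "D' \<in> extensional (carrier alg)"
    using D by (auto simp: linear_operator_def PiE_def)
  ultimately show ?thesis by (intro extensionalityI)
qed

end

definition basis_map :: "('i \<times> 'j \<Rightarrow> lop) \<Rightarrow> ('i \<times> 'j) set \<Rightarrow> ('i \<Rightarrow> 'j \<Rightarrow> lop) \<Rightarrow> lop \<Rightarrow> lop" where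
  "basis_map m I g = (SOME D. linop D \<and> (\<forall>(r, s)\<in>I. D (m (r, s)) = g r s))"

lemma basis_map:
  assumes "lop.independent (m ` I)" "inj_on m I"
  shows "linop (basis_map m I g)" "(r, s) \<in> I \<Longrightarrow> basis_map m I g (m (r, s)) = g r s"
proof -
  obtain D where D: "linop D" "\<And>k. k \<in> I \<Longrightarrow> D (m k) = case_prod g k"
    by (rule linop_extension[OF assms, of "case_prod g"]) blast
  have "linop D \<and> (\<forall>(r, s)\<in>I. D (m (r, s)) = g r s)"
    using D(1) D(2)[of "(r, s)" for r s] by auto
  then have *: "linop (basis_map m I g) \<and> (\<forall>(r, s)\<in>I. basis_map m I g (m (r, s)) = g r s)"
    unfolding basis_map_def
    by (rule someI[of "\<lambda>D. linop D \<and> (\<forall>(r, s)\<in>I. D (m (r, s)) = g r s)"])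
  then show "linop (basis_map m I g)" by (rule conjunct1)
  show "(r, s) \<in> I \<Longrightarrow> basis_map m I g (m (r, s)) = g r s" using * by auto
qed

lemma qint_0 [simp]: "qint q 0 = 0"
  by (simp add: qint_def)

context zw_setup
begin

text \<open>The faithful image of the algebra. From here on, equations between classes are equations
  between operators, and membership in \<open>B\<close> records that an operator comes from the
  algebra.\<close>

definition B where "B = evl ` fp"

lemma B_evl [intro]: "p \<in> fp \<Longrightarrow> evl p \<in> B"
  by (simp add: B_def)

lemma B_rep: assumes "x \<in> B" shows "\<exists>p\<in>fp. evl p = x"
proof -
  obtain p where "p \<in> fp" "x = evl p" using assms unfolding B_def by (rule imageE)
  then show ?thesis by (intro bexI[of _ p]) simp_all
qed

lemma B_add [intro]: "x \<in> B \<Longrightarrow> y \<in> B \<Longrightarrow> x + y \<in> B"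
  unfolding B_def by (auto simp flip: evl_simps(1))

lemma B_scale [intro]: assumes "x \<in> B" shows "scale c x \<in> B"
proof -
  obtain p where p: "p \<in> fp" "x = evl p" using assms unfolding B_def by (rule imageE)
  have "evl (scal c * p) \<in> B" by (intro B_evl fpoly_mult fpoly_scal p(1))
  then show ?thesis by (simp only: p(2) evl_scal)
qed

lemma B_mult [intro]: "x \<in> B \<Longrightarrow> y \<in> B \<Longrightarrow> x * y \<in> B"
  unfolding B_def by (auto simp flip: evl_simps(5))

lemma B_zero [intro, simp]: "0 \<in> B"
  using B_evl[of 0] by (simp add: evl_simps)

lemma B_one [intro, simp]: "1 \<in> B"
  using B_evl[of 1] by (auto simp: evl_simps)

lemma B_sum [intro]: "(\<And>i. i \<in> I \<Longrightarrow> f i \<in> B) \<Longrightarrow> sum f I \<in> B"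
  by (induction I rule: infinite_finite_induct) auto

lemma B_power [intro]: "x \<in> B \<Longrightarrow> x ^ k \<in> B"
  by (induction k) auto

lemma B_z [intro]: "i \<in> {1..n} \<Longrightarrow> z i \<in> B"
  using B_evl[OF zw.var_x] by (simp add: evl_simps)

lemma B_w [intro]: "i \<in> {1..n} \<Longrightarrow> w i \<in> B"
  using B_evl[OF zw.var_y] by (simp add: evl_simps)

lemma B_zmon [intro]: "zmon r \<in> B"
  using B_evl[OF zw.xm_fpoly] by (simp add: evl_mon)

lemma B_wmon [intro]: "wmon r \<in> B"
  using B_evl[OF zw.ym_fpoly] by (simp add: evl_mon)

lemma B_mzw [intro]: "mzw i \<in> B"
  by (auto simp: mzw_def split: prod.splits)

lemma B_mwz [intro]: "mwz i \<in> B"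
  by (auto simp: mwz_def split: prod.splits)

lemma evl_pair: "evl (zw.xm r * zw.ym s) = mzw (r, s)" "evl (wz.xm s * wz.ym r) = mwz (r, s)"
  by (simp_all add: evl_simps evl_mon mzw_def mwz_def)

lemma span_zw_induct [consumes 1, case_names zero add scale mon]:
  assumes "x \<in> evl ` zw.V A" "P 0" "\<And>x y. P x \<Longrightarrow> P y \<Longrightarrow> P (x + y)"
    "\<And>c x. P x \<Longrightarrow> P (scale c x)" "\<And>r s. (r, s) \<in> A \<Longrightarrow> P (mzw (r, s))"
  shows "P x"
proof -
  have "P (evl p)" if "p \<in> zw.V A" for p
    using that
    by (induction rule: zw.V.induct)
      (use assms(2-5) in \<open>auto simp: evl_simps(1) evl_scal evl_pair J_kernel\<close>)
  then show ?thesis using assms(1) by auto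
qed

lemma B_zw: "B = evl ` zw.V supp"
  unfolding B_def using zw.fpoly_V zw.V_fpoly by blast

lemma supp_swap: "(s, r) \<in> wz.supp \<longleftrightarrow> (r, s) \<in> supp"
  by (auto simp: wz.supp_def zw.supp_def)

lemma B_zw_induct [consumes 1, case_names zero add scale mon]:
  assumes "x \<in> B" "P 0" "\<And>x y. P x \<Longrightarrow> P y \<Longrightarrow> P (x + y)"
    "\<And>c x. P x \<Longrightarrow> P (scale c x)" "\<And>r s. (r, s) \<in> supp \<Longrightarrow> P (mzw (r, s))"
  shows "P x"
  using assms(1) unfolding B_zw by (rule span_zw_induct) (use assms in auto)

lemma B_wz_induct [consumes 1, case_names zero add scale mon]:
  assumes "x \<in> B" "P 0" "\<And>x y. P x \<Longrightarrow> P y \<Longrightarrow> P (x + y)"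
    "\<And>c x. P x \<Longrightarrow> P (scale c x)" "\<And>r s. (r, s) \<in> supp \<Longrightarrow> P (mwz (r, s))"
  shows "P x"
proof -
  have "P (evl p)" if "p \<in> wz.V wz.supp" for p
    using that
    by (induction rule: wz.V.induct)
      (use assms(2-5) in \<open>auto simp: evl_simps(1) evl_scal evl_pair J_kernel supp_swap\<close>)
  then show ?thesis using assms(1) wz.fpoly_V by (auto simp: B_def)
qed

definition kls :: "lop \<Rightarrow> zw ncpoly set" where
  "kls x = cls (SOME p. p \<in> fp \<and> evl p = x)"

lemma kls_evl: "p \<in> fp \<Longrightarrow> kls (evl p) = cls p"
  unfolding kls_def by (rule someI2[of _ p]) (auto simp: cls_eq_evl)

definition val :: "zw ncpoly set \<Rightarrow> lop" where
  "val X = evl (SOME p. p \<in> fp \<and> cls p = X)"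

lemma val_cls: "p \<in> fp \<Longrightarrow> val (cls p) = evl p"
  unfolding val_def by (rule someI2[of _ p]) (auto simp: cls_eq_evl)

text \<open>The restriction to the carrier makes the result extensional, as
  \<open>linear_operator\<close> demands.\<close>

definition transport :: "(lop \<Rightarrow> lop) \<Rightarrow> zw ncpoly set \<Rightarrow> zw ncpoly set" where
  "transport D = (\<lambda>X\<in>carrier alg. kls (D (val X)))"

lemma transport_cls:
  assumes "p \<in> fp" "u \<in> fp" "evl u = D (evl p)"
  shows "transport D (cls p) = cls u"
proof -
  have "cls p \<in> carrier alg" unfolding carrier_alg using assms(1) by (rule imageI)
  then show ?thesis
    by (simp only: transport_def restrict_apply' val_cls[OF assms(1)] assms(3)[symmetric] kls_evl[OF assms(2)])
qed

lemma linear_operator_transport: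
  assumes "linop D" "\<And>x. x \<in> B \<Longrightarrow> D x \<in> B"
  shows "linear_operator alg (transport D)"
proof -
  have pre: "\<exists>u\<in>fp. evl u = D (evl p)" if "p \<in> fp" for p
  proof -
    have "D (evl p) \<in> evl ` fp" using assms(2)[OF B_evl[OF that]] by (simp only: B_def)
    then show ?thesis by (metis imageE)
  qed
  show ?thesis
    unfolding linear_operator_def
  proof (intro conjI ballI allI)
    have "transport D X \<in> carrier alg" if X: "X \<in> carrier alg" for X
    proof -
      obtain p where p: "p \<in> fp" "X = cls p" using X unfolding carrier_alg by (rule imageE)
      obtain u where u: "u \<in> fp" "evl u = D (evl p)" using pre[OF p(1)] by (rule bexE)
      show ?thesis unfolding p(2) transport_cls[of p u D, OF p(1) u] carrier_alg using u(1) by (rule imageI)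
    qed
    then show "transport D \<in> carrier alg \<rightarrow>\<^sub>E carrier alg"
      by (intro PiE_I) (simp_all add: transport_def)
  next
    fix X Y assume X: "X \<in> carrier alg" and Y: "Y \<in> carrier alg"
    obtain p where p: "p \<in> fp" "X = cls p" using X unfolding carrier_alg by (rule imageE)
    obtain p' where p': "p' \<in> fp" "Y = cls p'" using Y unfolding carrier_alg by (rule imageE)
    obtain u where u: "u \<in> fp" "evl u = D (evl p)" using pre[OF p(1)] by (rule bexE)
    obtain u' where u': "u' \<in> fp" "evl u' = D (evl p')" using pre[OF p'(1)] by (rule bexE)
    have "evl (u + u') = D (evl (p + p'))"
      by (simp only: evl_simps(1) linop_add[OF assms(1)] u u')
    from transport_cls[of "p + p'" "u + u'" D, OF fpoly_add fpoly_add this] p p' u u'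
    have "transport D (cls (p + p')) = cls (u + u')" by simp
    then show "transport D (X \<oplus>\<^bsub>alg\<^esub> Y) = transport D X \<oplus>\<^bsub>alg\<^esub> transport D Y"
      unfolding p(2) p'(2) transport_cls[of p u D, OF p(1) u] transport_cls[of p' u' D, OF p'(1) u']
      by (simp only: alg_add p(1) p'(1) u(1) u'(1))
  next
    fix c X assume X: "X \<in> carrier alg"
    obtain p where p: "p \<in> fp" "X = cls p" using X unfolding carrier_alg by (rule imageE)
    obtain u where u: "u \<in> fp" "evl u = D (evl p)" using pre[OF p(1)] by (rule bexE)
    have "evl (scal c * u) = D (evl (scal c * p))"
      by (simp only: evl_scal linop_scale[OF assms(1)] u)
    from transport_cls[of "scal c * p" "scal c * u" D, OF fpoly_mult fpoly_mult this] p u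
    have "transport D (cls (scal c * p)) = cls (scal c * u)" by simp
    then show "transport D (c \<odot>\<^bsub>alg\<^esub> X) = c \<odot>\<^bsub>alg\<^esub> transport D X"
      unfolding p(2) transport_cls[of p u D, OF p(1) u] by (simp only: alg_smult)
  qed
qed

definition dz :: "nat \<Rightarrow> lop \<Rightarrow> lop" where
  "dz i = basis_map mzw supp (\<lambda>r s. scale (q ^ (\<Sum>j\<in>{i<..n}. r j) * qint q (r i)) (mzw (r(i := r i - 1), s)))"

definition db :: "nat \<Rightarrow> lop \<Rightarrow> lop" where
  "db i = basis_map mwz supp (\<lambda>r s. scale (q powi (- int (\<Sum>j\<in>{i<..n}. s j)) * qint q (s i)) (mwz (r, s(i := s i - 1))))"

lemma dz: "linop (dz i)" and dz_mzw: "(r, s) \<in> supp \<Longrightarrow> dz i (mzw (r, s))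
    = scale (q ^ (\<Sum>j\<in>{i<..n}. r j) * qint q (r i)) (mzw (r(i := r i - 1), s))"
  unfolding dz_def by (rule basis_map(1)[OF mzw_basis(2,1)]) (erule basis_map(2)[OF mzw_basis(2,1)])

lemma db: "linop (db i)" and db_mwz: "(r, s) \<in> supp \<Longrightarrow> db i (mwz (r, s))
    = scale (q powi (- int (\<Sum>j\<in>{i<..n}. s j)) * qint q (s i)) (mwz (r, s(i := s i - 1)))"
  unfolding db_def by (rule basis_map(1)[OF mwz_basis(2,1)]) (erule basis_map(2)[OF mwz_basis(2,1)])

lemma B_dz [intro]: "x \<in> B \<Longrightarrow> dz i x \<in> B"
  by (induction rule: B_zw_induct) (auto simp: linop_simps[OF dz] dz_mzw)

lemma B_db [intro]: "x \<in> B \<Longrightarrow> db i x \<in> B"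
  by (induction rule: B_wz_induct) (auto simp: linop_simps[OF db] db_mwz)

text \<open>The defining conditions of the derivatives quantify over all exponent functions, whose
  values outside 1..n do not affect the monomial; the bases are indexed by functions that vanish
  there.\<close>

definition clip :: "(nat \<Rightarrow> nat) \<Rightarrow> nat \<Rightarrow> nat" where
  "clip r i = (if i \<in> {1..n} then r i else 0)"

lemma xm_clip: "zw.xm (clip r) = z_monomial n r" "zw.ym (clip r) = w_monomial n r"
  "wz.xm (clip r) = w_monomial n r" "wz.ym (clip r) = z_monomial n r"
  unfolding zw.xm_def zw.ym_def wz.xm_def wz.ym_def z_monomial_def w_monomial_def
  by (rule arg_cong[of _ _ prod_list], rule map_cong, auto simp: clip_def simp del: upt_Suc)+

lemma clip_supp: "(clip r, clip s) \<in> supp"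
  by (auto simp: zw.supp_def clip_def)

lemma clip_upd: "i \<in> {1..n} \<Longrightarrow> (clip r)(i := clip r i - 1) = clip (r(i := r i - 1))"
  by (auto simp: clip_def)

lemma clip_sum: "1 \<le> i \<Longrightarrow> sum (clip r) {i<..n} = sum r {i<..n}"
  by (rule sum.cong) (auto simp: clip_def)

lemma clip_id: "(r, s) \<in> supp \<Longrightarrow> clip r = r \<and> clip s = s"
  by (auto simp: zw.supp_def clip_def fun_eq_iff)

lemma evl_monomial: "evl (z_monomial n r) = zmon (clip r)" "evl (w_monomial n r) = wmon (clip r)"
  by (metis evl_mon xm_clip)+

lemma monomial_fp [intro]: "z_monomial n r \<in> fp" "w_monomial n r \<in> fp"
  using xm_clip zw.xm_fpoly zw.ym_fpoly by metis+

lemma z_deriv_eq: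
  assumes i: "i \<in> {1..n}"
  shows "z_deriv n q i = transport (dz i)"
  unfolding z_deriv_def zw_algebra_def zw_class_def
proof (rule the_equality, intro conjI allI)
  show D: "linear_operator alg (transport (dz i))"
    by (rule linear_operator_transport) (auto intro: dz)
  show v: "transport (dz i) (cls (z_monomial n r * w_monomial n s)) = cls (scal (q ^ (\<Sum>j\<in>{i<..n}. r j) * qint q (r i)) *
          z_monomial n (r(i := r i - 1)) * w_monomial n s)" for r s
  proof -
    let ?p = "scal (q ^ (\<Sum>j\<in>{i<..n}. r j) * qint q (r i)) * z_monomial n (r(i := r i - 1)) * w_monomial n s"
    have p: "?p \<in> fp" by auto
    have "dz i (evl (z_monomial n r * w_monomial n s)) = dz i (mzw (clip r, clip s))"
      by (simp add: evl_simps(5) evl_monomial mzw_def)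
    also have "\<dots> = evl ?p"
      using i clip_sum[of i r] unfolding dz_mzw[OF clip_supp] clip_upd[OF i] mult.assoc evl_scal
      by (simp add: evl_simps(5) evl_monomial mzw_def clip_def[of r i])
    finally show ?thesis
      using transport_cls[OF fpoly_mult[OF monomial_fp] p, of "dz i" r s] by simp
  qed
  fix D assume "linear_operator alg D \<and>
     (\<forall>r s. D (cls (z_monomial n r * w_monomial n s)) = cls (scal (q ^ (\<Sum>j\<in>{i<..n}. r j) * qint q (r i)) *
          z_monomial n (r(i := r i - 1)) * w_monomial n s))"
  then show "D = transport (dz i)"
    using D v by (intro zw.linear_operator_unique) (metis clip_id xm_clip)+
qed

lemma w_deriv_eq:
  assumes i: "i \<in> {1..n}"
  shows "w_deriv n q i = transport (db i)"
  unfolding w_deriv_def zw_algebra_def zw_class_def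
proof (rule the_equality, intro conjI allI)
  show D: "linear_operator alg (transport (db i))"
    by (rule linear_operator_transport) (auto intro: db)
  show v: "transport (db i) (cls (w_monomial n r * z_monomial n s)) = cls (scal (q powi (- int (\<Sum>j\<in>{i<..n}. r j)) * qint q (r i)) *
          w_monomial n (r(i := r i - 1)) * z_monomial n s)" for r s
  proof -
    let ?p = "scal (q powi (- int (\<Sum>j\<in>{i<..n}. r j)) * qint q (r i)) * w_monomial n (r(i := r i - 1)) * z_monomial n s"
    have p: "?p \<in> fp" by auto
    have "db i (evl (w_monomial n r * z_monomial n s)) = db i (mwz (clip s, clip r))"
      by (simp add: evl_simps(5) evl_monomial mwz_def)
    also have "\<dots> = evl ?p"
      using i clip_sum[of i r] unfolding db_mwz[OF clip_supp] clip_upd[OF i] mult.assoc evl_scal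
      by (simp add: evl_simps(5) evl_monomial mwz_def clip_def[of r i])
    finally show ?thesis
      using transport_cls[OF fpoly_mult[OF monomial_fp(2,1)] p, of "db i" r s] by simp
  qed
  fix D assume "linear_operator alg D \<and>
     (\<forall>r s. D (cls (w_monomial n r * z_monomial n s)) = cls (scal (q powi (- int (\<Sum>j\<in>{i<..n}. r j)) * qint q (r i)) *
          w_monomial n (r(i := r i - 1)) * z_monomial n s))"
  then show "D = transport (db i)"
    using D v by (intro wz.linear_operator_unique) (metis clip_id xm_clip supp_swap)+
qed

definition lap :: "lop \<Rightarrow> lop" where "lap x = (\<Sum>i\<in>{1..n}. dz i (db i x))"

lemma lap: "linop lap"
  by (rule linopI) (simp_all add: lap_def linop_simps[OF dz] linop_simps[OF db] sum.distrib lop.scale_sum_right)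

lemma q_laplace_zero_iff:
  assumes p: "p \<in> fp"
  shows "q_laplace n q (cls p) = \<zero>\<^bsub>zw_algebra n q\<^esub> \<longleftrightarrow> lap (evl p) = 0"
proof -
  have "\<exists>u\<in>fp. evl u = dz i (db i (evl p))" for i
    by (rule B_rep[OF B_dz[OF B_db[OF B_evl[OF p]]]])
  then obtain u where u: "\<And>i. u i \<in> fp" "\<And>i. evl (u i) = dz i (db i (evl p))" by metis
  have "z_deriv n q i (w_deriv n q i (cls p)) = cls (u i)" if i: "i \<in> {1..n}" for i
  proof -
    obtain v where v: "v \<in> fp" "evl v = db i (evl p)"
      using B_rep[OF B_db[OF B_evl[OF p]]] by (rule bexE)
    have "w_deriv n q i (cls p) = cls v"
      using transport_cls[of p v "db i", OF p v] by (simp add: w_deriv_eq[OF i])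
    then show ?thesis
      using transport_cls[of v "u i" "dz i"] v u[of i] by (simp add: z_deriv_eq[OF i])
  qed
  note D = this
  interpret A: ring alg by (rule ring_alg)
  have "q_laplace n q (cls p) = (\<Oplus>\<^bsub>alg\<^esub>i\<in>{1..n}. cls (u i))"
    unfolding q_laplace_def zw_algebra_def
    by (rule A.finsum_cong'[OF refl]) (simp_all add: D u(1) carrier_alg)
  also have "\<dots> = cls (\<Sum>i\<in>{1..n}. u i)" by (rule alg_finsum) (use u in auto)
  finally have e: "q_laplace n q (cls p) = cls (\<Sum>i\<in>{1..n}. u i)" .
  have "evl (\<Sum>i\<in>{1..n}. u i) = lap (evl p)" by (simp add: evl_simps(10) u(2) lap_def)
  then show ?thesis
    unfolding e zw_algebra_def alg_zero using u(1) by (simp add: cls_eq_evl fpoly_sum evl_simps(2))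
qed

end

section \<open>Twisted Leibniz rules\<close>

context zw_setup
begin

abbreviation qi where "qi a \<equiv> qint q a"

lemma qq: "q - inverse q \<noteq> 0"
proof
  assume "q - inverse q = 0"
  then have "q * q = 1" using q0 by (simp add: field_simps)
  then show False using qroot[of 2] by (simp add: power2_eq_square)
qed

lemma qint_alt: "qi a = (q ^ a - 1 / q ^ a) / (q - inverse q)"
  by (simp add: qint_def power_int_minus field_simps)

lemma powi_diff: "q powi (x - y) = q powi x / q powi y"
  using q0 by (simp add: power_int_diff)

lemma qint_mult: "qi a * (q - inverse q) = q ^ a - 1 / q ^ a"
  using qq by (simp add: qint_alt)

lemma qint_eqI: "x * (q - inverse q) = y * (q - inverse q) \<Longrightarrow> x = y"
  using qq by simp

lemma qint_Suc: "qi (Suc a) = q * qi a + 1 / q ^ a"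
  by (rule qint_eqI) (use q0 in \<open>simp add: distrib_right mult.assoc qint_mult, simp add: field_simps\<close>)

lemma qint_Suc': "qi (Suc a) = qi a / q + q ^ a"
proof (rule qint_eqI)
  have "(qi a / q + q ^ a) * (q - inverse q) = qi a * (q - inverse q) / q + q ^ a * (q - inverse q)"
    by (simp add: distrib_right)
  then show "qi (Suc a) * (q - inverse q) = (qi a / q + q ^ a) * (q - inverse q)"
    unfolding qint_mult using q0 by (simp add: field_simps)
qed

lemma qint_nonzero: "a > 0 \<Longrightarrow> qi a \<noteq> 0"
proof
  assume a: "a > 0" "qi a = 0"
  then have "q ^ a * q ^ a = 1" using qint_mult[of a] q0 by (simp add: field_simps)
  then have "q ^ (2 * a) = 1" by (simp add: power_add mult_2)
  then show False using qroot[of "2 * a"] a(1) by simp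
qed

lemma z_zmon: "i \<in> {1..n} \<Longrightarrow> z i * zmon r = scale (1 / q ^ sum r {1..<i}) (zmon (r(i := Suc (r i))))"
  using cong_evl[OF zw.x_xm, of i r]
  unfolding evl_scal unfolding evl_simps(5,7) evl_mon gen_simps by (simp add: power_inverse divide_inverse)

lemma zmon_z: "i \<in> {1..n} \<Longrightarrow> zmon r * z i = scale (1 / q ^ sum r {i<..n}) (zmon (r(i := Suc (r i))))"
  using cong_evl[OF zw.xm_x, of i r]
  unfolding evl_scal unfolding evl_simps(5,7) evl_mon gen_simps by (simp add: power_inverse divide_inverse)

lemma w_wmon: "i \<in> {1..n} \<Longrightarrow> w i * wmon r = scale (q ^ sum r {1..<i}) (wmon (r(i := Suc (r i))))"
  using cong_evl[OF zw.y_ym, of i r]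
  unfolding evl_scal unfolding evl_simps(5,7) evl_mon gen_simps by simp

lemma wmon_w: "i \<in> {1..n} \<Longrightarrow> wmon r * w i = scale (q ^ sum r {i<..n}) (wmon (r(i := Suc (r i))))"
  using cong_evl[OF zw.ym_y, of i r]
  unfolding evl_scal unfolding evl_simps(5,7) evl_mon gen_simps by simp

lemma z_mzw: "i \<in> {1..n} \<Longrightarrow> z i * mzw (r, s) = scale (1 / q ^ sum r {1..<i}) (mzw (r(i := Suc (r i)), s))"
  by (simp add: mzw_def mult.assoc[symmetric] z_zmon scale_mult_left)

lemma mzw_w: "i \<in> {1..n} \<Longrightarrow> mzw (r, s) * w i = scale (q ^ sum s {i<..n}) (mzw (r, s(i := Suc (s i))))"
  by (simp add: mzw_def mult.assoc wmon_w scale_mult_right)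

lemma w_mwz: "i \<in> {1..n} \<Longrightarrow> w i * mwz (r, s) = scale (q ^ sum s {1..<i}) (mwz (r, s(i := Suc (s i))))"
  by (simp add: mwz_def mult.assoc[symmetric] w_wmon scale_mult_left)

lemma mwz_z: "i \<in> {1..n} \<Longrightarrow> mwz (r, s) * z i = scale (1 / q ^ sum r {i<..n}) (mwz (r(i := Suc (r i)), s))"
  by (simp add: mwz_def mult.assoc zmon_z scale_mult_right)

lemma supp_upd:
  "i \<in> {1..n} \<Longrightarrow> (r, s) \<in> supp \<Longrightarrow> (r(i := v), s) \<in> supp"
  "i \<in> {1..n} \<Longrightarrow> (r, s) \<in> supp \<Longrightarrow> (r, s(i := v)) \<in> supp"
  by (auto simp: supp_iff)

lemma sum_Suc:
  fixes r :: "nat \<Rightarrow> nat"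
  assumes "finite I"
  shows "sum (r(j := Suc (r j))) I = sum r I + (if j \<in> I then 1 else 0)"
proof -
  have "sum (r(j := Suc (r j))) I = (\<Sum>i\<in>I. r i + (if i = j then 1 else 0))"
    by (rule sum.cong) auto
  then show ?thesis using assms by (simp add: sum.distrib)
qed

lemma dz_w: "x \<in> B \<Longrightarrow> j \<in> {1..n} \<Longrightarrow> dz i (x * w j) = dz i x * w j"
proof (induction rule: B_zw_induct)
  case (mon r s)
  then show ?case
    by (simp add: mzw_w linop_simps[OF dz] dz_mzw supp_upd scale_mult_left mult.commute)
qed (simp_all add: linop_simps[OF dz] distrib_right scale_mult_left)

lemma db_z: "x \<in> B \<Longrightarrow> j \<in> {1..n} \<Longrightarrow> db i (x * z j) = db i x * z j"
proof (induction rule: B_wz_induct)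
  case (mon r s)
  then show ?case
    by (simp add: mwz_z linop_simps[OF db] db_mwz supp_upd scale_mult_left mult.commute)
qed (simp_all add: linop_simps[OF db] distrib_right scale_mult_left)

text \<open>For i < j the added z_j multiplies the coefficient of the derivative by
  \<open>q\<close>, while the removed z_i multiplies the reordering factor of z_j by
  \<open>q\<close> as well on the other side; the two effects cancel. For j < i neither
  occurs.\<close>

lemma dz_z: "x \<in> B \<Longrightarrow> j \<in> {1..n} \<Longrightarrow> i \<in> {1..n} \<Longrightarrow> j \<noteq> i \<Longrightarrow> dz i (z j * x) = z j * dz i x"
proof (induction rule: B_zw_induct)
  case (mon r s)
  show ?case
  proof (cases "r i = 0")
    case True
    then show ?thesis
      using mon by (simp add: z_mzw linop_simps[OF dz] dz_mzw supp_upd)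
  next
    case False
    define r' where "r' = r(i := r i - 1)"
    let ?e = "if i < j then 1 else 0 :: nat"
    let ?r = "r(j := Suc (r j))"
    have r: "r = r'(i := Suc (r' i))" using False by (auto simp: r'_def)
    have u: "?r(i := r i - 1) = r'(j := Suc (r' j))" "?r i = r i"
      using mon False by (auto simp: r'_def)
    have S: "sum ?r {i<..n} = sum r {i<..n} + ?e"
      using mon by (subst sum_Suc) auto
    have S': "sum r {1..<j} = sum r' {1..<j} + ?e"
      unfolding r using mon by (subst sum_Suc) auto
    have d: "dz i (mzw (r, s)) = scale (q ^ sum r {i<..n} * qi (r i)) (mzw (r', s))"
      using dz_mzw[OF mon(1), of i] unfolding r'_def .
    have "dz i (mzw (?r, s)) = scale (q ^ (sum r {i<..n} + ?e) * qi (r i)) (mzw (r'(j := Suc (r' j)), s))"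
      using dz_mzw[OF supp_upd(1)[OF mon(2,1)], of i "Suc (r j)"] unfolding u(2) S unfolding u(1) .
    then have lhs: "dz i (z j * mzw (r, s)) = scale (1 / q ^ (sum r' {1..<j} + ?e) * (q ^ (sum r {i<..n} + ?e) * qi (r i)))
        (mzw (r'(j := Suc (r' j)), s))"
      unfolding z_mzw[OF mon(2)] linop_scale[OF dz] S' by simp
    have coef: "1 / q ^ (sum r' {1..<j} + ?e) * (q ^ (sum r {i<..n} + ?e) * qi (r i))
        = q ^ sum r {i<..n} * qi (r i) * (1 / q ^ sum r' {1..<j})"
      using q0 by (simp add: power_add)
    have "z j * dz i (mzw (r, s)) = scale (q ^ sum r {i<..n} * qi (r i) * (1 / q ^ sum r' {1..<j}))
        (mzw (r'(j := Suc (r' j)), s))"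
      unfolding d scale_mult_right z_mzw[OF mon(2)] by simp
    then show ?thesis by (simp only: lhs coef)
  qed
qed (simp_all add: linop_simps[OF dz] distrib_left scale_mult_right)

lemma db_w: "x \<in> B \<Longrightarrow> j \<in> {1..n} \<Longrightarrow> i \<in> {1..n} \<Longrightarrow> j \<noteq> i \<Longrightarrow> db i (w j * x) = w j * db i x"
proof (induction rule: B_wz_induct)
  case (mon r s)
  show ?case
  proof (cases "s i = 0")
    case True
    then show ?thesis
      using mon by (simp add: w_mwz linop_simps[OF db] db_mwz supp_upd)
  next
    case False
    define s' where "s' = s(i := s i - 1)"
    let ?e = "if i < j then 1 else 0 :: nat"
    let ?s = "s(j := Suc (s j))"
    have s: "s = s'(i := Suc (s' i))" using False by (auto simp: s'_def)
    have u: "?s(i := s i - 1) = s'(j := Suc (s' j))" "?s i = s i"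
      using mon False by (auto simp: s'_def)
    have S: "sum ?s {i<..n} = sum s {i<..n} + ?e"
      using mon by (subst sum_Suc) auto
    have S': "sum s {1..<j} = sum s' {1..<j} + ?e"
      unfolding s using mon by (subst sum_Suc) auto
    have d: "db i (mwz (r, s)) = scale (q powi (- int (sum s {i<..n})) * qi (s i)) (mwz (r, s'))"
      using db_mwz[OF mon(1), of i] unfolding s'_def .
    have "db i (mwz (r, ?s)) = scale (q powi (- int (sum s {i<..n} + ?e)) * qi (s i)) (mwz (r, s'(j := Suc (s' j))))"
      using db_mwz[OF supp_upd(2)[OF mon(2,1)], of i "Suc (s j)"] unfolding u(2) S unfolding u(1) .
    then have lhs: "db i (w j * mwz (r, s)) = scale (q ^ (sum s' {1..<j} + ?e) * (q powi (- int (sum s {i<..n} + ?e)) * qi (s i)))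
        (mwz (r, s'(j := Suc (s' j))))"
      unfolding w_mwz[OF mon(2)] linop_scale[OF db] S' by simp
    have coef: "q ^ (sum s' {1..<j} + ?e) * (q powi (- int (sum s {i<..n} + ?e)) * qi (s i))
        = q powi (- int (sum s {i<..n})) * qi (s i) * q ^ sum s' {1..<j}"
      using q0 by (simp add: power_add power_int_minus del: of_nat_sum of_nat_add)
    have "w j * db i (mwz (r, s)) = scale (q powi (- int (sum s {i<..n})) * qi (s i) * q ^ sum s' {1..<j})
        (mwz (r, s'(j := Suc (s' j))))"
      unfolding d scale_mult_right w_mwz[OF mon(2)] by simp
    then show ?thesis by (simp only: lhs coef)
  qed
qed (simp_all add: linop_simps[OF db] distrib_left scale_mult_right)

lemma dz_z_same_mon: "(r, s) \<in> supp \<Longrightarrow> i \<in> {1..n} \<Longrightarrow>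
  dz i (z i * mzw (r, s)) = scale (q ^ sum r {i<..n} / q ^ sum r {1..<i} * qi (Suc (r i))) (mzw (r, s))"
proof -
  assume *: "(r, s) \<in> supp" "i \<in> {1..n}"
  have "sum (r(i := Suc (r i))) {i<..n} = sum r {i<..n}" by (subst sum_Suc) auto
  then show ?thesis using * by (simp add: z_mzw linop_simps[OF dz] dz_mzw supp_upd)
qed

text \<open>Only the total degree in z is fixed, with any degree in w: this is the number on which
  the scalars in \<open>dz_last\<close> and \<open>euler\<close> depend.\<close>

definition zdeg :: "nat \<Rightarrow> lop set" where
  "zdeg R = evl ` zw.V {(r, s) \<in> supp. sum r {1..n} = R}"

lemma evl_V_add: "x \<in> evl ` zw.V A \<Longrightarrow> y \<in> evl ` zw.V A \<Longrightarrow> x + y \<in> evl ` zw.V A"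
  by (auto simp flip: evl_simps(1) intro!: imageI zw.V_add)

lemma evl_V_scale: "x \<in> evl ` zw.V A \<Longrightarrow> scale c x \<in> evl ` zw.V A"
  by (auto simp flip: evl_scal intro!: imageI zw.V_scal)

lemma evl_V_mon: "(r, s) \<in> A \<Longrightarrow> mzw (r, s) \<in> evl ` zw.V A"
  by (auto simp flip: evl_pair(1) intro!: imageI zw.V_mon)

lemma evl_V_zero: "0 \<in> evl ` zw.V A"
  using zw.V_J[OF J_zero] evl_simps(2) by (metis image_eqI)

lemma zdeg_add: "x \<in> zdeg R \<Longrightarrow> y \<in> zdeg R \<Longrightarrow> x + y \<in> zdeg R"
  unfolding zdeg_def by (rule evl_V_add)

lemma zdeg_scale: "x \<in> zdeg R \<Longrightarrow> scale c x \<in> zdeg R"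
  unfolding zdeg_def by (rule evl_V_scale)

lemma zdeg_zero: "0 \<in> zdeg R"
  unfolding zdeg_def by (rule evl_V_zero)

lemma zdeg_sum: "(\<And>i. i \<in> I \<Longrightarrow> f i \<in> zdeg R) \<Longrightarrow> sum f I \<in> zdeg R"
  by (induction I rule: infinite_finite_induct) (auto intro: zdeg_zero zdeg_add)

lemma zdeg_one: "1 \<in> zdeg 0"
proof -
  have "mzw (\<lambda>_. 0, \<lambda>_. 0) \<in> zdeg 0"
    unfolding zdeg_def by (rule evl_V_mon) (simp add: supp_iff)
  then show ?thesis by (simp add: mzw_def zmon_def wmon_def map_replicate_const del: upt_Suc)
qed

lemma zdeg_induct [consumes 1, case_names zero add scale mon]:
  assumes "x \<in> zdeg R" "P 0" "\<And>x y. P x \<Longrightarrow> P y \<Longrightarrow> P (x + y)"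
    "\<And>c x. P x \<Longrightarrow> P (scale c x)" "\<And>r s. (r, s) \<in> supp \<Longrightarrow> sum r {1..n} = R \<Longrightarrow> P (mzw (r, s))"
  shows "P x"
  using assms(1) unfolding zdeg_def by (rule span_zw_induct) (use assms in auto)

lemma zdeg_z: "x \<in> zdeg R \<Longrightarrow> j \<in> {1..n} \<Longrightarrow> z j * x \<in> zdeg (Suc R)"
proof (induction rule: zdeg_induct)
  case (mon r s)
  have "mzw (r(j := Suc (r j)), s) \<in> zdeg (Suc R)"
    unfolding zdeg_def by (rule evl_V_mon) (use mon in \<open>simp add: supp_upd sum_Suc del: fun_upd_apply\<close>)
  then show ?case using mon by (simp add: z_mzw zdeg_scale)
qed (simp_all add: zdeg_zero zdeg_add zdeg_scale distrib_left scale_mult_right)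

lemma zdeg_w: "x \<in> zdeg R \<Longrightarrow> j \<in> {1..n} \<Longrightarrow> x * w j \<in> zdeg R"
proof (induction rule: zdeg_induct)
  case (mon r s)
  have "mzw (r, s(j := Suc (s j))) \<in> zdeg R"
    unfolding zdeg_def by (rule evl_V_mon) (use mon in \<open>simp add: supp_upd\<close>)
  then show ?case using mon by (simp add: mzw_w zdeg_scale)
qed (simp_all add: zdeg_zero zdeg_add zdeg_scale distrib_right scale_mult_left)

text \<open>On an ordered monomial this is [r+1] = q[r] + q^(-r) for the exponent r of z_n.
  Reordering contributes q to minus the sum of the other exponents, and together they give
  q^(-R).\<close>

lemma dz_last: "x \<in> zdeg R \<Longrightarrow> n \<ge> 1 \<Longrightarrow>
  dz n (z n * x) = scale q (z n * dz n x) + scale (1 / q ^ R) x"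
proof (induction rule: zdeg_induct)
  case (mon r s)
  have "{1..n} = insert n {1..<n}" using mon by auto
  then have R: "R = r n + sum r {1..<n}" using mon(2) by simp
  have "z n * dz n (mzw (r, s)) = scale (qi (r n) / q ^ sum r {1..<n}) (mzw (r, s))"
  proof (cases "r n = 0")
    case False
    then have "r(n := r n - 1, n := Suc ((r(n := r n - 1)) n)) = r" by auto
    moreover have "sum (r(n := r n - 1)) {1..<n} = sum r {1..<n}" by (rule sum.cong) auto
    ultimately show ?thesis using mon by (simp add: dz_mzw z_mzw scale_mult_right)
  qed (use mon in \<open>simp add: dz_mzw\<close>)
  then show ?case
    using mon by (simp add: dz_z_same_mon R qint_Suc power_add lop.scale_left_distrib[symmetric] add_divide_distrib)
next
  case (add x y)
  then show ?case by (simp add: linop_simps[OF dz] distrib_left lop.scale_right_distrib algebra_simps)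
next
  case (scale c x)
  then show ?case by (simp add: linop_simps[OF dz] scale_mult_right lop.scale_right_distrib mult.commute)
qed (simp add: linop_simps[OF dz])

text \<open>A telescoping sum. Multiplied by \<open>q - inverse q\<close>, the i-th term is the
  difference of the values at m = i - 1 and m = i of q to the sum of the t_j with j > m minus the
  sum of those with j <= m.\<close>

lemma euler_sum:
  fixes t :: "nat \<Rightarrow> nat"
  assumes "m \<le> n"
  shows "(\<Sum>i\<in>{1..m}. q powi (int (sum t {i<..n}) - int (sum t {1..<i})) * qi (t i)) * (q - inverse q)
    = q powi int (sum t {1..n}) - q powi (int (sum t {m<..n}) - int (sum t {1..m}))"
  using assms
proof (induction m)
  case 0
  have "{0<..n} = {1..n}" by auto
  then show ?case by simp
next
  case (Suc m)
  have "{m<..n} = insert (Suc m) {Suc m<..n}" using Suc.prems by auto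
  then have e: "sum t {m<..n} = t (Suc m) + sum t {Suc m<..n}" by simp
  have f: "{1..<Suc m} = {1..m}" by auto
  let ?a = "q powi (int (sum t {Suc m<..n}) - int (sum t {1..m}))"
  have "?a * qi (t (Suc m)) * (q - inverse q) = ?a * q powi int (t (Suc m)) - ?a * q powi (- int (t (Suc m)))"
    by (simp only: mult.assoc qint_mult) (simp add: power_int_minus right_diff_distrib divide_inverse)
  also have "\<dots> = q powi (int (sum t {m<..n}) - int (sum t {1..m})) - q powi (int (sum t {Suc m<..n}) - int (sum t {1..Suc m}))"
    unfolding powi_add[symmetric] e by (simp add: algebra_simps)
  finally have step: "?a * qi (t (Suc m)) * (q - inverse q)
    = q powi (int (sum t {m<..n}) - int (sum t {1..m})) - q powi (int (sum t {Suc m<..n}) - int (sum t {1..Suc m}))" .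
  have split: "sum h {1..Suc m} = sum h {1..m} + h (Suc m)" for h :: "nat \<Rightarrow> complex" by simp
  have "m \<le> n" using Suc.prems by simp
  show ?case
    unfolding split distrib_right f Suc.IH[OF \<open>m \<le> n\<close>] step by simp
qed

text \<open>A q-analogue of Euler's identity. \<open>euler_sum\<close> is applied to the exponents
  r_i + 1, whose sum is R + n; the change from r_i to r_i + 1 turns the weight q^(2(n-i)) into the
  constant q^(n-1).\<close>

lemma euler: "x \<in> zdeg R \<Longrightarrow> n \<ge> 1 \<Longrightarrow>
  (\<Sum>i\<in>{1..n}. scale (q ^ (2 * (n - i))) (dz i (z i * x))) = scale (q ^ (n - 1) * qi (R + n)) x"
proof (induction rule: zdeg_induct)
  case (mon r s)
  have T: "sum (\<lambda>i. Suc (r i)) {1..n} = R + n"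
    unfolding Suc_eq_plus1 sum.distrib mon(2) by simp
  have c: "q ^ (2 * (n - i)) * (q ^ sum r {i<..n} / q ^ sum r {1..<i} * qi (Suc (r i)))
    = q ^ (n - 1) * (q powi (int (sum (\<lambda>i. Suc (r i)) {i<..n}) - int (sum (\<lambda>i. Suc (r i)) {1..<i})) * qi (Suc (r i)))"
    if i: "i \<in> {1..n}" for i
  proof -
    have "q ^ (2 * (n - i)) * (q ^ sum r {i<..n} / q ^ sum r {1..<i})
       = q powi (int (2 * (n - i)) + (int (sum r {i<..n}) - int (sum r {1..<i})))"
      by (simp only: powi_add powi_diff power_int_of_nat times_divide_eq_right)
    also have "int (2 * (n - i)) + (int (sum r {i<..n}) - int (sum r {1..<i}))
       = int (n - 1) + (int (sum (\<lambda>i. Suc (r i)) {i<..n}) - int (sum (\<lambda>i. Suc (r i)) {1..<i}))"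
    proof -
      have "sum (\<lambda>i. Suc (r i)) {i<..n} = sum r {i<..n} + (n - i)"
        "sum (\<lambda>i. Suc (r i)) {1..<i} = sum r {1..<i} + (i - 1)"
        unfolding Suc_eq_plus1 sum.distrib by simp_all
      moreover have "int (2 * (n - i)) + (a - c) = int (n - 1) + (a + int (n - i) - (c + int (i - 1)))" for a c
        using i by auto
      ultimately show ?thesis by (simp only: of_nat_add)
    qed
    also have "q powi \<dots> = q ^ (n - 1) * q powi (int (sum (\<lambda>i. Suc (r i)) {i<..n}) - int (sum (\<lambda>i. Suc (r i)) {1..<i}))"
      by (simp only: powi_add power_int_of_nat)
    finally show ?thesis by (simp only: mult.assoc[symmetric])
  qed
  have "(\<Sum>i\<in>{1..n}. scale (q ^ (2 * (n - i))) (dz i (z i * mzw (r, s))))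
    = scale (\<Sum>i\<in>{1..n}. q ^ (2 * (n - i)) * (q ^ sum r {i<..n} / q ^ sum r {1..<i} * qi (Suc (r i)))) (mzw (r, s))"
    unfolding lop.scale_sum_left by (rule sum.cong) (use mon in \<open>simp_all add: dz_z_same_mon\<close>)
  also have "(\<Sum>i\<in>{1..n}. q ^ (2 * (n - i)) * (q ^ sum r {i<..n} / q ^ sum r {1..<i} * qi (Suc (r i))))
    = q ^ (n - 1) * (\<Sum>i\<in>{1..n}. q powi (int (sum (\<lambda>i. Suc (r i)) {i<..n}) - int (sum (\<lambda>i. Suc (r i)) {1..<i})) * qi (Suc (r i)))"
    unfolding sum_distrib_left by (rule sum.cong[OF refl c])
  also have "(\<Sum>i\<in>{1..n}. q powi (int (sum (\<lambda>i. Suc (r i)) {i<..n}) - int (sum (\<lambda>i. Suc (r i)) {1..<i})) * qi (Suc (r i))) = qi (R + n)"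
  proof (rule qint_eqI)
    have "q powi (int (sum (\<lambda>i. Suc (r i)) {n<..n}) - int (R + n)) = 1 / q ^ (R + n)"
      unfolding powi_diff power_int_of_nat by simp
    then show "(\<Sum>i\<in>{1..n}. q powi (int (sum (\<lambda>i. Suc (r i)) {i<..n}) - int (sum (\<lambda>i. Suc (r i)) {1..<i})) * qi (Suc (r i)))
        * (q - inverse q) = qi (R + n) * (q - inverse q)"
      unfolding euler_sum[OF order.refl] T qint_mult power_int_of_nat by (simp only:)
  qed
  finally show ?case .
next
  case (add x y)
  then show ?case by (simp add: linop_simps[OF dz] distrib_left lop.scale_right_distrib sum.distrib)
next
  case (scale c x)
  have "(\<Sum>i\<in>{1..n}. scale (q ^ (2 * (n - i))) (dz i (z i * scale c x)))
    = scale c (\<Sum>i\<in>{1..n}. scale (q ^ (2 * (n - i))) (dz i (z i * x)))"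
    by (simp add: linop_simps[OF dz] scale_mult_right lop.scale_sum_right mult.commute)
  then show ?case using scale by (simp add: mult.commute)
qed (simp add: linop_simps[OF dz])

text \<open>The defect in the Leibniz rule for \<open>db i\<close> and w_i. It is diagonal in the
  basis \<open>mwz\<close> (\<open>Kop_mwz\<close>), and every w_j with j <= i put in front
  contributes a factor \<open>q\<close>; hence it acts by a scalar on the products of partial sums
  below.\<close>

definition Kop :: "nat \<Rightarrow> lop \<Rightarrow> lop" where
  "Kop i x = db i (w i * x) - scale (1 / q) (w i * db i x)"

lemma Kop: "linop (Kop i)"
  by (rule linopI) (simp_all add: Kop_def linop_simps[OF db] distrib_left lop.scale_right_distrib
      scale_mult_right lop.scale_right_diff_distrib mult.commute)

lemma Kop_mwz: "(r, s) \<in> supp \<Longrightarrow> i \<in> {1..n} \<Longrightarrow>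
  Kop i (mwz (r, s)) = scale (q ^ sum s {1..i} / q ^ sum s {i<..n}) (mwz (r, s))"
proof -
  assume *: "(r, s) \<in> supp" "i \<in> {1..n}"
  have "{1..i} = insert i {1..<i}" using * by auto
  then have e: "sum s {1..i} = s i + sum s {1..<i}" by simp
  have 1: "sum (s(i := Suc (s i))) {i<..n} = sum s {i<..n}" by (subst sum_Suc) auto
  have "w i * db i (mwz (r, s)) = scale (q ^ sum s {1..<i} * qi (s i) / q ^ sum s {i<..n}) (mwz (r, s))"
  proof (cases "s i = 0")
    case False
    then have "s(i := s i - 1, i := Suc ((s(i := s i - 1)) i)) = s" by auto
    moreover have "sum (s(i := s i - 1)) {1..<i} = sum s {1..<i}" by (rule sum.cong) auto
    ultimately show ?thesis using * by (simp add: db_mwz w_mwz scale_mult_right power_int_minus divide_inverse mult_ac del: of_nat_sum)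
  qed (use * in \<open>simp add: db_mwz\<close>)
  moreover have "db i (w i * mwz (r, s)) = scale (q ^ sum s {1..<i} * qi (Suc (s i)) / q ^ sum s {i<..n}) (mwz (r, s))"
    using * 1 by (simp add: db_mwz w_mwz linop_simps[OF db] supp_upd power_int_minus divide_inverse mult_ac del: of_nat_sum)
  moreover have "q ^ sum s {1..<i} * qi (Suc (s i)) / q ^ sum s {i<..n} - 1 / q * (q ^ sum s {1..<i} * qi (s i) / q ^ sum s {i<..n})
     = q ^ sum s {1..i} / q ^ sum s {i<..n}"
    unfolding qint_Suc' e power_add by (simp add: distrib_left add_divide_distrib mult_ac)
  ultimately show ?thesis
    unfolding Kop_def by (simp add: lop.scale_left_diff_distrib[symmetric])
qed

lemma Kop_z: "x \<in> B \<Longrightarrow> i \<in> {1..n} \<Longrightarrow> j \<in> {1..n} \<Longrightarrow> Kop i (x * z j) = Kop i x * z j"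
  unfolding Kop_def using db_z[OF B_mult[OF B_w], of i x j i] db_z[of x j i]
  by (simp add: mult.assoc left_diff_distrib scale_mult_left)

lemma Kop_w: "x \<in> B \<Longrightarrow> i \<in> {1..n} \<Longrightarrow> 1 \<le> j \<Longrightarrow> j \<le> i \<Longrightarrow> Kop i (w j * x) = scale q (w j * Kop i x)"
proof (induction rule: B_wz_induct)
  case (mon r s)
  have "sum (s(j := Suc (s j))) {1..i} = Suc (sum s {1..i})" "sum (s(j := Suc (s j))) {i<..n} = sum s {i<..n}"
    using mon by (simp_all add: sum_Suc del: fun_upd_apply)
  then show ?case
    using mon by (simp add: w_mwz linop_simps[OF Kop] Kop_mwz supp_upd scale_mult_right mult_ac)
qed (simp_all add: linop_simps[OF Kop] distrib_left scale_mult_right lop.scale_right_distrib mult.commute)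

lemma Kop_one: "i \<in> {1..n} \<Longrightarrow> Kop i 1 = 1"
  using Kop_mwz[of "\<lambda>_. 0" "\<lambda>_. 0" i]
  by (simp add: supp_iff mwz_def zmon_def wmon_def map_replicate_const del: upt_Suc)

end

section \<open>The Laplacian on products of the quadratic invariants\<close>

context zw_setup
begin

text \<open>The multiplier of \<open>Qop\<close> sees only exponents above \<open>k\<close>. So Q is
  central, whereas Q_{n-1} commutes with z_n and w_n only up to q^2.\<close>

lemma Qop_z: assumes "i \<in> {1..n}" "k \<le> n"
  shows "Qop n q k * z i = scale (if i \<le> k then 1 else q\<^sup>2) (z i * Qop n q k)"
proof (rule lop_eqI)
  fix f and x :: idx
  obtain a l where x: "x = (a, l)" by (cases x)
  have "sum (a(i := a i + 1)) {k<..n} = sum a {k<..n} + (if i \<le> k then 0 else 1)"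
    unfolding sum_upd[OF finite_greaterThanAtMost] using assms by auto
  moreover have "q\<^sup>2 * q powi (- 2 * (A + 1)) = q powi (- 2 * A)" for A
    using powi_add[of 2 "- 2 * (A + 1)"] by simp
  ultimately show "app (Qop n q k * z i) f x = app (scale (if i \<le> k then 1 else q\<^sup>2) (z i * Qop n q k)) f x"
    unfolding x app_lop_simps app_scale app_zop app_Qop
    by (cases "i \<le> k") (simp_all add: mult.left_commute mult.assoc)
qed

lemma Qop_w: assumes "i \<in> {1..n}" "k \<le> n"
  shows "w i * Qop n q k = scale (if i \<le> k then 1 else q\<^sup>2) (Qop n q k * w i)"
proof (rule lop_eqI)
  fix f and x :: idx
  obtain a l where x: "x = (a, l)" by (cases x)
  have "sum (a(i := a i - 1)) {k<..n} = sum a {k<..n} - (if i \<le> k then 0 else 1)"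
    unfolding sum_upd[OF finite_greaterThanAtMost] using assms by auto
  moreover have "q powi (- 2 * (A - 1)) = q\<^sup>2 * q powi (- 2 * A)" for A
    using powi_add[of 2 "- 2 * A"] by simp
  ultimately show "app (w i * Qop n q k) f x = app (scale (if i \<le> k then 1 else q\<^sup>2) (Qop n q k * w i)) f x"
    unfolding x app_lop_simps app_scale app_wop app_Qop
    by (cases "i \<le> k") (simp_all add: mult.left_commute mult.assoc)
qed

lemma Qop_Qop: "Qop n q k * Qop n q k' = Qop n q k' * Qop n q k"
proof (rule lop_eqI)
  fix f and x :: idx
  obtain a l where x: "x = (a, l)" by (cases x)
  show "app (Qop n q k * Qop n q k') f x = app (Qop n q k' * Qop n q k) f x"
    unfolding x app_lop_simps app_Qop by simp
qed

lemma Qu_Qu: "k \<le> n \<Longrightarrow> k' \<le> n \<Longrightarrow> Qu k * Qu k' = Qu k' * Qu k"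
  by (simp add: Qu_eq Qop_Qop)

lemma Qu_z: "i \<in> {1..n} \<Longrightarrow> k \<le> n \<Longrightarrow> i \<le> k \<Longrightarrow> Qu k * z i = z i * Qu k"
  by (simp add: Qu_eq Qop_z)

lemma Qu_w: "i \<in> {1..n} \<Longrightarrow> k \<le> n \<Longrightarrow> i \<le> k \<Longrightarrow> Qu k * w i = w i * Qu k"
  by (simp add: Qu_eq Qop_w)

lemma Qu_z_gt: "i \<in> {1..n} \<Longrightarrow> k < i \<Longrightarrow> Qu k ^ b * z i = scale (q ^ (2 * b)) (z i * Qu k ^ b)"
proof (induction b)
  case (Suc b)
  then have "Qu k * z i = scale (q\<^sup>2) (z i * Qu k)" by (simp add: Qu_eq Qop_z)
  then have "Qu k ^ Suc b * z i = scale (q ^ (2 * b)) (scale (q\<^sup>2) (z i * Qu k) * Qu k ^ b)"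
    using Suc by (simp add: mult.assoc scale_mult_right flip: \<open>Qu k * z i = _\<close>)
  then show ?case by (simp add: scale_mult_left mult.assoc power2_eq_square mult_ac)
qed simp

lemma Qu_w_gt: "i \<in> {1..n} \<Longrightarrow> k < i \<Longrightarrow> w i * Qu k ^ b = scale (q ^ (2 * b)) (Qu k ^ b * w i)"
proof (induction b)
  case (Suc b)
  then have "w i * Qu k = scale (q\<^sup>2) (Qu k * w i)" by (simp add: Qu_eq Qop_w)
  then have "w i * Qu k ^ Suc b = scale (q\<^sup>2) (Qu k * (w i * Qu k ^ b))"
    by (simp add: mult.assoc[symmetric] scale_mult_left)
  then show ?case using Suc by (simp add: scale_mult_right mult.assoc power2_eq_square mult_ac)
qed simp

lemma Qu_rev: "k \<le> n \<Longrightarrow> Qu k = (\<Sum>s\<in>{1..k}. scale (q ^ (2 * (k - s))) (w s * z s))"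
  using cong_evl[OF Q_poly_reversed, of k] unfolding evl_simps(10) evl_scal
  by (simp add: evl_simps(5,7) Qu_def)

lemma Qu_B [intro]: "k \<le> n \<Longrightarrow> Qu k \<in> B"
  unfolding Qu_def by (intro B_sum B_mult B_z B_w) auto

text \<open>General \<open>k\<close> is kept, although the result concerns k = n, because the
  derivative \<open>db i\<close> for i < n is computed by induction on \<open>k\<close>.\<close>

definition X where "X k b a = Qu (k - 1) ^ b * Qu k ^ a"

lemma X_B [intro]: "k \<in> {1..n} \<Longrightarrow> X k b a \<in> B"
  unfolding X_def by (intro B_mult B_power Qu_B) auto

lemma X_z: "i \<in> {1..n} \<Longrightarrow> k \<le> n \<Longrightarrow> i < k \<Longrightarrow> X k b a * z i = z i * X k b a"
proof -
  assume *: "i \<in> {1..n}" "k \<le> n" "i < k"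
  then have "Qu k ^ a * z i = z i * Qu k ^ a" "Qu (k - 1) ^ b * z i = z i * Qu (k - 1) ^ b"
    by (auto intro!: power_commuting_commutes Qu_z)
  then show ?thesis unfolding X_def by (metis mult.assoc)
qed

lemma X_w: "i \<in> {1..n} \<Longrightarrow> k \<le> n \<Longrightarrow> i < k \<Longrightarrow> X k b a * w i = w i * X k b a"
proof -
  assume *: "i \<in> {1..n}" "k \<le> n" "i < k"
  then have "Qu k ^ a * w i = w i * Qu k ^ a" "Qu (k - 1) ^ b * w i = w i * Qu (k - 1) ^ b"
    by (auto intro!: power_commuting_commutes Qu_w)
  then show ?thesis unfolding X_def by (metis mult.assoc)
qed

lemma X_z_last: "k \<in> {1..n} \<Longrightarrow> X k b a * z k = scale (q ^ (2 * b)) (z k * X k b a)"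
proof -
  assume *: "k \<in> {1..n}"
  then have "Qu k ^ a * z k = z k * Qu k ^ a"
    by (intro power_commuting_commutes Qu_z) auto
  then have "X k b a * z k = Qu (k - 1) ^ b * z k * Qu k ^ a" by (simp add: X_def mult.assoc)
  also have "Qu (k - 1) ^ b * z k = scale (q ^ (2 * b)) (z k * Qu (k - 1) ^ b)"
    using * by (intro Qu_z_gt) auto
  finally show ?thesis by (simp only: X_def mult.assoc scale_mult_left)
qed

lemma X_w_last: "k \<in> {1..n} \<Longrightarrow> w k * X k b a = scale (q ^ (2 * b)) (X k b a * w k)"
proof -
  assume *: "k \<in> {1..n}"
  then have "w k * Qu k ^ a = Qu k ^ a * w k"
    by (intro power_commuting_commutes[symmetric] Qu_w) auto
  moreover have "w k * X k b a = scale (q ^ (2 * b)) (Qu (k - 1) ^ b * (w k * Qu k ^ a))"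
    using * Qu_w_gt[of k "k - 1" b] by (simp add: X_def mult.assoc[symmetric] scale_mult_left)
  ultimately show ?thesis by (simp add: X_def mult.assoc)
qed

lemma X_Suc: "X k (Suc b) a = Qu (k - 1) * X k b a"
  by (simp add: X_def mult.assoc)

lemma X_Suc_right: "k \<in> {1..n} \<Longrightarrow> X k (Suc b) a = X k b a * Qu (k - 1)"
proof -
  assume "k \<in> {1..n}"
  then have "Qu k ^ a * Qu (k - 1) = Qu (k - 1) * Qu k ^ a"
    by (intro power_commuting_commutes Qu_Qu) auto
  then show ?thesis by (simp add: X_def mult.assoc power_commutes[symmetric])
qed

text \<open>One factor Q_{k-1} is expanded and its w_i, which commute with the rest for i < k, are
  moved to the far right. In this sandwich form the rules \<open>dz_w\<close> and
  \<open>dz_z\<close> apply; \<open>X_rec_w\<close> is the counterpart for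
  \<open>db\<close>.\<close>

lemma X_rec_z: "k \<in> {1..n} \<Longrightarrow> X k (Suc b) a = (\<Sum>i\<in>{1..k - 1}. z i * X k b a * w i)"
proof -
  assume k: "k \<in> {1..n}"
  have "X k (Suc b) a = (\<Sum>i\<in>{1..k - 1}. z i * (w i * X k b a))"
    by (simp add: X_Suc Qu_def sum_distrib_right mult.assoc)
  also have "\<dots> = (\<Sum>i\<in>{1..k - 1}. z i * X k b a * w i)"
    by (rule sum.cong) (use k in \<open>auto simp: X_w mult.assoc\<close>)
  finally show ?thesis .
qed

lemma X_rec_w: "k \<in> {1..n} \<Longrightarrow>
  X k (Suc b) a = (\<Sum>s\<in>{1..k - 1}. scale (q ^ (2 * (k - 1 - s))) (w s * X k b a * z s))"
proof -
  assume k: "k \<in> {1..n}"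
  then have "k - 1 \<le> n" by auto
  then have "X k (Suc b) a = (\<Sum>s\<in>{1..k - 1}. scale (q ^ (2 * (k - 1 - s))) (w s * (z s * X k b a)))"
    by (simp add: X_Suc Qu_rev sum_distrib_right mult.assoc scale_mult_left)
  also have "\<dots> = (\<Sum>s\<in>{1..k - 1}. scale (q ^ (2 * (k - 1 - s))) (w s * X k b a * z s))"
    by (rule sum.cong) (use k in \<open>auto simp: X_z mult.assoc\<close>)
  finally show ?thesis .
qed

lemma Qu_rec_z: "k \<in> {1..n} \<Longrightarrow> Qu k ^ Suc a = (\<Sum>i\<in>{1..k}. z i * Qu k ^ a * w i)"
proof -
  assume k: "k \<in> {1..n}"
  have "Qu k ^ Suc a = (\<Sum>i\<in>{1..k}. z i * (w i * Qu k ^ a))"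
    by (subst power_Suc, subst Qu_def) (simp add: sum_distrib_right mult.assoc)
  also have "\<dots> = (\<Sum>i\<in>{1..k}. z i * Qu k ^ a * w i)"
  proof (rule sum.cong[OF refl])
    fix i assume "i \<in> {1..k}"
    then have "Qu k ^ a * w i = w i * Qu k ^ a"
      using k by (intro power_commuting_commutes Qu_w) auto
    then show "z i * (w i * Qu k ^ a) = z i * Qu k ^ a * w i" by (simp add: mult.assoc)
  qed
  finally show ?thesis .
qed

lemma Qu_rec_w: "k \<in> {1..n} \<Longrightarrow> Qu k ^ Suc a = (\<Sum>s\<in>{1..k}. scale (q ^ (2 * (k - s))) (w s * Qu k ^ a * z s))"
proof -
  assume k: "k \<in> {1..n}"
  have "Qu k ^ Suc a = (\<Sum>s\<in>{1..k}. scale (q ^ (2 * (k - s))) (w s * (z s * Qu k ^ a)))"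
    using k by (subst power_Suc, subst Qu_rev) (simp_all add: sum_distrib_right mult.assoc scale_mult_left)
  also have "\<dots> = (\<Sum>s\<in>{1..k}. scale (q ^ (2 * (k - s))) (w s * Qu k ^ a * z s))"
  proof (rule sum.cong[OF refl])
    fix i assume "i \<in> {1..k}"
    then have "Qu k ^ a * z i = z i * Qu k ^ a"
      using k by (intro power_commuting_commutes Qu_z) auto
    then show "scale (q ^ (2 * (k - i))) (w i * (z i * Qu k ^ a)) = scale (q ^ (2 * (k - i))) (w i * Qu k ^ a * z i)"
      by (simp add: mult.assoc)
  qed
  finally show ?thesis .
qed

text \<open>From Q_k = z_k w_k + Q_{k-1} and the q^2-commutation of Q_{k-1} with z_k. It brings
  products with a z_k and a w_k outside back into the family \<open>X\<close>.\<close>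

lemma z_X_w: "k \<in> {1..n} \<Longrightarrow> z k * X k b a * w k = scale (1 / q ^ (2 * b)) (X k b (Suc a) - X k (Suc b) a)"
proof -
  assume k: "k \<in> {1..n}"
  have "{1..k} = insert k {1..k - 1}" using k by auto
  moreover have "k \<notin> {1..k - 1}" using k by auto
  ultimately have Q: "Qu k = z k * w k + Qu (k - 1)" by (simp add: Qu_def)
  have "X k b (Suc a) = X k b a * Qu k"
    by (simp add: X_def mult.assoc power_commutes[symmetric])
  also have "\<dots> = X k b a * z k * w k + X k (Suc b) a"
    unfolding Q by (simp add: distrib_left mult.assoc X_Suc_right[OF k])
  also have "X k b a * z k * w k = scale (q ^ (2 * b)) (z k * X k b a * w k)"
    by (simp add: X_z_last[OF k] scale_mult_left)
  finally show ?thesis using q0 by (simp add: lop.scale_right_distrib)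
qed

lemma w_X_z: "k \<in> {1..n} \<Longrightarrow>
  w k * X k b a * z k = scale (q ^ (2 * b)) (X k b (Suc a) - scale (q\<^sup>2) (X k (Suc b) a))"
proof -
  assume k: "k \<in> {1..n}"
  then have "k - 1 \<le> n" by auto
  then have Q: "Qu k = w k * z k + scale (q\<^sup>2) (Qu (k - 1))"
    using k by (simp add: w_z_same Qu_eq)
  have "X k b (Suc a) = X k b a * Qu k"
    by (simp add: X_def mult.assoc power_commutes[symmetric])
  also have "\<dots> = X k b a * w k * z k + scale (q\<^sup>2) (X k (Suc b) a)"
    unfolding Q by (simp add: distrib_left mult.assoc X_Suc_right[OF k] scale_mult_right)
  finally show ?thesis
    by (simp add: X_w_last[OF k] scale_mult_left)
qed

lemma dz_one: "dz i 1 = 0"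
  using dz_mzw[of "\<lambda>_. 0" "\<lambda>_. 0" i]
  by (simp add: supp_iff mzw_def zmon_def wmon_def map_replicate_const del: upt_Suc)

lemma db_one: "db i 1 = 0"
  using db_mwz[of "\<lambda>_. 0" "\<lambda>_. 0" i]
  by (simp add: supp_iff mwz_def zmon_def wmon_def map_replicate_const del: upt_Suc)

lemma zdeg_Qu: "n \<ge> 1 \<Longrightarrow> Qu n ^ a \<in> zdeg a"
proof (induction a)
  case 0
  show ?case using zdeg_one by simp
next
  case (Suc a)
  then show ?case
    by (subst Qu_rec_z) (auto intro!: zdeg_sum zdeg_w zdeg_z)
qed

lemma zdeg_X: "n \<ge> 1 \<Longrightarrow> X n b a \<in> zdeg (b + a)"
proof (induction b)
  case 0
  then show ?case using zdeg_Qu by (simp add: X_def)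
next
  case (Suc b)
  then show ?case
    by (subst X_rec_z) (auto intro!: zdeg_sum zdeg_w zdeg_z)
qed

lemma zdeg_zX: "n \<ge> 1 \<Longrightarrow> z n ^ d * X n b a \<in> zdeg (d + b + a)"
proof (induction d)
  case 0
  then show ?case using zdeg_X by simp
next
  case (Suc d)
  then show ?case using zdeg_z[of "z n ^ d * X n b a" "d + b + a" n] by (simp add: mult.assoc)
qed

lemma w_w_last: "s \<in> {1..k - 1} \<Longrightarrow> k \<le> n \<Longrightarrow> w k * w s = scale q (w s * w k)"
proof -
  assume "s \<in> {1..k - 1}" "k \<le> n"
  then have "w s * w k = scale (inverse q) (w k * w s)" by (intro w_w) auto
  then show ?thesis using q0 by simp
qed

lemma z_z_last: "s \<in> {1..k - 1} \<Longrightarrow> k \<le> n \<Longrightarrow> z k * z s = scale (1 / q) (z s * z k)"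
proof -
  assume "s \<in> {1..k - 1}" "k \<le> n"
  then have "z s * z k = scale q (z k * z s)" by (intro z_z) auto
  then show ?thesis using q0 by simp
qed

lemma sum_last: "k \<ge> 1 \<Longrightarrow> sum f {1..k} = sum f {1..k - 1} + f k" for f :: "nat \<Rightarrow> lop"
  by (cases k) auto

text \<open>In the sandwich expansion, the terms with i < n acquire a factor \<open>q\<close> when
  w_n is moved to the right of w_i, and \<open>dz_last\<close> yields the same factor for i = n. So
  the sum reassembles to q[a] Q^a w_n, and the extra q^(-a) completes [a+1].\<close>

lemma dz_Qu: "n \<ge> 1 \<Longrightarrow> dz n (Qu n ^ a) = scale (qi a) (Qu n ^ (a - 1) * w n)"
proof (induction a)
  case 0
  show ?case by (simp add: dz_one)
next
  case (Suc a)
  have n: "n \<in> {1..n}" using Suc by simp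
  have QB: "Qu n ^ a \<in> B" by (intro B_power Qu_B) simp
  have "dz n (Qu n ^ Suc a) = (\<Sum>i\<in>{1..n - 1}. dz n (z i * Qu n ^ a) * w i) + dz n (z n * Qu n ^ a) * w n"
  proof -
    have "dz n (z i * Qu n ^ a * w i) = dz n (z i * Qu n ^ a) * w i" if "i \<in> {1..n}" for i
      using that by (intro dz_w B_mult B_z QB)
    then have "(\<Sum>i\<in>{1..n}. dz n (z i * Qu n ^ a * w i)) = (\<Sum>i\<in>{1..n}. dz n (z i * Qu n ^ a) * w i)"
      by (rule sum.cong[OF refl])
    then show ?thesis
      unfolding Qu_rec_z[OF n] linop_sum[OF dz] unfolding sum_last[OF Suc.prems] .
  qed
  also have "dz n (z n * Qu n ^ a) = scale q (z n * dz n (Qu n ^ a)) + scale (1 / q ^ a) (Qu n ^ a)"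
    by (rule dz_last[OF zdeg_Qu[OF Suc.prems] Suc.prems])
  also have "(\<Sum>i\<in>{1..n - 1}. dz n (z i * Qu n ^ a) * w i) = (\<Sum>i\<in>{1..n - 1}. scale (q * qi a) (z i * Qu n ^ (a - 1) * w i * w n))"
  proof (rule sum.cong[OF refl])
    fix i assume i: "i \<in> {1..n - 1}"
    then have "dz n (z i * Qu n ^ a) = z i * scale (qi a) (Qu n ^ (a - 1) * w n)"
      using Suc QB by (subst dz_z) auto
    moreover have "w n * w i = scale q (w i * w n)"
      using i by (rule w_w_last) simp
    ultimately show "dz n (z i * Qu n ^ a) * w i = scale (q * qi a) (z i * Qu n ^ (a - 1) * w i * w n)"
      by (simp add: scale_simps mult.assoc mult.commute)
  qed
  also have "(\<Sum>i\<in>{1..n - 1}. scale (q * qi a) (z i * Qu n ^ (a - 1) * w i * w n)) +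
      (scale q (z n * dz n (Qu n ^ a)) + scale (1 / q ^ a) (Qu n ^ a)) * w n
    = scale (q * qi a) ((\<Sum>i\<in>{1..n}. z i * Qu n ^ (a - 1) * w i) * w n) + scale (1 / q ^ a) (Qu n ^ a * w n)"
    using Suc unfolding sum_last[OF Suc.prems]
    by (simp add: distrib_right scale_simps sum_distrib_right lop.scale_sum_right lop.scale_right_distrib mult.assoc add.assoc add.commute)
  also have "scale (q * qi a) ((\<Sum>i\<in>{1..n}. z i * Qu n ^ (a - 1) * w i) * w n) = scale (q * qi a) (Qu n ^ a * w n)"
    by (cases a) (simp, simp only: Qu_rec_z[OF n] diff_Suc_1)
  finally show ?case by (simp add: qint_Suc lop.scale_left_distrib)
qed

text \<open>Each factor Q_{n-1} contributes one \<open>q\<close>, from the exchange of w_n with a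
  w_i of lower index.\<close>

lemma dz_X: "n \<ge> 1 \<Longrightarrow> dz n (X n b a) = scale (q ^ b * qi a) (X n b (a - 1) * w n)"
proof (induction b)
  case 0
  then show ?case using dz_Qu by (simp add: X_def)
next
  case (Suc b)
  have n: "n \<in> {1..n}" using Suc by simp
  have XB: "X n b a \<in> B" using n by auto
  have "dz n (X n (Suc b) a) = (\<Sum>i\<in>{1..n - 1}. scale (q ^ Suc b * qi a) (z i * X n b (a - 1) * w i * w n))"
    unfolding X_rec_z[OF n] linop_sum[OF dz]
  proof (rule sum.cong[OF refl])
    fix i assume i: "i \<in> {1..n - 1}"
    have "dz n (z i * X n b a * w i) = dz n (z i * X n b a) * w i"
      using i by (intro dz_w B_mult B_z XB) auto
    also have "dz n (z i * X n b a) = z i * dz n (X n b a)"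
      using i by (intro dz_z XB) auto
    finally have "dz n (z i * X n b a * w i) = z i * scale (q ^ b * qi a) (X n b (a - 1) * w n) * w i"
      using Suc by simp
    moreover have "w n * w i = scale q (w i * w n)"
      using i by (rule w_w_last) simp
    ultimately show "dz n (z i * X n b a * w i) = scale (q ^ Suc b * qi a) (z i * X n b (a - 1) * w i * w n)"
      by (simp add: scale_simps mult.assoc mult.commute mult.left_commute[of q])
  qed
  then show ?case by (simp add: X_rec_z[OF n] sum_distrib_right lop.scale_sum_right)
qed

lemma Kop_Qu: "k \<in> {1..n} \<Longrightarrow> Kop k (Qu k ^ a) = scale (q ^ a) (Qu k ^ a)"
proof (induction a)
  case 0
  then show ?case by (simp add: Kop_one)
next
  case (Suc a)
  have QB: "Qu k ^ a \<in> B" using Suc by (intro B_power Qu_B) simp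
  have "Kop k (w s * Qu k ^ a * z s) = scale (q ^ Suc a) (w s * Qu k ^ a * z s)" if "s \<in> {1..k}" for s
    using that Suc QB Kop_z[OF B_mult[OF B_w QB], of s k s]
    by (simp add: Kop_w scale_simps mult.assoc)
  then show ?case
    by (simp only: Qu_rec_w[OF Suc.prems] linop_simps[OF Kop] lop.scale_sum_right lop.scale_scale)
      (simp add: mult.commute)
qed

lemma Kop_X: "n \<ge> 1 \<Longrightarrow> Kop n (X n b a) = scale (q ^ (a + b)) (X n b a)"
proof (induction b)
  case 0
  then show ?case using Kop_Qu[of n a] by (simp add: X_def)
next
  case (Suc b)
  have n: "n \<in> {1..n}" using Suc by simp
  have XB: "X n b a \<in> B" using n by auto
  have "Kop n (w s * X n b a * z s) = scale (q ^ (a + Suc b)) (w s * X n b a * z s)" if "s \<in> {1..n - 1}" for s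
  proof -
    have "Kop n (w s * X n b a * z s) = Kop n (w s * X n b a) * z s"
      using that by (intro Kop_z B_mult B_w XB) auto
    also have "Kop n (w s * X n b a) = scale q (w s * Kop n (X n b a))"
      using that by (intro Kop_w XB) auto
    finally show ?thesis using Suc by (simp add: scale_simps)
  qed
  then show ?case
    by (simp only: X_rec_w[OF n] linop_simps[OF Kop] lop.scale_sum_right lop.scale_scale)
      (simp add: mult.commute)
qed

text \<open>The mirror image of \<open>dz_Qu\<close>: exchanging z_k with z_s gives 1/q, the defect
  \<open>Kop\<close> gives q^a, and [a+1] = [a]/q + q^a.\<close>

lemma db_Qu_last: "k \<in> {1..n} \<Longrightarrow> db k (Qu k ^ a) = scale (qi a) (Qu k ^ (a - 1) * z k)"
proof (induction a)
  case 0
  show ?case by (simp add: db_one)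
next
  case (Suc a)
  note k = Suc.prems
  have k1: "1 \<le> k" using k by simp
  have QB: "Qu k ^ a \<in> B" using k by (intro B_power Qu_B) simp
  have wk: "db k (w k * Qu k ^ a) = scale (1 / q) (w k * db k (Qu k ^ a)) + scale (q ^ a) (Qu k ^ a)"
    using Kop_Qu[OF k, of a] by (simp add: Kop_def algebra_simps)
  have "db k (Qu k ^ Suc a) = (\<Sum>s\<in>{1..k - 1}. scale (q ^ (2 * (k - s))) (db k (w s * Qu k ^ a) * z s)) + db k (w k * Qu k ^ a) * z k"
  proof -
    have "db k (w s * Qu k ^ a * z s) = db k (w s * Qu k ^ a) * z s" if "s \<in> {1..k}" for s
      using that k by (intro db_z B_mult B_w QB) auto
    then have "(\<Sum>s\<in>{1..k}. scale (q ^ (2 * (k - s))) (db k (w s * Qu k ^ a * z s)))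
        = (\<Sum>s\<in>{1..k}. scale (q ^ (2 * (k - s))) (db k (w s * Qu k ^ a) * z s))"
      by (intro sum.cong) auto
    then show ?thesis
      unfolding Qu_rec_w[OF k] linop_sum[OF db] linop_scale[OF db] unfolding sum_last[OF k1] by simp
  qed
  also have "(\<Sum>s\<in>{1..k - 1}. scale (q ^ (2 * (k - s))) (db k (w s * Qu k ^ a) * z s))
    = (\<Sum>s\<in>{1..k - 1}. scale (1 / q * qi a) (scale (q ^ (2 * (k - s))) (w s * Qu k ^ (a - 1) * z s * z k)))"
  proof (rule sum.cong[OF refl])
    fix s assume s: "s \<in> {1..k - 1}"
    then have "db k (w s * Qu k ^ a) = w s * scale (qi a) (Qu k ^ (a - 1) * z k)"
      using Suc QB by (subst db_w) auto
    moreover have "z k * z s = scale (1 / q) (z s * z k)"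
      using s k by (intro z_z_last) auto
    ultimately show "scale (q ^ (2 * (k - s))) (db k (w s * Qu k ^ a) * z s)
        = scale (1 / q * qi a) (scale (q ^ (2 * (k - s))) (w s * Qu k ^ (a - 1) * z s * z k))"
      by (simp add: scale_simps mult.assoc mult.commute)
  qed
  also have "\<dots> + db k (w k * Qu k ^ a) * z k
    = scale (1 / q * qi a) ((\<Sum>s\<in>{1..k}. scale (q ^ (2 * (k - s))) (w s * Qu k ^ (a - 1) * z s)) * z k) + scale (q ^ a) (Qu k ^ a * z k)"
    unfolding wk Suc.IH[OF k] sum_last[OF k1]
    by (simp add: distrib_right scale_simps sum_distrib_right lop.scale_sum_right lop.scale_right_distrib mult.assoc add.assoc add.commute)
  also have "scale (1 / q * qi a) ((\<Sum>s\<in>{1..k}. scale (q ^ (2 * (k - s))) (w s * Qu k ^ (a - 1) * z s)) * z k) = scale (1 / q * qi a) (Qu k ^ a * z k)"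
    by (cases a) (simp, simp only: Qu_rec_w[OF k] diff_Suc_1)
  finally show ?case by (simp add: qint_Suc' lop.scale_left_distrib)
qed

lemma db_X_last: "k \<in> {1..n} \<Longrightarrow> db k (X k b a) = scale (qi a / q ^ b) (X k b (a - 1) * z k)"
proof (induction b)
  case 0
  then show ?case using db_Qu_last by (simp add: X_def)
next
  case (Suc b)
  note k = Suc.prems
  have XB: "X k b a \<in> B" using k by auto
  have "db k (X k (Suc b) a) = (\<Sum>s\<in>{1..k - 1}. scale (qi a / q ^ Suc b) (scale (q ^ (2 * (k - 1 - s))) (w s * X k b (a - 1) * z s * z k)))"
    unfolding X_rec_w[OF k] linop_sum[OF db]
  proof (rule sum.cong[OF refl])
    fix s assume s: "s \<in> {1..k - 1}"
    have "db k (w s * X k b a * z s) = db k (w s * X k b a) * z s"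
      using s k by (intro db_z B_mult B_w XB) auto
    also have "db k (w s * X k b a) = w s * db k (X k b a)"
      using s k by (intro db_w XB) auto
    finally have "db k (w s * X k b a * z s) = w s * scale (qi a / q ^ b) (X k b (a - 1) * z k) * z s"
      using Suc by simp
    moreover have "z k * z s = scale (1 / q) (z s * z k)"
      using s k by (intro z_z_last) auto
    ultimately show "db k (scale (q ^ (2 * (k - 1 - s))) (w s * X k b a * z s))
        = scale (qi a / q ^ Suc b) (scale (q ^ (2 * (k - 1 - s))) (w s * X k b (a - 1) * z s * z k))"
      by (simp add: linop_simps[OF db] scale_simps mult.assoc mult.commute)
  qed
  then show ?case by (simp add: X_rec_w[OF k] sum_distrib_right lop.scale_sum_right scale_mult_left)
qed

end

section \<open>Derivatives of lower index, and derivatives of products with powers of z_n\<close>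

context zw_setup
begin

lemma z_z_up: "i \<in> {1..k - 1} \<Longrightarrow> k \<le> n \<Longrightarrow> z i * z k = scale q (z k * z i)"
  by (rule z_z) auto

lemma w_Xz_z:
  assumes "i \<in> {1..k - 1}" "k \<in> {1..n}"
  shows "w k * (X k b a * z i) * z k
    = scale (q * q ^ (2 * b)) (X k b (Suc a) * z i) - scale (q * q ^ (2 * b) * q\<^sup>2) (X k (Suc b) a * z i)"
proof -
  have "w k * (X k b a * z i) * z k = scale q (w k * X k b a * z k * z i)"
    using z_z_up[OF assms(1)] assms(2) by (simp add: mult.assoc scale_simps)
  then show ?thesis
    unfolding w_X_z[OF assms(2)]
    by (simp add: scale_simps left_diff_distrib lop.scale_right_diff_distrib mult.assoc)
qed

text \<open>Collects coefficients of three operators, so that only scalar identities remain to be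
  verified in \<open>db_X_step\<close>.\<close>

lemma linear_combination:
  fixes A0 A1 A2 :: lop
  shows "scale e (scale c0 A0 + scale c2 A2) + scale f (scale g1 (scale h1 A1 - scale h0 A0) + scale g2 (scale k0 A0 - scale k2 A2))
    = scale (f * (g1 * h1)) A1 + scale (e * c0 - f * (g1 * h0) + f * (g2 * k0)) A0 + scale (e * c2 - f * (g2 * k2)) A2"
  by (simp add: lop.scale_right_distrib lop.scale_right_diff_distrib lop.scale_left_distrib lop.scale_left_diff_distrib)

text \<open>Induction on the power of Q_k, starting from the known derivative of powers of Q_{k-1}.
  For i < k the derivative passes over w_k on the left and z_k on the right, and these are the
  factors by which the exponent of Q_k is raised. The constant \<open>D\<close> is carried along
  unchanged.\<close>

lemma db_X_step:
  assumes i: "i \<in> {1..k - 1}" and k: "k \<in> {1..n}"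
    and base: "\<And>b. db i (Qu (k - 1) ^ b) = scale (D * qi b) (Qu (k - 1) ^ (b - 1) * z i)"
  shows "db i (X k b a) = scale (D * qi b / q ^ a) (X k (b - 1) a * z i)
    + scale (D * (q ^ (b + 2) * qi a)) (X k b (a - 1) * z i)"
proof (induction a arbitrary: b)
  case 0
  then show ?case using base[of b] by (simp add: X_def)
next
  case (Suc a)
  have XB: "X k b a \<in> B" using k by auto
  define A0 A1 A2 where "A0 = X k b a * z i" "A1 = X k (b - 1) (Suc a) * z i" "A2 = X k (Suc b) (a - 1) * z i"
  \<comment> \<open>\<open>w_X_z\<close> solved for the product with the higher power of Q_k; the
    other two terms are within reach of the induction hypothesis, at \<open>Suc b\<close> and at
    \<open>b\<close>.\<close>
  have X: "X k b (Suc a) = scale (q\<^sup>2) (X k (Suc b) a) + scale (1 / q ^ (2 * b)) (w k * X k b a * z k)"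
    using w_X_z[OF k, of b a] q0 by (simp add: lop.scale_right_diff_distrib)
  have "db i (w k * X k b a * z k) = db i (w k * X k b a) * z k"
    using i k by (intro db_z B_mult B_w XB) auto
  also have "db i (w k * X k b a) = w k * db i (X k b a)"
    using i k by (intro db_w XB) auto
  finally have w: "db i (w k * X k b a * z k) = scale (D / q ^ a) (scale (qi b) (w k * (X k (b - 1) a * z i) * z k))
      + scale (D * q ^ (b + 2)) (scale (qi a) (w k * (X k b (a - 1) * z i) * z k))"
    by (simp add: Suc.IH distrib_left distrib_right scale_simps mult.assoc)
  \<comment> \<open>The q-integer stays in front because \<open>w_Xz_z\<close> fits only a genuine
    predecessor of \<open>b\<close>; for b = 0 the term vanishes, whatever the truncated
    \<open>b - 1\<close> means.\<close>
  have 1: "scale (qi b) (w k * (X k (b - 1) a * z i) * z k)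
      = scale (qi b * q ^ (2 * b) / q) A1 - scale (qi b * q ^ (2 * b) * q) A0"
  proof (cases b)
    case (Suc m)
    have "qi b * (q * q ^ (2 * m)) = qi b * q ^ (2 * b) / q" "qi b * (q * q ^ (2 * m) * q\<^sup>2) = qi b * q ^ (2 * b) * q"
      unfolding Suc using q0 by (simp_all add: field_simps power2_eq_square)
    then show ?thesis
      unfolding A0_A1_A2_def Suc diff_Suc_1 w_Xz_z[OF i k] by (simp add: lop.scale_right_diff_distrib)
  qed simp
  have 2: "scale (qi a) (w k * (X k b (a - 1) * z i) * z k)
      = scale (qi a * q ^ (2 * b) * q) A0 - scale (qi a * q ^ (2 * b) * q * q\<^sup>2) A2"
  proof (cases a)
    case (Suc m)
    have "qi a * (q * q ^ (2 * b)) = qi a * q ^ (2 * b) * q" "qi a * (q * q ^ (2 * b) * q\<^sup>2) = qi a * q ^ (2 * b) * q * q\<^sup>2"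
      by simp_all
    then show ?thesis
      unfolding A0_A1_A2_def Suc diff_Suc_1 w_Xz_z[OF i k] by (simp only: lop.scale_right_diff_distrib lop.scale_scale)
  qed simp
  have "db i (X k b (Suc a)) = scale (q\<^sup>2) (scale (D * qi (Suc b) / q ^ a) A0 + scale (D * (q ^ (Suc b + 2) * qi a)) A2)
    + scale (1 / q ^ (2 * b)) (scale (D / q ^ a) (scale (qi b * q ^ (2 * b) / q) A1 - scale (qi b * q ^ (2 * b) * q) A0)
        + scale (D * q ^ (b + 2)) (scale (qi a * q ^ (2 * b) * q) A0 - scale (qi a * q ^ (2 * b) * q * q\<^sup>2) A2))"
    unfolding X linop_simps[OF db] Suc.IH[of "Suc b"] w 1 2 diff_Suc_1 A0_A1_A2_def ..
  also have "\<dots> = scale (D * qi b / q ^ Suc a) A1 + scale (D * (q ^ (b + 2) * qi (Suc a))) A0 + scale 0 A2"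
    unfolding linear_combination
  proof (intro arg_cong2[of _ _ _ _ "(+)"] arg_cong2[of _ _ _ _ scale] refl)
    show "1 / q ^ (2 * b) * (D / q ^ a * (qi b * q ^ (2 * b) / q)) = D * qi b / q ^ Suc a"
      using q0 by (simp add: field_simps)
    show "q\<^sup>2 * (D * qi (Suc b) / q ^ a) - 1 / q ^ (2 * b) * (D / q ^ a * (qi b * q ^ (2 * b) * q))
        + 1 / q ^ (2 * b) * (D * q ^ (b + 2) * (qi a * q ^ (2 * b) * q)) = D * (q ^ (b + 2) * qi (Suc a))"
      unfolding qint_Suc'[of b] qint_Suc[of a] using q0 by (simp add: field_simps power2_eq_square power_add)
    show "q\<^sup>2 * (D * (q ^ (Suc b + 2) * qi a)) - 1 / q ^ (2 * b) * (D * q ^ (b + 2) * (qi a * q ^ (2 * b) * q * q\<^sup>2)) = 0"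
      using q0 by (simp add: field_simps power2_eq_square power_add)
  qed
  finally show ?case by (simp add: A0_A1_A2_def)
qed

text \<open>Induction on \<open>k\<close>. For i = k this is \<open>db_Qu_last\<close>; for i < k
  the formula for k - 1 is the base of \<open>db_X_step\<close> with b = 0, which contributes the
  factor q^2.\<close>

lemma db_Qu: "k \<le> n \<Longrightarrow> i \<in> {1..k} \<Longrightarrow> db i (Qu k ^ a) = scale (q ^ (2 * (k - i)) * qi a) (Qu k ^ (a - 1) * z i)"
proof (induction k arbitrary: a)
  case (Suc k)
  show ?case
  proof (cases "i = Suc k")
    case True
    then show ?thesis using db_Qu_last[of "Suc k" a] Suc.prems by simp
  next
    case False
    then have i: "i \<in> {1..Suc k - 1}" "Suc k \<in> {1..n}" using Suc.prems by auto
    have "db i (X (Suc k) 0 a) = scale (q ^ (2 * (k - i)) * (q ^ (0 + 2) * qi a)) (X (Suc k) 0 (a - 1) * z i)"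
      using db_X_step[OF i, of "q ^ (2 * (k - i))" 0 a] Suc.IH Suc.prems i by simp
    moreover have "q ^ (2 * (k - i)) * q ^ (0 + 2) = q ^ (2 * (Suc k - i))"
      using i by (simp add: Suc_diff_le power2_eq_square)
    ultimately show ?thesis by (simp add: X_def mult.assoc[symmetric])
  qed
qed simp

lemma db_X: "i \<in> {1..n - 1} \<Longrightarrow> db i (X n b a) = scale (q ^ (2 * (n - 1 - i)) * qi b / q ^ a) (X n (b - 1) a * z i)
    + scale (q ^ (2 * (n - 1 - i)) * (q ^ (b + 2) * qi a)) (X n b (a - 1) * z i)"
  by (rule db_X_step) (auto simp: db_Qu)

abbreviation Y where "Y d b a \<equiv> z n ^ d * X n b a"

lemma X_z_power: "n \<ge> 1 \<Longrightarrow> X n b a * z n ^ d = scale (q ^ (2 * b * d)) (Y d b a)"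
proof (induction d)
  case (Suc d)
  then have n: "n \<in> {1..n}" by simp
  have "X n b a * z n ^ Suc d = X n b a * z n * z n ^ d" by (simp add: mult.assoc)
  also have "\<dots> = scale (q ^ (2 * b)) (z n * (X n b a * z n ^ d))"
    unfolding X_z_last[OF n] by (simp add: scale_mult_left mult.assoc)
  finally show ?case
    using Suc by (simp add: scale_simps mult.assoc power_add mult.commute)
qed simp

lemma w_X_power: "n \<ge> 1 \<Longrightarrow> w n ^ d * X n b a = scale (q ^ (2 * b * d)) (X n b a * w n ^ d)"
proof (induction d)
  case (Suc d)
  then have n: "n \<in> {1..n}" by simp
  have "w n ^ Suc d * X n b a = w n * (w n ^ d * X n b a)" by (simp add: mult.assoc)
  also have "\<dots> = scale (q ^ (2 * b * d)) (w n * X n b a * w n ^ d)"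
    using Suc by (simp add: scale_simps mult.assoc)
  finally show ?case
    unfolding X_w_last[OF n] by (simp add: scale_simps mult.assoc power_add mult.commute)
qed simp

text \<open>\<open>dz_last\<close> is applied once for each z_n. At d = 0 the term z_n X w_n is
  resolved by \<open>z_X_w\<close>, which introduces the second product; further factors z_n only
  change the scalars.\<close>

lemma dz_zX: "n \<ge> 1 \<Longrightarrow> dz n (Y (Suc d) b a)
  = scale (qi (a + d + 1) / q ^ b) (Y d b a) - scale (q ^ (d + 1) * qi a / q ^ b) (Y d (Suc b) (a - 1))"
proof (induction d)
  case 0
  then have n: "n \<in> {1..n}" by simp
  have "dz n (z n * X n b a) = scale q (z n * dz n (X n b a)) + scale (1 / q ^ (b + a)) (X n b a)"
    by (rule dz_last[OF zdeg_X[OF 0] 0])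
  also have "z n * dz n (X n b a) = scale (q ^ b) (scale (qi a) (z n * X n b (a - 1) * w n))"
    unfolding dz_X[OF 0] by (simp add: scale_simps mult.assoc)
  also have "scale (qi a) (z n * X n b (a - 1) * w n) = scale (qi a / q ^ (2 * b)) (X n b a - X n (Suc b) (a - 1))"
    by (cases a) (simp_all add: z_X_w[OF n])
  finally have "dz n (z n * X n b a) = scale (q * (q ^ b * (qi a / q ^ (2 * b))) + 1 / q ^ (b + a)) (X n b a)
      - scale (q * (q ^ b * (qi a / q ^ (2 * b)))) (X n (Suc b) (a - 1))"
    by (simp add: lop.scale_right_diff_distrib lop.scale_left_distrib)
  also have "q * (q ^ b * (qi a / q ^ (2 * b))) + 1 / q ^ (b + a) = qi (a + 0 + 1) / q ^ b"
    using q0 by (simp add: qint_Suc field_simps power_add mult_2_right)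
  also have "q * (q ^ b * (qi a / q ^ (2 * b))) = q ^ (0 + 1) * qi a / q ^ b"
    using q0 by (simp add: field_simps power_add mult_2_right)
  finally show ?case by simp
next
  case (Suc d)
  have "dz n (z n * Y (Suc d) b a) = scale q (z n * dz n (Y (Suc d) b a)) + scale (1 / q ^ (Suc d + b + a)) (Y (Suc d) b a)"
    by (rule dz_last[OF zdeg_zX[OF Suc.prems] Suc.prems])
  also have "z n * dz n (Y (Suc d) b a) = scale (qi (a + d + 1) / q ^ b) (Y (Suc d) b a) - scale (q ^ (d + 1) * qi a / q ^ b) (Y (Suc d) (Suc b) (a - 1))"
    unfolding Suc.IH[OF Suc.prems] by (simp add: right_diff_distrib scale_simps mult.assoc)
  finally have "dz n (z n * Y (Suc d) b a) = scale (q * (qi (a + d + 1) / q ^ b) + 1 / q ^ (Suc d + b + a)) (Y (Suc d) b a)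
      - scale (q * (q ^ (d + 1) * qi a / q ^ b)) (Y (Suc d) (Suc b) (a - 1))"
    by (simp add: lop.scale_right_diff_distrib lop.scale_left_distrib)
  also have "q * (qi (a + d + 1) / q ^ b) + 1 / q ^ (Suc d + b + a) = qi (a + Suc d + 1) / q ^ b"
    using q0 by (simp add: qint_Suc[of "Suc (a + d)"] field_simps power_add)
  also have "q * (q ^ (d + 1) * qi a / q ^ b) = q ^ (Suc d + 1) * qi a / q ^ b"
    by simp
  finally show ?case by (simp add: mult.assoc)
qed

lemma qint_add: "qi (a + c) = qi a / q ^ c + q ^ a * qi c"
  by (rule qint_eqI)
    (use q0 in \<open>simp only: distrib_right times_divide_eq_left mult.assoc qint_mult, simp add: field_simps power_add\<close>)

text \<open>The identity \<open>euler\<close> minus its term i = n, which \<open>dz_zX\<close>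
  evaluates; division by q^2 adjusts the weights to n - 1 variables.\<close>

lemma partial_euler:
  assumes n: "n \<ge> 1"
  shows "(\<Sum>i\<in>{1..n - 1}. scale (q ^ (2 * (n - 1 - i))) (dz i (z i * Y d b a)))
    = scale (q ^ (n + a + d) * qi (b + (n - 1)) / q\<^sup>2) (Y d b a) + scale (q ^ (d + 1) * qi a / (q ^ b * q\<^sup>2)) (Y d (Suc b) (a - 1))"
proof -
  have "(\<Sum>i\<in>{1..n - 1}. scale (q ^ (2 * (n - i))) (dz i (z i * Y d b a))) + dz n (z n * Y d b a)
      = scale (q ^ (n - 1) * qi (d + b + a + n)) (Y d b a)"
    using euler[OF zdeg_zX[OF n] n, of d b a] unfolding sum_last[OF n] by simp
  moreover have "dz n (z n * Y d b a) = dz n (Y (Suc d) b a)" by (simp add: mult.assoc)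
  ultimately have "(\<Sum>i\<in>{1..n - 1}. scale (q ^ (2 * (n - i))) (dz i (z i * Y d b a)))
      = scale (q ^ (n - 1) * qi (d + b + a + n) - qi (a + d + 1) / q ^ b) (Y d b a) + scale (q ^ (d + 1) * qi a / q ^ b) (Y d (Suc b) (a - 1))"
    unfolding dz_zX[OF n] by (simp add: algebra_simps)
  also have "q ^ (n - 1) * qi (d + b + a + n) - qi (a + d + 1) / q ^ b = q ^ (n + a + d) * qi (b + (n - 1))"
  proof -
    \<comment> \<open>With this splitting the addition formula for q-integers reproduces exactly the
      subtracted term.\<close>
    have e: "d + b + a + n = (a + d + 1) + (b + (n - 1))" "n + a + d = (n - 1) + (a + d + 1)" using n by auto
    show ?thesis unfolding e qint_add[of "a + d + 1"] using q0 by (simp add: field_simps power_add)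
  qed
  finally have "scale (1 / q\<^sup>2) (\<Sum>i\<in>{1..n - 1}. scale (q ^ (2 * (n - i))) (dz i (z i * Y d b a)))
      = scale (q ^ (n + a + d) * qi (b + (n - 1)) / q\<^sup>2) (Y d b a) + scale (q ^ (d + 1) * qi a / (q ^ b * q\<^sup>2)) (Y d (Suc b) (a - 1))"
    by (simp add: lop.scale_right_distrib)
  moreover have "scale (1 / q\<^sup>2) (\<Sum>i\<in>{1..n - 1}. scale (q ^ (2 * (n - i))) (dz i (z i * Y d b a)))
      = (\<Sum>i\<in>{1..n - 1}. scale (q ^ (2 * (n - 1 - i))) (dz i (z i * Y d b a)))"
    unfolding lop.scale_sum_right
  proof (rule sum.cong[OF refl])
    fix i assume "i \<in> {1..n - 1}"
    then have "2 * (n - i) = 2 + 2 * (n - 1 - i)" by auto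
    then have "1 / q\<^sup>2 * q ^ (2 * (n - i)) = q ^ (2 * (n - 1 - i))" using q0 by (simp add: power_add power2_eq_square)
    then show "scale (1 / q\<^sup>2) (scale (q ^ (2 * (n - i))) (dz i (z i * Y d b a)))
        = scale (q ^ (2 * (n - 1 - i))) (dz i (z i * Y d b a))" by simp
  qed
  ultimately show ?thesis by simp
qed

lemma db_z_power: "x \<in> B \<Longrightarrow> n \<ge> 1 \<Longrightarrow> db i (x * z n ^ d) = db i x * z n ^ d"
proof (induction d)
  case (Suc d)
  have "x * z n ^ d \<in> B" using Suc by (intro B_mult B_power B_z) auto
  then have "db i (x * z n ^ d * z n) = db i (x * z n ^ d) * z n" using Suc by (intro db_z) auto
  then show ?case using Suc by (simp add: mult.assoc power_commutes)
qed simp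

lemma dz_w_power: "x \<in> B \<Longrightarrow> n \<ge> 1 \<Longrightarrow> dz i (x * w n ^ d) = dz i x * w n ^ d"
proof (induction d)
  case (Suc d)
  have "x * w n ^ d \<in> B" using Suc by (intro B_mult B_power B_w) auto
  then have "dz i (x * w n ^ d * w n) = dz i (x * w n ^ d) * w n" using Suc by (intro dz_w) auto
  then show ?case using Suc by (simp add: mult.assoc power_commutes)
qed simp

lemma db_w_power: "x \<in> B \<Longrightarrow> i \<in> {1..n - 1} \<Longrightarrow> db i (w n ^ d * x) = w n ^ d * db i x"
proof (induction d)
  case (Suc d)
  have "w n ^ d * x \<in> B" using Suc by (intro B_mult B_power B_w) auto
  then have "db i (w n * (w n ^ d * x)) = w n * db i (w n ^ d * x)" using Suc by (intro db_w) auto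
  then show ?case using Suc by (simp add: mult.assoc)
qed simp

end

section \<open>Assembling the Laplacian on products of Q and Q_{n-1} with powers of z_n or
  w_n\<close>

context zw_setup
begin

lemma laplace_combination:
  fixes A B' C :: lop
  shows "scale e (scale c1 (scale p1 A + scale p2 B') + scale c2 (scale p3 B' + scale p4 C) + scale c3 (scale p5 B' - scale p6 C))
    = scale (e * (c1 * p1)) A + scale (e * (c1 * p2 + c2 * p3 + c3 * p5)) B' + scale (e * (c2 * p4 - c3 * p6)) C"
  by (simp add: lop.scale_right_distrib lop.scale_right_diff_distrib lop.scale_left_distrib
      lop.scale_left_diff_distrib distrib_left right_diff_distrib)

lemma qint_add': "qi (a + c) = q ^ c * qi a + qi c / q ^ a"
  using qint_add[of c a] by (simp add: add.commute)

text \<open>Three contributions to the coefficient of the product with one Q fewer: two from i < n,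
  through either term of \<open>db_X\<close>, and one from i = n. Two uses of the addition formula
  merge them.\<close>

lemma laplace_coefficient:
  assumes "n \<ge> 2"
  shows "qi b / q ^ (a + d + b) + q ^ (b + (n - 1) + a + d) * qi (b + (n - 1)) + qi (a + d)
    = q ^ (n - 1) * qi (a + 2 * b + d + n - 1)"
proof -
  have e: "a + 2 * b + d + n - 1 = (a + d + b) + (b + (n - 1))" using assms by auto
  show ?thesis
    unfolding e qint_add[of "a + d + b"] qint_add'[of "a + d" b] using q0 by (simp add: field_simps power_add)
qed

definition S where "S d b a = (\<Sum>i\<in>{1..n - 1}. scale (q ^ (2 * (n - 1 - i))) (dz i (z i * Y d b a)))"

lemma S_pred_b:
  assumes "n \<ge> 2"
  shows "scale (qi b * q ^ (2 * (b - 1) * e)) (S d (b - 1) a)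
    = scale (qi b * (q ^ (2 * b * e) / q ^ (2 * e)) * (q ^ (n + a + d) * qi (b + n - 2) / q\<^sup>2)) (Y d (b - 1) a)
      + scale (qi b * (q ^ (2 * b * e) / q ^ (2 * e)) * (q ^ (d + 1) * qi a * q / (q ^ b * q\<^sup>2))) (Y d b (a - 1))"
proof (cases b)
  case (Suc m)
  have "q ^ (2 * m * e) = q ^ (2 * b * e) / q ^ (2 * e)"
    unfolding Suc using q0 by (simp add: power_add distrib_right)
  moreover have "m + (n - 1) = b + n - 2" using Suc assms by simp
  moreover have "q ^ (d + 1) * qi a / (q ^ m * q\<^sup>2) = q ^ (d + 1) * qi a * q / (q ^ b * q\<^sup>2)"
    unfolding Suc using q0 by simp
  moreover have "n \<ge> 1" using assms by simp
  ultimately show ?thesis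
    unfolding S_def using partial_euler[of d m a] by (simp only: Suc diff_Suc_1 lop.scale_right_distrib lop.scale_scale)
qed simp

lemma S_pred_a:
  assumes "n \<ge> 2"
  shows "scale (qi a) (S d b (a - 1))
    = scale (qi a * (q ^ (n + a + d) * qi (b + (n - 1)) / (q * q\<^sup>2))) (Y d b (a - 1))
      + scale (qi a * (q ^ (d + 1) * qi (a - 1) / (q ^ b * q\<^sup>2))) (Y d (Suc b) (a - 1 - 1))"
proof (cases a)
  case (Suc m)
  have "q ^ (n + m + d) * qi (b + (n - 1)) / q\<^sup>2 = q ^ (n + a + d) * qi (b + (n - 1)) / (q * q\<^sup>2)"
    unfolding Suc using q0 by simp
  moreover have "n \<ge> 1" using assms by simp
  ultimately show ?thesis
    unfolding S_def using partial_euler[of d b m] by (simp only: Suc diff_Suc_1 lop.scale_right_distrib lop.scale_scale)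
qed simp

lemma lap_split: "n \<ge> 2 \<Longrightarrow> lap x = (\<Sum>i\<in>{1..n - 1}. dz i (db i x)) + dz n (db n x)"
  unfolding lap_def by (rule sum_last) simp

text \<open>For i < n, \<open>db_X\<close> leaves two sums of z-derivatives, evaluated by
  \<open>partial_euler\<close>; the term i = n follows from \<open>db_X_last\<close> and
  \<open>dz_zX\<close>. Three products arise. The one with exponents b + 1 of Q_{n-1} and a - 2 of Q
  comes from both parts and cancels.\<close>

lemma lap_Y:
  assumes n2: "n \<ge> 2"
  shows "lap (Y d b a) = scale (q ^ n / (q\<^sup>2 * q ^ d) * (qi b * qi (b + n - 2))) (Y d (b - 1) a)
    + scale (q ^ (n - 1) * (qi a * qi (a + 2 * b + d + n - 1))) (Y d b (a - 1))"
proof -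
  have n1: "n \<ge> 1" and n: "n \<in> {1..n}" using n2 by auto
  have XB: "X n b' a' \<in> B" for b' a' using n by auto
  \<comment> \<open>The power of z_n is put on the right, where \<open>db i\<close> passes over it;
    the scalar from \<open>X_z_power\<close> is divided out again.\<close>
  let ?x = "X n b a * z n ^ d"
  have Yx: "Y d b a = scale (1 / q ^ (2 * b * d)) ?x"
    unfolding X_z_power[OF n1] using q0 by simp
  have lx: "lap (Y d b a) = scale (1 / q ^ (2 * b * d)) (lap ?x)"
    unfolding Yx by (rule linop_scale[OF lap])
  have i_term: "dz i (db i ?x) = scale (1 / q ^ a * (qi b * q ^ (2 * (b - 1) * d))) (scale (q ^ (2 * (n - 1 - i))) (dz i (z i * Y d (b - 1) a)))
      + scale (q ^ (b + 2) * q ^ (2 * b * d) * qi a) (scale (q ^ (2 * (n - 1 - i))) (dz i (z i * Y d b (a - 1))))"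
    if i: "i \<in> {1..n - 1}" for i
  proof -
    have X: "X n b' a' * z i * z n ^ d = scale (q ^ (2 * b' * d)) (z i * Y d b' a')" for b' a'
    proof -
      have "X n b' a' * z i = z i * X n b' a'" using i by (intro X_z) auto
      then show ?thesis by (simp add: mult.assoc X_z_power[OF n1] scale_mult_right)
    qed
    have "db i ?x = db i (X n b a) * z n ^ d" by (rule db_z_power[OF XB n1])
    also have "\<dots> = scale (q ^ (2 * (n - 1 - i)) * qi b / q ^ a * q ^ (2 * (b - 1) * d)) (z i * Y d (b - 1) a)
      + scale (q ^ (2 * (n - 1 - i)) * (q ^ (b + 2) * qi a) * q ^ (2 * b * d)) (z i * Y d b (a - 1))"
      unfolding db_X[OF i] by (simp only: distrib_right scale_mult_left X lop.scale_scale)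
    finally show ?thesis by (simp add: linop_simps[OF dz] mult_ac)
  qed
  have "(\<Sum>i\<in>{1..n - 1}. dz i (db i ?x)) = scale (1 / q ^ a) (scale (qi b * q ^ (2 * (b - 1) * d)) (S d (b - 1) a))
      + scale (q ^ (b + 2) * q ^ (2 * b * d)) (scale (qi a) (S d b (a - 1)))"
    unfolding S_def lop.scale_sum_right sum.distrib[symmetric]
    by (rule sum.cong[OF refl]) (simp only: i_term lop.scale_scale mult.assoc)
  note sum1 = this[unfolded S_pred_b[OF n2] S_pred_a[OF n2]]
  have n_term: "dz n (db n ?x) = scale (q ^ (2 * b * (d + 1)) / q ^ b) (scale (qi a * qi (a + d) / q ^ b) (Y d b (a - 1))
      - scale (qi a * (q ^ (d + 1) * qi (a - 1) / q ^ b)) (Y d (Suc b) (a - 1 - 1)))"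
  proof -
    have "db n ?x = scale (qi a / q ^ b) (X n b (a - 1) * z n ^ Suc d)"
      unfolding db_z_power[OF XB n1] db_X_last[OF n] by (simp add: scale_mult_left mult.assoc)
    then have "dz n (db n ?x) = scale (q ^ (2 * b * (d + 1)) / q ^ b) (scale (qi a) (dz n (Y (Suc d) b (a - 1))))"
      by (simp add: X_z_power[OF n1] linop_simps[OF dz] mult_ac del: power_Suc)
    also have "scale (qi a) (dz n (Y (Suc d) b (a - 1))) = scale (qi a * qi (a + d) / q ^ b) (Y d b (a - 1))
      - scale (qi a * (q ^ (d + 1) * qi (a - 1) / q ^ b)) (Y d (Suc b) (a - 1 - 1))"
      by (cases a) (simp_all add: dz_zX[OF n1] lop.scale_right_diff_distrib del: power_Suc)
    finally show ?thesis .
  qed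
  have qn: "q ^ n = q * q ^ (n - 1)" using n1 by (cases n) auto
  have c1: "1 / q ^ (2 * b * d) * (1 / q ^ a * (qi b * (q ^ (2 * b * d) / q ^ (2 * d)) * (q ^ (n + a + d) * qi (b + n - 2) / q\<^sup>2)))
    = q ^ n / (q\<^sup>2 * q ^ d) * (qi b * qi (b + n - 2))"
    using q0 by (simp add: field_simps power_add mult_2_right)
  have "1 / q ^ (2 * b * d) * (1 / q ^ a * (qi b * (q ^ (2 * b * d) / q ^ (2 * d)) * (q ^ (d + 1) * qi a * q / (q ^ b * q\<^sup>2)))
    + q ^ (b + 2) * q ^ (2 * b * d) * (qi a * (q ^ (n + a + d) * qi (b + (n - 1)) / (q * q\<^sup>2)))
    + q ^ (2 * b * (d + 1)) / q ^ b * (qi a * qi (a + d) / q ^ b))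
    = qi a * (qi b / q ^ (a + d + b) + q ^ (b + (n - 1) + a + d) * qi (b + (n - 1)) + qi (a + d))"
    using q0 by (simp add: field_simps power_add mult_2_right power2_eq_square qn)
  then have c2: "1 / q ^ (2 * b * d) * (1 / q ^ a * (qi b * (q ^ (2 * b * d) / q ^ (2 * d)) * (q ^ (d + 1) * qi a * q / (q ^ b * q\<^sup>2)))
    + q ^ (b + 2) * q ^ (2 * b * d) * (qi a * (q ^ (n + a + d) * qi (b + (n - 1)) / (q * q\<^sup>2)))
    + q ^ (2 * b * (d + 1)) / q ^ b * (qi a * qi (a + d) / q ^ b))
    = q ^ (n - 1) * (qi a * qi (a + 2 * b + d + n - 1))"
    unfolding laplace_coefficient[OF n2] by simp
  \<comment> \<open>The cancellation that makes the recurrence two-term.\<close>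
  have c3: "1 / q ^ (2 * b * d) * (q ^ (b + 2) * q ^ (2 * b * d) * (qi a * (q ^ (d + 1) * qi (a - 1) / (q ^ b * q\<^sup>2)))
    - q ^ (2 * b * (d + 1)) / q ^ b * (qi a * (q ^ (d + 1) * qi (a - 1) / q ^ b))) = 0"
    using q0 by (simp add: field_simps power_add mult_2_right power2_eq_square)
  have "lap (Y d b a) = scale (q ^ n / (q\<^sup>2 * q ^ d) * (qi b * qi (b + n - 2))) (Y d (b - 1) a)
    + scale (q ^ (n - 1) * (qi a * qi (a + 2 * b + d + n - 1))) (Y d b (a - 1)) + scale 0 (Y d (Suc b) (a - 1 - 1))"
    unfolding lx by (simp only: lap_split[OF n2] sum1 n_term laplace_combination c1 c2 c3)
  then show ?thesis by simp
qed

abbreviation U where "U d b a \<equiv> X n b a * w n ^ d"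

lemma w_z_power: "i \<in> {1..n - 1} \<Longrightarrow> w n ^ d * z i = scale (q ^ d) (z i * w n ^ d)"
proof (induction d)
  case (Suc d)
  have "w n ^ Suc d * z i = w n * (w n ^ d * z i)" by (simp add: mult.assoc)
  also have "\<dots> = scale (q ^ d) (w n * z i * w n ^ d)" using Suc by (simp add: scale_mult_right mult.assoc)
  also have "w n * z i = scale q (z i * w n)" using Suc by (intro w_z) auto
  finally show ?case by (simp add: scale_simps mult.assoc mult.commute)
qed simp

lemma db_wX: "n \<ge> 1 \<Longrightarrow> db n (w n ^ Suc d * X n b a)
  = scale (q ^ b * qi (a + d + 1)) (w n ^ d * X n b a) - scale (q ^ (b + 2) / q ^ (d + 1) * qi a) (w n ^ d * X n (Suc b) (a - 1))"
proof (induction d)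
  case 0
  then have n: "n \<in> {1..n}" by simp
  have "db n (w n * X n b a) = scale (1 / q) (w n * db n (X n b a)) + scale (q ^ (a + b)) (X n b a)"
    using Kop_X[OF 0, of b a] by (simp add: Kop_def algebra_simps)
  also have "w n * db n (X n b a) = scale (1 / q ^ b) (scale (qi a) (w n * X n b (a - 1) * z n))"
    unfolding db_X_last[OF n] by (simp add: scale_simps mult.assoc)
  also have "scale (qi a) (w n * X n b (a - 1) * z n) = scale (qi a * q ^ (2 * b)) (X n b a - scale (q\<^sup>2) (X n (Suc b) (a - 1)))"
    by (cases a) (simp_all add: w_X_z[OF n])
  finally have "db n (w n * X n b a) = scale (1 / q * (1 / q ^ b * (qi a * q ^ (2 * b))) + q ^ (a + b)) (X n b a)
      - scale (1 / q * (1 / q ^ b * (qi a * q ^ (2 * b) * q\<^sup>2))) (X n (Suc b) (a - 1))"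
    by (simp only: lop.scale_right_diff_distrib lop.scale_left_distrib lop.scale_scale) (simp add: mult.assoc)
  also have "1 / q * (1 / q ^ b * (qi a * q ^ (2 * b))) + q ^ (a + b) = q ^ b * qi (a + 0 + 1)"
    using q0 by (simp add: qint_Suc' field_simps power_add mult_2_right)
  also have "1 / q * (1 / q ^ b * (qi a * q ^ (2 * b) * q\<^sup>2)) = q ^ (b + 2) / q ^ (0 + 1) * qi a"
    using q0 by (simp add: field_simps power_add mult_2_right power2_eq_square)
  finally show ?case by simp
next
  case (Suc d)
  have n: "n \<in> {1..n}" using Suc by simp
  have K: "Kop n (w n ^ e * X n b a) = scale (q ^ (e + a + b)) (w n ^ e * X n b a)" for e
  proof (induction e)
    case 0
    then show ?case using Kop_X[OF \<open>n \<ge> 1\<close>] by simp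
  next
    case (Suc e)
    have "w n ^ e * X n b a \<in> B" using n by (intro B_mult B_power B_w X_B)
    then have "Kop n (w n * (w n ^ e * X n b a)) = scale q (w n * Kop n (w n ^ e * X n b a))"
      using n by (intro Kop_w) auto
    then show ?case by (simp add: Suc scale_mult_right mult.assoc)
  qed
  let ?x = "w n ^ Suc d * X n b a"
  have "db n (w n * ?x) = scale (1 / q) (w n * db n ?x) + scale (q ^ (Suc d + a + b)) ?x"
    using K[of "Suc d"] unfolding Kop_def by (simp add: algebra_simps del: power_Suc)
  also have "w n * db n ?x = scale (q ^ b * qi (a + d + 1)) ?x - scale (q ^ (b + 2) / q ^ (d + 1) * qi a) (w n ^ Suc d * X n (Suc b) (a - 1))"
    unfolding Suc.IH[OF Suc.prems] by (simp add: right_diff_distrib scale_simps mult.assoc)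
  finally have "db n (w n * ?x) = scale (1 / q * (q ^ b * qi (a + d + 1)) + q ^ (Suc d + a + b)) ?x
      - scale (1 / q * (q ^ (b + 2) / q ^ (d + 1) * qi a)) (w n ^ Suc d * X n (Suc b) (a - 1))"
    by (simp only: lop.scale_right_diff_distrib lop.scale_left_distrib lop.scale_scale) simp
  also have "1 / q * (q ^ b * qi (a + d + 1)) + q ^ (Suc d + a + b) = q ^ b * qi (a + Suc d + 1)"
    using q0 by (simp add: qint_Suc'[of "Suc (a + d)"] field_simps power_add)
  also have "1 / q * (q ^ (b + 2) / q ^ (d + 1) * qi a) = q ^ (b + 2) / q ^ (Suc d + 1) * qi a"
    using q0 by simp
  finally show ?case by (simp only: power_Suc[of _ "Suc d"] mult.assoc)
qed

text \<open>As \<open>lap_Y\<close>, but w_n^d has to stand on the left for \<open>db\<close> and on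
  the right for \<open>dz\<close>, so it is moved across between the two. The power is a successor
  because \<open>db_wX\<close>, which treats i = n, splits off one w_n.\<close>

lemma lap_U:
  assumes n2: "n \<ge> 2"
  shows "lap (U (Suc d) b a) = scale (q ^ n / (q\<^sup>2 * q ^ Suc d) * (qi b * qi (b + n - 2))) (U (Suc d) (b - 1) a)
    + scale (q ^ (n - 1) * (qi a * qi (a + 2 * b + Suc d + n - 1))) (U (Suc d) b (a - 1))"
proof -
  have n1: "n \<ge> 1" and n: "n \<in> {1..n}" using n2 by auto
  have XB: "X n b' a' \<in> B" for b' a' using n by auto
  define e where "e = Suc d"
  let ?x = "w n ^ e * X n b a"
  have Ux: "U e b a = scale (1 / q ^ (2 * b * e)) ?x"
    unfolding w_X_power[OF n1] using q0 by simp
  have lx: "lap (U e b a) = scale (1 / q ^ (2 * b * e)) (lap ?x)"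
    unfolding Ux by (rule linop_scale[OF lap])
  have i_term: "dz i (db i ?x) = scale (1 / q ^ a * q ^ e * (qi b * q ^ (2 * (b - 1) * e))) (scale (q ^ (2 * (n - 1 - i))) (dz i (z i * Y 0 (b - 1) a))) * w n ^ e
      + scale (q ^ (b + 2) * q ^ e * q ^ (2 * b * e) * qi a) (scale (q ^ (2 * (n - 1 - i))) (dz i (z i * Y 0 b (a - 1)))) * w n ^ e"
    if i: "i \<in> {1..n - 1}" for i
  proof -
    have X: "w n ^ e * (X n b' a' * z i) = scale (q ^ e * q ^ (2 * b' * e)) (z i * X n b' a' * w n ^ e)" for b' a'
    proof -
      have "X n b' a' * z i = z i * X n b' a'" using i by (intro X_z) auto
      then have "w n ^ e * (X n b' a' * z i) = w n ^ e * z i * X n b' a'" by (simp add: mult.assoc)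
      also have "\<dots> = scale (q ^ e) (z i * (w n ^ e * X n b' a'))"
        unfolding w_z_power[OF i] by (simp add: scale_mult_left mult.assoc)
      finally show ?thesis unfolding w_X_power[OF n1] by (simp add: scale_mult_right mult.assoc)
    qed
    have D: "dz i (z i * X n b' a' * w n ^ e) = dz i (z i * Y 0 b' a') * w n ^ e" for b' a'
    proof -
      have "dz i (z i * X n b' a' * w n ^ e) = dz i (z i * X n b' a') * w n ^ e"
        using i by (intro dz_w_power B_mult B_z XB n1) auto
      then show ?thesis by simp
    qed
    have "db i ?x = w n ^ e * db i (X n b a)" by (rule db_w_power[OF XB i])
    also have "\<dots> = scale (q ^ (2 * (n - 1 - i)) * qi b / q ^ a * (q ^ e * q ^ (2 * (b - 1) * e))) (z i * X n (b - 1) a * w n ^ e)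
      + scale (q ^ (2 * (n - 1 - i)) * (q ^ (b + 2) * qi a) * (q ^ e * q ^ (2 * b * e))) (z i * X n b (a - 1) * w n ^ e)"
      unfolding db_X[OF i] by (simp only: distrib_left scale_mult_right X lop.scale_scale)
    finally have "dz i (db i ?x) = scale (q ^ (2 * (n - 1 - i)) * qi b / q ^ a * (q ^ e * q ^ (2 * (b - 1) * e))) (dz i (z i * Y 0 (b - 1) a) * w n ^ e)
      + scale (q ^ (2 * (n - 1 - i)) * (q ^ (b + 2) * qi a) * (q ^ e * q ^ (2 * b * e))) (dz i (z i * Y 0 b (a - 1)) * w n ^ e)"
      by (simp only: linop_simps[OF dz] D)
    moreover have "q ^ (2 * (n - 1 - i)) * qi b / q ^ a * (q ^ e * q ^ (2 * (b - 1) * e))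
      = 1 / q ^ a * q ^ e * (qi b * q ^ (2 * (b - 1) * e)) * q ^ (2 * (n - 1 - i))"
      "q ^ (2 * (n - 1 - i)) * (q ^ (b + 2) * qi a) * (q ^ e * q ^ (2 * b * e)) = q ^ (b + 2) * q ^ e * q ^ (2 * b * e) * qi a * q ^ (2 * (n - 1 - i))"
      by simp_all
    ultimately show ?thesis by (simp only: scale_mult_left lop.scale_scale)
  qed
  have "(\<Sum>i\<in>{1..n - 1}. dz i (db i ?x)) = (scale (1 / q ^ a * q ^ e) (scale (qi b * q ^ (2 * (b - 1) * e)) (S 0 (b - 1) a))
      + scale (q ^ (b + 2) * q ^ e * q ^ (2 * b * e)) (scale (qi a) (S 0 b (a - 1)))) * w n ^ e"
    unfolding S_def lop.scale_sum_right sum.distrib[symmetric] sum_distrib_right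
    by (rule sum.cong[OF refl]) (simp only: i_term lop.scale_scale mult.assoc distrib_right)
  also have "\<dots> = scale (1 / q ^ a * q ^ e) (scale (qi b * (q ^ (2 * b * e) / q ^ (2 * e)) * (q ^ (n + a + 0) * qi (b + n - 2) / q\<^sup>2)) (U e (b - 1) a)
      + scale (qi b * (q ^ (2 * b * e) / q ^ (2 * e)) * (q ^ (0 + 1) * qi a * q / (q ^ b * q\<^sup>2))) (U e b (a - 1)))
    + scale (q ^ (b + 2) * q ^ e * q ^ (2 * b * e)) (scale (qi a * (q ^ (n + a + 0) * qi (b + (n - 1)) / (q * q\<^sup>2))) (U e b (a - 1))
      + scale (qi a * (q ^ (0 + 1) * qi (a - 1) / (q ^ b * q\<^sup>2))) (U e (Suc b) (a - 1 - 1)))"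
    unfolding S_pred_b[OF n2] S_pred_a[OF n2] power_0 mult_1_left by (simp only: distrib_right scale_mult_left)
  finally have sum1: "(\<Sum>i\<in>{1..n - 1}. dz i (db i ?x)) = \<dots>" .
  have wU: "dz n (w n ^ d * X n b' a') = scale (q ^ (2 * b' * d) * (q ^ b' * qi a')) (U e b' (a' - 1))" for b' a'
    unfolding w_X_power[OF n1] linop_scale[OF dz] dz_w_power[OF XB n1] dz_X[OF n1]
    by (simp add: scale_simps mult.assoc e_def)
  have n_term: "dz n (db n ?x) = scale 1 (scale (q ^ b * qi (a + d + 1) * (q ^ (2 * b * d) * (q ^ b * qi a))) (U e b (a - 1))
      - scale (q ^ (b + 2) / q ^ (d + 1) * qi a * (q ^ (2 * Suc b * d) * (q ^ Suc b * qi (a - 1)))) (U e (Suc b) (a - 1 - 1)))"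
    unfolding e_def db_wX[OF n1] unfolding linop_simps[OF dz] wU unfolding e_def by (simp only: lop.scale_scale lop.scale_one)
  have qn: "q ^ n = q * q ^ (n - 1)" using n1 by (cases n) auto
  have c1: "1 / q ^ (2 * b * e) * (1 / q ^ a * q ^ e * (qi b * (q ^ (2 * b * e) / q ^ (2 * e)) * (q ^ (n + a + 0) * qi (b + n - 2) / q\<^sup>2)))
    = q ^ n / (q\<^sup>2 * q ^ e) * (qi b * qi (b + n - 2))"
    using q0 by (simp add: field_simps power_add mult_2_right)
  have "1 / q ^ (2 * b * e) * (1 / q ^ a * q ^ e * (qi b * (q ^ (2 * b * e) / q ^ (2 * e)) * (q ^ (0 + 1) * qi a * q / (q ^ b * q\<^sup>2)))
    + q ^ (b + 2) * q ^ e * q ^ (2 * b * e) * (qi a * (q ^ (n + a + 0) * qi (b + (n - 1)) / (q * q\<^sup>2)))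
    + 1 * (q ^ b * qi (a + d + 1) * (q ^ (2 * b * d) * (q ^ b * qi a))))
    = qi a * (qi b / q ^ (a + e + b) + q ^ (b + (n - 1) + a + e) * qi (b + (n - 1)) + qi (a + e))"
    using q0 unfolding e_def by (simp add: field_simps power_add mult_2_right power2_eq_square qn)
  then have c2: "1 / q ^ (2 * b * e) * (1 / q ^ a * q ^ e * (qi b * (q ^ (2 * b * e) / q ^ (2 * e)) * (q ^ (0 + 1) * qi a * q / (q ^ b * q\<^sup>2)))
    + q ^ (b + 2) * q ^ e * q ^ (2 * b * e) * (qi a * (q ^ (n + a + 0) * qi (b + (n - 1)) / (q * q\<^sup>2)))
    + 1 * (q ^ b * qi (a + d + 1) * (q ^ (2 * b * d) * (q ^ b * qi a))))
    = q ^ (n - 1) * (qi a * qi (a + 2 * b + e + n - 1))"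
    unfolding laplace_coefficient[OF n2] by simp
  have c3: "1 / q ^ (2 * b * e) * (q ^ (b + 2) * q ^ e * q ^ (2 * b * e) * (qi a * (q ^ (0 + 1) * qi (a - 1) / (q ^ b * q\<^sup>2)))
    - 1 * (q ^ (b + 2) / q ^ (d + 1) * qi a * (q ^ (2 * Suc b * d) * (q ^ Suc b * qi (a - 1))))) = 0"
    using q0 unfolding e_def by (simp add: field_simps power_add mult_2_right power2_eq_square)
  have "lap (U e b a) = scale (q ^ n / (q\<^sup>2 * q ^ e) * (qi b * qi (b + n - 2))) (U e (b - 1) a)
    + scale (q ^ (n - 1) * (qi a * qi (a + 2 * b + e + n - 1))) (U e b (a - 1)) + scale 0 (U e (Suc b) (a - 1 - 1))"
    unfolding lx by (simp only: lap_split[OF n2] sum1 n_term laplace_combination c1 c2 c3)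
  then show ?thesis by (simp add: e_def)
qed

end

section \<open>The action of the quantum group\<close>

lemma uq_rels_fpoly: "uq_rels n q h \<subseteq> fpoly (uq_gens n)"
proof -
  have g: "i \<in> {1..n} \<Longrightarrow> var (KH i) \<in> fpoly (uq_gens n)" "i \<in> {1..n} \<Longrightarrow> var (KHI i) \<in> fpoly (uq_gens n)"
    "i \<in> {1..<n} \<Longrightarrow> var (E i) \<in> fpoly (uq_gens n)" "i \<in> {1..<n} \<Longrightarrow> var (F i) \<in> fpoly (uq_gens n)" for i
    by (auto intro!: fpoly_var simp: uq_gens_def)
  show ?thesis
    unfolding uq_rels_def
    by (intro Un_least UN_least)
      (auto intro!: fpoly_diff fpoly_add fpoly_mult fpoly_power g)
qed

lemma counit_rels: "r \<in> uq_rels n q h \<Longrightarrow> cnum.ev counit_gen r = 0"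
  unfolding uq_rels_def by (elim UnE UN_E) (auto simp: cnum.ev_simps)

text \<open>The action is an arbitrary map with the required properties; all its values below are
  derived from the module algebra laws and the values on generators.\<close>

locale zw_action = zw_setup +
  fixes h :: complex and act :: "uq_gen ncpoly set \<Rightarrow> zw ncpoly set \<Rightarrow> zw ncpoly set"
  assumes h_square: "h\<^sup>2 = q" and action: "uq_action n q h act"
begin

lemma h0: "h \<noteq> 0"
  using h_square q0 by auto

sublocale uq: presented "uq_gens n" "uq_rels n q h"
  by standard (rule uq_rels_fpoly)

abbreviation ufp where "ufp \<equiv> fpoly (uq_gens n)"

lemma counit_cls:
  assumes "p \<in> ufp" shows "counit (uq.cls p) = nc_eval counit_gen p"
proof -
  have eq: "nc_eval counit_gen p' = nc_eval counit_gen p" if "p' \<in> uq.cls p" for p'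
  proof -
    obtain j where j: "j \<in> uq.J" "p' = j + p" using \<open>p' \<in> uq.cls p\<close> unfolding uq.cls_eq_image by (rule imageE)
    have "uq.J \<subseteq> {p \<in> ufp. cnum.ev counit_gen p = 0}"
      by (rule cnum.ideal_in_kernel[OF uq.presented_axioms]) (erule counit_rels)
    from subsetD[OF this j(1)] have "cnum.ev counit_gen j = 0" by simp
    then show ?thesis by (simp add: j(2) nc_eval_eq cnum.ev_add)
  qed
  have "nc_eval counit_gen ` uq.cls p = {nc_eval counit_gen p}"
  proof (rule antisym)
    show "nc_eval counit_gen ` uq.cls p \<subseteq> {nc_eval counit_gen p}"
      by (rule image_subsetI) (simp only: singleton_iff eq)
    show "{nc_eval counit_gen p} \<subseteq> nc_eval counit_gen ` uq.cls p"
      using imageI[OF uq.cls_self] by simp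
  qed
  then show ?thesis by (simp only: counit_def the_elem_eq)
qed

lemmas action' = action[unfolded uq_action_def Let_def uq_algebra_def uq_class_def zw_algebra_def zw_class_def]

lemmas act_closed = action'[THEN conjunct1, rule_format]
lemmas act_add = action'[THEN conjunct2, THEN conjunct1, rule_format]
lemmas act_smult = action'[THEN conjunct2, THEN conjunct2, THEN conjunct1, rule_format]
lemmas act_add_left = action'[THEN conjunct2, THEN conjunct2, THEN conjunct2, THEN conjunct1, rule_format]
lemmas act_smult_left = action'[THEN conjunct2, THEN conjunct2, THEN conjunct2, THEN conjunct2, THEN conjunct1, rule_format]
lemmas act_one = action'[THEN conjunct2, THEN conjunct2, THEN conjunct2, THEN conjunct2, THEN conjunct2, THEN conjunct1, rule_format]
lemmas act_mult = action'[THEN conjunct2, THEN conjunct2, THEN conjunct2, THEN conjunct2, THEN conjunct2,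
    THEN conjunct2, THEN conjunct1, rule_format]
lemmas act_on_one = action'[THEN conjunct2, THEN conjunct2, THEN conjunct2, THEN conjunct2, THEN conjunct2,
    THEN conjunct2, THEN conjunct2, THEN conjunct1, rule_format]
lemmas act_KH = action'[THEN conjunct2, THEN conjunct2, THEN conjunct2, THEN conjunct2, THEN conjunct2,
    THEN conjunct2, THEN conjunct2, THEN conjunct2, THEN conjunct1, rule_format]
lemmas act_EF = action'[THEN conjunct2, THEN conjunct2, THEN conjunct2, THEN conjunct2, THEN conjunct2,
    THEN conjunct2, THEN conjunct2, THEN conjunct2, THEN conjunct2, THEN conjunct1, rule_format]
lemmas act_comult = action'[THEN conjunct2, THEN conjunct2, THEN conjunct2, THEN conjunct2, THEN conjunct2,
    THEN conjunct2, THEN conjunct2, THEN conjunct2, THEN conjunct2, THEN conjunct2, rule_format]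

lemma kls_carrier: "x \<in> B \<Longrightarrow> kls x \<in> carrier alg"
proof -
  assume "x \<in> B"
  then obtain p where "p \<in> fp" "x = evl p" unfolding B_def by (rule imageE)
  then show ?thesis by (simp add: kls_evl carrier_alg)
qed

lemma val_kls: "x \<in> B \<Longrightarrow> val (kls x) = x"
proof -
  assume "x \<in> B"
  then obtain p where "p \<in> fp" "x = evl p" unfolding B_def by (rule imageE)
  then show ?thesis by (simp add: kls_evl val_cls)
qed

lemma carrier_val: "P \<in> carrier alg \<Longrightarrow> val P \<in> B \<and> kls (val P) = P"
  by (auto simp: carrier_alg val_cls kls_evl)

lemma val_hom:
  assumes "P \<in> carrier alg" "P' \<in> carrier alg"
  shows "val (P \<oplus>\<^bsub>alg\<^esub> P') = val P + val P'" "val (P \<otimes>\<^bsub>alg\<^esub> P') = val P * val P'"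
    "val (c \<odot>\<^bsub>alg\<^esub> P) = scale c (val P)"
proof -
  obtain p where p: "p \<in> fp" "P = cls p" using assms(1) unfolding carrier_alg by (rule imageE)
  obtain p' where p': "p' \<in> fp" "P' = cls p'" using assms(2) unfolding carrier_alg by (rule imageE)
  show "val (P \<oplus>\<^bsub>alg\<^esub> P') = val P + val P'"
    using p p' val_cls[OF fpoly_add[OF p(1) p'(1)]] by (simp add: alg_add val_cls evl_simps(1))
  show "val (P \<otimes>\<^bsub>alg\<^esub> P') = val P * val P'"
    using p p' val_cls[OF fpoly_mult[OF p(1) p'(1)]] by (simp add: alg_mult val_cls evl_simps(5))
  show "val (c \<odot>\<^bsub>alg\<^esub> P) = scale c (val P)"
    using p val_cls[OF fpoly_mult[OF fpoly_scal p(1)]] by (simp add: alg_smult val_cls evl_scal)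
qed

lemma kls_hom:
  assumes "x \<in> B" "y \<in> B"
  shows "kls (x + y) = kls x \<oplus>\<^bsub>alg\<^esub> kls y" "kls (x * y) = kls x \<otimes>\<^bsub>alg\<^esub> kls y"
    "kls (scale c x) = c \<odot>\<^bsub>alg\<^esub> kls x"
proof -
  obtain p where p: "p \<in> fp" "x = evl p" using assms(1) unfolding B_def by (rule imageE)
  obtain p' where p': "p' \<in> fp" "y = evl p'" using assms(2) unfolding B_def by (rule imageE)
  show "kls (x + y) = kls x \<oplus>\<^bsub>alg\<^esub> kls y"
    using p p' kls_evl[OF fpoly_add[OF p(1) p'(1)]] by (simp add: alg_add kls_evl evl_simps(1))
  show "kls (x * y) = kls x \<otimes>\<^bsub>alg\<^esub> kls y"
    using p p' kls_evl[OF fpoly_mult[OF p(1) p'(1)]] by (simp add: alg_mult kls_evl evl_simps(5))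
  show "kls (scale c x) = c \<odot>\<^bsub>alg\<^esub> kls x"
    using p kls_evl[OF fpoly_mult[OF fpoly_scal p(1)]] by (simp add: alg_smult kls_evl evl_scal)
qed

text \<open>The action carried over to operators and taken on representatives, so that products in
  the quantum group are products of noncommutative polynomials. Its laws are available for arguments
  in \<open>B\<close> only.\<close>

definition ac :: "uq_gen ncpoly \<Rightarrow> lop \<Rightarrow> lop" where
  "ac p x = val (act (uq.cls p) (kls x))"

lemma uq_carrier: "p \<in> ufp \<Longrightarrow> uq.cls p \<in> carrier uq.alg"
  by (simp add: uq.carrier_alg)

lemma act_carrier: "p \<in> ufp \<Longrightarrow> x \<in> B \<Longrightarrow> act (uq.cls p) (kls x) \<in> carrier alg"
  by (intro act_closed uq_carrier kls_carrier)

lemma ac_B [intro]: "p \<in> ufp \<Longrightarrow> x \<in> B \<Longrightarrow> ac p x \<in> B"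
  unfolding ac_def using carrier_val act_carrier by blast

lemma kls_ac: "p \<in> ufp \<Longrightarrow> x \<in> B \<Longrightarrow> kls (ac p x) = act (uq.cls p) (kls x)"
  unfolding ac_def using carrier_val act_carrier by blast

lemma ac_add: "p \<in> ufp \<Longrightarrow> x \<in> B \<Longrightarrow> y \<in> B \<Longrightarrow> ac p (x + y) = ac p x + ac p y"
  unfolding ac_def by (simp add: kls_hom(1) act_add uq_carrier kls_carrier val_hom(1) act_carrier)

lemma ac_scale: "p \<in> ufp \<Longrightarrow> x \<in> B \<Longrightarrow> ac p (scale c x) = scale c (ac p x)"
  unfolding ac_def using kls_hom(3)[of x x c] val_hom(3)[of "act (uq.cls p) (kls x)" "act (uq.cls p) (kls x)" c]
  by (simp add: act_smult uq_carrier kls_carrier act_carrier)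

lemma ac_add_left: "p \<in> ufp \<Longrightarrow> p' \<in> ufp \<Longrightarrow> x \<in> B \<Longrightarrow> ac (p + p') x = ac p x + ac p' x"
  unfolding ac_def by (simp add: uq.alg_add[symmetric] act_add_left uq_carrier kls_carrier val_hom(1) act_carrier)

lemma ac_mult_left: "p \<in> ufp \<Longrightarrow> p' \<in> ufp \<Longrightarrow> x \<in> B \<Longrightarrow> ac (p * p') x = ac p (ac p' x)"
  unfolding ac_def[of "p * p'"] ac_def[of p]
  by (simp add: uq.alg_mult[symmetric] act_mult uq_carrier kls_carrier kls_ac)

lemma ac_scal_left: "p \<in> ufp \<Longrightarrow> x \<in> B \<Longrightarrow> ac (scal c * p) x = scale c (ac p x)"
  unfolding ac_def using val_hom(3)[of "act (uq.cls p) (kls x)" "act (uq.cls p) (kls x)" c]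
  by (simp add: uq.alg_smult[symmetric] act_smult_left uq_carrier kls_carrier act_carrier)

lemma ac_one_left: "x \<in> B \<Longrightarrow> ac 1 x = x"
  unfolding ac_def by (simp add: uq.alg_one[symmetric] act_one kls_carrier val_kls)

lemma ac_zero: "p \<in> ufp \<Longrightarrow> ac p 0 = 0"
  using ac_scale[of p 0 0] by simp

lemma ac_sum: "p \<in> ufp \<Longrightarrow> (\<And>i. i \<in> I \<Longrightarrow> f i \<in> B) \<Longrightarrow> ac p (sum f I) = (\<Sum>i\<in>I. ac p (f i))"
proof (induction I rule: infinite_finite_induct)
  case (insert i I)
  then have "sum f I \<in> B" by (intro B_sum) simp
  with insert show ?case by (simp add: ac_add)
qed (simp_all add: ac_zero)

lemma ac_one: "p \<in> ufp \<Longrightarrow> ac p 1 = scale (nc_eval counit_gen p) 1"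
proof -
  assume p: "p \<in> ufp"
  have "kls 1 = \<one>\<^bsub>alg\<^esub>" using kls_evl[of 1] by (simp add: evl_simps(6) alg_one)
  then have "act (uq.cls p) (kls 1) = nc_eval counit_gen p \<odot>\<^bsub>alg\<^esub> kls 1"
    using act_on_one[OF uq_carrier[OF p]] p by (simp add: counit_cls)
  then show ?thesis
    unfolding ac_def using val_hom(3)[OF kls_carrier kls_carrier, of 1 1] by (simp add: val_kls)
qed

lemma ac_cls: "p \<in> ufp \<Longrightarrow> p' \<in> fp \<Longrightarrow> u \<in> fp \<Longrightarrow> act (uq.cls p) (cls p') = cls u \<Longrightarrow> ac p (evl p') = evl u"
  by (simp add: ac_def kls_evl val_cls)

lemma ufp_gens:
  "i \<in> {1..n} \<Longrightarrow> var (KH i) \<in> ufp" "i \<in> {1..n} \<Longrightarrow> var (KHI i) \<in> ufp"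
  "i \<in> {1..<n} \<Longrightarrow> var (E i) \<in> ufp" "i \<in> {1..<n} \<Longrightarrow> var (F i) \<in> ufp"
  by (auto intro!: fpoly_var simp: uq_gens_def)

lemma ac_KH_z: assumes "i \<in> {1..n}" "j \<in> {1..n}"
  shows "ac (var (KH i)) (z j) = scale (if i = j then h else 1) (z j)"
proof -
  have "scal (if i = j then h else 1) * var (Z j) \<in> fp" using assms by (intro fpoly_mult fpoly_scal zw.var_x)
  from ac_cls[OF ufp_gens(1)[OF assms(1)] zw.var_x[OF assms(2)] this conjunct1[OF act_KH[OF assms]]]
  show ?thesis unfolding evl_scal by (simp add: evl_simps(7))
qed

lemma ac_KH_w: assumes "i \<in> {1..n}" "j \<in> {1..n}"
  shows "ac (var (KH i)) (w j) = scale (if i = j then inverse h else 1) (w j)"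
proof -
  have "scal (if i = j then inverse h else 1) * var (W j) \<in> fp" using assms by (intro fpoly_mult fpoly_scal zw.var_y)
  from ac_cls[OF ufp_gens(1)[OF assms(1)] zw.var_y[OF assms(2)] this conjunct2[OF act_KH[OF assms]]]
  show ?thesis unfolding evl_scal by (simp add: evl_simps(7))
qed

lemma ac_E_z: assumes "i \<in> {1..<n}" "j \<in> {1..n}" shows "ac (var (E i)) (z j) = (if j = Suc i then z i else 0)"
proof -
  have "(if j = Suc i then var (Z (j - 1)) else 0) \<in> fp" using assms by (auto intro!: zw.var_x)
  from ac_cls[OF ufp_gens(3)[OF assms(1)] zw.var_x[OF assms(2)] this] act_EF[OF assms]
  show ?thesis by (auto simp: evl_simps(7,2))
qed

lemma ac_F_z: assumes "i \<in> {1..<n}" "j \<in> {1..n}" shows "ac (var (F i)) (z j) = (if j = i then z (Suc i) else 0)"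
proof -
  have "(if j = i then var (Z (Suc j)) else 0) \<in> fp" using assms by (auto intro!: zw.var_x)
  from ac_cls[OF ufp_gens(4)[OF assms(1)] zw.var_x[OF assms(2)] this] act_EF[OF assms]
  show ?thesis by (auto simp: evl_simps(7,2))
qed

lemma ac_E_w: assumes "i \<in> {1..<n}" "j \<in> {1..n}"
  shows "ac (var (E i)) (w j) = (if j = i then scale (- inverse q) (w (Suc i)) else 0)"
proof -
  have "(if j = i then - scal (inverse q) * var (W (Suc j)) else 0) \<in> fp"
    using assms by (auto intro!: zw.var_y fpoly_uminus fpoly_mult)
  from ac_cls[OF ufp_gens(3)[OF assms(1)] zw.var_y[OF assms(2)] this] act_EF[OF assms]
  show ?thesis by (auto simp: evl_simps(2,3,5,7,8) scale_one_mult)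
qed

lemma ac_F_w: assumes "i \<in> {1..<n}" "j \<in> {1..n}"
  shows "ac (var (F i)) (w j) = (if j = Suc i then scale (- q) (w i) else 0)"
proof -
  have "(if j = Suc i then - scal q * var (W (j - 1)) else 0) \<in> fp"
    using assms by (auto intro!: zw.var_y fpoly_uminus fpoly_mult)
  from ac_cls[OF ufp_gens(4)[OF assms(1)] zw.var_y[OF assms(2)] this] act_EF[OF assms]
  show ?thesis by (auto simp: evl_simps(2,3,5,7,8) scale_one_mult)
qed

lemma alg_add_zero: "P \<in> carrier alg \<Longrightarrow> P \<oplus>\<^bsub>alg\<^esub> \<zero>\<^bsub>alg\<^esub> = P"
proof -
  interpret A: ring alg by (rule ring_alg)
  show "P \<in> carrier alg \<Longrightarrow> P \<oplus>\<^bsub>alg\<^esub> \<zero>\<^bsub>alg\<^esub> = P" by simp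
qed

lemma alg_mult_closed: "P \<in> carrier alg \<Longrightarrow> P' \<in> carrier alg \<Longrightarrow> P \<otimes>\<^bsub>alg\<^esub> P' \<in> carrier alg"
proof -
  interpret A: ring alg by (rule ring_alg)
  show "P \<in> carrier alg \<Longrightarrow> P' \<in> carrier alg \<Longrightarrow> P \<otimes>\<^bsub>alg\<^esub> P' \<in> carrier alg" by simp
qed

lemma ac_grouplike:
  assumes "comult n q h (uq.cls g) [(uq.cls g, uq.cls g)]" "g \<in> ufp" "x \<in> B" "y \<in> B"
  shows "ac g (x * y) = ac g x * ac g y"
proof -
  have "act (uq.cls g) (kls x \<otimes>\<^bsub>alg\<^esub> kls y) = act (uq.cls g) (kls x) \<otimes>\<^bsub>alg\<^esub> act (uq.cls g) (kls y)"
    using act_comult[OF assms(1) kls_carrier[OF assms(3)] kls_carrier[OF assms(4)]] assms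
    by (simp add: alg_add_zero alg_mult_closed act_carrier)
  then show ?thesis
    unfolding ac_def using assms by (simp add: kls_hom(2) val_hom(2) act_carrier)
qed

lemma ac_primitive:
  assumes "comult n q h (uq.cls g) [(uq.cls g, uq.cls k), (uq.cls k', uq.cls g)]"
    "g \<in> ufp" "k \<in> ufp" "k' \<in> ufp" "x \<in> B" "y \<in> B"
  shows "ac g (x * y) = ac g x * ac k y + ac k' x * ac g y"
proof -
  have "act (uq.cls g) (kls x \<otimes>\<^bsub>alg\<^esub> kls y) = (act (uq.cls g) (kls x) \<otimes>\<^bsub>alg\<^esub> act (uq.cls k) (kls y))
      \<oplus>\<^bsub>alg\<^esub> (act (uq.cls k') (kls x) \<otimes>\<^bsub>alg\<^esub> act (uq.cls g) (kls y))"
    using act_comult[OF assms(1) kls_carrier[OF assms(5)] kls_carrier[OF assms(6)]] assms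
    by (simp add: alg_add_zero alg_mult_closed act_carrier)
  then show ?thesis
    unfolding ac_def using assms by (simp add: kls_hom(2) val_hom(1,2) act_carrier alg_mult_closed)
qed

lemma ac_KH_mult: "i \<in> {1..n} \<Longrightarrow> x \<in> B \<Longrightarrow> y \<in> B \<Longrightarrow> ac (var (KH i)) (x * y) = ac (var (KH i)) x * ac (var (KH i)) y"
  by (rule ac_grouplike) (use comult_KH[of i n q h] in \<open>auto simp: uq_class_def intro: ufp_gens\<close>)

lemma ac_KHI_mult: "i \<in> {1..n} \<Longrightarrow> x \<in> B \<Longrightarrow> y \<in> B \<Longrightarrow> ac (var (KHI i)) (x * y) = ac (var (KHI i)) x * ac (var (KHI i)) y"
  by (rule ac_grouplike) (use comult_KHI[of i n q h] in \<open>auto simp: uq_class_def intro: ufp_gens\<close>)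

abbreviation Kd where "Kd i \<equiv> var (KHI i) * var (KH (Suc i))"

abbreviation Ku where "Ku i \<equiv> var (KH i) * var (KHI (Suc i))"

lemma K_ufp: "i \<in> {1..<n} \<Longrightarrow> Kd i \<in> ufp \<and> Ku i \<in> ufp"
  by (auto intro!: fpoly_mult ufp_gens)

lemma ac_E_mult: "i \<in> {1..<n} \<Longrightarrow> x \<in> B \<Longrightarrow> y \<in> B \<Longrightarrow>
  ac (var (E i)) (x * y) = ac (var (E i)) x * ac (Kd i) y + ac (Ku i) x * ac (var (E i)) y"
  by (rule ac_primitive) (use comult_E[of i n q h] K_ufp[of i] in \<open>auto simp: uq_class_def intro: ufp_gens\<close>)

lemma ac_F_mult: "i \<in> {1..<n} \<Longrightarrow> x \<in> B \<Longrightarrow> y \<in> B \<Longrightarrow>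
  ac (var (F i)) (x * y) = ac (var (F i)) x * ac (Kd i) y + ac (Ku i) x * ac (var (F i)) y"
  by (rule ac_primitive) (use comult_F[of i n q h] K_ufp[of i] in \<open>auto simp: uq_class_def intro: ufp_gens\<close>)

lemma ac_KHI_KH: "i \<in> {1..n} \<Longrightarrow> x \<in> B \<Longrightarrow> ac (var (KHI i)) (ac (var (KH i)) x) = x"
proof -
  assume *: "i \<in> {1..n}" "x \<in> B"
  have "var (KHI i) * var (KH i) - 1 \<in> uq_rels n q h"
    unfolding uq_rels_def using * by blast
  then have "uq.cls (var (KHI i) * var (KH i)) = uq.cls 1"
    using uq.J_rel by (simp add: uq.cls_eq_iff)
  then have "ac (var (KHI i) * var (KH i)) x = ac 1 x" by (simp add: ac_def)
  then show ?thesis using * by (simp add: ac_mult_left ac_one_left ufp_gens)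
qed

text \<open>The values of \<open>KHI\<close> on the z_j and w_j are not prescribed; they follow from
  the relation KHI KH = 1 once the eigenvalue of \<open>KH\<close> is known.\<close>

lemma ac_KHI_eigen:
  assumes "i \<in> {1..n}" "x \<in> B" "c \<noteq> 0" "ac (var (KH i)) x = scale c x"
  shows "ac (var (KHI i)) x = scale (1 / c) x"
proof -
  have "scale c (ac (var (KHI i)) x) = x"
    using ac_KHI_KH[OF assms(1,2)] assms by (simp add: ac_scale ufp_gens)
  then have "scale (1 / c) (scale c (ac (var (KHI i)) x)) = scale (1 / c) x" by simp
  then show ?thesis using assms(3) by simp
qed

end

section \<open>Invariants\<close>

context zw_action
begin

text \<open>Invariance tested on generators of the subalgebra. The inverses \<open>KHI\<close> are
  left out, as invariance under \<open>KH\<close> implies theirs.\<close>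

definition Ginv :: "lop \<Rightarrow> bool" where
  "Ginv x \<longleftrightarrow> x \<in> B \<and> (\<forall>i\<in>{1..n - 1}. ac (var (KH i)) x = x) \<and>
     (\<forall>j\<in>{1..<n - 1}. ac (var (E j)) x = 0 \<and> ac (var (F j)) x = 0)"

lemma Ginv_B: "Ginv x \<Longrightarrow> x \<in> B"
  by (simp add: Ginv_def)

lemma nc_eval_simps:
  "nc_eval counit_gen (p + p') = nc_eval counit_gen p + nc_eval counit_gen p'"
  "nc_eval counit_gen (p * p') = nc_eval counit_gen p * nc_eval counit_gen p'"
  "nc_eval counit_gen (var g) = counit_gen g"
  "nc_eval counit_gen 1 = 1"
  "nc_eval counit_gen (scal c) = c"
  by (simp_all add: nc_eval_eq cnum.ev_simps)

lemma Ginv_one: "Ginv 1"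
  unfolding Ginv_def by (auto simp: ac_one ufp_gens nc_eval_simps)

lemma Ginv_add: "Ginv x \<Longrightarrow> Ginv y \<Longrightarrow> Ginv (x + y)"
  unfolding Ginv_def by (auto simp: ac_add ufp_gens)

lemma Ginv_scale: "Ginv x \<Longrightarrow> Ginv (scale c x)"
  unfolding Ginv_def by (auto simp: ac_scale ufp_gens)

lemma Ginv_zero: "Ginv 0"
  using Ginv_scale[OF Ginv_one, of 0] by simp

lemma Ginv_sum: "(\<And>i. i \<in> I \<Longrightarrow> Ginv (f i)) \<Longrightarrow> Ginv (sum f I)"
  by (induction I rule: infinite_finite_induct) (auto intro: Ginv_zero Ginv_add)

lemma Ginv_mult: "Ginv x \<Longrightarrow> Ginv y \<Longrightarrow> Ginv (x * y)"
  unfolding Ginv_def by (auto simp: ac_KH_mult ac_E_mult ac_F_mult)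

lemma Ginv_power: "Ginv x \<Longrightarrow> Ginv (x ^ k)"
  by (induction k) (auto intro: Ginv_one Ginv_mult)

lemma Ginv_z: assumes "n \<ge> 1" shows "Ginv (z n)"
proof -
  have "\<not> n \<le> n - Suc 0" "\<not> n < n - Suc 0" using assms by auto
  then show ?thesis
    unfolding Ginv_def using assms by (auto simp: ac_KH_z ac_E_z ac_F_z B_z)
qed

lemma Ginv_w: assumes "n \<ge> 1" shows "Ginv (w n)"
proof -
  have "\<not> n \<le> n - Suc 0" "\<not> n < n - Suc 0" using assms by auto
  then show ?thesis
    unfolding Ginv_def using assms by (auto simp: ac_KH_w ac_E_w ac_F_w B_w)
qed

lemma ac_KHI_z: "i \<in> {1..n} \<Longrightarrow> j \<in> {1..n} \<Longrightarrow> ac (var (KHI i)) (z j) = scale (if i = j then inverse h else 1) (z j)"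
proof -
  assume *: "i \<in> {1..n}" "j \<in> {1..n}"
  have "ac (var (KHI i)) (z j) = scale (1 / (if i = j then h else 1)) (z j)"
    by (rule ac_KHI_eigen[OF *(1) B_z[OF *(2)] _ ac_KH_z[OF *]]) (use h0 in auto)
  then show ?thesis by (simp add: divide_inverse split: if_splits)
qed

lemma ac_KHI_w: "i \<in> {1..n} \<Longrightarrow> j \<in> {1..n} \<Longrightarrow> ac (var (KHI i)) (w j) = scale (if i = j then h else 1) (w j)"
proof -
  assume *: "i \<in> {1..n}" "j \<in> {1..n}"
  have "ac (var (KHI i)) (w j) = scale (1 / (if i = j then inverse h else 1)) (w j)"
    by (rule ac_KHI_eigen[OF *(1) B_w[OF *(2)] _ ac_KH_w[OF *]]) (use h0 in auto)
  then show ?thesis by (simp add: divide_inverse split: if_splits)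
qed

lemma ac_Ku: "j \<in> {1..<n} \<Longrightarrow> x \<in> B \<Longrightarrow> ac (Ku j) x = ac (var (KH j)) (ac (var (KHI (Suc j))) x)"
  by (simp add: ac_mult_left ufp_gens)

lemma ac_Kd: "j \<in> {1..<n} \<Longrightarrow> x \<in> B \<Longrightarrow> ac (Kd j) x = ac (var (KHI j)) (ac (var (KH (Suc j))) x)"
  by (simp add: ac_mult_left ufp_gens)

lemma ac_Ku_mult: "j \<in> {1..<n} \<Longrightarrow> x \<in> B \<Longrightarrow> y \<in> B \<Longrightarrow> ac (Ku j) (x * y) = ac (Ku j) x * ac (Ku j) y"
  by (simp add: ac_Ku B_mult ac_KHI_mult ac_KH_mult ac_B ufp_gens)

lemma ac_Kd_mult: "j \<in> {1..<n} \<Longrightarrow> x \<in> B \<Longrightarrow> y \<in> B \<Longrightarrow> ac (Kd j) (x * y) = ac (Kd j) x * ac (Kd j) y"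
  by (simp add: ac_Kd B_mult ac_KHI_mult ac_KH_mult ac_B ufp_gens)

lemma ac_Ku_z: "j \<in> {1..<n} \<Longrightarrow> k \<in> {1..n} \<Longrightarrow> ac (Ku j) (z k) = scale (if k = j then h else if k = Suc j then inverse h else 1) (z k)"
  by (simp add: ac_Ku B_z ac_KHI_z ac_scale ufp_gens ac_KH_z)

lemma ac_Kd_z: "j \<in> {1..<n} \<Longrightarrow> k \<in> {1..n} \<Longrightarrow> ac (Kd j) (z k) = scale (if k = j then inverse h else if k = Suc j then h else 1) (z k)"
  by (simp add: ac_Kd B_z ac_KHI_z ac_scale ufp_gens ac_KH_z)

lemma ac_Ku_w: "j \<in> {1..<n} \<Longrightarrow> k \<in> {1..n} \<Longrightarrow> ac (Ku j) (w k) = scale (if k = j then inverse h else if k = Suc j then h else 1) (w k)"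
  by (simp add: ac_Ku B_w ac_KHI_w ac_scale ufp_gens ac_KH_w)

lemma ac_Kd_w: "j \<in> {1..<n} \<Longrightarrow> k \<in> {1..n} \<Longrightarrow> ac (Kd j) (w k) = scale (if k = j then h else if k = Suc j then inverse h else 1) (w k)"
  by (simp add: ac_Kd B_w ac_KHI_w ac_scale ufp_gens ac_KH_w)

text \<open>E_j and F_j affect only the summands i = j and i = j + 1, and both give multiples of the
  same product. The scalars are opposite because q/h = h and h/q = 1/h.\<close>

lemma Ginv_Qu:
  assumes m: "m = n \<or> m = n - 1"
  shows "Ginv (Qu m)"
proof -
  have zwB: "z i * w i \<in> B" if "i \<in> {1..m}" for i using that m by (intro B_mult B_z B_w) auto
  have S: "ac g (Qu m) = (\<Sum>i\<in>{1..m}. ac g (z i * w i))" if "g \<in> ufp" for g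
    unfolding Qu_def by (rule ac_sum[OF that zwB])
  have "ac (var (KH i)) (Qu m) = Qu m" if i: "i \<in> {1..n}" for i
  proof -
    have "ac (var (KH i)) (z j * w j) = z j * w j" if "j \<in> {1..m}" for j
    proof -
      have j: "j \<in> {1..n}" using that m by auto
      show ?thesis
        using h0 by (simp add: ac_KH_mult[OF i B_z[OF j] B_w[OF j]] ac_KH_z[OF i j] ac_KH_w[OF i j] scale_simps)
    qed
    then show ?thesis unfolding S[OF ufp_gens(1)[OF i]] unfolding Qu_def by (rule sum.cong[OF refl])
  qed
  moreover have "ac (var (E j)) (Qu m) = 0 \<and> ac (var (F j)) (Qu m) = 0" if j: "j \<in> {1..<n - 1}" for j
  proof -
    \<comment> \<open>Both affected summands must be present in the partial sum: j + 1 <= m holds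
      for all j < n - 1 since m is at least n - 1.\<close>
    have j': "j \<in> {1..<n}" "j \<in> {1..m}" "Suc j \<in> {1..m}" using j m by auto
    have hq: "h * inverse q = inverse h" unfolding h_square[symmetric] using h0 by (simp add: power2_eq_square)
    have E: "ac (var (E j)) (z i * w i) = (if i = j then scale (- inverse h) (z j * w (Suc j)) else if i = Suc j then scale (inverse h) (z j * w (Suc j)) else 0)"
      if "i \<in> {1..m}" for i
    proof -
      have i: "i \<in> {1..n}" using that m by auto
      show ?thesis
        unfolding ac_E_mult[OF j'(1) B_z[OF i] B_w[OF i]] ac_E_z[OF j'(1) i] ac_E_w[OF j'(1) i] ac_Ku_z[OF j'(1) i] ac_Kd_w[OF j'(1) i]
        by (auto simp: scale_simps hq)
    qed
    have F: "ac (var (F j)) (z i * w i) = (if i = j then scale h (z (Suc j) * w j) else if i = Suc j then scale (- (inverse h * q)) (z (Suc j) * w j) else 0)"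
      if "i \<in> {1..m}" for i
    proof -
      have i: "i \<in> {1..n}" using that m by auto
      show ?thesis
        unfolding ac_F_mult[OF j'(1) B_z[OF i] B_w[OF i]] ac_F_z[OF j'(1) i] ac_F_w[OF j'(1) i] ac_Ku_z[OF j'(1) i] ac_Kd_w[OF j'(1) i]
        by (auto simp: scale_simps)
    qed
    have hq': "inverse h * q = h" unfolding h_square[symmetric] using h0 by (simp add: power2_eq_square)
    have two: "(\<Sum>i\<in>{1..m}. if i = j then u else if i = Suc j then v else 0) = u + v" for u v :: lop
    proof -
      have "(\<Sum>i\<in>{1..m}. if i = j then u else if i = Suc j then v else 0)
        = (\<Sum>i\<in>{1..m}. (if i = j then u else 0) + (if i = Suc j then v else 0))"
        by (rule sum.cong) auto
      then show ?thesis using j'(2,3) by (simp add: sum.distrib)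
    qed
    have "ac (var (E j)) (Qu m) = (\<Sum>i\<in>{1..m}. if i = j then scale (- inverse h) (z j * w (Suc j)) else if i = Suc j then scale (inverse h) (z j * w (Suc j)) else 0)"
      unfolding S[OF ufp_gens(3)[OF j'(1)]] by (rule sum.cong[OF refl E])
    moreover have "ac (var (F j)) (Qu m) = (\<Sum>i\<in>{1..m}. if i = j then scale h (z (Suc j) * w j) else if i = Suc j then scale (- (inverse h * q)) (z (Suc j) * w j) else 0)"
      unfolding S[OF ufp_gens(4)[OF j'(1)]] by (rule sum.cong[OF refl F])
    ultimately show ?thesis unfolding two hq' by (simp add: lop.scale_left_distrib[symmetric])
  qed
  ultimately show ?thesis
    unfolding Ginv_def using m by (auto intro: Qu_B)
qed

text \<open>From generators to the whole subalgebra: on an invariant vector a word acts by the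
  product of the counits of its letters, and linearity extends this to polynomials.\<close>

lemma zonal_iff_Ginv:
  assumes n: "n \<ge> 1" and x: "x \<in> B"
  shows "(\<forall>p\<in>fpoly (uq_gens (n - 1)). ac p x = scale (nc_eval counit_gen p) x) \<longleftrightarrow> Ginv x"
proof
  assume *: "\<forall>p\<in>fpoly (uq_gens (n - 1)). ac p x = scale (nc_eval counit_gen p) x"
  have g: "ac (var g) x = scale (counit_gen g) x" if "g \<in> uq_gens (n - 1)" for g
    using *[rule_format, OF fpoly_var[OF that]] by (simp add: nc_eval_simps)
  have "KH i \<in> uq_gens (n - 1)" if "i \<in> {1..n - 1}" for i using that by (auto simp: uq_gens_def)
  moreover have "E j \<in> uq_gens (n - 1)" "F j \<in> uq_gens (n - 1)" if "j \<in> {1..<n - 1}" for j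
    using that by (auto simp: uq_gens_def)
  ultimately show "Ginv x" unfolding Ginv_def using g x by simp
next
  assume G: "Ginv x"
  have sub: "uq_gens (n - 1) \<subseteq> uq_gens n" by (auto simp: uq_gens_def)
  have gen: "ac (var g) x = scale (counit_gen g) x" if "g \<in> uq_gens (n - 1)" for g
  proof -
    have KHI: "ac (var (KHI i)) x = x" if "i \<in> {1..n - 1}" for i
    proof -
      have "i \<in> {1..n}" "ac (var (KH i)) x = scale 1 x" using that G by (auto simp: Ginv_def)
      then show ?thesis using ac_KHI_eigen[of i x 1] x by simp
    qed
    show ?thesis using that G KHI unfolding uq_gens_def Ginv_def by auto
  qed
  have word: "ac (Poly_Mapping.single u c) x = scale (nc_eval counit_gen (Poly_Mapping.single u c)) x"
    if "u \<in> lists (uq_gens (n - 1))" for u c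
    using that
  proof (induction u rule: list.induct)
    case Nil
    have "ac (scal c * 1) x = scale c (ac 1 x)" by (rule ac_scal_left[OF fpoly_one x])
    then show ?case by (simp add: ac_one_left x nc_eval_simps)
  next
    case (Cons g u)
    then have g: "g \<in> uq_gens (n - 1)" "u \<in> lists (uq_gens (n - 1))" by auto
    then have gu: "var g \<in> ufp" "Poly_Mapping.single u c \<in> ufp"
      using sub by (auto intro!: fpoly_var fpoly_single)
    show ?case
      unfolding single_Cons[of g u c] ac_mult_left[OF gu x] Cons.IH[OF g(2)] ac_scale[OF gu(1) x] gen[OF g(1)] nc_eval_simps
      by (simp add: mult.commute)
  qed
  show "\<forall>p\<in>fpoly (uq_gens (n - 1)). ac p x = scale (nc_eval counit_gen p) x"
  proof
    fix p assume "p \<in> fpoly (uq_gens (n - 1))"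
    then have "p \<in> ufp \<and> ac p x = scale (nc_eval counit_gen p) x"
    proof (induction rule: fpoly_induct)
      case zero
      then show ?case using word[of "[]" 0] by simp
    next
      case (add p p')
      then show ?case by (auto simp: ac_add_left x nc_eval_simps lop.scale_left_distrib)
    next
      case (mult u c)
      then show ?case using word sub fpoly_mono[OF sub] by (auto intro: fpoly_single)
    qed
    then show "ac p x = scale (nc_eval counit_gen p) x" ..
  qed
qed

lemma KH_prod_list:
  assumes "i \<in> {1..n}" "\<And>j. j \<in> set js \<Longrightarrow> f j \<in> B \<and> ac (var (KH i)) (f j) = scale (c j) (f j)"
  shows "prod_list (map f js) \<in> B \<and> ac (var (KH i)) (prod_list (map f js)) = scale (prod_list (map c js)) (prod_list (map f js))"
  using assms(2)
proof (induction js)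
  case Nil
  then show ?case using assms(1) by (simp add: ac_one ufp_gens nc_eval_simps)
next
  case (Cons j js)
  then have "prod_list (map f js) \<in> B" "f j \<in> B" by auto
  then show ?case using Cons assms(1) by (simp add: ac_KH_mult scale_simps B_mult mult.commute)
qed

lemma KH_power:
  assumes "i \<in> {1..n}" "x \<in> B" "ac (var (KH i)) x = scale c x"
  shows "ac (var (KH i)) (x ^ k) = scale (c ^ k) (x ^ k)"
  using KH_prod_list[of i "replicate k x" "\<lambda>x. x" "\<lambda>_. c"] assms
  by (simp add: map_replicate_const prod_list_replicate)

lemma prod_list_neutral: "(\<And>x. x \<in> set xs \<Longrightarrow> x = (1 :: complex)) \<Longrightarrow> prod_list xs = 1"
  by (induction xs) auto

lemma prod_list_if: "i \<in> {1..n} \<Longrightarrow> prod_list (map (\<lambda>j. (if i = j then c else 1 :: complex) ^ r j) [1..<Suc n]) = c ^ r i"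
proof -
  assume i: "i \<in> {1..n}"
  have "prod_list (map (\<lambda>j. (if i = j then c else 1) ^ r j) [1..<i]) = 1"
    "prod_list (map (\<lambda>j. (if i = j then c else 1) ^ r j) [Suc i..<Suc n]) = 1"
    by (rule prod_list_neutral, auto simp del: upt_Suc)+
  then show ?thesis unfolding prod_list_split[OF i] by simp
qed

lemma KH_mzw: assumes i: "i \<in> {1..n}"
  shows "ac (var (KH i)) (mzw (r, s)) = scale (h ^ r i * inverse h ^ s i) (mzw (r, s))"
proof -
  have "ac (var (KH i)) (zmon r) = scale (prod_list (map (\<lambda>j. (if i = j then h else 1) ^ r j) [1..<Suc n])) (zmon r)"
    unfolding zmon_def
    by (rule conjunct2[OF KH_prod_list[OF i]]) (intro conjI B_power KH_power[OF i] B_z ac_KH_z[OF i]; simp del: upt_Suc)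
  moreover have "ac (var (KH i)) (wmon s) = scale (prod_list (map (\<lambda>j. (if i = j then inverse h else 1) ^ s j) [1..<Suc n])) (wmon s)"
    unfolding wmon_def
    by (rule conjunct2[OF KH_prod_list[OF i]]) (intro conjI B_power KH_power[OF i] B_w ac_KH_w[OF i]; simp del: upt_Suc)
  ultimately show ?thesis
    unfolding prod_list_if[OF i] using i by (simp add: mzw_def ac_KH_mult B_zmon B_wmon scale_simps mult.commute)
qed

text \<open>Eigenvalues are recorded only as nonzero: \<open>E_coef\<close> below requires a
  nonvanishing factor and not its value.\<close>

definition Keig :: "nat \<Rightarrow> lop \<Rightarrow> bool" where
  "Keig j x \<longleftrightarrow> x \<in> B \<and> (\<exists>c. c \<noteq> 0 \<and> ac (Ku j) x = scale c x) \<and> (\<exists>c. c \<noteq> 0 \<and> ac (Kd j) x = scale c x)"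

lemma Keig_mult: assumes "j \<in> {1..<n}" "Keig j x" "Keig j y" shows "Keig j (x * y)"
proof -
  obtain c d c' d' where *: "c \<noteq> 0" "ac (Ku j) x = scale c x" "c' \<noteq> 0" "ac (Ku j) y = scale c' y"
    "d \<noteq> 0" "ac (Kd j) x = scale d x" "d' \<noteq> 0" "ac (Kd j) y = scale d' y" "x \<in> B" "y \<in> B"
    using assms unfolding Keig_def by metis
  then have "ac (Ku j) (x * y) = scale (c * c') (x * y)" "ac (Kd j) (x * y) = scale (d * d') (x * y)"
    using assms(1) by (simp_all add: ac_Ku_mult ac_Kd_mult scale_simps mult.commute)
  moreover have "c * c' \<noteq> 0" "d * d' \<noteq> 0" using * by auto
  ultimately show ?thesis unfolding Keig_def using * by (intro conjI exI B_mult)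
qed

lemma Keig_one: "j \<in> {1..<n} \<Longrightarrow> Keig j 1"
  unfolding Keig_def by (auto intro!: exI[of _ 1] simp: ac_one K_ufp nc_eval_simps)

lemma Keig_power: "j \<in> {1..<n} \<Longrightarrow> Keig j x \<Longrightarrow> Keig j (x ^ k)"
  by (induction k) (auto intro: Keig_one Keig_mult)

lemma Keig_prod_list: "j \<in> {1..<n} \<Longrightarrow> (\<And>x. x \<in> set xs \<Longrightarrow> Keig j x) \<Longrightarrow> Keig j (prod_list xs)"
  by (induction xs) (auto intro: Keig_one Keig_mult)

lemma Keig_z: "j \<in> {1..<n} \<Longrightarrow> k \<in> {1..n} \<Longrightarrow> Keig j (z k)"
  unfolding Keig_def using h0
  by (intro conjI B_z exI[of _ "if k = j then h else if k = Suc j then inverse h else 1"]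
      exI[of _ "if k = j then inverse h else if k = Suc j then h else 1"]) (simp_all add: ac_Ku_z ac_Kd_z)

lemma Keig_w: "j \<in> {1..<n} \<Longrightarrow> k \<in> {1..n} \<Longrightarrow> Keig j (w k)"
  unfolding Keig_def using h0
  by (intro conjI B_w exI[of _ "if k = j then inverse h else if k = Suc j then h else 1"]
      exI[of _ "if k = j then h else if k = Suc j then inverse h else 1"]) (simp_all add: ac_Ku_w ac_Kd_w)

lemma E_zero_mult: "j \<in> {1..<n} \<Longrightarrow> x \<in> B \<Longrightarrow> y \<in> B \<Longrightarrow> ac (var (E j)) x = 0 \<Longrightarrow> ac (var (E j)) y = 0 \<Longrightarrow> ac (var (E j)) (x * y) = 0"
  by (simp add: ac_E_mult)

lemma E_zero_prod_list:
  assumes j: "j \<in> {1..<n}" and x: "\<And>x. x \<in> set xs \<Longrightarrow> x \<in> B \<and> ac (var (E j)) x = 0"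
  shows "prod_list xs \<in> B \<and> ac (var (E j)) (prod_list xs) = 0"
  using x
proof (induction xs)
  case Nil
  then show ?case using j by (simp add: ac_one ufp_gens nc_eval_simps)
next
  case (Cons x xs)
  then show ?case using E_zero_mult[OF j, of x "prod_list xs"] by (simp add: B_mult)
qed

lemma E_zero_power: "j \<in> {1..<n} \<Longrightarrow> x \<in> B \<Longrightarrow> ac (var (E j)) x = 0 \<Longrightarrow> ac (var (E j)) (x ^ k) = 0"
  using E_zero_prod_list[of j "replicate k x"] by simp

text \<open>Splitting off one factor gives a recurrence that is solved by [b+1] = [b]/q + q^b after
  writing q^b as h^b h^b. The new z_j is kept on the left, where an ordered monomial wants
  it.\<close>

lemma E_z_power: assumes j: "j \<in> {1..<n}"
  shows "ac (var (E j)) (z (Suc j) ^ b) = scale (qi b * h / h ^ b) (z j * z (Suc j) ^ (b - 1))"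
proof (induction b)
  case 0
  show ?case using j by (simp add: ac_one ufp_gens nc_eval_simps)
next
  case (Suc b)
  have B: "z (Suc j) \<in> B" "z (Suc j) ^ b \<in> B" using j by (auto intro!: B_power B_z)
  have Kd: "ac (Kd j) (z (Suc j) ^ k) = scale (h ^ k) (z (Suc j) ^ k)" for k
  proof (induction k)
    case 0
    show ?case using K_ufp[OF j] by (simp add: ac_one nc_eval_simps)
  next
    case (Suc k)
    have "z (Suc j) ^ k \<in> B" using B by auto
    then show ?case using Suc j B by (simp add: ac_Kd_mult ac_Kd_z scale_simps mult.commute)
  qed
  have zz: "z (Suc j) * z j = scale (inverse q) (z j * z (Suc j))"
    using z_z[of j "Suc j"] j q0 by simp
  have "ac (var (E j)) (z (Suc j) * z (Suc j) ^ b)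
    = scale (h ^ b) (z j * z (Suc j) ^ b) + scale (inverse h) (scale (qi b * h / h ^ b) (z (Suc j) * z j * z (Suc j) ^ (b - 1)))"
    unfolding ac_E_mult[OF j B] Kd Suc.IH using j
    by (simp add: ac_E_z ac_Ku_z scale_simps mult.assoc)
  also have "scale (qi b * h / h ^ b) (z (Suc j) * z j * z (Suc j) ^ (b - 1)) = scale (qi b * h / h ^ b * inverse q) (z j * z (Suc j) ^ b)"
    unfolding zz by (cases b) (simp_all add: scale_simps mult.assoc)
  also have "scale (h ^ b) (z j * z (Suc j) ^ b) + scale (inverse h) (scale (qi b * h / h ^ b * inverse q) (z j * z (Suc j) ^ b))
    = scale (h ^ b + inverse h * (qi b * h / h ^ b * inverse q)) (z j * z (Suc j) ^ b)"
    by (simp add: lop.scale_left_distrib)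
  also have "h ^ b + inverse h * (qi b * h / h ^ b * inverse q) = qi (Suc b) * h / h ^ Suc b"
  proof -
    have "q ^ b = h ^ b * h ^ b" unfolding h_square[symmetric] by (simp add: power2_eq_square power_mult_distrib)
    then show ?thesis unfolding qint_Suc' using h0 q0 by (simp add: field_simps)
  qed
  finally show ?case by simp
qed

text \<open>Here the single factor is split off on the right, so that the new w_{j+1} ends up behind
  the powers of w_j; the recurrence is [c+1] = q[c] + q^(-c).\<close>

lemma E_w_power: assumes j: "j \<in> {1..<n}"
  shows "ac (var (E j)) (w j ^ c) = scale (- (qi c * h ^ c) / (h * q)) (w j ^ (c - 1) * w (Suc j))"
proof (induction c)
  case 0
  show ?case using j by (simp add: ac_one ufp_gens nc_eval_simps)
next
  case (Suc c)
  have B: "w j \<in> B" "w j ^ c \<in> B" using j by (auto intro!: B_power B_w)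
  have Ku: "ac (Ku j) (w j ^ k) = scale (inverse h ^ k) (w j ^ k)" for k
  proof (induction k)
    case 0
    show ?case using K_ufp[OF j] by (simp add: ac_one nc_eval_simps)
  next
    case (Suc k)
    have "w j ^ k \<in> B" using B by auto
    then show ?case using Suc j B by (simp add: ac_Ku_mult ac_Ku_w scale_simps mult.commute)
  qed
  have ww: "w (Suc j) * w j = scale q (w j * w (Suc j))"
    using w_w[of j "Suc j"] j q0 by simp
  have "ac (var (E j)) (w j ^ c * w j)
    = scale h (scale (- (qi c * h ^ c) / (h * q)) (w j ^ (c - 1) * (w (Suc j) * w j))) + scale (- (inverse h ^ c * inverse q)) (w j ^ c * w (Suc j))"
    unfolding ac_E_mult[OF j B(2,1)] Ku Suc.IH using j
    by (simp add: ac_E_w ac_Kd_w scale_simps mult.assoc mult.commute[of "inverse q"])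
  also have "scale (- (qi c * h ^ c) / (h * q)) (w j ^ (c - 1) * (w (Suc j) * w j)) = scale (- (qi c * h ^ c) / (h * q) * q) (w j ^ c * w (Suc j))"
    unfolding ww
  proof (cases c)
    case (Suc k)
    have "w j ^ k * (w j * w (Suc j)) = w j ^ c * w (Suc j)" unfolding Suc power_Suc2 by (simp add: mult.assoc)
    then show "scale (- (qi c * h ^ c) / (h * q)) (w j ^ (c - 1) * scale q (w j * w (Suc j))) = scale (- (qi c * h ^ c) / (h * q) * q) (w j ^ c * w (Suc j))"
      unfolding Suc diff_Suc_1 by (simp only: scale_simps)
  qed simp
  also have "scale h (scale (- (qi c * h ^ c) / (h * q) * q) (w j ^ c * w (Suc j))) + scale (- (inverse h ^ c * inverse q)) (w j ^ c * w (Suc j))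
    = scale (h * (- (qi c * h ^ c) / (h * q) * q) + - (inverse h ^ c * inverse q)) (w j ^ c * w (Suc j))"
    by (simp only: lop.scale_left_distrib lop.scale_scale)
  also have "h * (- (qi c * h ^ c) / (h * q) * q) + - (inverse h ^ c * inverse q) = - (qi (Suc c) * h ^ Suc c) / (h * q)"
  proof -
    have "q ^ c = h ^ c * h ^ c" unfolding h_square[symmetric] by (simp add: power2_eq_square power_mult_distrib)
    then show ?thesis unfolding qint_Suc using h0 q0 by (simp add: field_simps)
  qed
  finally show ?case by (simp only: power_Suc2 diff_Suc_1)
qed

end

section \<open>Coordinates with respect to the ordered monomials z w\<close>

context zw_setup
begin

definition coef :: "(nat \<Rightarrow> nat) \<times> (nat \<Rightarrow> nat) \<Rightarrow> lop \<Rightarrow> complex" where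
  "coef = (SOME \<kappa>. (\<forall>i x y. \<kappa> i (x + y) = \<kappa> i x + \<kappa> i y) \<and> (\<forall>i c x. \<kappa> i (scale c x) = c * \<kappa> i x) \<and>
     (\<forall>i\<in>supp. \<forall>j\<in>supp. \<kappa> i (mzw j) = (if i = j then 1 else 0)))"

lemma coef_add: "coef i (x + y) = coef i x + coef i y"
  and coef_scale: "coef i (scale c x) = c * coef i x"
  and coef_mzw: "i \<in> supp \<Longrightarrow> j \<in> supp \<Longrightarrow> coef i (mzw j) = (if i = j then 1 else 0)"
proof -
  obtain \<kappa> :: "(nat \<Rightarrow> nat) \<times> (nat \<Rightarrow> nat) \<Rightarrow> lop \<Rightarrow> complex" where
    "\<And>i x y. \<kappa> i (x + y) = \<kappa> i x + \<kappa> i y" "\<And>i c x. \<kappa> i (scale c x) = c * \<kappa> i x"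
    "\<And>i j. i \<in> supp \<Longrightarrow> j \<in> supp \<Longrightarrow> \<kappa> i (mzw j) = (if i = j then 1 else 0)"
    by (rule coeff_functional[OF mzw_basis(2,1)]) blast
  then have "\<exists>\<kappa> :: (nat \<Rightarrow> nat) \<times> (nat \<Rightarrow> nat) \<Rightarrow> lop \<Rightarrow> complex. (\<forall>i x y. \<kappa> i (x + y) = \<kappa> i x + \<kappa> i y) \<and> (\<forall>i c x. \<kappa> i (scale c x) = c * \<kappa> i x) \<and>
     (\<forall>i\<in>supp. \<forall>j\<in>supp. \<kappa> i (mzw j) = (if i = j then 1 else 0))"
    by (intro exI[of _ \<kappa>]) simp
  from someI_ex[OF this, folded coef_def]
  show "coef i (x + y) = coef i x + coef i y" "coef i (scale c x) = c * coef i x"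
    "i \<in> supp \<Longrightarrow> j \<in> supp \<Longrightarrow> coef i (mzw j) = (if i = j then 1 else 0)"
    by blast+
qed

lemma coef_zero: "coef i 0 = 0"
  using coef_scale[of i 0 0] by simp

lemma coef_sum: "coef i (sum f I) = (\<Sum>k\<in>I. coef i (f k))"
  by (induction I rule: infinite_finite_induct) (simp_all add: coef_zero coef_add)

lemma coef_diff: "coef i (x - y) = coef i x - coef i y"
  using coef_add[of i x "scale (-1) y"] unfolding coef_scale by simp

lemma coef_outside: "x \<in> evl ` zw.V A \<Longrightarrow> A \<subseteq> supp \<Longrightarrow> i \<in> supp \<Longrightarrow> i \<notin> A \<Longrightarrow> coef i x = 0"
  by (induction rule: span_zw_induct) (auto simp: coef_zero coef_add coef_scale coef_mzw)

lemma coef_eq_zero: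
  assumes "x \<in> B" "\<And>i. i \<in> supp \<Longrightarrow> coef i x = 0"
  shows "x = 0"
proof -
  obtain p where p: "p \<in> fp" "x = evl p" using assms(1) unfolding B_def by (rule imageE)
  obtain I c where I: "finite I" "I \<subseteq> supp" and c: "cong p (\<Sum>(r, s)\<in>I. scal (c (r, s)) * (zw.xm r * zw.ym s))"
    using zw.V_explicit[OF zw.fpoly_V[OF p(1)]] by (elim exE conjE)
  have x: "x = (\<Sum>i\<in>I. scale (c i) (mzw i))"
    unfolding p(2) cong_evl[OF c] evl_simps(10)
    by (rule sum.cong[OF refl]) (simp add: case_prod_unfold evl_scal evl_pair)
  have "c i = 0" if "i \<in> I" for i
  proof -
    have "coef i x = (\<Sum>k\<in>I. if i = k then c k else 0)"
      unfolding x coef_sum coef_scale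
    proof (rule sum.cong[OF refl])
      fix k assume "k \<in> I"
      then show "c k * coef i (mzw k) = (if i = k then c k else 0)"
        using coef_mzw[OF subsetD[OF I(2) that] subsetD[OF I(2)], of k] by simp
    qed
    then show ?thesis using I that assms(2)[of i] by auto
  qed
  then show ?thesis unfolding x by simp
qed

lemma upd_Suc_inj: "r(j := Suc (r j)) = r'(j := Suc (r' j)) \<longleftrightarrow> r = r'"
proof
  assume e: "r(j := Suc (r j)) = r'(j := Suc (r' j))"
  show "r = r'"
  proof
    fix k
    show "r k = r' k" using fun_cong[OF e, of k] by (cases "k = j") auto
  qed
qed simp

lemma coef_z: "x \<in> B \<Longrightarrow> (r, s) \<in> supp \<Longrightarrow> j \<in> {1..n} \<Longrightarrow>
  coef (r(j := Suc (r j)), s) (z j * x) = 1 / q ^ sum r {1..<j} * coef (r, s) x"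
proof (induction rule: B_zw_induct)
  case (mon r' s')
  then show ?case
    by (simp add: z_mzw coef_scale coef_mzw supp_upd upd_Suc_inj del: fun_upd_apply)
qed (simp_all add: coef_zero coef_add coef_scale distrib_left scale_mult_right)

lemma coef_z_zero: "x \<in> B \<Longrightarrow> (r, s) \<in> supp \<Longrightarrow> j \<in> {1..n} \<Longrightarrow> r j = 0 \<Longrightarrow> coef (r, s) (z j * x) = 0"
proof (induction rule: B_zw_induct)
  case (mon r' s')
  then have "(r, s) \<noteq> (r'(j := Suc (r' j)), s')" by (metis Pair_inject fun_upd_same nat.distinct(1))
  then show ?case
    using mon unfolding z_mzw[OF mon(3)] coef_scale
    by (subst coef_mzw) (auto intro: supp_upd simp del: fun_upd_apply)
qed (simp_all add: coef_zero coef_add coef_scale distrib_left scale_mult_right)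

lemma coef_w: "x \<in> B \<Longrightarrow> (r, s) \<in> supp \<Longrightarrow> j \<in> {1..n} \<Longrightarrow>
  coef (r, s(j := Suc (s j))) (x * w j) = q ^ sum s {j<..n} * coef (r, s) x"
proof (induction rule: B_zw_induct)
  case (mon r' s')
  then show ?case
    by (simp add: mzw_w coef_scale coef_mzw supp_upd upd_Suc_inj del: fun_upd_apply)
qed (simp_all add: coef_zero coef_add coef_scale distrib_right[where 'a = lop] distrib_left scale_mult_left)

text \<open>The scalar is a power of \<open>q\<close>; it is left implicit because only its
  nonvanishing matters for separating the invariants.\<close>

lemma coef_z_power: "x \<in> B \<Longrightarrow> (r, s) \<in> supp \<Longrightarrow> n \<ge> 1 \<Longrightarrow>
  \<exists>c. c \<noteq> 0 \<and> coef (r(n := r n + p), s) (z n ^ p * x) = c * coef (r, s) x"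
proof (induction p)
  case 0
  then show ?case by (intro exI[of _ 1]) simp
next
  case (Suc p)
  then obtain c where c: "c \<noteq> 0" "coef (r(n := r n + p), s) (z n ^ p * x) = c * coef (r, s) x" by blast
  let ?r = "r(n := r n + p)"
  have "(?r, s) \<in> supp" "z n ^ p * x \<in> B" using Suc by (auto intro!: supp_upd B_mult B_power B_z)
  then have "coef (?r(n := Suc (?r n)), s) (z n * (z n ^ p * x)) = 1 / q ^ sum ?r {1..<n} * (c * coef (r, s) x)"
    unfolding c(2)[symmetric] using Suc by (intro coef_z) auto
  moreover have "?r(n := Suc (?r n)) = r(n := r n + Suc p)" by simp
  ultimately show ?case
    using c(1) q0 by (intro exI[of _ "1 / q ^ sum ?r {1..<n} * c"]) (simp only: power_Suc mult.assoc, simp)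
qed

lemma coef_w_power: "x \<in> B \<Longrightarrow> (r, s) \<in> supp \<Longrightarrow> n \<ge> 1 \<Longrightarrow>
  \<exists>c. c \<noteq> 0 \<and> coef (r, s(n := s n + p)) (x * w n ^ p) = c * coef (r, s) x"
proof (induction p)
  case 0
  then show ?case by (intro exI[of _ 1]) simp
next
  case (Suc p)
  then obtain c where c: "c \<noteq> 0" "coef (r, s(n := s n + p)) (x * w n ^ p) = c * coef (r, s) x" by blast
  let ?s = "s(n := s n + p)"
  have "(r, ?s) \<in> supp" "x * w n ^ p \<in> B" using Suc by (auto intro!: supp_upd B_mult B_power B_w)
  then have "coef (r, ?s(n := Suc (?s n))) ((x * w n ^ p) * w n) = q ^ sum ?s {n<..n} * (c * coef (r, s) x)"
    unfolding c(2)[symmetric] using Suc by (intro coef_w) auto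
  moreover have "?s(n := Suc (?s n)) = s(n := s n + Suc p)" by simp
  ultimately show ?case
    using c(1) q0 by (intro exI[of _ "q ^ sum ?s {n<..n} * c"]) (simp only: power_Suc2 mult.assoc, simp)
qed

lemma coef_z_power_zero: "x \<in> B \<Longrightarrow> (r, s) \<in> supp \<Longrightarrow> n \<ge> 1 \<Longrightarrow> r n < p \<Longrightarrow> coef (r, s) (z n ^ p * x) = 0"
proof (induction p arbitrary: r)
  case (Suc p)
  have xB: "z n ^ p * x \<in> B" using Suc by (auto intro!: B_mult B_power B_z)
  show ?case
  proof (cases "r n")
    case 0
    then show ?thesis using coef_z_zero[OF xB Suc.prems(2), of n] Suc.prems by (simp add: mult.assoc)
  next
    case (Suc k)
    let ?r = "r(n := k)"
    have s: "(?r, s) \<in> supp" using Suc.prems by (intro supp_upd) auto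
    have "r = ?r(n := Suc (?r n))" using Suc by auto
    then have "coef (r, s) (z n * (z n ^ p * x)) = 1 / q ^ sum ?r {1..<n} * coef (?r, s) (z n ^ p * x)"
      using coef_z[OF xB s, of n] Suc.prems by simp
    also have "?r n < p" using Suc.prems Suc by simp
    then have "coef (?r, s) (z n ^ p * x) = 0" using Suc.IH[OF Suc.prems(1) s] Suc.prems by blast
    finally show ?thesis by (simp add: mult.assoc)
  qed
qed simp

lemma Qu_power_mult: "k \<le> n \<Longrightarrow> Qu k ^ Suc t * x = (\<Sum>i\<in>{1..k}. z i * (Qu k ^ t * (w i * x)))"
proof (cases "k = 0")
  case False
  assume "k \<le> n"
  then have "k \<in> {1..n}" using False by auto
  then show ?thesis by (simp only: Qu_rec_z sum_distrib_right mult.assoc)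
qed (simp add: Qu_def)

text \<open>By \<open>Qu_power_mult\<close>, every factor Q_k puts some z_i with i <= k in front,
  and left multiplication by z_i raises the exponent of z_i by one. So only monomials of degree at
  least \<open>t\<close> in z_1, ..., z_k can occur.\<close>

lemma coef_Qu_zero:
  "x \<in> B \<Longrightarrow> (r, s) \<in> supp \<Longrightarrow> k \<le> n \<Longrightarrow> sum r {1..k} < t \<Longrightarrow> coef (r, s) (Qu k ^ t * x) = 0"
proof (induction t arbitrary: r x)
  case (Suc t)
  have "coef (r, s) (z i * (Qu k ^ t * (w i * x))) = 0" if i: "i \<in> {1..k}" for i
  proof -
    have i': "i \<in> {1..n}" using i Suc.prems by auto
    have xB: "w i * x \<in> B" "Qu k ^ t * (w i * x) \<in> B"
      using Suc.prems i' by (auto intro!: B_mult B_power B_w Qu_B)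
    show ?thesis
    proof (cases "r i")
      case 0
      then show ?thesis using coef_z_zero[OF xB(2) Suc.prems(2) i'] by simp
    next
      case (Suc m)
      let ?r = "r(i := m)"
      have s: "(?r, s) \<in> supp" using Suc.prems i' by (intro supp_upd) auto
      have r: "r = ?r(i := Suc (?r i))" using Suc by auto
      have "sum r {1..k} = Suc (sum ?r {1..k})"
        by (subst r, subst sum_Suc) (use i in auto)
      then have "sum ?r {1..k} < t" using Suc.prems(4) by linarith
      then have "coef (?r, s) (Qu k ^ t * (w i * x)) = 0"
        by (rule Suc.IH[OF xB(1) s Suc.prems(3)])
      then show ?thesis using coef_z[OF xB(2) s i'] unfolding r[symmetric] by simp
    qed
  qed
  then show ?case
    unfolding Qu_power_mult[OF Suc.prems(3)] coef_sum by (simp add: sum.neutral)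
qed simp

text \<open>In each step only the summand i = 1 can produce a monomial in z_1 and w_1 alone. No
  power of \<open>q\<close> arises: nothing stands before z_1, and the exponents of w behind w_1 are
  zero.\<close>

lemma coef_Qu_first:
  assumes k: "1 \<le> k" "k \<le> n"
  defines "e \<equiv> \<lambda>t i. if i = 1 then t else 0 :: nat"
  shows "coef (e t, e t) (Qu k ^ t) = 1"
proof (induction t)
  case 0
  have "mzw (e 0, e 0) = 1"
    by (simp add: e_def mzw_def zmon_def wmon_def map_replicate_const if_distrib cong: if_cong del: upt_Suc)
  then show ?case using coef_mzw[of "(e 0, e 0)" "(e 0, e 0)"] by (simp add: supp_iff e_def)
next
  case (Suc t)
  have e: "(e t, e t') \<in> supp" for t t' using k by (auto simp: supp_iff e_def)
  have eS: "(e t)(1 := Suc (e t 1)) = e (Suc t)" for t by (auto simp: e_def)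
  have QB: "Qu k ^ t \<in> B" using k by (intro B_power Qu_B)
  have "coef (e (Suc t), e (Suc t)) (z i * (Qu k ^ t * w i)) = (if i = 1 then 1 else 0)" if i: "i \<in> {1..k}" for i
  proof -
    have i': "i \<in> {1..n}" using i k by auto
    have xB: "Qu k ^ t * w i \<in> B" using QB i' by (intro B_mult B_w)
    show ?thesis
    proof (cases "i = 1")
      case True
      have "coef (e (Suc t), e (Suc t)) (z 1 * (Qu k ^ t * w 1)) = coef (e t, e (Suc t)) (Qu k ^ t * w 1)"
        using coef_z[OF xB e i', of t "Suc t"] unfolding True eS by simp
      also have "\<dots> = q ^ sum (e t) {1<..n} * coef (e t, e t) (Qu k ^ t)"
        using coef_w[OF QB e i', of t t] unfolding True eS .
      also have "sum (e t) {1<..n} = 0" by (simp add: e_def)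
      finally show ?thesis using True Suc.IH by simp
    next
      case False
      then show ?thesis using coef_z_zero[OF xB e i'] by (simp add: e_def)
    qed
  qed
  then have "coef (e (Suc t), e (Suc t)) (Qu k ^ Suc t * 1) = (\<Sum>i\<in>{1..k}. if i = 1 then 1 else 0)"
    unfolding Qu_power_mult[OF k(2)] coef_sum by simp
  then show ?case using k(1) by simp
qed

end

context zw_action
begin

lemma coef_KH: "x \<in> B \<Longrightarrow> (r, s) \<in> supp \<Longrightarrow> i \<in> {1..n} \<Longrightarrow>
  coef (r, s) (ac (var (KH i)) x) = h ^ r i * inverse h ^ s i * coef (r, s) x"
proof -
  assume *: "(r, s) \<in> supp" "i \<in> {1..n}"
  show "x \<in> B \<Longrightarrow> ?thesis"
  proof -
    assume "x \<in> B"
    then have "x \<in> B \<and> coef (r, s) (ac (var (KH i)) x) = h ^ r i * inverse h ^ s i * coef (r, s) x"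
    proof (induction rule: B_zw_induct)
      case (mon r' s')
      then show ?case using * by (auto simp: KH_mzw coef_scale coef_mzw)
    qed (use * in \<open>auto simp: ac_zero ac_add ac_scale ufp_gens coef_zero coef_add coef_scale distrib_left\<close>)
    then show ?thesis ..
  qed
qed

lemma h_power_inj: "h ^ a = h ^ b \<Longrightarrow> a = b"
proof -
  have le: "a = b" if eq: "h ^ a = h ^ b" and ab: "a \<le> b" for a b :: nat
  proof (rule ccontr)
    assume "a \<noteq> b"
    obtain d where d: "b = a + d" using le_Suc_ex[OF ab] by blast
    then have "h ^ d = 1" using eq h0 by (simp add: power_add)
    then have "(h ^ d)\<^sup>2 = 1" by simp
    then have "q ^ d = 1" unfolding h_square[symmetric] by (simp add: power_mult[symmetric] mult.commute)
    then show False using qroot[of d] d \<open>a \<noteq> b\<close> by simp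
  qed
  show "h ^ a = h ^ b \<Longrightarrow> a = b" using le[of a b] le[of b a] by (cases "a \<le> b") auto
qed

text \<open>\<open>KH i\<close> multiplies the coefficient by h^(r_i - s_i), which differs from 1
  because \<open>h\<close> is not a root of unity either.\<close>

lemma Ginv_weight: "Ginv x \<Longrightarrow> (r, s) \<in> supp \<Longrightarrow> i \<in> {1..n - 1} \<Longrightarrow> r i \<noteq> s i \<Longrightarrow> coef (r, s) x = 0"
proof -
  assume *: "Ginv x" "(r, s) \<in> supp" "i \<in> {1..n - 1}" "r i \<noteq> s i"
  then have "coef (r, s) x = h ^ r i * inverse h ^ s i * coef (r, s) x"
    using coef_KH[of x r s i] by (auto simp: Ginv_def)
  moreover have "h ^ r i * inverse h ^ s i \<noteq> 1"
    using *(4) h_power_inj[of "r i" "s i"] h0 by (auto simp: power_inverse field_simps)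
  ultimately show ?thesis by (metis mult_cancel_right1)
qed

end

section \<open>Raising operators determine an invariant by few coefficients\<close>

context zw_action
begin

text \<open>If the outer factors are killed by E_j and are eigenvectors of the group-like elements
  in its comultiplication, then E_j acts on the middle factor alone, up to a nonzero scalar.\<close>

lemma E_conjugate:
  assumes j: "j \<in> {1..<n}" and P: "Keig j P" "ac (var (E j)) P = 0" and T: "Keig j T" "ac (var (E j)) T = 0"
    and x: "x \<in> B"
  shows "\<exists>k. k \<noteq> 0 \<and> ac (var (E j)) (P * x * T) = scale k (P * ac (var (E j)) x * T)"
proof -
  obtain k where k: "k \<noteq> 0" "ac (Ku j) P = scale k P" and PB: "P \<in> B" using P unfolding Keig_def by blast
  obtain k' where k': "k' \<noteq> 0" "ac (Kd j) T = scale k' T" and TB: "T \<in> B" using T unfolding Keig_def by blast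
  have xT: "x * T \<in> B" using x TB by (rule B_mult)
  have "ac (var (E j)) (P * (x * T)) = scale (k * k') (P * (ac (var (E j)) x * T))"
    unfolding ac_E_mult[OF j PB xT] ac_E_mult[OF j x TB] P(2) T(2) k(2) k'(2) by (simp add: scale_simps)
  then show ?thesis using k(1) k'(1) by (intro exI[of _ "k * k'"]) (simp add: mult.assoc)
qed

text \<open>E_j kills every z_i except z_{j+1}. The z_j that it produces stands to the left of the
  remaining powers of z_{j+1} and joins the power of z_j, so the result is ordered already.\<close>

lemma E_zmon:
  assumes j: "j \<in> {1..<n}"
  shows "\<exists>k. k \<noteq> 0 \<and> ac (var (E j)) (zmon r) = scale (k * qi (r (Suc j))) (zmon (r(j := Suc (r j), Suc j := r (Suc j) - 1)))"
proof -
  let ?f = "\<lambda>i. z i ^ r i"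
  define r' where "r' = r(j := Suc (r j), Suc j := r (Suc j) - 1)"
  let ?f' = "\<lambda>i. z i ^ r' i"
  define P where "P = prod_list (map ?f [1..<Suc j])"
  define T where "T = prod_list (map ?f [Suc (Suc j)..<Suc n])"
  let ?z = "z (Suc j)"
  have Sj: "Suc j \<in> {1..n}" using j by auto
  have zr: "zmon r = P * ?z ^ r (Suc j) * T"
    unfolding zmon_def P_def T_def by (rule prod_list_split[OF Sj])
  have m: "map ?f' [1..<j] = map ?f [1..<j]" by (auto simp: r'_def)
  have e: "[1..<Suc j] = [1..<j] @ [j]" using j by auto
  have P': "prod_list (map ?f' [1..<Suc j]) = P * z j"
    unfolding P_def e map_append prod_list.append m by (simp add: r'_def mult.assoc power_commutes)
  have T': "prod_list (map ?f' [Suc (Suc j)..<Suc n]) = T"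
    unfolding T_def by (rule arg_cong[of _ _ prod_list], rule map_cong) (auto simp: r'_def simp del: upt_Suc)
  have zr': "zmon r' = P * z j * ?z ^ (r (Suc j) - 1) * T"
    unfolding zmon_def prod_list_split[OF Sj, of ?f'] P' T' by (simp add: r'_def)
  have KP: "Keig j P" "Keig j T"
    unfolding P_def T_def using j
    by (auto intro!: Keig_prod_list Keig_power Keig_z simp del: upt_Suc)
  have "P \<in> B \<and> ac (var (E j)) P = 0"
    unfolding P_def by (rule E_zero_prod_list[OF j]) (use j in \<open>auto intro!: E_zero_power B_power B_z simp: ac_E_z simp del: upt_Suc\<close>)
  moreover have "T \<in> B \<and> ac (var (E j)) T = 0"
    unfolding T_def by (rule E_zero_prod_list[OF j]) (use j in \<open>auto intro!: E_zero_power B_power B_z simp: ac_E_z simp del: upt_Suc\<close>)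
  moreover have "?z ^ r (Suc j) \<in> B" using Sj by (intro B_power B_z)
  ultimately obtain k where k: "k \<noteq> 0" "ac (var (E j)) (P * ?z ^ r (Suc j) * T) = scale k (P * ac (var (E j)) (?z ^ r (Suc j)) * T)"
    using E_conjugate[OF j KP(1) _ KP(2)] by blast
  have "ac (var (E j)) (zmon r) = scale (k * (qi (r (Suc j)) * h / h ^ r (Suc j))) (zmon r')"
    unfolding zr k(2) E_z_power[OF j] zr' by (simp add: scale_simps mult.assoc)
  moreover have "k * (qi (r (Suc j)) * h / h ^ r (Suc j)) = k * h / h ^ r (Suc j) * qi (r (Suc j))" by simp
  ultimately show ?thesis
    using k(1) h0 unfolding r'_def by (intro exI[of _ "k * h / h ^ r (Suc j)"] conjI) simp_all
qed

text \<open>E_j kills every w_i except w_j, and the w_{j+1} that it produces joins the power of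
  w_{j+1} directly behind.\<close>

lemma E_wmon:
  assumes j: "j \<in> {1..<n}"
  shows "\<exists>k. k \<noteq> 0 \<and> ac (var (E j)) (wmon s) = scale (k * qi (s j)) (wmon (s(j := s j - 1, Suc j := Suc (s (Suc j)))))"
proof -
  let ?f = "\<lambda>i. w i ^ s i"
  define s' where "s' = s(j := s j - 1, Suc j := Suc (s (Suc j)))"
  let ?f' = "\<lambda>i. w i ^ s' i"
  define P where "P = prod_list (map ?f [1..<j])"
  define T where "T = prod_list (map ?f [Suc j..<Suc n])"
  have jn: "j \<in> {1..n}" using j by auto
  have wr: "wmon s = P * w j ^ s j * T"
    unfolding wmon_def P_def T_def by (rule prod_list_split[OF jn])
  have P': "prod_list (map ?f' [1..<j]) = P"
    unfolding P_def by (rule arg_cong[of _ _ prod_list], rule map_cong) (auto simp: s'_def)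
  have m: "map ?f' [Suc (Suc j)..<Suc n] = map ?f [Suc (Suc j)..<Suc n]"
    by (rule map_cong) (auto simp: s'_def simp del: upt_Suc)
  have e: "[Suc j..<Suc n] = Suc j # [Suc (Suc j)..<Suc n]" using j by (intro upt_conv_Cons) auto
  have T': "prod_list (map ?f' [Suc j..<Suc n]) = w (Suc j) * T"
    unfolding T_def e list.map prod_list.Cons m by (simp add: s'_def mult.assoc del: upt_Suc)
  have wr': "wmon s' = P * w j ^ (s j - 1) * (w (Suc j) * T)"
    unfolding wmon_def prod_list_split[OF jn, of ?f'] P' T' by (simp add: s'_def)
  have KP: "Keig j P" "Keig j T"
    unfolding P_def T_def using j
    by (auto intro!: Keig_prod_list Keig_power Keig_w simp del: upt_Suc)
  have "P \<in> B \<and> ac (var (E j)) P = 0"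
    unfolding P_def by (rule E_zero_prod_list[OF j]) (use j in \<open>auto intro!: E_zero_power B_power B_w simp: ac_E_w simp del: upt_Suc\<close>)
  moreover have "T \<in> B \<and> ac (var (E j)) T = 0"
    unfolding T_def by (rule E_zero_prod_list[OF j]) (use j in \<open>auto intro!: E_zero_power B_power B_w simp: ac_E_w simp del: upt_Suc\<close>)
  moreover have "w j ^ s j \<in> B" using jn by (intro B_power B_w)
  ultimately obtain k where k: "k \<noteq> 0" "ac (var (E j)) (P * w j ^ s j * T) = scale k (P * ac (var (E j)) (w j ^ s j) * T)"
    using E_conjugate[OF j KP(1) _ KP(2)] by blast
  have "ac (var (E j)) (wmon s) = scale (k * (- (qi (s j) * h ^ s j) / (h * q))) (wmon s')"
    unfolding wr k(2) E_w_power[OF j] wr' by (simp add: scale_simps mult.assoc)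
  moreover have "k * (- (qi (s j) * h ^ s j) / (h * q)) = - k * h ^ s j / (h * q) * qi (s j)" by simp
  ultimately show ?thesis
    using k(1) h0 q0 unfolding s'_def by (intro exI[of _ "- k * h ^ s j / (h * q)"] conjI) simp_all
qed

lemma Keig_zmon: "j \<in> {1..<n} \<Longrightarrow> Keig j (zmon r)"
  unfolding zmon_def by (rule Keig_prod_list) (auto intro!: Keig_power Keig_z simp del: upt_Suc)

lemma Keig_wmon: "j \<in> {1..<n} \<Longrightarrow> Keig j (wmon r)"
  unfolding wmon_def by (rule Keig_prod_list) (auto intro!: Keig_power Keig_w simp del: upt_Suc)

lemma E_mzw:
  assumes j: "j \<in> {1..<n}"
  shows "\<exists>k k'. k \<noteq> 0 \<and> ac (var (E j)) (mzw (r, s))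
    = scale (k * qi (r (Suc j))) (mzw (r(j := Suc (r j), Suc j := r (Suc j) - 1), s))
      + scale (k' * qi (s j)) (mzw (r, s(j := s j - 1, Suc j := Suc (s (Suc j)))))"
proof -
  obtain k1 where k1: "k1 \<noteq> 0" "ac (var (E j)) (zmon r) = scale (k1 * qi (r (Suc j))) (zmon (r(j := Suc (r j), Suc j := r (Suc j) - 1)))"
    using E_zmon[OF j] by blast
  obtain k2 where k2: "ac (var (E j)) (wmon s) = scale (k2 * qi (s j)) (wmon (s(j := s j - 1, Suc j := Suc (s (Suc j)))))"
    using E_wmon[OF j] by blast
  obtain d where d: "d \<noteq> 0" "ac (Kd j) (wmon s) = scale d (wmon s)"
    using Keig_wmon[OF j, of s] unfolding Keig_def by blast
  obtain u where u: "ac (Ku j) (zmon r) = scale u (zmon r)"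
    using Keig_zmon[OF j, of r] unfolding Keig_def by blast
  have "ac (var (E j)) (mzw (r, s))
    = scale (k1 * d * qi (r (Suc j))) (mzw (r(j := Suc (r j), Suc j := r (Suc j) - 1), s))
      + scale (u * k2 * qi (s j)) (mzw (r, s(j := s j - 1, Suc j := Suc (s (Suc j)))))"
    unfolding mzw_def prod.case ac_E_mult[OF j B_zmon B_wmon] k1(2) k2 d(2) u
    by (simp add: scale_simps mult_ac del: fun_upd_apply)
  then show ?thesis using k1(1) d(1) by (intro exI[of _ "k1 * d"] exI[of _ "u * k2"]) simp
qed

abbreviation raise :: "nat \<Rightarrow> (nat \<Rightarrow> nat) \<Rightarrow> nat \<Rightarrow> nat" where
  "raise j r \<equiv> r(j := Suc (r j), Suc j := r (Suc j) - 1)"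

abbreviation lower :: "nat \<Rightarrow> (nat \<Rightarrow> nat) \<Rightarrow> nat \<Rightarrow> nat" where
  "lower j s \<equiv> s(j := s j - 1, Suc j := Suc (s (Suc j)))"

lemma raise_inj: "r (Suc j) > 0 \<Longrightarrow> r' (Suc j) > 0 \<Longrightarrow> raise j r = raise j r' \<Longrightarrow> r = r'"
proof
  fix k assume "r (Suc j) > 0" "r' (Suc j) > 0" and e: "raise j r = raise j r'"
  have "raise j r k = raise j r' k" using e by (rule fun_cong)
  then show "r k = r' k" using \<open>r (Suc j) > 0\<close> \<open>r' (Suc j) > 0\<close> by (auto split: if_splits)
qed

lemma lower_raise: "s j > 0 \<Longrightarrow> raise j (lower j s) = s"
  by (auto simp: fun_eq_iff)

lemma raise_lower: "s (Suc j) > 0 \<Longrightarrow> lower j (raise j s) = s"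
  by (auto simp: fun_eq_iff)

lemma raise_supp: "j \<in> {1..<n} \<Longrightarrow> (r, s) \<in> supp \<Longrightarrow> (raise j r, s) \<in> supp \<and> (raise j r, raise j s) \<in> supp"
  by (auto simp: supp_iff)

lemma lower_supp: "j \<in> {1..<n} \<Longrightarrow> (r, s) \<in> supp \<Longrightarrow> (r, lower j s) \<in> supp"
  by (auto simp: supp_iff)

text \<open>Under E_j the monomial (raise j r, s) comes from two monomials only: from (r, s), by
  turning a z_{j+1} into z_j, and from (raise j r, raise j s), by turning a w_j into w_{j+1}.
  Positivity at j + 1 makes \<open>raise\<close> invertible in spite of the truncated subtraction
  and makes the q-integer in \<open>k\<close> nonzero.\<close>

lemma E_coef:
  assumes j: "j \<in> {1..<n}" and rs: "(r, s) \<in> supp" and pos: "r (Suc j) > 0" "s (Suc j) > 0"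
  shows "\<exists>k k'. k \<noteq> 0 \<and> (\<forall>x\<in>B. coef (raise j r, s) (ac (var (E j)) x)
    = k * coef (r, s) x + k' * coef (raise j r, raise j s) x)"
proof -
  have "\<forall>i. \<exists>kk. fst kk \<noteq> 0 \<and> ac (var (E j)) (mzw i)
    = scale (fst kk * qi (fst i (Suc j))) (mzw (raise j (fst i), snd i))
      + scale (snd kk * qi (snd i j)) (mzw (fst i, lower j (snd i)))"
  proof
    fix i :: "(nat \<Rightarrow> nat) \<times> (nat \<Rightarrow> nat)"
    obtain k k' where "k \<noteq> 0 \<and> ac (var (E j)) (mzw (fst i, snd i))
    = scale (k * qi (fst i (Suc j))) (mzw (raise j (fst i), snd i))
      + scale (k' * qi (snd i j)) (mzw (fst i, lower j (snd i)))"
      using E_mzw[OF j, of "fst i" "snd i"] by (elim exE) rule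
    then show "\<exists>kk. fst kk \<noteq> 0 \<and> ac (var (E j)) (mzw i)
    = scale (fst kk * qi (fst i (Suc j))) (mzw (raise j (fst i), snd i))
      + scale (snd kk * qi (snd i j)) (mzw (fst i, lower j (snd i)))"
      by (intro exI[of _ "(k, k')"]) simp
  qed
  from choice[OF this] obtain K where K: "\<And>i. fst (K i) \<noteq> 0"
    "\<And>i. ac (var (E j)) (mzw i) = scale (fst (K i) * qi (fst i (Suc j))) (mzw (raise j (fst i), snd i))
      + scale (snd (K i) * qi (snd i j)) (mzw (fst i, lower j (snd i)))" by blast
  define k where "k = fst (K (r, s)) * qi (r (Suc j))"
  define p where "p = (raise j r, raise j s)"
  define k' where "k' = snd (K p) * qi (Suc (s j))"
  have T: "(raise j r, s) \<in> supp" "p \<in> supp" using raise_supp[OF j rs] by (simp_all add: p_def)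
  have "coef (raise j r, s) (ac (var (E j)) x) = k * coef (r, s) x + k' * coef p x" if "x \<in> B" for x
  proof -
    have "x \<in> B \<and> coef (raise j r, s) (ac (var (E j)) x) = k * coef (r, s) x + k' * coef p x"
      using that
    proof (induction rule: B_zw_induct)
      case (mon r' s')
      have M: "(raise j r', s') \<in> supp" "(r', lower j s') \<in> supp"
        using raise_supp[OF j mon] lower_supp[OF j mon] by auto
      have 1: "fst (K (r', s')) * qi (r' (Suc j)) * coef (raise j r, s) (mzw (raise j r', s')) = k * coef (r, s) (mzw (r', s'))"
      proof (cases "r' (Suc j) = 0")
        case True
        then have "(r, s) \<noteq> (r', s')" using pos by auto
        then show ?thesis using True unfolding coef_mzw[OF rs mon] by auto
      next
        case False
        then have "(raise j r, s) = (raise j r', s') \<longleftrightarrow> (r, s) = (r', s')"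
          using raise_inj[of r j r'] pos by blast
        then show ?thesis using coef_mzw[OF rs mon] coef_mzw[OF T(1) M(1)] by (auto simp: k_def)
      qed
      have 2: "snd (K (r', s')) * qi (s' j) * coef (raise j r, s) (mzw (r', lower j s')) = k' * coef p (mzw (r', s'))"
      proof (cases "s' j = 0")
        case True
        then have "p \<noteq> (r', s')" by (auto simp: p_def)
        then show ?thesis using True coef_mzw[OF T(2) mon] by simp
      next
        case False
        then have eq: "(raise j r, s) = (r', lower j s') \<longleftrightarrow> p = (r', s')"
          using lower_raise[of s' j] raise_lower[of s j] pos unfolding p_def by (metis Pair_inject neq0_conv)
        show ?thesis
        proof (cases "p = (r', s')")
          case True
          then have s': "s' j = Suc (s j)" by (auto simp: p_def)
          have "coef (raise j r, s) (mzw (r', lower j s')) = 1" "coef p (mzw (r', s')) = 1"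
            unfolding coef_mzw[OF T(1) M(2)] coef_mzw[OF T(2) mon] eq using True by simp_all
          then show ?thesis unfolding k'_def True s' by (simp only:)
        next
          case False
          then show ?thesis
            unfolding coef_mzw[OF T(1) M(2)] coef_mzw[OF T(2) mon] eq by simp
        qed
      qed
      show ?case
        unfolding K(2) fst_conv snd_conv coef_add coef_scale 1 2 by auto
    qed (use j in \<open>auto simp: ac_zero ac_add ac_scale ufp_gens coef_zero coef_add coef_scale distrib_left\<close>)
    then show ?thesis ..
  qed
  moreover have "k \<noteq> 0" using K(1) qint_nonzero[OF pos(1)] by (simp add: k_def)
  ultimately show ?thesis unfolding p_def by blast
qed

lemma Ginv_step:
  assumes "Ginv x" "j \<in> {1..<n - 1}" "(r, s) \<in> supp" "r (Suc j) > 0" "s (Suc j) > 0"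
    "coef (raise j r, raise j s) x = 0"
  shows "coef (r, s) x = 0"
proof -
  have j: "j \<in> {1..<n}" using assms(2) by auto
  obtain k k' where k: "k \<noteq> 0" "\<And>x. x \<in> B \<Longrightarrow> coef (raise j r, s) (ac (var (E j)) x)
    = k * coef (r, s) x + k' * coef (raise j r, raise j s) x"
    using E_coef[OF j assms(3-5)] by blast
  have "ac (var (E j)) x = 0" using assms(1,2) by (simp add: Ginv_def)
  then show ?thesis using k(2)[OF Ginv_B[OF assms(1)]] assms(6) k(1) by (simp add: coef_zero)
qed

text \<open>For an invariant, \<open>Ginv_step\<close> reduces a coefficient to the one with a unit
  moved from j + 1 to j in both exponents. Each move lowers the sum of the i r_i over i < n by one;
  it ends when only z_1, z_n, w_1, w_n remain.\<close>

lemma Ginv_determined: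
  assumes x: "Ginv x" and n2: "n \<ge> 2"
    and base: "\<And>r s. (r, s) \<in> supp \<Longrightarrow> r 1 = s 1 \<Longrightarrow> (\<And>i. i \<in> {2..n - 1} \<Longrightarrow> r i = 0 \<and> s i = 0) \<Longrightarrow> coef (r, s) x = 0"
  shows "x = 0"
proof (rule coef_eq_zero[OF Ginv_B[OF x]])
  fix i assume "i \<in> supp"
  obtain r s where i: "i = (r, s)" by fastforce
  have "(r, s) \<in> supp \<Longrightarrow> coef (r, s) x = 0"
  proof (induction "\<Sum>i\<in>{1..n - 1}. i * r i" arbitrary: r s rule: less_induct)
    case less
    show ?case
    proof (cases "\<exists>i\<in>{1..n - 1}. r i \<noteq> s i")
      case True
      then show ?thesis using Ginv_weight[OF x less.prems] by blast
    next
      case False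
      then have eq: "\<And>i. i \<in> {1..n - 1} \<Longrightarrow> r i = s i" by blast
      show ?thesis
      proof (cases "\<forall>i\<in>{2..n - 1}. r i = 0")
        case True
        show ?thesis
        proof (rule base[OF less.prems])
          show "r 1 = s 1" using eq[of 1] n2 by simp
          show "r i = 0 \<and> s i = 0" if "i \<in> {2..n - 1}" for i
            using True eq[of i] that by simp
        qed
      next
        case False
        then obtain l where l: "l \<in> {2..n - 1}" "r l \<noteq> 0" by blast
        define j where "j = l - 1"
        have j: "l = Suc j" "j \<in> {1..<n - 1}" using l by (auto simp: j_def)
        have rl: "Suc j * (r (Suc j) - 1) + Suc j = Suc j * r (Suc j)"
          using l j by (cases "r (Suc j)") auto
        have "(\<Sum>i\<in>{1..n - 1}. i * raise j r i) + Suc j = (\<Sum>i\<in>{1..n - 1}. i * raise j r i + (if i = Suc j then Suc j else 0))"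
          using j by (simp add: sum.distrib)
        also have "\<dots> = (\<Sum>i\<in>{1..n - 1}. i * r i + (if i = j then j else 0))"
          by (rule sum.cong[OF refl]) (use rl in auto)
        also have "\<dots> = (\<Sum>i\<in>{1..n - 1}. i * r i) + j" using j by (simp add: sum.distrib)
        finally have lt: "(\<Sum>i\<in>{1..n - 1}. i * raise j r i) < (\<Sum>i\<in>{1..n - 1}. i * r i)" by linarith
        have "j \<in> {1..<n}" using j(2) by auto
        then have "(raise j r, raise j s) \<in> supp" using raise_supp less.prems by blast
        then have "coef (raise j r, raise j s) x = 0" by (rule less.hyps[OF lt])
        moreover have "r (Suc j) > 0" "s (Suc j) > 0" using l j eq[of l] by auto
        ultimately show ?thesis using Ginv_step[OF x j(2) less.prems] by blast
      qed
    qed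
  qed
  then show "coef i x = 0" using \<open>i \<in> supp\<close> i by simp
qed

end

section \<open>Invariants z_n^(m-t) Q_{n-1}^t w_n^(m'-t) and the coefficients that separate
  them\<close>

context zw_setup
begin

definition deg :: "nat \<Rightarrow> nat \<Rightarrow> lop set" where
  "deg a b = evl ` zw.V (Dg a b)"

lemma deg_z: "x \<in> deg a b \<Longrightarrow> j \<in> {1..n} \<Longrightarrow> z j * x \<in> deg (Suc a) b"
  unfolding deg_def using zw.x_V by (force simp: evl_simps(5,7) image_iff)

lemma deg_w: "x \<in> deg a b \<Longrightarrow> j \<in> {1..n} \<Longrightarrow> w j * x \<in> deg a (Suc b)"
  unfolding deg_def using zw.y_V by (force simp: evl_simps(5,7) image_iff)

lemma deg_add: "x \<in> deg a b \<Longrightarrow> y \<in> deg a b \<Longrightarrow> x + y \<in> deg a b"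
  unfolding deg_def by (rule evl_V_add)

lemma deg_scale: "x \<in> deg a b \<Longrightarrow> scale c x \<in> deg a b"
  unfolding deg_def by (rule evl_V_scale)

lemma deg_zero: "0 \<in> deg a b"
  unfolding deg_def by (rule evl_V_zero)

lemma deg_sum: "(\<And>i. i \<in> I \<Longrightarrow> f i \<in> deg a b) \<Longrightarrow> sum f I \<in> deg a b"
  by (induction I rule: infinite_finite_induct) (auto intro: deg_zero deg_add)

lemma deg_one: "1 \<in> deg 0 0"
proof -
  have "mzw (\<lambda>_. 0, \<lambda>_. 0) \<in> deg 0 0"
    unfolding deg_def by (rule evl_V_mon) (simp add: zw.Dg_def supp_iff)
  then show ?thesis by (simp add: mzw_def zmon_def wmon_def map_replicate_const del: upt_Suc)
qed

lemma deg_Qu: "x \<in> deg a b \<Longrightarrow> k \<le> n \<Longrightarrow> Qu k * x \<in> deg (Suc a) (Suc b)"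
  unfolding Qu_def sum_distrib_right mult.assoc by (intro deg_sum deg_z deg_w) auto

lemma deg_Qu_power: "x \<in> deg a b \<Longrightarrow> k \<le> n \<Longrightarrow> Qu k ^ t * x \<in> deg (t + a) (t + b)"
  by (induction t) (auto simp: mult.assoc intro: deg_Qu)

lemma deg_w_power: "n \<ge> 1 \<Longrightarrow> w n ^ t \<in> deg 0 t"
  using deg_one by (induction t) (auto intro: deg_w)

lemma deg_z_power: "x \<in> deg a b \<Longrightarrow> n \<ge> 1 \<Longrightarrow> z n ^ t * x \<in> deg (t + a) b"
  by (induction t) (auto simp: mult.assoc intro: deg_z)

definition T :: "nat \<Rightarrow> nat \<Rightarrow> nat \<Rightarrow> lop" where
  "T m m' t = z n ^ (m - t) * (Qu (n - 1) ^ t * w n ^ (m' - t))"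

lemma T_deg: "n \<ge> 1 \<Longrightarrow> t \<le> m \<Longrightarrow> t \<le> m' \<Longrightarrow> T m m' t \<in> deg m m'"
  using deg_z_power[OF deg_Qu_power[OF deg_w_power[of "m' - t"], of "n - 1" t], of "m - t"]
  by (simp add: T_def)

text \<open>The exponents of z_1^t z_n^(m-t) w_1^t w_n^(m'-t). Since n is at least 2 in all uses,
  the positions 1 and n differ.\<close>

definition base :: "nat \<Rightarrow> nat \<Rightarrow> nat \<Rightarrow> (nat \<Rightarrow> nat) \<times> (nat \<Rightarrow> nat)" where
  "base m m' t = (\<lambda>i. if i = 1 then t else if i = n then m - t else 0, \<lambda>i. if i = 1 then t else if i = n then m' - t else 0)"

text \<open>The matrix of coefficients is diagonal. For t' > t the monomial has fewer z_n than the
  power in front; for t' < t, once that power is stripped off, its degree in z_1, ..., z_{n-1} is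
  t', too small for Q_{n-1}^t. On the diagonal \<open>coef_Qu_first\<close> gives a nonzero
  entry.\<close>

lemma coef_T:
  assumes n2: "n \<ge> 2" and t: "t \<le> m" "t \<le> m'"
  shows "\<exists>c. c \<noteq> 0 \<and> (\<forall>t'. t' \<le> m \<longrightarrow> t' \<le> m' \<longrightarrow> coef (base m m' t') (T m m' t) = (if t' = t then c else 0))"
proof -
  have n1: "n \<ge> 1" and n: "1 \<le> n - 1" "n - 1 \<le> n" using n2 by auto
  let ?e = "\<lambda>t i. if i = 1 then t else 0 :: nat"
  let ?x = "Qu (n - 1) ^ t * w n ^ (m' - t)"
  have QB: "Qu (n - 1) ^ t \<in> B" using n by (intro B_power Qu_B)
  have wB: "w n ^ (m' - t) \<in> B" using n1 by (intro B_power B_w) auto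
  have xB: "?x \<in> B" by (rule B_mult[OF QB wB])
  have e: "(?e t1, ?e t2) \<in> supp" for t1 t2 using n2 by (auto simp: supp_iff)
  have es: "(?e t1, (?e t2)(n := k)) \<in> supp" for t1 t2 k using e n1 by (intro supp_upd(2)) auto
  obtain c1 where c1: "c1 \<noteq> 0" "coef ((?e t)(n := ?e t n + (m - t)), (?e t)(n := m' - t)) (z n ^ (m - t) * ?x)
      = c1 * coef (?e t, (?e t)(n := m' - t)) ?x"
    using coef_z_power[OF xB es[of t t "m' - t"] n1, of "m - t"] by (elim exE conjE) (rule that)
  obtain c2 where c2: "c2 \<noteq> 0" "coef (?e t, (?e t)(n := ?e t n + (m' - t))) ?x = c2 * coef (?e t, ?e t) (Qu (n - 1) ^ t)"
    using coef_w_power[OF QB e[of t t] n1, of "m' - t"] by (elim exE conjE) (rule that)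
  have b: "base m m' t' = ((?e t')(n := m - t'), (?e t')(n := m' - t'))" for t'
    using n2 by (auto simp: base_def fun_eq_iff)
  have en: "?e t n + k = k" for t k using n2 by simp
  have same: "coef (base m m' t) (T m m' t) = c1 * c2"
    unfolding b T_def using c1(2) c2(2) coef_Qu_first[OF n, of t] unfolding en by simp
  have diff: "coef (base m m' t') (T m m' t) = 0" if t': "t' \<le> m" "t' \<noteq> t" for t'
  proof (cases "t' > t")
    case True
    then have "((?e t')(n := m - t')) n < m - t" using t' by simp
    moreover have "((?e t')(n := m - t'), (?e t')(n := m' - t')) \<in> supp"
      using es n1 by (intro supp_upd(1)) auto
    ultimately show ?thesis unfolding b T_def by (intro coef_z_power_zero[OF xB _ n1])
  next
    case False
    then have lt: "t' < t" using t' by simp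
    let ?r = "(?e t')(n := t - t')"
    have s: "(?r, (?e t')(n := m' - t')) \<in> supp"
      using es n1 by (intro supp_upd(1)) auto
    obtain c where "coef (?r(n := ?r n + (m - t)), (?e t')(n := m' - t')) (z n ^ (m - t) * ?x)
        = c * coef (?r, (?e t')(n := m' - t')) ?x"
      using coef_z_power[OF xB s n1, of "m - t"] by (elim exE conjE) (rule that)
    moreover have "?r(n := ?r n + (m - t)) = (?e t')(n := m - t')" using lt t by auto
    moreover have "sum ?r {1..n - 1} = (\<Sum>i\<in>{1..n - 1}. if i = 1 then t' else 0)"
      by (rule sum.cong) auto
    then have "sum ?r {1..n - 1} < t" using n lt by simp
    then have "coef (?r, (?e t')(n := m' - t')) ?x = 0"
      by (rule coef_Qu_zero[OF wB s n(2)])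
    ultimately show ?thesis unfolding b T_def by simp
  qed
  show ?thesis
    by (rule exI[of _ "c1 * c2"]) (use c1(1) c2(1) same diff in auto)
qed

end

context zw_action
begin

lemma Ginv_T: "n \<ge> 1 \<Longrightarrow> Ginv (T m m' t)"
  unfolding T_def by (intro Ginv_mult Ginv_power Ginv_z Ginv_w Ginv_Qu) auto

lemma sum_first_last:
  fixes r :: "nat \<Rightarrow> nat"
  assumes "n \<ge> 2" "\<And>i. i \<in> {2..n - 1} \<Longrightarrow> r i = 0"
  shows "sum r {1..n} = r 1 + r n"
proof -
  have "sum r {1..n} = sum r {1, n}"
  proof (rule sum.mono_neutral_right)
    show "\<forall>i\<in>{1..n} - {1, n}. r i = 0"
    proof
      fix i assume "i \<in> {1..n} - {1, n}"
      then have "i \<in> {2..n - 1}" by auto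
      then show "r i = 0" by (rule assms(2))
    qed
  qed (use assms(1) in auto)
  then show ?thesis using assms(1) by simp
qed

text \<open>Subtracting the combination with the same coefficients at the \<open>base\<close>
  monomials leaves an invariant of the same bidegree that vanishes there, hence zero by
  \<open>Ginv_determined\<close>.\<close>

lemma Ginv_span:
  assumes n2: "n \<ge> 2" and x: "Ginv x" "x \<in> deg m m'"
  shows "\<exists>c. x = (\<Sum>t\<le>min m m'. scale (c t) (T m m' t))"
proof -
  have n1: "n \<ge> 1" using n2 by simp
  have "\<forall>t. \<exists>c. t \<le> min m m' \<longrightarrow> c \<noteq> 0 \<and> (\<forall>t'. t' \<le> m \<longrightarrow> t' \<le> m' \<longrightarrow> coef (base m m' t') (T m m' t) = (if t' = t then c else 0))"
    using coef_T[OF n2] by (metis min.boundedE)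
  from choice[OF this] obtain c where c: "\<And>t. t \<le> min m m' \<Longrightarrow> c t \<noteq> 0"
    "\<And>t t'. t \<le> min m m' \<Longrightarrow> t' \<le> min m m' \<Longrightarrow> coef (base m m' t') (T m m' t) = (if t' = t then c t else 0)"
    by auto
  define y where "y = x - (\<Sum>t\<le>min m m'. scale (coef (base m m' t) x / c t) (T m m' t))"
  have S: "Ginv (\<Sum>t\<le>min m m'. scale (d t) (T m m' t))" "(\<Sum>t\<le>min m m'. scale (d t) (T m m' t)) \<in> deg m m'" for d
    by (intro Ginv_sum Ginv_scale Ginv_T n1, intro deg_sum deg_scale T_deg n1) auto
  have y_eq: "y = x + scale (-1) (\<Sum>t\<le>min m m'. scale (coef (base m m' t) x / c t) (T m m' t))"
    by (simp add: y_def)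
  have y: "Ginv y" "y \<in> deg m m'"
    unfolding y_eq by (intro Ginv_add Ginv_scale x(1) S(1), intro deg_add deg_scale x(2) S(2))
  have base0: "coef (base m m' t') y = 0" if t': "t' \<le> min m m'" for t'
  proof -
    have "coef (base m m' t') (\<Sum>t\<le>min m m'. scale (coef (base m m' t) x / c t) (T m m' t))
        = (\<Sum>t\<le>min m m'. if t = t' then coef (base m m' t') x else 0)"
      unfolding coef_sum coef_scale by (rule sum.cong[OF refl]) (use c t' in auto)
    also have "\<dots> = coef (base m m' t') x" using t' by simp
    finally show ?thesis by (simp add: y_def coef_diff)
  qed
  have "y = 0"
  proof (rule Ginv_determined[OF y(1) n2])
    fix r s assume rs: "(r, s) \<in> supp" "r 1 = s 1" "\<And>i. i \<in> {2..n - 1} \<Longrightarrow> r i = 0 \<and> s i = 0"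
    show "coef (r, s) y = 0"
    proof (cases "(r, s) \<in> Dg m m'")
      case False
      then show ?thesis
        using coef_outside[OF y(2)[unfolded deg_def] _ rs(1)] by (auto simp: zw.Dg_def)
    next
      case True
      have "r 1 + r n = m" "s 1 + s n = m'"
        using True sum_first_last[OF n2, of r] sum_first_last[OF n2, of s] rs(3) by (auto simp: zw.Dg_def)
      moreover have "(r, s) = base m m' (r 1)"
      proof -
        have H: "r i = (if i = 1 then r 1 else if i = n then m - r 1 else 0)
          \<and> s i = (if i = 1 then r 1 else if i = n then m' - r 1 else 0)" for i
        proof -
          consider "i = 1" | "i = n" "i \<noteq> 1" | "i \<in> {2..n - 1}" | "i \<notin> {1..n}" by fastforce
          then show ?thesis
          proof cases
            case 3
            then show ?thesis using rs(3)[of i] by auto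
          next
            case 4
            then show ?thesis using rs(1) n2 by (auto simp: supp_iff)
          qed (use calculation rs(2) in auto)
        qed
        show ?thesis
          unfolding base_def
          by (intro arg_cong2[of _ _ _ _ Pair] ext) (rule conjunct1[OF H], rule conjunct2[OF H])
      qed
      ultimately show ?thesis using base0[of "r 1"] rs(2) by simp
    qed
  qed
  then show ?thesis by (intro exI[of _ "\<lambda>t. coef (base m m' t) x / c t"]) (simp add: y_def)
qed

end

section \<open>Rewriting the invariants as polynomials in Q and Q_{n-1}\<close>

context zw_setup
begin

text \<open>The homogeneous polynomials of degree \<open>K\<close> in the commuting elements Q and
  Q_{n-1}.\<close>

definition PX :: "nat \<Rightarrow> lop \<Rightarrow> bool" where
  "PX K x \<longleftrightarrow> (\<exists>c. x = (\<Sum>s\<le>K. scale (c s) (X n s (K - s))))"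

lemma PX_add: "PX K x \<Longrightarrow> PX K y \<Longrightarrow> PX K (x + y)"
proof -
  assume "PX K x" "PX K y"
  then obtain c d where "x = (\<Sum>s\<le>K. scale (c s) (X n s (K - s)))" "y = (\<Sum>s\<le>K. scale (d s) (X n s (K - s)))"
    unfolding PX_def by blast
  then have "x + y = (\<Sum>s\<le>K. scale (c s + d s) (X n s (K - s)))"
    by (simp add: lop.scale_left_distrib sum.distrib)
  then show ?thesis unfolding PX_def by (rule exI[of _ "\<lambda>s. c s + d s"])
qed

lemma PX_scale: "PX K x \<Longrightarrow> PX K (scale a x)"
proof -
  assume "PX K x"
  then obtain c where "x = (\<Sum>s\<le>K. scale (c s) (X n s (K - s)))" unfolding PX_def by blast
  then have "scale a x = (\<Sum>s\<le>K. scale (a * c s) (X n s (K - s)))"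
    by (simp add: lop.scale_sum_right)
  then show ?thesis unfolding PX_def by (rule exI[of _ "\<lambda>s. a * c s"])
qed

lemma PX_sum: "finite I \<Longrightarrow> (\<And>i. i \<in> I \<Longrightarrow> PX K (f i)) \<Longrightarrow> PX K (sum f I)"
proof (induction I rule: finite_induct)
  case empty
  show ?case unfolding PX_def by (intro exI[of _ "\<lambda>_. 0"]) simp
qed (auto intro: PX_add)

lemma PX_X: "s \<le> K \<Longrightarrow> PX K (X n s (K - s))"
  unfolding PX_def
proof (intro exI)
  assume "s \<le> K"
  have "(\<Sum>t\<le>K. scale (if t = s then 1 else 0) (X n t (K - t))) = (\<Sum>t\<le>K. if t = s then X n s (K - s) else 0)"
    by (rule sum.cong) auto
  then show "X n s (K - s) = (\<Sum>t\<le>K. scale ((\<lambda>t. if t = s then 1 else 0) t) (X n t (K - t)))"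
    using \<open>s \<le> K\<close> by simp
qed

text \<open>By \<open>z_X_w\<close>, enclosing a product between z_n and w_n raises the exponent of
  Q or that of Q_{n-1} by one.\<close>

lemma PX_step: "n \<ge> 1 \<Longrightarrow> PX K x \<Longrightarrow> PX (Suc K) (z n * x * w n)"
proof -
  assume n: "n \<ge> 1" and "PX K x"
  then obtain c where c: "x = (\<Sum>s\<le>K. scale (c s) (X n s (K - s)))" unfolding PX_def by blast
  have "PX (Suc K) (z n * X n s (K - s) * w n)" if "s \<le> K" for s
  proof -
    have k: "Suc (K - s) = Suc K - s" "K - s = Suc K - Suc s" using that by auto
    have "z n * X n s (K - s) * w n = scale (1 / q ^ (2 * s)) (X n s (Suc (K - s)) + scale (-1) (X n (Suc s) (K - s)))"
      using z_X_w[of n s "K - s"] n by simp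
    moreover have "PX (Suc K) (X n s (Suc (K - s)))"
      unfolding k(1) using that by (intro PX_X) simp
    moreover have "PX (Suc K) (X n (Suc s) (K - s))"
      unfolding k(2) using that by (intro PX_X) simp
    ultimately show ?thesis by (simp only: PX_scale PX_add)
  qed
  then have "PX (Suc K) (\<Sum>s\<le>K. scale (c s) (z n * X n s (K - s) * w n))"
    by (intro PX_sum PX_scale) auto
  then show ?thesis unfolding c sum_distrib_left sum_distrib_right scale_mult_right scale_mult_left .
qed

lemma PX_zQw: "n \<ge> 1 \<Longrightarrow> PX (t + k) (z n ^ k * (Qu (n - 1) ^ t * w n ^ k))"
proof (induction k)
  case 0
  then show ?case using PX_X[of t t] by (simp add: X_def)
next
  case (Suc k)
  have "z n ^ Suc k * (Qu (n - 1) ^ t * w n ^ Suc k) = z n * (z n ^ k * (Qu (n - 1) ^ t * w n ^ k)) * w n"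
    unfolding power_Suc[of "z n"] power_Suc2[of "w n"] by (simp add: mult.assoc)
  then show ?case using PX_step[OF Suc.prems Suc.IH[OF Suc.prems]] by simp
qed

end

context zw_action
begin

text \<open>The surplus z_n^d is common to all spanning invariants and is split off on the left;
  what remains is z_n^k Q_{n-1}^t w_n^k with k + t = K.\<close>

lemma Ginv_Y:
  assumes n2: "n \<ge> 2" and x: "Ginv x" "x \<in> deg (d + K) K"
  shows "\<exists>c. x = (\<Sum>s\<le>K. scale (c s) (Y d s (K - s)))"
proof -
  have n1: "n \<ge> 1" using n2 by simp
  obtain c where c: "x = (\<Sum>t\<le>K. scale (c t) (T (d + K) K t))"
    using Ginv_span[OF n2 x] by auto
  have "T (d + K) K t = z n ^ d * (z n ^ (K - t) * (Qu (n - 1) ^ t * w n ^ (K - t)))" if "t \<le> K" for t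
    using that by (simp add: T_def power_add mult.assoc[symmetric] flip: power_add)
  then have "x = z n ^ d * (\<Sum>t\<le>K. scale (c t) (z n ^ (K - t) * (Qu (n - 1) ^ t * w n ^ (K - t))))"
    unfolding c sum_distrib_left scale_mult_right by (intro sum.cong) auto
  moreover have "PX K (\<Sum>t\<le>K. scale (c t) (z n ^ (K - t) * (Qu (n - 1) ^ t * w n ^ (K - t))))"
  proof (intro PX_sum PX_scale)
    fix t assume "t \<in> {..K}"
    then show "PX K (z n ^ (K - t) * (Qu (n - 1) ^ t * w n ^ (K - t)))"
      using PX_zQw[OF n1, of t "K - t"] by simp
  qed simp
  then obtain b where "(\<Sum>t\<le>K. scale (c t) (z n ^ (K - t) * (Qu (n - 1) ^ t * w n ^ (K - t)))) = (\<Sum>s\<le>K. scale (b s) (X n s (K - s)))"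
    unfolding PX_def by (rule exE)
  ultimately have "x = z n ^ d * (\<Sum>s\<le>K. scale (b s) (X n s (K - s)))" by simp
  then show ?thesis by (auto simp: sum_distrib_left scale_mult_right)
qed

lemma Ginv_U:
  assumes n2: "n \<ge> 2" and x: "Ginv x" "x \<in> deg K (d + K)"
  shows "\<exists>c. x = (\<Sum>s\<le>K. scale (c s) (U d s (K - s)))"
proof -
  have n1: "n \<ge> 1" using n2 by simp
  obtain c where c: "x = (\<Sum>t\<le>K. scale (c t) (T K (d + K) t))"
    using Ginv_span[OF n2 x] by auto
  have "T K (d + K) t = z n ^ (K - t) * (Qu (n - 1) ^ t * w n ^ (K - t)) * w n ^ d" if "t \<le> K" for t
  proof -
    have "d + K - t = (K - t) + d" using that by simp
    then show ?thesis by (simp add: T_def power_add mult.assoc)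
  qed
  then have "x = (\<Sum>t\<le>K. scale (c t) (z n ^ (K - t) * (Qu (n - 1) ^ t * w n ^ (K - t)))) * w n ^ d"
    unfolding c sum_distrib_right scale_mult_left by (intro sum.cong) auto
  moreover have "PX K (\<Sum>t\<le>K. scale (c t) (z n ^ (K - t) * (Qu (n - 1) ^ t * w n ^ (K - t))))"
  proof (intro PX_sum PX_scale)
    fix t assume "t \<in> {..K}"
    then show "PX K (z n ^ (K - t) * (Qu (n - 1) ^ t * w n ^ (K - t)))"
      using PX_zQw[OF n1, of t "K - t"] by simp
  qed simp
  then obtain b where "(\<Sum>t\<le>K. scale (c t) (z n ^ (K - t) * (Qu (n - 1) ^ t * w n ^ (K - t)))) = (\<Sum>s\<le>K. scale (b s) (X n s (K - s)))"
    unfolding PX_def by (rule exE)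
  ultimately have "x = (\<Sum>s\<le>K. scale (b s) (X n s (K - s))) * w n ^ d" by simp
  then show ?thesis by (auto simp: sum_distrib_right scale_mult_left)
qed

end

section \<open>Harmonic invariants\<close>

context zw_setup
begin

lemma shiftdeg_Qu: assumes "k \<in> {1..n}" shows "shiftdeg M (Qu k) (\<lambda>i. 0) (M ^ k)"
  unfolding shiftdeg_def
proof
  fix a :: "nat \<Rightarrow> int"
  let ?c = "q powi (- 2 * sum a {k<..n})"
  have c: "?c \<noteq> 0" using q0 by simp
  have "app (Qu k) f (a, \<lambda>k. t ^ M ^ k) = poly (monom ?c (M ^ k)) t * f (\<lambda>i. a i + 0, \<lambda>k. t ^ M ^ k)" for f t
    using assms by (simp add: Qu_eq app_Qop poly_monom)
  then show "\<exists>P. P \<noteq> 0 \<and> degree P = M ^ k \<and> (\<forall>f t. app (Qu k) f (a, \<lambda>k. t ^ M ^ k)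
      = poly P t * f (\<lambda>i. a i + 0, \<lambda>k. t ^ M ^ k))"
    using c by (intro exI[of _ "monom ?c (M ^ k)"] conjI allI) (simp_all only: degree_monom_eq monom_eq_0_iff not_False_eq_True)
qed

lemma shiftdeg_X: "n \<ge> 2 \<Longrightarrow> shiftdeg M (X n s a) (\<lambda>i. int s * 0 + int a * 0) (s * M ^ (n - 1) + a * M ^ n)"
  unfolding X_def by (intro shiftdeg_mult shiftdeg_power shiftdeg_Qu) auto

text \<open>With base 2 the degree equals a fixed number plus (2K - s) 2^(n-1), which determines
  \<open>s\<close>. All products compared here have the same shift, so degrees alone give their
  independence.\<close>

lemma degree_inj:
  assumes "s \<le> K" "s' \<le> K" "e + (s * 2 ^ (n - 1) + (K - s) * 2 ^ n) = e + (s' * 2 ^ (n - 1) + (K - s') * 2 ^ n)" "n \<ge> 2"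
  shows "s = (s' :: nat)"
proof -
  have p: "(2 :: nat) ^ n = 2 * 2 ^ (n - 1)" using assms(4) by (cases n) auto
  have "(s + 2 * (K - s)) * 2 ^ (n - 1) = (s' + 2 * (K - s')) * 2 ^ (n - 1)"
    using assms(3) unfolding p by (simp add: algebra_simps)
  then have "s + 2 * (K - s) = s' + 2 * (K - s')" by simp
  then show ?thesis using assms(1,2) by linarith
qed

lemma Y_independent:
  assumes "n \<ge> 2" "(\<Sum>s\<le>K. scale (c s) (Y d s (K - s))) = 0" "s \<le> K"
  shows "c s = 0"
proof (rule shiftdeg_independent[OF _ _ _ assms(2)])
  show "shiftdeg 2 (Y d s (K - s)) (\<lambda>i. int d * (if i = n then 1 else 0) + (int s * 0 + int (K - s) * 0))
      (d * 0 + (s * 2 ^ (n - 1) + (K - s) * 2 ^ n))" for s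
    using assms(1) by (intro shiftdeg_mult shiftdeg_power shiftdeg_z shiftdeg_X)
  show "inj_on (\<lambda>s. ((\<lambda>i. int d * (if i = n then 1 else 0) + (int s * 0 + int (K - s) * 0)),
      d * 0 + (s * 2 ^ (n - 1) + (K - s) * 2 ^ n))) {..K}"
    by (rule inj_onI) (use degree_inj[of _ K _ "d * 0"] assms(1) in auto)
qed (use assms(3) in auto)

lemma U_independent:
  assumes "n \<ge> 2" "(\<Sum>s\<le>K. scale (c s) (U d s (K - s))) = 0" "s \<le> K"
  shows "c s = 0"
proof (rule shiftdeg_independent[OF _ _ _ assms(2)])
  show "shiftdeg 2 (U d s (K - s)) (\<lambda>i. (int s * 0 + int (K - s) * 0) + int d * (if i = n then - 1 else 0))
      ((s * 2 ^ (n - 1) + (K - s) * 2 ^ n) + d * 2 ^ n)" for s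
    using assms(1) by (intro shiftdeg_mult shiftdeg_power shiftdeg_w shiftdeg_X) auto
  show "inj_on (\<lambda>s. ((\<lambda>i. (int s * 0 + int (K - s) * 0) + int d * (if i = n then - 1 else 0)),
      (s * 2 ^ (n - 1) + (K - s) * 2 ^ n) + d * 2 ^ n)) {..K}"
    by (rule inj_onI) (use degree_inj[of _ K _ "d * 2 ^ n"] assms(1) in \<open>auto simp: add.commute\<close>)
qed (use assms(3) in auto)

text \<open>Stated for an abstract family because the products with z_n^d and with w_n^d obey the
  same rule. The vanishing of \<alpha> at 0 and of \<beta> at exponent 0 removes the summands with
  truncated indices; all others lie in the family of total exponent K - 1, where independence
  compares coefficients.\<close>

lemma lap_family:
  assumes V: "\<And>b a. lap (V b a) = scale (\<alpha> b) (V (b - 1) a) + scale (\<beta> b a) (V b (a - 1))"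
    and zero: "\<alpha> 0 = 0" "\<And>b. \<beta> b 0 = 0"
    and indep: "\<And>K c s. (\<Sum>s\<le>K. scale (c s) (V s (K - s))) = 0 \<Longrightarrow> s \<le> K \<Longrightarrow> c s = 0"
  shows "lap (\<Sum>s\<le>K. scale (c s) (V s (K - s))) = 0
    \<longleftrightarrow> (\<forall>s<K. c (Suc s) * \<alpha> (Suc s) + c s * \<beta> s (K - s) = 0)"
proof (cases K)
  case 0
  then show ?thesis by (simp add: linop_simps[OF lap] V zero)
next
  case (Suc L)
  have "lap (\<Sum>s\<le>K. scale (c s) (V s (K - s)))
    = (\<Sum>s\<le>Suc L. scale (c s * \<alpha> s) (V (s - 1) (Suc L - s))) + (\<Sum>s\<le>Suc L. scale (c s * \<beta> s (Suc L - s)) (V s (Suc L - s - 1)))"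
    unfolding linop_simps[OF lap] V lop.scale_right_distrib lop.scale_scale sum.distrib Suc ..
  also have "(\<Sum>s\<le>Suc L. scale (c s * \<alpha> s) (V (s - 1) (Suc L - s))) = (\<Sum>s\<le>L. scale (c (Suc s) * \<alpha> (Suc s)) (V s (L - s)))"
    unfolding sum.atMost_Suc_shift by (simp add: zero)
  also have "(\<Sum>s\<le>Suc L. scale (c s * \<beta> s (Suc L - s)) (V s (Suc L - s - 1))) = (\<Sum>s\<le>L. scale (c s * \<beta> s (Suc L - s)) (V s (L - s)))"
  proof -
    have "(\<Sum>s\<le>L. scale (c s * \<beta> s (Suc L - s)) (V s (Suc L - s - 1))) = (\<Sum>s\<le>L. scale (c s * \<beta> s (Suc L - s)) (V s (L - s)))"
      by (rule sum.cong) (auto simp: Suc_diff_le)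
    then show ?thesis by (simp add: zero)
  qed
  finally have e: "lap (\<Sum>s\<le>K. scale (c s) (V s (K - s))) = (\<Sum>s\<le>L. scale (c (Suc s) * \<alpha> (Suc s) + c s * \<beta> s (K - s)) (V s (L - s)))"
    by (simp add: sum.distrib lop.scale_left_distrib Suc)
  show ?thesis
  proof
    assume "lap (\<Sum>s\<le>K. scale (c s) (V s (K - s))) = 0"
    then show "\<forall>s<K. c (Suc s) * \<alpha> (Suc s) + c s * \<beta> s (K - s) = 0"
      using indep[of "\<lambda>s. c (Suc s) * \<alpha> (Suc s) + c s * \<beta> s (K - s)" L] e Suc by simp
  next
    assume "\<forall>s<K. c (Suc s) * \<alpha> (Suc s) + c s * \<beta> s (K - s) = 0"
    then show "lap (\<Sum>s\<le>K. scale (c s) (V s (K - s))) = 0"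
      unfolding e by (intro sum.neutral) (simp add: Suc)
  qed
qed

text \<open>As \<alpha> does not vanish at successors, each coefficient is determined by the
  previous one, and the solution \<open>g\<close> is normalised by its value 1 at 0.\<close>

lemma recurrence_unique:
  fixes c g \<alpha> \<beta> :: "nat \<Rightarrow> complex"
  assumes "g 0 = 1" "\<And>s. s < K \<Longrightarrow> g (Suc s) * \<alpha> (Suc s) + g s * \<beta> s = 0" "\<And>s. \<alpha> (Suc s) \<noteq> 0"
    and "\<And>s. s < K \<Longrightarrow> c (Suc s) * \<alpha> (Suc s) + c s * \<beta> s = 0"
  shows "s \<le> K \<Longrightarrow> c s = c 0 * g s"
proof (induction s)
  case (Suc s)
  then have s: "s < K" "c s = c 0 * g s" by simp_all
  have "c (Suc s) * \<alpha> (Suc s) = - (c s * \<beta> s)" using assms(4)[OF s(1)] unfolding eq_neg_iff_add_eq_0 .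
  moreover have "g (Suc s) * \<alpha> (Suc s) = - (g s * \<beta> s)" using assms(2)[OF s(1)] unfolding eq_neg_iff_add_eq_0 .
  ultimately have "c (Suc s) * \<alpha> (Suc s) = (c 0 * g (Suc s)) * \<alpha> (Suc s)"
    unfolding s(2) mult.assoc by (simp only: mult_minus_right)
  then show ?case unfolding mult_right_cancel[OF assms(3)] .
qed (simp add: assms(1))

text \<open>The coefficients of \<open>lap_Y\<close>: \<open>ga\<close> belongs to the product with
  one Q_{n-1} fewer and \<open>gb\<close> to the one with one Q fewer. In \<open>gc\<close>,
  \<open>K\<close> is the smaller and \<open>L\<close> the larger of the two degrees.\<close>

definition ga :: "nat \<Rightarrow> nat \<Rightarrow> complex" where
  "ga d b = q ^ n / (q\<^sup>2 * q ^ d) * (qi b * qi (b + n - 2))"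

definition gb :: "nat \<Rightarrow> nat \<Rightarrow> nat \<Rightarrow> complex" where
  "gb d b a = q ^ (n - 1) * (qi a * qi (a + 2 * b + d + n - 1))"

definition gc :: "nat \<Rightarrow> nat \<Rightarrow> nat \<Rightarrow> complex" where
  "gc K L s = qpoch (q powi (- 2 * int K)) (q\<^sup>2) s * qpoch (q ^ (2 * (L + n - 1))) (q\<^sup>2) s
     / (qpoch (q ^ (2 * (n - 1))) (q\<^sup>2) s * qpoch (q\<^sup>2) (q\<^sup>2) s) * q ^ (2 * s)"

lemma ga_nonzero: "n \<ge> 2 \<Longrightarrow> ga d (Suc s) \<noteq> 0"
  unfolding ga_def using q0 qint_nonzero[of "Suc s"] qint_nonzero[of "Suc s + n - 2"] by simp

lemma qpoch_Suc: "qpoch a t (Suc s) = qpoch a t s * (1 - a * t ^ s)"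
  by (simp add: qpoch_def)

lemma qpoch_nonzero:
  assumes k: "k > 0"
  shows "qpoch (q ^ k) (q\<^sup>2) s \<noteq> 0"
proof -
  have "1 - q ^ k * (q\<^sup>2) ^ j \<noteq> 0" for j
  proof -
    have "q ^ k * (q\<^sup>2) ^ j = q ^ (k + 2 * j)" by (simp only: power_add power_mult)
    moreover have "q ^ (k + 2 * j) \<noteq> 1" by (rule qroot) (use k in simp)
    ultimately show ?thesis by (metis right_minus_eq)
  qed
  note f = this
  show ?thesis
  proof (induction s)
    case 0
    show ?case by (simp add: qpoch_def)
  next
    case (Suc s)
    show ?case unfolding qpoch_Suc by (rule no_zero_divisors[OF Suc f])
  qed
qed

end

section \<open>The q-hypergeometric coefficients solve the harmonic recurrence\<close>

context zw_setup
begin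

text \<open>The ratio of successive \<open>gc\<close> is q^2 A1 A2 / (A3 A4), with A1, ..., A4 the
  last factors of the four q-shifted factorials. Up to powers of \<open>q\<close>, signs and the
  common denominator these are the q-integers [K-s], [K+s+d+n-1], [s+n-1] and [s+1] that make up
  \<open>gb\<close> and \<open>ga\<close>.\<close>

lemma gc_rec:
  assumes n2: "n \<ge> 2" and s: "s < K"
  shows "gc K (K + d) (Suc s) * ga d (Suc s) + gc K (K + d) s * gb d s (K - s) = 0"
proof -
  obtain N where n: "n = Suc (Suc N)" using n2 by (intro that[of "n - 2"]) simp
  obtain r where K: "K = Suc (s + r)" using less_imp_Suc_add[OF s] by (elim exE) (rule that)
  define e where "e = q - inverse q"
  have e: "e \<noteq> 0" using qq by (simp add: e_def)
  define A1 A2 A3 A4 where "A1 = 1 - q powi (- 2 * int K) * (q\<^sup>2) ^ s" "A2 = 1 - q ^ (2 * (K + d + n - 1)) * (q\<^sup>2) ^ s"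
    "A3 = 1 - q ^ (2 * (n - 1)) * (q\<^sup>2) ^ s" "A4 = 1 - q\<^sup>2 * (q\<^sup>2) ^ s"
  have nz: "A3 \<noteq> 0" "A4 \<noteq> 0"
    using qpoch_nonzero[of "2 * (n - 1)" "Suc s"] qpoch_nonzero[of 2 "Suc s"] n2 unfolding qpoch_Suc A1_A2_A3_A4_def by auto
  define G where "G = gc K (K + d) s"
  have frac: "x * a1 * (y * a2) / (u * a3 * (v * a4)) * (c * q\<^sup>2) = x * y / (u * v) * c * (a1 * a2 / (a3 * a4) * q\<^sup>2)"
    for x y u v c a1 a2 a3 a4 :: complex by (simp add: mult_ac)
  have "q ^ (2 * Suc s) = q ^ (2 * s) * q\<^sup>2" by (simp add: power2_eq_square mult_ac)
  then have G: "gc K (K + d) (Suc s) = G * (A1 * A2 / (A3 * A4) * q\<^sup>2)"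
    unfolding G_def gc_def qpoch_Suc A1_A2_A3_A4_def by (simp only: frac)
  have p: "q powi (- 2 * int K) = 1 / q ^ (2 * K)"
    by (simp add: power_int_minus divide_inverse flip: power_int_of_nat)
  \<comment> \<open>[k] is written with 1 - q^(2k) here and with 1 - q^(-2k) in \<open>qB\<close>;
    the second form serves A1, which stems from the negative power q^(-2K).\<close>
  have qA: "qi k = - (1 - (q\<^sup>2) ^ k) / (q ^ k * e)" for k
    unfolding qint_alt e_def[symmetric] power_mult[symmetric] mult_2 power_add using q0 e by (simp add: field_simps)
  have qB: "qi k = q ^ k * (1 - 1 / (q\<^sup>2) ^ k) / e" for k
    unfolding qint_alt e_def[symmetric] power_mult[symmetric] mult_2 power_add using q0 e by (simp add: field_simps)
  have "A4 = 1 - (q\<^sup>2) ^ Suc s" by (simp add: A1_A2_A3_A4_def)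
  then have i1: "qi (Suc s) = - A4 / (q ^ Suc s * e)" by (simp only: qA)
  have "A3 = 1 - (q\<^sup>2) ^ (s + n - 1)"
    unfolding A1_A2_A3_A4_def n power_mult by (simp add: power_add mult_ac)
  then have i2: "qi (Suc s + n - 2) = - A3 / (q ^ (s + n - 1) * e)"
    using n by (simp add: qA)
  have "A1 = 1 - 1 / (q\<^sup>2) ^ (K - s)"
    unfolding A1_A2_A3_A4_def p unfolding K power_mult using q0 by (simp add: power_add field_simps)
  then have i3: "qi (K - s) = q ^ (K - s) * A1 / e" by (simp only: qB)
  have "A2 = 1 - (q\<^sup>2) ^ (K + s + d + n - 1)"
    unfolding A1_A2_A3_A4_def n power_mult by (simp add: power_add mult_ac)
  moreover have "K - s + 2 * s + d + n - 1 = K + s + d + n - 1" using s by simp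
  ultimately have i4: "qi (K - s + 2 * s + d + n - 1) = - A2 / (q ^ (K + s + d + n - 1) * e)"
    by (simp only: qA)
  have f1: "a1 * a2 / (a3 * a4) * q\<^sup>2 * (x / (q\<^sup>2 * y) * (- a4 / (u * e) * (- a3 / (v * e)))) = a1 * a2 / (e * e) * (x / (y * (u * v)))"
    if "a3 \<noteq> 0" "a4 \<noteq> 0" for x y u v a1 a2 a3 a4 :: complex using that q0 by (simp add: mult_ac)
  have t1: "A1 * A2 / (A3 * A4) * q\<^sup>2 * ga d (Suc s) = A1 * A2 / (e * e) * (q ^ n / (q ^ d * (q ^ Suc s * q ^ (s + n - 1))))"
    unfolding ga_def i1 i2 using nz by (rule f1)
  have f2: "x * (y * a1 / e * (- a2 / (u * e))) = - (a1 * a2 / (e * e) * (x * y / u))" for x y u a1 a2 :: complex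
    by (simp add: mult_ac)
  have t2: "gb d s (K - s) = - (A1 * A2 / (e * e) * (q ^ (n - 1) * q ^ (K - s) / q ^ (K + s + d + n - 1)))"
    unfolding gb_def i3 i4 by (rule f2)
  have t3: "q ^ n / (q ^ d * (q ^ Suc s * q ^ (s + n - 1))) = q ^ (n - 1) * q ^ (K - s) / q ^ (K + s + d + n - 1)"
    unfolding K n using q0 by (simp add: field_simps power_add)
  have z: "A1 * A2 / (A3 * A4) * q\<^sup>2 * ga d (Suc s) + gb d s (K - s) = 0"
    unfolding t1 t2 t3 by (rule right_minus)
  have "G * (A1 * A2 / (A3 * A4) * q\<^sup>2) * ga d (Suc s) + G * gb d s (K - s)
      = G * (A1 * A2 / (A3 * A4) * q\<^sup>2 * ga d (Suc s) + gb d s (K - s))"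
    by (simp only: distrib_left mult.assoc)
  then show ?thesis unfolding G G_def[symmetric] z by simp
qed

end

section \<open>Zonal polynomials\<close>

definition homog :: "nat \<Rightarrow> nat \<Rightarrow> nat \<Rightarrow> zw ncpoly set" where
  "homog n m m' = {p \<in> fpoly (zw_gens n). \<forall>u\<in>Poly_Mapping.keys p.
     length (filter (\<lambda>g. g \<in> range Z) u) = m \<and> length (filter (\<lambda>g. g \<in> range W) u) = m'}"

lemma zw_homogeneous_eq: "zw_homogeneous n q m m' = zw_class n q ` homog n m m'"
  by (simp add: zw_homogeneous_def homog_def)

lemma homog_fpoly: "p \<in> homog n m m' \<Longrightarrow> p \<in> fpoly (zw_gens n)"
  by (simp add: homog_def)

lemma homog_add: "p \<in> homog n a b \<Longrightarrow> p' \<in> homog n a b \<Longrightarrow> p + p' \<in> homog n a b"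
  using Poly_Mapping.keys_add[of p p'] by (auto simp: homog_def)

lemma homog_zero: "0 \<in> homog n a b"
  by (simp add: homog_def)

lemma homog_sum: "(\<And>i. i \<in> I \<Longrightarrow> f i \<in> homog n a b) \<Longrightarrow> sum f I \<in> homog n a b"
  by (induction I rule: infinite_finite_induct) (auto intro: homog_zero homog_add)

lemma homog_mult:
  assumes "p \<in> homog n a b" "p' \<in> homog n c d"
  shows "p * p' \<in> homog n (a + c) (b + d)"
proof -
  have "length (filter (\<lambda>g. g \<in> range Z) u) = a + c \<and> length (filter (\<lambda>g. g \<in> range W) u) = b + d"
    if "u \<in> Poly_Mapping.keys (p * p')" for u
  proof -
    obtain v v' where "u = v + v'" "v \<in> Poly_Mapping.keys p" "v' \<in> Poly_Mapping.keys p'"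
      using keys_mult[of p p'] \<open>u \<in> _\<close> by auto
    then show ?thesis using assms by (simp add: homog_def plus_list_def)
  qed
  moreover have "p * p' \<in> fpoly (zw_gens n)" using assms by (intro fpoly_mult homog_fpoly)
  ultimately show ?thesis by (simp add: homog_def)
qed

lemma homog_scal: "scal c \<in> homog n 0 0"
  by (simp add: homog_def keys_single)

lemma homog_scal_mult: "p \<in> homog n a b \<Longrightarrow> scal c * p \<in> homog n a b"
  using homog_mult[OF homog_scal] by simp

lemma homog_Z: "i \<in> {1..n} \<Longrightarrow> var (Z i) \<in> homog n 1 0"
  using fpoly_var[of "Z i" "zw_gens n"] by (auto simp: homog_def zw_gens_def keys_single)

lemma homog_W: "i \<in> {1..n} \<Longrightarrow> var (W i) \<in> homog n 0 1"
  using fpoly_var[of "W i" "zw_gens n"] by (auto simp: homog_def zw_gens_def keys_single)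

lemma homog_power: "p \<in> homog n a b \<Longrightarrow> p ^ k \<in> homog n (k * a) (k * b)"
proof (induction k)
  case 0
  then show ?case using homog_scal[of 1 n] by (simp add: ncpoly_one)
next
  case (Suc k)
  then show ?case using homog_mult[of p n a b "p ^ k"] by simp
qed

lemma homog_Q_poly: "k \<le> n \<Longrightarrow> Q_poly k \<in> homog n 1 1"
  unfolding Q_poly_def using homog_mult[OF homog_Z homog_W] by (intro homog_sum) simp

lemma homog_Q_power:
  assumes "s \<le> K" "n \<ge> 1"
  shows "scal c * Q_poly n ^ (K - s) * Q_poly (n - 1) ^ s \<in> homog n K K"
proof -
  have "scal c * Q_poly n ^ (K - s) * Q_poly (n - 1) ^ s \<in> homog n ((K - s) * 1 + s * 1) ((K - s) * 1 + s * 1)"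
    by (intro homog_mult homog_scal_mult homog_power homog_Q_poly) simp_all
  then show ?thesis using assms(1) by simp
qed

context zw_setup
begin

lemma evl_homog: "p \<in> homog n a b \<Longrightarrow> evl p \<in> deg a b"
  unfolding deg_def using zw.homogeneous_V[of p a b] by (auto simp: homog_def)

lemma evl_Q_poly: "evl (Q_poly k) = Qu k"
  by (simp add: Q_poly_def Qu_def evl_simps)

lemma Qu_powers: "k \<le> n \<Longrightarrow> k' \<le> n \<Longrightarrow> Qu k ^ a * Qu k' ^ b = Qu k' ^ b * Qu k ^ a"
  by (rule power_commuting_commutes, rule power_commuting_commutes[symmetric], rule Qu_Qu[symmetric])

lemma evl_Q_power: "n \<ge> 1 \<Longrightarrow> evl (scal c * Q_poly n ^ a * Q_poly (n - 1) ^ s) = scale c (X n s a)"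
  unfolding mult.assoc evl_scal unfolding evl_simps evl_Q_poly X_def
  using Qu_powers[of n "n - 1" a s] by simp

text \<open>The dimension predicate is built up by line extensions from the zero space; the scalar
  multiples of a nonzero class are one such extension.\<close>

lemma dimension_one:
  assumes p: "p \<in> fp" "cls p \<noteq> \<zero>\<^bsub>alg\<^esub>"
  shows "ring.dimension alg 1 (scalars alg) (range (\<lambda>c. c \<odot>\<^bsub>alg\<^esub> cls p))"
proof -
  interpret A: ring alg by (rule ring_alg)
  have "c \<odot>\<^bsub>alg\<^esub> \<one>\<^bsub>alg\<^esub> \<otimes>\<^bsub>alg\<^esub> cls p \<oplus>\<^bsub>alg\<^esub> \<zero>\<^bsub>alg\<^esub> = c \<odot>\<^bsub>alg\<^esub> cls p" for c
    using p(1) by (simp add: alg_smult alg_one alg_zero alg_mult alg_add fpoly_mult)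
  then have "A.line_extension (scalars alg) (cls p) {\<zero>\<^bsub>alg\<^esub>} = range (\<lambda>c. c \<odot>\<^bsub>alg\<^esub> cls p)"
    by (auto simp: A.line_extension_mem_iff scalars_def)
  moreover have "A.dimension (Suc 0) (scalars alg) (A.line_extension (scalars alg) (cls p) {\<zero>\<^bsub>alg\<^esub>})"
    by (rule A.Suc_dim) (use p in \<open>auto simp: carrier_alg\<close>)
  ultimately show ?thesis by simp
qed

lemma gc_0: "gc K L 0 = 1"
  by (simp add: gc_def qpoch_def)

end

context zw_action
begin

text \<open>Translates homogeneity, harmonicity and invariance of a class into conditions on one
  homogeneous representative and its operator.\<close>

lemma zonal_iff:
  assumes n: "n \<ge> 1"
  shows "P \<in> zonal n q h act a b \<longleftrightarrow> (\<exists>p\<in>homog n a b. P = cls p \<and> lap (evl p) = 0 \<and> Ginv (evl p))"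
proof -
  have sub: "fpoly (uq_gens (n - 1)) \<subseteq> ufp" by (rule fpoly_mono) (auto simp: uq_gens_def)
  have inv: "(\<forall>X\<in>uq_subalgebra n q h. act X (cls p) = counit X \<odot>\<^bsub>zw_algebra n q\<^esub> cls p) \<longleftrightarrow> Ginv (evl p)"
    if p: "p \<in> fp" for p
  proof -
    have x: "evl p \<in> B" using p by (rule B_evl)
    have "act (uq.cls u) (cls p) = counit (uq.cls u) \<odot>\<^bsub>alg\<^esub> cls p \<longleftrightarrow> ac u (evl p) = scale (nc_eval counit_gen u) (evl p)"
      if "u \<in> fpoly (uq_gens (n - 1))" for u
    proof -
      have u: "u \<in> ufp" using sub that by (rule subsetD)
      have "act (uq.cls u) (cls p) = kls (ac u (evl p))" by (simp only: kls_ac[OF u x] kls_evl[OF p])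
      moreover have "counit (uq.cls u) \<odot>\<^bsub>alg\<^esub> cls p = kls (scale (nc_eval counit_gen u) (evl p))"
        by (simp only: kls_hom(3)[OF x x] kls_evl[OF p] counit_cls[OF u])
      moreover have "kls (ac u (evl p)) = kls (scale (nc_eval counit_gen u) (evl p))
          \<longleftrightarrow> ac u (evl p) = scale (nc_eval counit_gen u) (evl p)"
        using val_kls[OF ac_B[OF u x]] val_kls[OF B_scale[OF x]] by metis
      ultimately show ?thesis by (simp only:)
    qed
    then show ?thesis unfolding zonal_iff_Ginv[OF n x, symmetric]
      by (simp add: uq_subalgebra_def uq_class_def zw_algebra_def)
  qed
  show ?thesis
    unfolding zonal_def harmonic_def zw_homogeneous_eq mem_Collect_eq
  proof
    assume *: "(P \<in> zw_class n q ` homog n a b \<and> q_laplace n q P = \<zero>\<^bsub>zw_algebra n q\<^esub>) \<and>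
      (\<forall>X\<in>uq_subalgebra n q h. act X P = counit X \<odot>\<^bsub>zw_algebra n q\<^esub> P)"
    obtain p where p: "P = zw_class n q p" "p \<in> homog n a b" using *[THEN conjunct1, THEN conjunct1] by (rule imageE)
    have P: "P = cls p" by (simp only: p(1) zw_class_def)
    show "\<exists>p\<in>homog n a b. P = cls p \<and> lap (evl p) = 0 \<and> Ginv (evl p)"
      using * unfolding P q_laplace_zero_iff[OF homog_fpoly[OF p(2)]] inv[OF homog_fpoly[OF p(2)]]
      by (intro bexI[OF _ p(2)]) simp
  next
    assume "\<exists>p\<in>homog n a b. P = cls p \<and> lap (evl p) = 0 \<and> Ginv (evl p)"
    then obtain p where p: "p \<in> homog n a b" and P: "P = cls p" and lg: "lap (evl p) = 0" "Ginv (evl p)"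
      by (elim bexE conjE) (rule that)
    have "cls p \<in> zw_class n q ` homog n a b"
      unfolding zw_class_def by (rule imageI[OF p])
    then show "(P \<in> zw_class n q ` homog n a b \<and> q_laplace n q P = \<zero>\<^bsub>zw_algebra n q\<^esub>) \<and>
      (\<forall>X\<in>uq_subalgebra n q h. act X P = counit X \<odot>\<^bsub>zw_algebra n q\<^esub> P)"
      using lg unfolding P q_laplace_zero_iff[OF homog_fpoly[OF p]] inv[OF homog_fpoly[OF p]] by (intro conjI)
  qed
qed

text \<open>The common conclusion for both ranges of degrees. An invariant of the given bidegree is
  a combination of the \<open>V s (K - s)\<close>; harmonicity turns into the recurrence, whose
  solutions are the multiples of \<open>gc\<close>. Since \<open>gc\<close> starts with 1 and the
  family is independent, the spanning class is nonzero.\<close>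

lemma zonal_family:
  assumes n2: "n \<ge> 2"
    and inv: "\<And>s. Ginv (V s (K - s))"
    and span: "\<And>x. Ginv x \<Longrightarrow> x \<in> deg a b \<Longrightarrow> \<exists>c. x = (\<Sum>s\<le>K. scale (c s) (V s (K - s)))"
    and indep: "\<And>K c s. (\<Sum>s\<le>K. scale (c s) (V s (K - s))) = 0 \<Longrightarrow> s \<le> K \<Longrightarrow> c s = 0"
    and lap_V: "\<And>b a. lap (V b a) = scale (ga d b) (V (b - 1) a) + scale (gb d b a) (V b (a - 1))"
    and \<Phi>: "\<Phi> \<in> homog n a b" "evl \<Phi> = (\<Sum>s\<le>K. scale (gc K (K + d) s) (V s (K - s)))"
  shows "ring.dimension (zw_algebra n q) 1 (scalars (zw_algebra n q)) (zonal n q h act a b) \<and>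
    zonal n q h act a b = range (\<lambda>c. c \<odot>\<^bsub>zw_algebra n q\<^esub> zw_class n q \<Phi>)"
proof -
  have n1: "n \<ge> 1" using n2 by simp
  have f: "\<Phi> \<in> fp" by (rule homog_fpoly[OF \<Phi>(1)])
  have fc: "scal c * \<Phi> \<in> fp" for c by (intro fpoly_mult fpoly_scal f)
  have z: "ga d 0 = 0" "gb d b 0 = 0" for b by (simp_all add: ga_def gb_def)
  have lf: "lap (\<Sum>s\<le>K. scale (c s) (V s (K - s))) = 0
      \<longleftrightarrow> (\<forall>s<K. c (Suc s) * ga d (Suc s) + c s * gb d s (K - s) = 0)" for c
  proof (rule lap_family[of V "ga d" "gb d"])
    show "c s = 0" if "(\<Sum>s\<le>K. scale (c s) (V s (K - s))) = 0" "s \<le> K" for K c s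
      using that by (rule indep)
  qed (rule lap_V z)+
  have rec: "s < K \<Longrightarrow> gc K (K + d) (Suc s) * ga d (Suc s) + gc K (K + d) s * gb d s (K - s) = 0" for s
    by (rule gc_rec[OF n2])
  have lap\<Phi>: "lap (evl \<Phi>) = 0" unfolding \<Phi>(2) by (rule lf[THEN iffD2]) (use rec in simp)
  have Ginv\<Phi>: "Ginv (evl \<Phi>)" unfolding \<Phi>(2) by (intro Ginv_sum Ginv_scale inv)
  have nz: "evl \<Phi> \<noteq> 0"
  proof
    assume "evl \<Phi> = 0"
    then have "gc K (K + d) 0 = 0" unfolding \<Phi>(2) by (rule indep) simp
    then show False by (simp add: gc_0)
  qed
  have "zonal n q h act a b = range (\<lambda>c. c \<odot>\<^bsub>alg\<^esub> cls \<Phi>)"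
  proof (intro subset_antisym subsetI)
    fix P assume "P \<in> zonal n q h act a b"
    then obtain p where p: "p \<in> homog n a b" and P: "P = cls p" and lg: "lap (evl p) = 0" "Ginv (evl p)"
      unfolding zonal_iff[OF n1] by (elim bexE conjE) (rule that)
    obtain c where c: "evl p = (\<Sum>s\<le>K. scale (c s) (V s (K - s)))"
      using span[OF lg(2) evl_homog[OF p]] by (elim exE) (rule that)
    have "\<forall>s<K. c (Suc s) * ga d (Suc s) + c s * gb d s (K - s) = 0"
      by (rule lf[THEN iffD1]) (use lg(1) in \<open>simp only: c\<close>)
    then have cs: "c s = c 0 * gc K (K + d) s" if "s \<le> K" for s
      using recurrence_unique[of "gc K (K + d)" K "ga d" "\<lambda>s. gb d s (K - s)" c s, OF gc_0 rec ga_nonzero[OF n2]] that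
      by simp
    have "scale (c s) (V s (K - s)) = scale (c 0) (scale (gc K (K + d) s) (V s (K - s)))" if "s \<in> {..K}" for s
      unfolding lop.scale_scale by (rule arg_cong[OF cs]) (use that in simp)
    then have "evl p = scale (c 0) (evl \<Phi>)"
      unfolding c \<Phi>(2) lop.scale_sum_right by (rule sum.cong[OF refl])
    then have "cls p = cls (scal (c 0) * \<Phi>)"
      unfolding cls_eq_evl[OF homog_fpoly[OF p] fc] evl_scal .
    then show "P \<in> range (\<lambda>c. c \<odot>\<^bsub>alg\<^esub> cls \<Phi>)"
      unfolding P alg_smult by (intro image_eqI[of _ _ "c 0"]) simp_all
  next
    fix P assume "P \<in> range (\<lambda>c. c \<odot>\<^bsub>alg\<^esub> cls \<Phi>)"
    then obtain c where P: "P = cls (scal c * \<Phi>)" unfolding alg_smult by (rule imageE)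
    show "P \<in> zonal n q h act a b"
      unfolding zonal_iff[OF n1] P
      by (rule bexI[of _ "scal c * \<Phi>"])
        (simp_all add: evl_scal linop_simps[OF lap] lap\<Phi> Ginv_scale[OF Ginv\<Phi>] homog_scal_mult[OF \<Phi>(1)])
  qed
  moreover have "cls \<Phi> \<noteq> \<zero>\<^bsub>alg\<^esub>"
    using nz unfolding alg_zero cls_eq_evl[OF f fpoly_zero] evl_simps .
  ultimately show ?thesis
    unfolding zw_algebra_def zw_class_def using dimension_one[OF f] by simp
qed

lemma lap_Y_family: "n \<ge> 2 \<Longrightarrow> lap (Y d b a) = scale (ga d b) (Y d (b - 1) a) + scale (gb d b a) (Y d b (a - 1))"
  unfolding ga_def gb_def by (rule lap_Y)

text \<open>For d = 0 the families \<open>U\<close> and \<open>Y\<close> coincide, which covers the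
  case outside \<open>lap_U\<close>.\<close>

lemma lap_U_family: "n \<ge> 2 \<Longrightarrow> lap (U d b a) = scale (ga d b) (U d (b - 1) a) + scale (gb d b a) (U d b (a - 1))"
  using lap_Y_family[of 0 b a] lap_U[where b = b and a = a] by (cases d) (simp_all only: ga_def gb_def power_0 mult_1_left mult_1_right)

lemma zonal_Z:
  assumes n2: "n \<ge> 2"
    and \<Phi>: "\<Phi> = var (Z n) ^ d * (\<Sum>s\<le>K. scal (gc K (d + K) s) * Q_poly n ^ (K - s) * Q_poly (n - 1) ^ s)"
  shows "ring.dimension (zw_algebra n q) 1 (scalars (zw_algebra n q)) (zonal n q h act (d + K) K) \<and>
    zonal n q h act (d + K) K = range (\<lambda>c. c \<odot>\<^bsub>zw_algebra n q\<^esub> zw_class n q \<Phi>)"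
proof (rule zonal_family[OF n2, where V = "Y d" and d = d and K = K])
  have n1: "n \<ge> 1" "n \<in> {1..n}" using n2 by auto
  show "Ginv (Y d s (K - s))" for s
    unfolding X_def by (intro Ginv_mult Ginv_power Ginv_z Ginv_Qu n1) auto
  have "var (Z n) ^ d * (\<Sum>s\<le>K. scal (gc K (d + K) s) * Q_poly n ^ (K - s) * Q_poly (n - 1) ^ s) \<in> homog n (d * 1 + K) (d * 0 + K)"
    by (intro homog_mult homog_power homog_Z homog_sum homog_Q_power n1) simp
  then show "\<Phi> \<in> homog n (d + K) K" by (simp add: \<Phi>)
  show "evl \<Phi> = (\<Sum>s\<le>K. scale (gc K (K + d) s) (Y d s (K - s)))"
    unfolding \<Phi> evl_simps(5)[of "var (Z n) ^ d"] evl_simps(10) evl_Q_power[OF n1(1)]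
    by (simp add: evl_simps sum_distrib_left scale_mult_right add.commute)
qed (use Ginv_Y[OF n2] Y_independent[OF n2] lap_Y_family[OF n2] in \<open>simp_all\<close>)

lemma zonal_W:
  assumes n2: "n \<ge> 2"
    and \<Phi>: "\<Phi> = (\<Sum>s\<le>K. scal (gc K (d + K) s) * Q_poly n ^ (K - s) * Q_poly (n - 1) ^ s) * var (W n) ^ d"
  shows "ring.dimension (zw_algebra n q) 1 (scalars (zw_algebra n q)) (zonal n q h act K (d + K)) \<and>
    zonal n q h act K (d + K) = range (\<lambda>c. c \<odot>\<^bsub>zw_algebra n q\<^esub> zw_class n q \<Phi>)"
proof (rule zonal_family[OF n2, where V = "U d" and d = d and K = K])
  have n1: "n \<ge> 1" "n \<in> {1..n}" using n2 by auto
  show "Ginv (U d s (K - s))" for s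
    unfolding X_def by (intro Ginv_mult Ginv_power Ginv_w Ginv_Qu n1) auto
  have "(\<Sum>s\<le>K. scal (gc K (d + K) s) * Q_poly n ^ (K - s) * Q_poly (n - 1) ^ s) * var (W n) ^ d \<in> homog n (K + d * 0) (K + d * 1)"
    by (intro homog_mult homog_power homog_W homog_sum homog_Q_power n1) simp
  then show "\<Phi> \<in> homog n K (d + K)" by (simp add: \<Phi> add.commute)
  show "evl \<Phi> = (\<Sum>s\<le>K. scale (gc K (K + d) s) (U d s (K - s)))"
    unfolding \<Phi> evl_simps(5)[of _ "var (W n) ^ d"] evl_simps(10) evl_Q_power[OF n1(1)]
    by (simp add: evl_simps sum_distrib_right scale_mult_left add.commute)
qed (use Ginv_U[OF n2] U_independent[OF n2] lap_U_family[OF n2] in \<open>simp_all\<close>)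

end

theorem proposition9:
  fixes n m m' :: nat and q h :: complex
    and act :: "uq_gen ncpoly set \<Rightarrow> zw ncpoly set \<Rightarrow> zw ncpoly set"
  assumes n: "n \<ge> 2"
    and q_nonzero: "q \<noteq> 0"
    and q_not_root_of_unity: "\<forall>k>0. q ^ k \<noteq> 1"
    and h_sqrt: "h\<^sup>2 = q"
    and act: "uq_action n q h act"
  shows "ring.dimension (zw_algebra n q) 1 (scalars (zw_algebra n q)) (zonal n q h act m m')
    \<and> (m \<ge> m' \<longrightarrow> zonal n q h act m m' = range (\<lambda>c. c \<odot>\<^bsub>zw_algebra n q\<^esub> zw_class n q
          (var (Z n) ^ (m - m') *
           (\<Sum>s\<le>m'. scal (qpoch (q powi (- 2 * int m')) (q\<^sup>2) s * qpoch (q ^ (2 * (m + n - 1))) (q\<^sup>2) s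
                 / (qpoch (q ^ (2 * (n - 1))) (q\<^sup>2) s * qpoch (q\<^sup>2) (q\<^sup>2) s) * q ^ (2 * s))
               * Q_poly n ^ (m' - s) * Q_poly (n - 1) ^ s))))
    \<and> (m \<le> m' \<longrightarrow> zonal n q h act m m' = range (\<lambda>c. c \<odot>\<^bsub>zw_algebra n q\<^esub> zw_class n q
          ((\<Sum>s\<le>m. scal (qpoch (q powi (- 2 * int m)) (q\<^sup>2) s * qpoch (q ^ (2 * (m' + n - 1))) (q\<^sup>2) s
                 / (qpoch (q ^ (2 * (n - 1))) (q\<^sup>2) s * qpoch (q\<^sup>2) (q\<^sup>2) s) * q ^ (2 * s))
               * Q_poly n ^ (m - s) * Q_poly (n - 1) ^ s)
           * var (W n) ^ (m' - m))))"
proof -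
  have "zw_action n q h act"
    using q_nonzero q_not_root_of_unity h_sqrt act by (simp add: zw_action_def zw_action_axioms_def zw_setup_def)
  then interpret zw_action n q h act .
  have Z: "ring.dimension (zw_algebra n q) 1 (scalars (zw_algebra n q)) (zonal n q h act m m') \<and>
      zonal n q h act m m' = range (\<lambda>c. c \<odot>\<^bsub>zw_algebra n q\<^esub> zw_class n q (var (Z n) ^ (m - m') *
        (\<Sum>s\<le>m'. scal (gc m' m s) * Q_poly n ^ (m' - s) * Q_poly (n - 1) ^ s)))" if "m \<ge> m'"
    using zonal_Z[OF n refl, where d = "m - m'" and K = m'] unfolding le_add_diff_inverse2[OF that] .
  have W: "ring.dimension (zw_algebra n q) 1 (scalars (zw_algebra n q)) (zonal n q h act m m') \<and>
      zonal n q h act m m' = range (\<lambda>c. c \<odot>\<^bsub>zw_algebra n q\<^esub> zw_class n q (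
        (\<Sum>s\<le>m. scal (gc m m' s) * Q_poly n ^ (m - s) * Q_poly (n - 1) ^ s) * var (W n) ^ (m' - m)))" if "m \<le> m'"
    using zonal_W[OF n refl, where d = "m' - m" and K = m] unfolding le_add_diff_inverse2[OF that] .
  show ?thesis unfolding gc_def[symmetric]
  proof (intro conjI impI)
    show "ring.dimension (zw_algebra n q) 1 (scalars (zw_algebra n q)) (zonal n q h act m m')"
      using Z[THEN conjunct1] W[THEN conjunct1] by (cases rule: le_cases[of m m'])
  qed (fact Z[THEN conjunct2] W[THEN conjunct2])+
qed



end
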